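(* If $V$ satisfies $\mathrm{ZFC}$, then there is a forcing extension of $V$ by (proper) class forcing which satisfies $\mathrm{ZFC}+\mathrm{CCA}$.
   Context: The Continuum Coding Axiom ($\mathrm{CCA}$) asserts: for every ordinal $\alpha$ and every $a\subseteq\alpha$ there is an ordinal $\theta$ such that for every $\beta<\alpha$, $\beta\in a$ if and only if $2^{\aleph_{\theta+\beta+1}}=(\aleph_{\theta+\beta+1})^+$. Class forcing means forcing with a partial order that is a definable proper class. *)

theory Defs
  imports "HOL-Library.FuncSet" "HOL-Library.Countable_Set"
begin

section \<open>The first-order language of set theory\<close>

text \<open>Variables are named by natural numbers.\<close>

datatype fm = Mem nat nat | Eq nat nat | Neg fm | Conj fm fm | All nat fm

definition Disj :: "fm \<Rightarrow> fm \<Rightarrow> fm" where "Disj \<phi> \<psi> = Neg (Conj (Neg \<phi>) (Neg \<psi>))"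
definition Imp :: "fm \<Rightarrow> fm \<Rightarrow> fm" where "Imp \<phi> \<psi> = Neg (Conj \<phi> (Neg \<psi>))"
definition Iff :: "fm \<Rightarrow> fm \<Rightarrow> fm" where "Iff \<phi> \<psi> = Conj (Imp \<phi> \<psi>) (Imp \<psi> \<phi>)"
definition Ex :: "nat \<Rightarrow> fm \<Rightarrow> fm" where "Ex x \<phi> = Neg (All x (Neg \<phi>))"

primrec fv :: "fm \<Rightarrow> nat set" where
  "fv (Mem x y) = {x, y}"
| "fv (Eq x y) = {x, y}"
| "fv (Neg \<phi>) = fv \<phi>"
| "fv (Conj \<phi> \<psi>) = fv \<phi> \<union> fv \<psi>"
| "fv (All x \<phi>) = fv \<phi> - {x}"

text \<open>A structure is a carrier \<open>M\<close> with an arbitrary binary relation \<open>E\<close> for membership; it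
  need be neither transitive nor well-founded nor countable.\<close>

primrec sat :: "'a set \<Rightarrow> ('a \<Rightarrow> 'a \<Rightarrow> bool) \<Rightarrow> fm \<Rightarrow> (nat \<Rightarrow> 'a) \<Rightarrow> bool" where
  "sat M E (Mem x y) v \<longleftrightarrow> E (v x) (v y)"
| "sat M E (Eq x y) v \<longleftrightarrow> v x = v y"
| "sat M E (Neg \<phi>) v \<longleftrightarrow> \<not> sat M E \<phi> v"
| "sat M E (Conj \<phi> \<psi>) v \<longleftrightarrow> sat M E \<phi> v \<and> sat M E \<psi> v"
| "sat M E (All x \<phi>) v \<longleftrightarrow> (\<forall>a\<in>M. sat M E \<phi> (v(x := a)))"

text \<open>Formulas with free variables stand for their universal closures.\<close>

definition models :: "'a set \<Rightarrow> ('a \<Rightarrow> 'a \<Rightarrow> bool) \<Rightarrow> fm set \<Rightarrow> bool" where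
  "models M E T \<longleftrightarrow> M \<noteq> {} \<and> (\<forall>\<phi>\<in>T. \<forall>v\<in>UNIV \<rightarrow> M. sat M E \<phi> v)"


section \<open>Writing concrete formulas\<close>

text \<open>To avoid choosing names of bound variables by hand, concrete formulas are written as
  functions of a number \<open>n\<close> above all variables in scope: a quantifier binds the variable \<open>n\<close> and
  passes \<open>Suc n\<close> to its body. Sentences are obtained by applying the result to \<open>0\<close>.\<close>

type_synonym pfm = "nat \<Rightarrow> fm"

definition f_mem :: "nat \<Rightarrow> nat \<Rightarrow> pfm" (infix "\<^bold>\<in>" 50) where "(x \<^bold>\<in> y) = (\<lambda>n. Mem x y)"
definition f_eq :: "nat \<Rightarrow> nat \<Rightarrow> pfm" (infix "\<^bold>=" 50) where "(x \<^bold>= y) = (\<lambda>n. Eq x y)"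
definition f_not :: "pfm \<Rightarrow> pfm" ("\<^bold>\<not> _" [40] 40) where "(\<^bold>\<not> p) = (\<lambda>n. Neg (p n))"
definition f_and :: "pfm \<Rightarrow> pfm \<Rightarrow> pfm" (infixr "\<^bold>\<and>" 35) where
  "(p \<^bold>\<and> q) = (\<lambda>n. Conj (p n) (q n))"
definition f_or :: "pfm \<Rightarrow> pfm \<Rightarrow> pfm" (infixr "\<^bold>\<or>" 30) where
  "(p \<^bold>\<or> q) = (\<lambda>n. Disj (p n) (q n))"
definition f_imp :: "pfm \<Rightarrow> pfm \<Rightarrow> pfm" (infixr "\<^bold>\<longrightarrow>" 25) where
  "(p \<^bold>\<longrightarrow> q) = (\<lambda>n. Imp (p n) (q n))"
definition f_iff :: "pfm \<Rightarrow> pfm \<Rightarrow> pfm" (infixr "\<^bold>\<longleftrightarrow>" 25) where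
  "(p \<^bold>\<longleftrightarrow> q) = (\<lambda>n. Iff (p n) (q n))"
definition f_all :: "(nat \<Rightarrow> pfm) \<Rightarrow> pfm" (binder "\<^bold>\<forall>" 10) where
  "f_all p = (\<lambda>n. All n (p n (Suc n)))"
definition f_ex :: "(nat \<Rightarrow> pfm) \<Rightarrow> pfm" (binder "\<^bold>\<exists>" 10) where
  "f_ex p = (\<lambda>n. Ex n (p n (Suc n)))"


section \<open>The axioms of ZFC\<close>

definition f_subset :: "nat \<Rightarrow> nat \<Rightarrow> pfm" where
  "f_subset x y = (\<^bold>\<forall>z. z \<^bold>\<in> x \<^bold>\<longrightarrow> z \<^bold>\<in> y)"
definition f_empty :: "nat \<Rightarrow> pfm" where
  "f_empty x = (\<^bold>\<forall>z. \<^bold>\<not> z \<^bold>\<in> x)"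
definition f_succ :: "nat \<Rightarrow> nat \<Rightarrow> pfm" where  \<comment> \<open>\<open>s = x \<union> {x}\<close>\<close>
  "f_succ s x = (\<^bold>\<forall>z. z \<^bold>\<in> s \<^bold>\<longleftrightarrow> z \<^bold>\<in> x \<^bold>\<or> z \<^bold>= x)"

definition extensionality :: fm where
  "extensionality = (\<^bold>\<forall>x. \<^bold>\<forall>y. (\<^bold>\<forall>z. z \<^bold>\<in> x \<^bold>\<longleftrightarrow> z \<^bold>\<in> y) \<^bold>\<longrightarrow> x \<^bold>= y) 0"

definition foundation :: fm where
  "foundation = (\<^bold>\<forall>x. (\<^bold>\<exists>y. y \<^bold>\<in> x) \<^bold>\<longrightarrow> (\<^bold>\<exists>y. y \<^bold>\<in> x \<^bold>\<and> (\<^bold>\<forall>z. z \<^bold>\<in> x \<^bold>\<longrightarrow> \<^bold>\<not> z \<^bold>\<in> y))) 0"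

definition pairing :: fm where
  "pairing = (\<^bold>\<forall>x. \<^bold>\<forall>y. \<^bold>\<exists>z. \<^bold>\<forall>w. w \<^bold>\<in> z \<^bold>\<longleftrightarrow> w \<^bold>= x \<^bold>\<or> w \<^bold>= y) 0"

definition union :: fm where
  "union = (\<^bold>\<forall>x. \<^bold>\<exists>u. \<^bold>\<forall>z. z \<^bold>\<in> u \<^bold>\<longleftrightarrow> (\<^bold>\<exists>y. y \<^bold>\<in> x \<^bold>\<and> z \<^bold>\<in> y)) 0"

definition power_set :: fm where
  "power_set = (\<^bold>\<forall>x. \<^bold>\<exists>p. \<^bold>\<forall>z. z \<^bold>\<in> p \<^bold>\<longleftrightarrow> f_subset z x) 0"

definition infinity :: fm where
  "infinity = (\<^bold>\<exists>x. (\<^bold>\<exists>e. f_empty e \<^bold>\<and> e \<^bold>\<in> x) \<^bold>\<and>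
     (\<^bold>\<forall>y. y \<^bold>\<in> x \<^bold>\<longrightarrow> (\<^bold>\<exists>s. f_succ s y \<^bold>\<and> s \<^bold>\<in> x))) 0"

definition choice :: fm where
  "choice = (\<^bold>\<forall>x.
     (\<^bold>\<forall>y. y \<^bold>\<in> x \<^bold>\<longrightarrow> (\<^bold>\<exists>z. z \<^bold>\<in> y)) \<^bold>\<and>
     (\<^bold>\<forall>y. \<^bold>\<forall>y'. y \<^bold>\<in> x \<^bold>\<and> y' \<^bold>\<in> x \<^bold>\<and> (\<^bold>\<exists>z. z \<^bold>\<in> y \<^bold>\<and> z \<^bold>\<in> y') \<^bold>\<longrightarrow> y \<^bold>= y')
     \<^bold>\<longrightarrow> (\<^bold>\<exists>c. \<^bold>\<forall>y. y \<^bold>\<in> x \<^bold>\<longrightarrow> (\<^bold>\<exists>u. \<^bold>\<forall>z. z \<^bold>\<in> y \<^bold>\<and> z \<^bold>\<in> c \<^bold>\<longleftrightarrow> z \<^bold>= u))) 0"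

definition separation :: "fm set" where
  "separation =
    {Ex b (All x (Iff (Mem x b) (Conj (Mem x a) \<phi>))) | x a b \<phi>.
       distinct [x, a, b] \<and> b \<notin> fv \<phi>}"

text \<open>\<open>(\<forall>x\<in>a. \<exists>!y. \<phi>) \<longrightarrow> (\<exists>b. \<forall>x\<in>a. \<exists>y\<in>b. \<phi>)\<close>\<close>

definition replacement :: "fm set" where
  "replacement =
    {Imp (All x (Imp (Mem x a) (Ex z (All y (Iff \<phi> (Eq y z))))))
         (Ex b (All x (Imp (Mem x a) (Ex y (Conj (Mem y b) \<phi>))))) | x y z a b \<phi>.
       distinct [x, y, z, a, b] \<and> z \<notin> fv \<phi> \<and> b \<notin> fv \<phi>}"

definition ZFC :: "fm set" where
  "ZFC = {extensionality, foundation, pairing, union, power_set, infinity, choice}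
           \<union> separation \<union> replacement"


section \<open>The Continuum Coding Axiom\<close>

definition f_trans :: "nat \<Rightarrow> pfm" where
  "f_trans x = (\<^bold>\<forall>y. y \<^bold>\<in> x \<^bold>\<longrightarrow> f_subset y x)"

text \<open>Well-foundedness of membership on \<open>x\<close> is left to the axiom of foundation.\<close>

definition f_ord :: "nat \<Rightarrow> pfm" where
  "f_ord x = (f_trans x \<^bold>\<and>
     (\<^bold>\<forall>y. \<^bold>\<forall>z. y \<^bold>\<in> x \<^bold>\<and> z \<^bold>\<in> x \<^bold>\<longrightarrow> y \<^bold>\<in> z \<^bold>\<or> y \<^bold>= z \<^bold>\<or> z \<^bold>\<in> y))"

definition f_limit :: "nat \<Rightarrow> pfm" where
  "f_limit x = (f_ord x \<^bold>\<and> (\<^bold>\<not> f_empty x) \<^bold>\<and>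
     (\<^bold>\<forall>y. y \<^bold>\<in> x \<^bold>\<longrightarrow> (\<^bold>\<exists>s. f_succ s y \<^bold>\<and> s \<^bold>\<in> x)))"

definition f_omega :: "nat \<Rightarrow> pfm" where
  "f_omega x = (f_limit x \<^bold>\<and> (\<^bold>\<forall>y. y \<^bold>\<in> x \<^bold>\<longrightarrow> \<^bold>\<not> f_limit y))"

definition f_upair :: "nat \<Rightarrow> nat \<Rightarrow> nat \<Rightarrow> pfm" where  \<comment> \<open>\<open>z = {x, y}\<close>\<close>
  "f_upair z x y = (\<^bold>\<forall>w. w \<^bold>\<in> z \<^bold>\<longleftrightarrow> w \<^bold>= x \<^bold>\<or> w \<^bold>= y)"

definition f_pair :: "nat \<Rightarrow> nat \<Rightarrow> nat \<Rightarrow> pfm" where  \<comment> \<open>\<open>z = {{x}, {x, y}}\<close>\<close>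
  "f_pair z x y = (\<^bold>\<exists>u. \<^bold>\<exists>w. f_upair u x x \<^bold>\<and> f_upair w x y \<^bold>\<and> f_upair z u w)"

definition f_app :: "nat \<Rightarrow> nat \<Rightarrow> nat \<Rightarrow> pfm" where  \<comment> \<open>\<open>(x, y) \<in> f\<close>\<close>
  "f_app f x y = (\<^bold>\<exists>z. z \<^bold>\<in> f \<^bold>\<and> f_pair z x y)"

definition f_fun :: "nat \<Rightarrow> nat \<Rightarrow> pfm" where  \<comment> \<open>\<open>f\<close> is a function with domain \<open>d\<close>\<close>
  "f_fun f d = (
     (\<^bold>\<forall>z. z \<^bold>\<in> f \<^bold>\<longrightarrow> (\<^bold>\<exists>x. \<^bold>\<exists>y. f_pair z x y)) \<^bold>\<and>
     (\<^bold>\<forall>x. \<^bold>\<forall>y. \<^bold>\<forall>y'. f_app f x y \<^bold>\<and> f_app f x y' \<^bold>\<longrightarrow> y \<^bold>= y') \<^bold>\<and>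
     (\<^bold>\<forall>x. x \<^bold>\<in> d \<^bold>\<longleftrightarrow> (\<^bold>\<exists>y. f_app f x y)))"

definition f_bij :: "nat \<Rightarrow> nat \<Rightarrow> nat \<Rightarrow> pfm" where
  "f_bij f a b = (f_fun f a \<^bold>\<and>
     (\<^bold>\<forall>x. \<^bold>\<forall>x'. \<^bold>\<forall>y. f_app f x y \<^bold>\<and> f_app f x' y \<^bold>\<longrightarrow> x \<^bold>= x') \<^bold>\<and>
     (\<^bold>\<forall>y. y \<^bold>\<in> b \<^bold>\<longleftrightarrow> (\<^bold>\<exists>x. f_app f x y)))"

definition f_eqpoll :: "nat \<Rightarrow> nat \<Rightarrow> pfm" where
  "f_eqpoll a b = (\<^bold>\<exists>f. f_bij f a b)"

definition f_cardinal :: "nat \<Rightarrow> pfm" where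
  "f_cardinal k = (f_ord k \<^bold>\<and> (\<^bold>\<forall>x. x \<^bold>\<in> k \<^bold>\<longrightarrow> \<^bold>\<not> f_eqpoll x k))"

definition f_card :: "nat \<Rightarrow> nat \<Rightarrow> pfm" where  \<comment> \<open>\<open>k = |x|\<close>\<close>
  "f_card k x = (f_cardinal k \<^bold>\<and> f_eqpoll x k)"

definition f_csucc :: "nat \<Rightarrow> nat \<Rightarrow> pfm" where  \<comment> \<open>\<open>l\<close> is the least cardinal above \<open>k\<close>\<close>
  "f_csucc l k = (f_cardinal l \<^bold>\<and> k \<^bold>\<in> l \<^bold>\<and>
     (\<^bold>\<forall>m. f_cardinal m \<^bold>\<and> k \<^bold>\<in> m \<^bold>\<longrightarrow> f_subset l m))"

text \<open>\<open>f_rec start step c b\<close> says that \<open>c\<close> is the value at the ordinal \<open>b\<close> of the continuous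
  function \<open>H\<close> on ordinals given by transfinite recursion: \<open>start (H 0)\<close>,
  \<open>step (H (x + 1)) (H x)\<close>, and \<open>H x = (\<Union>y<x. H y)\<close> at limits \<open>x\<close>.
  Here \<open>f\<close> is the restriction of \<open>H\<close> to \<open>d = b + 1\<close>.\<close>

definition f_rec :: "(nat \<Rightarrow> pfm) \<Rightarrow> (nat \<Rightarrow> nat \<Rightarrow> pfm) \<Rightarrow> nat \<Rightarrow> nat \<Rightarrow> pfm" where
  "f_rec start step c b = (\<^bold>\<exists>f. \<^bold>\<exists>d. f_succ d b \<^bold>\<and> f_fun f d \<^bold>\<and> f_app f b c \<^bold>\<and>
     (\<^bold>\<forall>x. \<^bold>\<forall>u. x \<^bold>\<in> d \<^bold>\<and> f_app f x u \<^bold>\<longrightarrow>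
        (f_empty x \<^bold>\<longrightarrow> start u) \<^bold>\<and>
        (\<^bold>\<forall>y. \<^bold>\<forall>w. f_succ x y \<^bold>\<and> f_app f y w \<^bold>\<longrightarrow> step u w) \<^bold>\<and>
        (f_limit x \<^bold>\<longrightarrow>
           (\<^bold>\<forall>z. z \<^bold>\<in> u \<^bold>\<longleftrightarrow> (\<^bold>\<exists>y. \<^bold>\<exists>w. y \<^bold>\<in> x \<^bold>\<and> f_app f y w \<^bold>\<and> z \<^bold>\<in> w)))))"

definition f_add :: "nat \<Rightarrow> nat \<Rightarrow> nat \<Rightarrow> pfm" where  \<comment> \<open>\<open>c = a + b\<close> (ordinal sum)\<close>
  "f_add c a b = f_rec (\<lambda>u. u \<^bold>= a) f_succ c b"

definition f_aleph :: "nat \<Rightarrow> nat \<Rightarrow> pfm" where  \<comment> \<open>\<open>k\<close> is the \<open>b\<close>-th aleph\<close>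
  "f_aleph k b = f_rec f_omega f_csucc k b"

text \<open>\<open>l = 2\<^sup>k\<close>, the cardinality of the power set of \<open>k\<close>\<close>

definition f_two_power :: "nat \<Rightarrow> nat \<Rightarrow> pfm" where
  "f_two_power l k = (\<^bold>\<exists>p. (\<^bold>\<forall>x. x \<^bold>\<in> p \<^bold>\<longleftrightarrow> f_subset x k) \<^bold>\<and> f_card l p)"

text \<open>In the following, \<open>t\<close> is the ordinal \<open>\<theta>\<close>, and \<open>k\<close> is the aleph with index \<open>\<theta> + \<beta> + 1\<close>.\<close>

definition CCA :: fm where
  "CCA = (\<^bold>\<forall>\<alpha>. \<^bold>\<forall>a. f_ord \<alpha> \<^bold>\<and> f_subset a \<alpha> \<^bold>\<longrightarrow>
     (\<^bold>\<exists>t. f_ord t \<^bold>\<and>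
       (\<^bold>\<forall>\<beta>. \<beta> \<^bold>\<in> \<alpha> \<^bold>\<longrightarrow>
         (\<beta> \<^bold>\<in> a \<^bold>\<longleftrightarrow>
           (\<^bold>\<exists>s. \<^bold>\<exists>s'. \<^bold>\<exists>k. \<^bold>\<exists>l. f_add s t \<beta> \<^bold>\<and> f_succ s' s \<^bold>\<and> f_aleph k s' \<^bold>\<and>
              f_two_power l k \<^bold>\<and> f_csucc l k))))) 0"


section \<open>Class forcing\<close>

text \<open>Definability over \<open>(M, E)\<close> is first-order definability with parameters from \<open>M\<close>.\<close>

definition definable1 :: "'a set \<Rightarrow> ('a \<Rightarrow> 'a \<Rightarrow> bool) \<Rightarrow> 'a set \<Rightarrow> bool" where
  "definable1 M E C \<longleftrightarrow>
    (\<exists>\<phi>. \<exists>v\<in>UNIV \<rightarrow> M. C = {a \<in> M. sat M E \<phi> (v(0 := a))})"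

definition definable2 :: "'a set \<Rightarrow> ('a \<Rightarrow> 'a \<Rightarrow> bool) \<Rightarrow> ('a \<times> 'a) set \<Rightarrow> bool" where
  "definable2 M E C \<longleftrightarrow>
    (\<exists>\<phi>. \<exists>v\<in>UNIV \<rightarrow> M. C = {(a, b) \<in> M \<times> M. sat M E \<phi> (v(0 := a, 1 := b))})"

definition definable3 :: "'a set \<Rightarrow> ('a \<Rightarrow> 'a \<Rightarrow> bool) \<Rightarrow> ('a \<times> 'a \<times> 'a) set \<Rightarrow> bool" where
  "definable3 M E C \<longleftrightarrow>
    (\<exists>\<phi>. \<exists>v\<in>UNIV \<rightarrow> M.
       C = {(a, b, c) \<in> M \<times> M \<times> M. sat M E \<phi> (v(0 := a, 1 := b, 2 := c))})"

definition proper_class :: "'a set \<Rightarrow> ('a \<Rightarrow> 'a \<Rightarrow> bool) \<Rightarrow> 'a set \<Rightarrow> bool" where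
  "proper_class M E C \<longleftrightarrow> \<not> (\<exists>s\<in>M. C = {x \<in> M. E x s})"

text \<open>\<open>(p, q) \<in> r\<close> means \<open>p \<le> q\<close>, i.e. that \<open>p\<close> is the stronger condition.\<close>

definition class_forcing ::
    "'a set \<Rightarrow> ('a \<Rightarrow> 'a \<Rightarrow> bool) \<Rightarrow> 'a set \<Rightarrow> 'a rel \<Rightarrow> bool" where
  "class_forcing M E P r \<longleftrightarrow>
    definable1 M E P \<and> proper_class M E P \<and> definable2 M E r \<and> partial_order_on P r"

definition upair_in :: "'a set \<Rightarrow> ('a \<Rightarrow> 'a \<Rightarrow> bool) \<Rightarrow> 'a \<Rightarrow> 'a \<Rightarrow> 'a \<Rightarrow> bool" where
  "upair_in M E z a b \<longleftrightarrow> z \<in> M \<and> a \<in> M \<and> b \<in> M \<and> (\<forall>w\<in>M. E w z \<longleftrightarrow> w = a \<or> w = b)"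

definition pair_in :: "'a set \<Rightarrow> ('a \<Rightarrow> 'a \<Rightarrow> bool) \<Rightarrow> 'a \<Rightarrow> 'a \<Rightarrow> 'a \<Rightarrow> bool" where
  "pair_in M E z a b \<longleftrightarrow>
    (\<exists>u w. upair_in M E u a a \<and> upair_in M E w a b \<and> upair_in M E z u w)"

text \<open>\<open>(\<sigma>, p) \<in> \<tau>\<close> in the sense of \<open>(M, E)\<close>\<close>

definition has_entry :: "'a set \<Rightarrow> ('a \<Rightarrow> 'a \<Rightarrow> bool) \<Rightarrow> 'a \<Rightarrow> 'a \<Rightarrow> 'a \<Rightarrow> bool" where
  "has_entry M E \<tau> \<sigma> p \<longleftrightarrow> (\<exists>z. pair_in M E z \<sigma> p \<and> E z \<tau>)"

text \<open>A \<open>P\<close>-name is a set all of whose elements are pairs of a \<open>P\<close>-name and a condition. As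
  \<open>(M, E)\<close> may be ill-founded, this recursion has to be carried out inside the structure: the
  set \<open>t \<in> M\<close> is a witness containing \<open>\<tau>\<close>, the names occurring in \<open>\<tau>\<close>, the names occurring in
  those, and so on.\<close>

definition names :: "'a set \<Rightarrow> ('a \<Rightarrow> 'a \<Rightarrow> bool) \<Rightarrow> 'a set \<Rightarrow> 'a set" where
  "names M E P = {\<tau> \<in> M. \<exists>t\<in>M. E \<tau> t \<and>
     (\<forall>x\<in>M. E x t \<longrightarrow> (\<forall>z\<in>M. E z x \<longrightarrow> (\<exists>\<sigma> p. pair_in M E z \<sigma> p \<and> E \<sigma> t \<and> p \<in> P)))}"

text \<open>The standard recursion for forcing atomic formulas. A relation \<open>F\<close> on
  \<open>P \<times> names \<times> names\<close> stands for \<open>p \<tturnstile> \<sigma> = \<tau>\<close>, and membership is defined from it: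
  \<^item> \<open>p \<tturnstile> \<sigma> \<in> \<tau>\<close> iff the \<open>s\<close> with \<open>s \<le> q\<close> and \<open>s \<tturnstile> \<sigma> = \<rho>\<close> for some \<open>(\<rho>, q) \<in> \<tau>\<close> are dense
    below \<open>p\<close>;
  \<^item> \<open>p \<tturnstile> \<sigma> \<subseteq> \<tau>\<close> iff \<open>s \<tturnstile> \<rho> \<in> \<tau>\<close> whenever \<open>(\<rho>, q) \<in> \<sigma>\<close> and \<open>s \<le> p, q\<close>;
  \<^item> \<open>p \<tturnstile> \<sigma> = \<tau>\<close> iff \<open>p \<tturnstile> \<sigma> \<subseteq> \<tau>\<close> and \<open>p \<tturnstile> \<tau> \<subseteq> \<sigma>\<close>.

  In a model of ZFC at most one definable \<open>F\<close> satisfies this recursion, by induction on names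
  inside the model. For class forcing, existence is not automatic.\<close>

definition forces_mem :: "'a set \<Rightarrow> ('a \<Rightarrow> 'a \<Rightarrow> bool) \<Rightarrow> 'a rel \<Rightarrow>
    ('a \<times> 'a \<times> 'a) set \<Rightarrow> 'a \<Rightarrow> 'a \<Rightarrow> 'a \<Rightarrow> bool" where
  "forces_mem M E r F p \<sigma> \<tau> \<longleftrightarrow>
    (\<forall>p'. (p', p) \<in> r \<longrightarrow>
       (\<exists>s. (s, p') \<in> r \<and> (\<exists>\<rho> q. has_entry M E \<tau> \<rho> q \<and> (s, q) \<in> r \<and> (s, \<sigma>, \<rho>) \<in> F)))"

definition forces_subset :: "'a set \<Rightarrow> ('a \<Rightarrow> 'a \<Rightarrow> bool) \<Rightarrow> 'a rel \<Rightarrow>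
    ('a \<times> 'a \<times> 'a) set \<Rightarrow> 'a \<Rightarrow> 'a \<Rightarrow> 'a \<Rightarrow> bool" where
  "forces_subset M E r F p \<sigma> \<tau> \<longleftrightarrow>
    (\<forall>\<rho> q s. has_entry M E \<sigma> \<rho> q \<and> (s, p) \<in> r \<and> (s, q) \<in> r \<longrightarrow> forces_mem M E r F s \<rho> \<tau>)"

definition atomic_forcing :: "'a set \<Rightarrow> ('a \<Rightarrow> 'a \<Rightarrow> bool) \<Rightarrow> 'a set \<Rightarrow> 'a rel \<Rightarrow>
    ('a \<times> 'a \<times> 'a) set \<Rightarrow> bool" where
  "atomic_forcing M E P r F \<longleftrightarrow>
    definable3 M E F \<and>
    F = {(p, \<sigma>, \<tau>) \<in> P \<times> names M E P \<times> names M E P.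
           forces_subset M E r F p \<sigma> \<tau> \<and> forces_subset M E r F p \<tau> \<sigma>}"

primrec forces :: "'a set \<Rightarrow> ('a \<Rightarrow> 'a \<Rightarrow> bool) \<Rightarrow> 'a set \<Rightarrow> 'a rel \<Rightarrow>
    ('a \<times> 'a \<times> 'a) set \<Rightarrow> fm \<Rightarrow> 'a \<Rightarrow> (nat \<Rightarrow> 'a) \<Rightarrow> bool" where
  "forces M E P r F (Mem x y) p v \<longleftrightarrow> forces_mem M E r F p (v x) (v y)"
| "forces M E P r F (Eq x y) p v \<longleftrightarrow> (p, v x, v y) \<in> F"
| "forces M E P r F (Neg \<phi>) p v \<longleftrightarrow> (\<forall>q. (q, p) \<in> r \<longrightarrow> \<not> forces M E P r F \<phi> q v)"
| "forces M E P r F (Conj \<phi> \<psi>) p v \<longleftrightarrow> forces M E P r F \<phi> p v \<and> forces M E P r F \<psi> p v"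
| "forces M E P r F (All x \<phi>) p v \<longleftrightarrow>
     (\<forall>\<tau>\<in>names M E P. forces M E P r F \<phi> p (v(x := \<tau>)))"

text \<open>Every condition forces (the universal closure of) every element of \<open>T\<close>.\<close>

definition forced :: "'a set \<Rightarrow> ('a \<Rightarrow> 'a \<Rightarrow> bool) \<Rightarrow> 'a set \<Rightarrow> 'a rel \<Rightarrow>
    ('a \<times> 'a \<times> 'a) set \<Rightarrow> fm set \<Rightarrow> bool" where
  "forced M E P r F T \<longleftrightarrow>
    (\<forall>\<phi>\<in>T. \<forall>p\<in>P. \<forall>v\<in>UNIV \<rightarrow> names M E P. forces M E P r F \<phi> p v)"


section \<open>Generic extensions\<close>

definition dense_in :: "'a set \<Rightarrow> 'a rel \<Rightarrow> 'a set \<Rightarrow> bool" where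
  "dense_in P r D \<longleftrightarrow> D \<subseteq> P \<and> (\<forall>p\<in>P. \<exists>d\<in>D. (d, p) \<in> r)"

definition filter_in :: "'a set \<Rightarrow> 'a rel \<Rightarrow> 'a set \<Rightarrow> bool" where
  "filter_in P r G \<longleftrightarrow> G \<subseteq> P \<and> G \<noteq> {} \<and>
    (\<forall>p\<in>G. \<forall>q. (p, q) \<in> r \<longrightarrow> q \<in> G) \<and>
    (\<forall>p\<in>G. \<forall>q\<in>G. \<exists>s\<in>G. (s, p) \<in> r \<and> (s, q) \<in> r)"

definition generic :: "'a set \<Rightarrow> ('a \<Rightarrow> 'a \<Rightarrow> bool) \<Rightarrow> 'a set \<Rightarrow> 'a rel \<Rightarrow> 'a set \<Rightarrow> bool" where
  "generic M E P r G \<longleftrightarrow> filter_in P r G \<and>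
    (\<forall>D. definable1 M E D \<and> dense_in P r D \<longrightarrow> G \<inter> D \<noteq> {})"

text \<open>The extension \<open>M[G]\<close> consists of the names, where two names are identified if some
  condition in \<open>G\<close> forces them to be equal, and the elements of (the class of) \<open>\<tau>\<close> are (the classes
  of) those \<open>\<sigma>\<close> with \<open>(\<sigma>, p) \<in> \<tau>\<close> for some \<open>p \<in> G\<close>. If \<open>(M, E)\<close> is a transitive set with the true
  membership relation, then \<open>M[G]\<close> is isomorphic to the set of all values \<open>\<tau>\<^sup>G\<close>, where
  \<open>\<tau>\<^sup>G = {\<sigma>\<^sup>G | \<exists>p\<in>G. (\<sigma>, p) \<in> \<tau>}\<close>; the quotient also makes sense for ill-founded structures.\<close>

definition ext_carrier :: "'a set \<Rightarrow> ('a \<Rightarrow> 'a \<Rightarrow> bool) \<Rightarrow> 'a set \<Rightarrow>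
    ('a \<times> 'a \<times> 'a) set \<Rightarrow> 'a set \<Rightarrow> 'a set set" where
  "ext_carrier M E P F G = names M E P // {(\<sigma>, \<tau>). \<exists>p\<in>G. (p, \<sigma>, \<tau>) \<in> F}"

definition ext_mem :: "'a set \<Rightarrow> ('a \<Rightarrow> 'a \<Rightarrow> bool) \<Rightarrow> 'a set \<Rightarrow> 'a set \<Rightarrow> 'a set \<Rightarrow> bool" where
  "ext_mem M E G X Y \<longleftrightarrow> (\<exists>\<sigma>\<in>X. \<exists>\<tau>\<in>Y. \<exists>p\<in>G. has_entry M E \<tau> \<sigma> p)"

end

theory Submission
  imports Defs
begin

text \<open>
  Let \<open>\<kappa>\<^sub>c\<close> be the Hartogs number of the union of the power sets of \<open>V\<^bsub>\<kappa>\<^sub>d\<^esub>\<close> for \<open>d < c\<close>. Stage \<open>c\<close> of the forcing adds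
  \<open>\<kappa>\<^bsub>c+2\<^esub>\<close> subsets of \<open>\<kappa>\<^sub>c\<close> and collapses the power set of \<open>V\<^bsub>\<kappa>\<^sub>c\<^esub>\<close> to \<open>\<kappa>\<^sub>c\<close>, and a condition may in addition decide
  that a later stage is switched off, depending on the generic object below that stage; then only the collapse is
  performed there. Conditions are small below each stage, so the part of the forcing below a stage has a chain condition
  and the part above it is closed. A fusion argument therefore meets any small family of dense classes up to small
  antichains of the lower part. This gives ZFC in the extension and the regularity of the \<open>\<kappa>\<^sub>c\<close>, and it shows that
  \<open>\<kappa>\<^sub>c\<close> has at most \<open>\<kappa>\<^bsub>c+1\<^esub>\<close> subsets if stage \<open>c\<close> is switched off; otherwise it has at least \<open>\<kappa>\<^bsub>c+2\<^esub>\<close>.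

  In the extension \<open>\<kappa>\<^bsub>c+1\<^esub>\<close> is the cardinal successor of \<open>\<kappa>\<^sub>c\<close>, and for limit \<open>c\<close>, \<open>\<kappa>\<^sub>c\<close> is the cardinal successor
  of the supremum of the earlier \<open>\<kappa>\<^sub>d\<close>. So if \<open>\<theta>\<close> is a successor, then \<open>\<kappa>\<^bsub>\<theta>+\<beta>\<^esub>\<close> is the aleph with index \<open>t + \<beta> + 1\<close> for
  a fixed \<open>t\<close>. Given a name for a subset \<open>a\<close> of \<open>\<alpha>\<close>, every condition can be extended so that, for a large enough \<open>\<theta>\<close>,
  stage \<open>\<theta> + \<beta>\<close> is switched off iff \<open>\<beta> \<in> a\<close>.
\<close>

text \<open>The set \<open>a\<close> to be coded exists only in the extension, so a condition cannot
  settle in advance which stages have to be off. Hence a switch is an open set of lower conditions,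
  and the order must forget entries at stages that turn out to be off, since such entries may have
  been made before the generic object below decides the matter. The ground model need not satisfy
  GCH: the growth of \<kappa> leaves room for all power sets involved, and the collapses in row 0
  remove the cardinals in between. As \<open>E\<close> may be ill-founded, recursion, ranks and
  names live inside the structure, and every induction there needs a definable predicate; this is
  why definability is tracked everywhere. That forcing for atomic formulas is definable is not
  automatic for a proper class of conditions. It holds here because conditions have a length: names
  that mention only conditions of length at most \<open>l\<close> are compared by a set forcing, to
  which every condition projects by being cut at \<open>l\<close>.\<close>

abbreviation (input) iff_ascii (infixr "<->" 25) where "P <-> Q == P = Q"

section \<open>Definability with parameters\<close>

lemma finite_fv: "finite (fv ph)"
 by (induction ph) auto

lemma sat_cong: "(!!x. x:fv ph ==> v x = w x) ==> sat M E ph v = sat M E ph w"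
proof (induction ph arbitrary: v w)
 case (All x ph)
 have "sat M E ph (v(x := a)) = sat M E ph (w(x := a))" for a
  by (rule All.IH) (use All.prems in auto)
 then show ?case by simp
next
 case (Neg ph) then show ?case by (metis fv.simps(3) sat.simps(3))
next
 case (Conj ph ps) then show ?case by (metis UnCI fv.simps(4) sat.simps(4))
qed auto

text \<open>The map \<open>ro\<close> may identify variables. Capture is avoided by a bound variable
  outside the image of the free ones. All shuffling of arguments and parameters below reduces to
  this lemma.\<close>

lemma rename_fm: "EX ps. fv ps <= ro ` fv ph & (ALL u. sat M E ps u = sat M E ph (%n. u (ro n)))"
proof (induction ph arbitrary: ro)
 case (Mem x y) show ?case by (intro exI[of _ "Mem (ro x) (ro y)"]) auto
next
 case (Eq x y) show ?case by (intro exI[of _ "Eq (ro x) (ro y)"]) auto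
next
 case (Neg ph)
 from Neg[of ro] obtain ps where "fv ps <= ro ` fv ph" "ALL u. sat M E ps u = sat M E ph (%n. u (ro n))" by blast
 then show ?case by (intro exI[of _ "Neg ps"]) auto
next
 case (Conj ph ph')
 from Conj(1)[of ro] obtain ps where 1: "fv ps <= ro ` fv ph" "ALL u. sat M E ps u = sat M E ph (%n. u (ro n))" by blast
 from Conj(2)[of ro] obtain ps' where 2: "fv ps' <= ro ` fv ph'" "ALL u. sat M E ps' u = sat M E ph' (%n. u (ro n))" by blast
 from 1 2 show ?case by (intro exI[of _ "Conj ps ps'"]) auto
next
 case (All x ph)
 obtain y where y: "y ~: ro ` fv ph" using ex_new_if_finite[OF infinite_UNIV_nat] finite_fv finite_imageI by metis
 from All[of "ro(x := y)"] obtain ps where 1: "fv ps <= (ro(x := y)) ` fv ph" "!!u. sat M E ps u = sat M E ph (%n. u ((ro(x := y)) n))"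
  by blast
 have "sat M E ps (u(y := a)) = sat M E ph ((%n. u (ro n))(x := a))" for u a
  unfolding 1(2) by (rule sat_cong) (use y in auto)
 moreover have "fv (All y ps) <= ro ` fv (All x ph)" using 1(1) by auto
 ultimately show ?case by (intro exI[of _ "All y ps"]) auto
qed

lemma sat_abbrevs [simp]:
 "sat M E (Disj ph ps) v <-> sat M E ph v | sat M E ps v"
 "sat M E (Imp ph ps) v <-> (sat M E ph v --> sat M E ps v)"
 "sat M E (Iff ph ps) v <-> (sat M E ph v <-> sat M E ps v)"
 "sat M E (Ex x ph) v <-> (EX a:M. sat M E ph (v(x := a)))"
 by (auto simp: Disj_def Imp_def Iff_def Ex_def)

lemmas f_defs = f_mem_def f_eq_def f_not_def f_and_def f_or_def f_imp_def f_iff_def f_all_def f_ex_def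

named_theorems dfn

text \<open>Variables at even positions are the arguments, those at odd positions the parameters.\<close>

definition vmix :: "(nat => 'a) => (nat => 'a) => nat => 'a" where
 "vmix v w n = (if even n then v (n div 2) else w (n div 2))"

locale struct =
 fixes M :: "'a set" and E :: "'a => 'a => bool"
begin

definition el :: "'a => 'a set" where "el x = {y:M. E y x}"

text \<open>\<open>D A\<close> holds vacuously unless \<open>A\<close> is a nonempty subset of \<open>M\<close>, which spares side conditions in the closure rules.\<close>

definition D :: "'a set => ((nat => 'a) => bool) => bool" where
 "D A R <-> (A <= M & A ~= {} -->
  (EX ph. EX w:UNIV \<rightarrow> A. ALL v:UNIV \<rightarrow> M. R v = sat M E ph (vmix v w)))"

text \<open>Terms are functions with definable graph. Tracking them next to predicates lets the
  rules \<open>dfn\<close> prove definability by descent through an expression; a binder uses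
  argument 0 and shifts the other arguments by one.\<close>

definition Tm :: "'a set => ((nat => 'a) => 'a) => bool" where
 "Tm A t <-> (ALL v:UNIV \<rightarrow> M. t v:M) & D A (%v. v 0 = t (%n. v (Suc n)))"

lemma D_cong: "(!!v. v:UNIV \<rightarrow> M ==> R v = R' v) ==> D A R' ==> D A R"
 unfolding D_def by simp

lemma D_rename: assumes "D A R" shows "D A (%v. R (%n. v (ro n)))"
 unfolding D_def
proof
 assume A: "A <= M & A ~= {}"
 then obtain ph w where w: "w:UNIV \<rightarrow> A" and R: "!!v. v:UNIV \<rightarrow> M ==> R v = sat M E ph (vmix v w)"
  using assms unfolding D_def by metis
 obtain ps where p: "!!u. sat M E ps u = sat M E ph (%n. u (if even n then 2 * ro (n div 2) else n))"
  using rename_fm[of "%n. if even n then 2 * ro (n div 2) else n" ph M E] by auto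
 have "R (%n. v (ro n)) = sat M E ps (vmix v w)" if "v:UNIV \<rightarrow> M" for v
 proof -
  have "(%n. v (ro n)):UNIV \<rightarrow> M" using that by auto
  moreover have "(%n. vmix v w (if even n then 2 * ro (n div 2) else n)) = vmix (%n. v (ro n)) w"
   by (auto simp: vmix_def fun_eq_iff)
  ultimately show ?thesis using R unfolding p by simp
 qed
 then show "EX ph. EX w:UNIV \<rightarrow> A. ALL v:UNIV \<rightarrow> M. R (%n. v (ro n)) = sat M E ph (vmix v w)" using w by blast
qed

lemma D_not [dfn]: assumes "D A R" shows "D A (%v. ~ R v)"
 unfolding D_def
proof
 assume "A <= M & A ~= {}"
 then obtain ph w where "w:UNIV \<rightarrow> A" "ALL v:UNIV \<rightarrow> M. R v = sat M E ph (vmix v w)"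
  using assms unfolding D_def by metis
 then show "EX ph. EX w:UNIV \<rightarrow> A. ALL v:UNIV \<rightarrow> M. (~ R v) = sat M E ph (vmix v w)"
  by (intro exI[of _ "Neg ph"] bexI[of _ w]) auto
qed

text \<open>The two parameter sequences have to become one; they are interleaved as
  \<open>vmix w w'\<close> and the formulas renamed accordingly.\<close>

lemma D_and [dfn]: assumes "D A R" "D A R'" shows "D A (%v. R v & R' v)"
 unfolding D_def
proof
 assume A: "A <= M & A ~= {}"
 obtain ph w where 1: "w:UNIV \<rightarrow> A" "!!v. v:UNIV \<rightarrow> M ==> R v = sat M E ph (vmix v w)"
  using assms(1) A unfolding D_def by metis
 obtain ph' w' where 2: "w':UNIV \<rightarrow> A" "!!v. v:UNIV \<rightarrow> M ==> R' v = sat M E ph' (vmix v w')"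
  using assms(2) A unfolding D_def by metis
 obtain ps where p: "!!u. sat M E ps u = sat M E ph (%n. u (if even n then n else 2 * (2 * (n div 2)) + 1))"
  using rename_fm[of "%n. if even n then n else 2 * (2 * (n div 2)) + 1" ph M E] by auto
 obtain ps' where p': "!!u. sat M E ps' u = sat M E ph' (%n. u (if even n then n else 2 * (2 * (n div 2) + 1) + 1))"
  using rename_fm[of "%n. if even n then n else 2 * (2 * (n div 2) + 1) + 1" ph' M E] by auto
 have "vmix w w':UNIV \<rightarrow> A" using 1(1) 2(1) by (auto simp: vmix_def Pi_iff)
 moreover have "(R v & R' v) = sat M E (Conj ps ps') (vmix v (vmix w w'))" if "v:UNIV \<rightarrow> M" for v
 proof -
  have "(%n. vmix v (vmix w w') (if even n then n else 2 * (2 * (n div 2)) + 1)) = vmix v w"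
   "(%n. vmix v (vmix w w') (if even n then n else 2 * (2 * (n div 2) + 1) + 1)) = vmix v w'"
   by (auto simp: vmix_def fun_eq_iff elim!: oddE)
  then show ?thesis using 1(2)[OF that] 2(2)[OF that] p p' by simp
 qed
 ultimately show "EX ph. EX w:UNIV \<rightarrow> A. ALL v:UNIV \<rightarrow> M. (R v & R' v) = sat M E ph (vmix v w)" by blast
qed

lemma D_all [dfn]: assumes "D A (%v. R (v 0) (%n. v (Suc n)))" shows "D A (%v. ALL x:M. R x v)"
 unfolding D_def
proof
 assume A: "A <= M & A ~= {}"
 then obtain ph w where w: "w:UNIV \<rightarrow> A"
  and R: "!!v. v:UNIV \<rightarrow> M ==> R (v 0) (%n. v (Suc n)) = sat M E ph (vmix v w)"
  using assms unfolding D_def by metis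
 \<comment> \<open>\<open>?r\<close> frees variable 0 for the bound element by placing every
   argument and parameter one position too high; \<open>?s\<close> moves them back once variable 0
   is bound.\<close>
 let ?r = "%n. if n = 0 then 0 else if even n then n - 1 else Suc n"
 let ?s = "%n. n - Suc 0"
 obtain ps where p: "!!u. sat M E ps u = sat M E ph (%n. u (?r n))" using rename_fm[of ?r ph M E] by auto
 obtain ch where q: "!!u. sat M E ch u = sat M E (All 0 ps) (%n. u (?s n))" using rename_fm[of ?s "All 0 ps" M E] by auto
 have "(ALL x:M. R x v) = sat M E ch (vmix v w)" if v: "v:UNIV \<rightarrow> M" for v
 proof -
  have "R x v = sat M E ps ((%n. vmix v w (?s n))(0 := x))" if "x:M" for x
  proof -
   let ?v = "%n. case n of 0 => x | Suc k => v k"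
   have v': "?v:UNIV \<rightarrow> M" using v that by (auto simp: Pi_iff split: nat.splits)
   have "((%n. vmix v w (?s n))(0 := x)) (?r n) = vmix ?v w n" for n
   proof (cases "even n")
    case True then obtain k where "n = 2 * k" by blast
    then show ?thesis by (cases k) (auto simp: vmix_def)
   next
    case False then show ?thesis by (auto simp: vmix_def elim: oddE)
   qed
   then show ?thesis using R[OF v'] unfolding p by simp
  qed
  then show ?thesis unfolding q by simp
 qed
 then show "EX ph. EX w:UNIV \<rightarrow> A. ALL v:UNIV \<rightarrow> M. (ALL x:M. R x v) = sat M E ph (vmix v w)" using w by blast
qed

lemma D_or [dfn]: "D A R ==> D A R' ==> D A (%v. R v | R' v)"
 using D_not[OF D_and[OF D_not D_not, of A R R']] by simp
lemma D_imp [dfn]: "D A R ==> D A R' ==> D A (%v. R v --> R' v)"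
 using D_or[OF D_not, of A R R'] by (simp only: imp_conv_disj)
lemma D_iff [dfn]: "D A R ==> D A R' ==> D A (%v. R v <-> R' v)"
 using D_and[OF D_imp D_imp, of A R R' R' R] by (simp add: iff_conv_conj_imp)
lemma D_ex [dfn]: "D A (%v. R (v 0) (%n. v (Suc n))) ==> D A (%v. EX x:M. R x v)"
 using D_not[OF D_all[OF D_not, of A R]] by simp

lemma D_var_E: "D A (%v. E (v i) (v j))"
 unfolding D_def
proof
 assume "A <= M & A ~= {}"
 then obtain a where "a:A" by auto
 then show "EX ph. EX w:UNIV \<rightarrow> A. ALL v:UNIV \<rightarrow> M. E (v i) (v j) = sat M E ph (vmix v w)"
  by (intro exI[of _ "Mem (2*i) (2*j)"] bexI[of _ "%_. a"]) (auto simp: vmix_def)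
qed

lemma D_var_eq: "D A (%v. v i = v j)"
 unfolding D_def
proof
 assume "A <= M & A ~= {}"
 then obtain a where "a:A" by auto
 then show "EX ph. EX w:UNIV \<rightarrow> A. ALL v:UNIV \<rightarrow> M. (v i = v j) = sat M E ph (vmix v w)"
  by (intro exI[of _ "Eq (2*i) (2*j)"] bexI[of _ "%_. a"]) (auto simp: vmix_def)
qed

lemma D_var_const: "a:A ==> D A (%v. v i = a)"
 unfolding D_def
 by (intro impI exI[of _ "Eq (2*i) 1"] bexI[of _ "%_. a"]) (auto simp: vmix_def)

lemma Tm_in: "Tm A t ==> v:UNIV \<rightarrow> M ==> t v:M"
 unfolding Tm_def by blast

lemma Tm_var [dfn]: "Tm A (%v. v n)"
 unfolding Tm_def using D_var_eq[of A 0 "Suc n"] by auto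

lemma Tm_const: "a:A ==> A <= M ==> Tm A (%v. a)"
 unfolding Tm_def using D_var_const[of a A 0] by auto

lemma Tm_constM [dfn]: "a:M ==> Tm M (%v. a)"
 by (rule Tm_const) auto

lemma D_subst: assumes "Tm A t" "D A (%v. R (v 0) (%n. v (Suc n)))" shows "D A (%v. R (t v) v)"
proof -
 have "D A (%v. EX x:M. x = t v & R x v)"
  using assms unfolding Tm_def by (intro D_ex D_and) auto
 then show ?thesis by (rule D_cong[rotated]) (use Tm_in[OF assms(1)] in auto)
qed

lemma Tm_rename: assumes "Tm A t" shows "Tm A (%v. t (%n. v (ro n)))"
proof -
 have "D A (%v. v 0 = t (%n. v (Suc n)))" using assms unfolding Tm_def by blast
 from D_rename[OF this, of "%n. if n = 0 then 0 else Suc (ro (n - 1))"] show ?thesis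
  using assms unfolding Tm_def by (auto simp: Pi_iff)
qed
lemmas Tm_shift = Tm_rename[of _ _ Suc]

lemma D1: "Tm A s ==> D A (%v. Q (v 0)) ==> D A (%v. Q (s v))"
 by (rule D_subst[where R = "%x v. Q x"])

text \<open>A definition is unfolded once, at bare variables, and the result is transferred to
  arbitrary terms. Most later \<open>dfn\<close> rules follow this pattern.\<close>

lemma D2: assumes "Tm A s" "Tm A t" "D A (%v. Q (v 0) (v 1))" shows "D A (%v. Q (s v) (t v))"
proof -
 have "D A (%v. Q (s (%n. v (Suc n))) (v 0))"
  by (rule D_subst[where R = "%x v. Q x (v 0)", OF Tm_shift]) (use assms in auto)
 from D_subst[where R = "%x v. Q (s v) x", OF assms(2) this] show ?thesis by simp
qed

lemma D3: assumes "Tm A s" "Tm A t" "Tm A u" "D A (%v. Q (v 0) (v 1) (v 2))" shows "D A (%v. Q (s v) (t v) (u v))"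
proof -
 have "D A (%v. Q (s (%n. v (Suc (Suc n)))) (v 0) (v 1))"
  by (rule D_subst[where R = "%x v. Q x (v 0) (v 1)", OF Tm_shift[OF Tm_shift]]) (use assms in \<open>auto simp: numeral_2_eq_2\<close>)
 then have "D A (%v. Q (s (%n. v (Suc n))) (t (%n. v (Suc n))) (v 0))"
  by (intro D_subst[where R = "%x v. Q (s (%n. v (Suc n))) x (v 0)", OF Tm_shift]) (use assms in auto)
 from D_subst[where R = "%x v. Q (s v) (t v) x", OF assms(3) this] show ?thesis by simp
qed

lemma D4: assumes "Tm A s" "Tm A t" "Tm A u" "Tm A r" "D A (%v. Q (v 0) (v 1) (v 2) (v 3))" shows "D A (%v. Q (s v) (t v) (u v) (r v))"
proof -
 have "D A (%v. Q (s (%n. v (Suc (Suc (Suc n))))) (v 0) (v 1) (v 2))"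
  by (rule D_subst[where R = "%x v. Q x (v 0) (v 1) (v 2)", OF Tm_shift[OF Tm_shift[OF Tm_shift]]]) (use assms in \<open>auto simp: eval_nat_numeral\<close>)
 then have "D A (%v. Q (s (%n. v (Suc (Suc n)))) (t (%n. v (Suc (Suc n)))) (v 0) (v 1))"
  by (intro D_subst[where R = "%x v. Q (s (%n. v (Suc (Suc n)))) x (v 0) (v 1)", OF Tm_shift[OF Tm_shift]]) (use assms in \<open>auto simp: eval_nat_numeral\<close>)
 then have "D A (%v. Q (s (%n. v (Suc n))) (t (%n. v (Suc n))) (u (%n. v (Suc n))) (v 0))"
  by (intro D_subst[where R = "%x v. Q (s (%n. v (Suc n))) (t (%n. v (Suc n))) x (v 0)", OF Tm_shift]) (use assms in auto)
 from D_subst[where R = "%x v. Q (s v) (t v) (u v) x", OF assms(4) this] show ?thesis by simp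
qed

lemma D_E [dfn]: "Tm A s ==> Tm A t ==> D A (%v. E (s v) (t v))"
 by (rule D2[where Q = E]) (auto intro: D_var_E)
lemma D_eq [dfn]: "Tm A s ==> Tm A t ==> D A (%v. s v = t v)"
 by (rule D2[where Q = "(=)"]) (auto intro: D_var_eq)
lemma D_True [dfn]: "D A (%v. True)"
 using D_var_eq[of A 0 0] by simp
lemma D_False [dfn]: "D A (%v. False)"
 using D_not[OF D_True] by simp

lemma D_el [dfn]: assumes "Tm A s" "Tm A t" shows "D A (%v. s v:el (t v))"
 by (rule D_cong[OF _ D_E[OF assms]]) (use Tm_in[OF assms(1)] in \<open>auto simp: el_def\<close>)
lemma D_inM [dfn]: assumes "Tm A s" shows "D A (%v. s v:M)"
 by (rule D_cong[OF _ D_True]) (use Tm_in[OF assms(1)] in auto)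
lemma D_ball [dfn]: assumes "Tm A t" "D A (%v. R (v 0) (%n. v (Suc n)))" shows "D A (%v. ALL x:el (t v). R x v)"
proof -
 have "D A (%v. ALL x:M. E x (t v) --> R x v)" by (intro D_all D_imp D_E Tm_var Tm_shift assms)
 then show ?thesis by (rule D_cong[rotated]) (auto simp: el_def)
qed
lemma D_bex [dfn]: assumes "Tm A t" "D A (%v. R (v 0) (%n. v (Suc n)))" shows "D A (%v. EX x:el (t v). R x v)"
 using D_not[OF D_ball[OF assms(1) D_not, of R]] assms(2) by simp
lemma D_sub [dfn]: assumes "Tm A s" "Tm A t" shows "D A (%v. el (s v) <= el (t v))"
proof -
 have "D A (%v. ALL x:el (s v). x:el (t v))" by (intro D_ball D_el Tm_var Tm_shift assms)
 then show ?thesis by (simp add: subset_eq)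
qed

lemma Tm_the:
 assumes "!!v. v:UNIV \<rightarrow> M ==> t v:M" "D A (%v. R (v 0) (%n. v (Suc n)))"
  "!!v x. v:UNIV \<rightarrow> M ==> x:M ==> R x v = (x = t v)"
 shows "Tm A t"
 unfolding Tm_def
proof
 show "D A (%v. v 0 = t (%n. v (Suc n)))" 
  by (rule D_cong[OF _ assms(2)]) (simp add: assms(3) Pi_iff)
qed (use assms in auto)

lemma Tm1: assumes "Tm A s" "Tm A (%v. f (v 0))" shows "Tm A (%v. f (s v))"
proof (rule Tm_the[where R = "%x v. x = f (s v)"])
 have m: "f x:M" if "x:M" for x using Tm_in[OF assms(2), of "%_. x"] that by auto
 then show "f (s v):M" if "v:UNIV \<rightarrow> M" for v using Tm_in[OF assms(1) that] by auto
 have "D A (%v. v 0 = f (v 1))" using assms(2) unfolding Tm_def by simp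
 from D2[OF Tm_var Tm_shift[OF assms(1)] this] show "D A (%v. v 0 = f (s (%n. v (Suc n))))" .
qed auto
lemma Tm2: assumes "Tm A s" "Tm A t" "Tm A (%v. f (v 0) (v 1))" shows "Tm A (%v. f (s v) (t v))"
proof (rule Tm_the[where R = "%x v. x = f (s v) (t v)"])
 have m: "f x y:M" if "x:M" "y:M" for x y using Tm_in[OF assms(3), of "%n. if n = 0 then x else y"] that by auto
 then show "f (s v) (t v):M" if "v:UNIV \<rightarrow> M" for v using Tm_in that assms by blast
 have "D A (%v. v 0 = f (v 1) (v 2))" using assms(3) unfolding Tm_def by (simp add: numeral_2_eq_2)
 from D3[OF Tm_var Tm_shift Tm_shift this] assms show "D A (%v. v 0 = f (s (%n. v (Suc n))) (t (%n. v (Suc n))))" by blast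
qed auto
lemma Tm3: assumes "Tm A s" "Tm A t" "Tm A u" "Tm A (%v. f (v 0) (v 1) (v 2))" shows "Tm A (%v. f (s v) (t v) (u v))"
proof (rule Tm_the[where R = "%x v. x = f (s v) (t v) (u v)"])
 have m: "f x y z:M" if "x:M" "y:M" "z:M" for x y z using Tm_in[OF assms(4), of "%n. if n = 0 then x else if n = 1 then y else z"] that by auto
 then show "f (s v) (t v) (u v):M" if "v:UNIV \<rightarrow> M" for v using Tm_in that assms by blast
 have "D A (%v. v 0 = f (v 1) (v 2) (v 3))" using assms(4) unfolding Tm_def by (simp add: eval_nat_numeral)
 from D4[OF Tm_var Tm_shift Tm_shift Tm_shift this] assms show "D A (%v. v 0 = f (s (%n. v (Suc n))) (t (%n. v (Suc n))) (u (%n. v (Suc n))))" by blast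
qed auto

definition isset :: "'a set => bool" where "isset S <-> (EX x:M. el x = S)"

text \<open>The set with elements \<open>S\<close>; for other \<open>S\<close> the value is the empty set.\<close>

definition mk :: "'a set => 'a" where
 "mk S = (THE x. x:M & el x = (if isset S then S else {}))"

end

section \<open>Sets inside a model of ZFC\<close>

locale zfc = struct M E for M :: "'a set" and E +
 assumes ZFC: "models M E ZFC"
begin

lemma nonempty: "M ~= {}"
 using ZFC unfolding models_def by blast

lemma axiom: "ph:ZFC ==> v:UNIV \<rightarrow> M ==> sat M E ph v"
 using ZFC unfolding models_def by blast

lemma sentence: assumes "ph:ZFC" obtains a where "a:M" "sat M E ph (%_. a)"
proof -
 obtain a where "a:M" using nonempty by blast
 with axiom[OF assms, of "%_. a"] that show thesis by auto
qed

lemma elM: "y:el x ==> y:M" and el_sub [simp]: "el x <= M"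
 by (auto simp: el_def)
lemma E_iff: "y:M ==> E y x <-> y:el x"
 by (simp add: el_def)

lemma ext: assumes "x:M" "y:M" "el x = el y" shows "x = y"
proof -
 obtain a where "sat M E extensionality (%_. a)" using sentence[of extensionality] by (auto simp: ZFC_def)
 then have "ALL x:M. ALL y:M. (ALL z:M. E z x <-> E z y) --> x = y" unfolding extensionality_def f_defs by simp
 then show ?thesis using assms by (auto simp: el_def)
qed

lemma foundation: assumes "x:M" "el x ~= {}" shows "EX y:el x. el y Int el x = {}"
proof -
 obtain a where "sat M E foundation (%_. a)" using sentence[of foundation] by (auto simp: ZFC_def)
 then have "ALL x:M. (EX y:M. E y x) --> (EX y:M. E y x & (ALL z:M. E z x --> ~ E z y))"
  unfolding foundation_def f_defs by simp
 then show ?thesis using assms by (fastforce simp: el_def)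
qed

lemma isset_el [simp]: "x:M ==> isset (el x)"
 unfolding isset_def by blast

lemma isset_up: assumes "x:M" "y:M" shows "isset {x, y}"
proof -
 obtain a where "sat M E pairing (%_. a)" using sentence[of pairing] by (auto simp: ZFC_def)
 then have "ALL x:M. ALL y:M. EX z:M. ALL w:M. E w z <-> w = x | w = y" unfolding pairing_def f_defs by simp
 then obtain z where "z:M" "ALL w:M. E w z <-> w = x | w = y" using assms by blast
 then show ?thesis using assms unfolding isset_def el_def by (intro bexI[of _ z]) auto
qed

lemma isset_Union: assumes "x:M" shows "isset (UN y:el x. el y)"
proof -
 obtain a where "sat M E union (%_. a)" using sentence[of union] by (auto simp: ZFC_def)
 then have "ALL x:M. EX u:M. ALL z:M. E z u <-> (EX y:M. E y x & E z y)" unfolding union_def f_defs by simp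
 then obtain u where "u:M" "ALL z:M. E z u <-> (EX y:M. E y x & E z y)" using assms by blast
 then show ?thesis unfolding isset_def el_def by (intro bexI[of _ u]) auto
qed

lemma isset_Pow: assumes "x:M" shows "isset {y:M. el y <= el x}"
proof -
 obtain a where "sat M E power_set (%_. a)" using sentence[of power_set] by (auto simp: ZFC_def)
 then have "ALL x:M. EX p:M. ALL z:M. E z p <-> (ALL w:M. E w z --> E w x)"
  unfolding power_set_def f_subset_def f_defs by simp
 then obtain p where p: "p:M" "ALL z:M. E z p <-> (ALL w:M. E w z --> E w x)" using assms by blast
 have "el p = {y:M. el y <= el x}" using p(2) by (auto simp: el_def)
 with p(1) show ?thesis unfolding isset_def by blast
qed

lemma isset_sep: assumes "x:M" "D M (%v. R (v 0))" shows "isset {y:M. y:el x & R y}"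
proof -
 obtain ph w where w: "w:UNIV \<rightarrow> M" and R: "!!v. v:UNIV \<rightarrow> M ==> R (v 0) = sat M E ph (vmix v w)"
  using assms(2) nonempty unfolding D_def by (metis equalityD1)
 \<comment> \<open>All arguments become the candidate element 0 and the parameters start at 3, which
   leaves 1 for the given set and 2 for the new one.\<close>
 let ?r = "%n. if even n then 0 else n div 2 + 3"
 obtain ps where p: "fv ps <= ?r ` fv ph" "!!u. sat M E ps u = sat M E ph (%n. u (?r n))" using rename_fm[of ?r ph M E] by auto
 have "2 ~: fv ps" using p(1) by (auto split: if_splits)
 then have "Ex 2 (All 0 (Iff (Mem 0 2) (Conj (Mem 0 1) ps))):separation" unfolding separation_def
  by (intro CollectI, rule_tac exI[of _ 0], rule_tac exI[of _ 1], rule_tac exI[of _ 2], rule_tac exI[of _ ps], simp)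
 then have "Ex 2 (All 0 (Iff (Mem 0 2) (Conj (Mem 0 1) ps))):ZFC" unfolding ZFC_def by blast
 moreover let ?v = "%n. if n < 3 then x else w (n - 3)"
 have "?v:UNIV \<rightarrow> M" using w assms(1) by (auto simp: Pi_iff)
 ultimately have "sat M E (Ex 2 (All 0 (Iff (Mem 0 2) (Conj (Mem 0 1) ps)))) ?v" by (rule axiom)
 then obtain b where b: "b:M" "ALL y:M. E y b = (E y x & sat M E ps (?v(2 := b, 0 := y)))" by auto
 have "sat M E ps (?v(2 := b, 0 := y)) = R y" if y: "y:M" for y
 proof -
  have "(%n. (?v(2 := b, 0 := y)) (?r n)) = vmix (%_. y) w" by (auto simp: vmix_def fun_eq_iff)
  then show ?thesis using R[of "%_. y"] y unfolding p(2) by auto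
 qed
 with b show ?thesis unfolding isset_def el_def by (intro bexI[of _ b]) auto
qed

lemma issetI: assumes "x:M" "D M (%v. R (v 0))" "!!y. y:M ==> R y ==> y:el x" shows "isset {y:M. R y}"
proof -
 have "{y:M. y:el x & R y} = {y:M. R y}" using assms(3) by auto
 with isset_sep[OF assms(1,2)] show ?thesis by simp
qed

lemma isset_empty [simp]: "isset {}"
proof -
 obtain x where "x:M" using nonempty by blast
 from isset_sep[OF this D_False] show ?thesis by simp
qed

lemma mk_aux: "EX! x. x:M & el x = (if isset S then S else {})"
proof -
 have "isset (if isset S then S else {})" by simp
 then show ?thesis using ext unfolding isset_def by (metis (full_types))
qed
lemma mk_in [simp, intro]: "mk S:M" and el_mk': "el (mk S) = (if isset S then S else {})"
 using theI'[OF mk_aux[of S]] unfolding mk_def by blast+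
lemma el_mk [simp]: "isset S ==> el (mk S) = S"
 by (simp add: el_mk')
lemma mk_el [simp]: "x:M ==> mk (el x) = x"
 by (simp add: ext)

lemma Tm_mk [dfn]: assumes "D A (%v. R (v 0) (%n. v (Suc n)))" shows "Tm A (%v. mk {y:M. R y v})"
\<comment> \<open>The second disjunct describes the default: if no set has exactly these elements,
  the value is the empty set.\<close>
proof (rule Tm_the[where R = "%x v. (ALL y:M. E y x <-> R y v) | ((ALL x:M. EX y:M. ~ (E y x <-> R y v)) & (ALL y:M. ~ E y x))"])
 have "D A (%v. R (v 0) (%n. v (Suc (Suc n))))" "D A (%v. R (v 0) (%n. v (Suc (Suc (Suc n)))))"
  using D_rename[OF assms, of "%n. if n = 0 then 0 else Suc n"] D_rename[OF assms, of "%n. if n = 0 then 0 else Suc (Suc n)"] by auto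
 then show "D A (%v. (ALL y:M. E y (v 0) = R y (%n. v (Suc n))) |
     (ALL x:M. EX y:M. E y x ~= R y (%n. v (Suc n))) & (ALL y:M. ~ E y (v 0)))"
  by (intro dfn)
 fix v :: "nat => 'a" and x assume "v:UNIV \<rightarrow> M" "x:M"
 have "(ALL y:M. E y x = R y v) <-> el x = {y:M. R y v}" "(ALL x:M. EX y:M. ~ (E y x <-> R y v)) <-> ~ isset {y:M. R y v}"
  "(ALL y:M. ~ E y x) <-> el x = {}"
  unfolding isset_def el_def by blast+
 then show "((ALL y:M. E y x = R y v) | (ALL x:M. EX y:M. E y x ~= R y v) & (ALL y:M. ~ E y x)) = (x = mk {y:M. R y v})"
  using ext[OF \<open>x : M\<close> mk_in] el_mk' isset_el[OF \<open>x : M\<close>] by (smt (verit, best))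
qed auto

lemma replacement: assumes "a:M" "D M (%v. R (v 0) (v 1))" "!!x. x:el a ==> EX! y. y:M & R x y"
 shows "EX b:M. ALL x:el a. EX y:el b. R x y"
proof -
 obtain ph w where w: "w:UNIV \<rightarrow> M" and R: "!!v. v:UNIV \<rightarrow> M ==> R (v 0) (v 1) = sat M E ph (vmix v w)"
  using assms(2) nonempty unfolding D_def by (metis equalityD1)
 \<comment> \<open>Variables 0 and 1 are the related elements; 2, 3 and 4 are reserved for the
   uniqueness witness, the domain and the bound, so parameters start at 5.\<close>
 let ?r = "%n. if even n then if n = 2 then 1 else 0 else n div 2 + 5"
 obtain ps where p: "fv ps <= ?r ` fv ph" "!!u. sat M E ps u = sat M E ph (%n. u (?r n))" using rename_fm[of ?r ph M E] by auto
 have "2 ~: fv ps" "4 ~: fv ps" using p(1) by (auto split: if_splits)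
 then have "Imp (All 0 (Imp (Mem 0 3) (Ex 2 (All 1 (Iff ps (Eq 1 2))))))
    (Ex 4 (All 0 (Imp (Mem 0 3) (Ex 1 (Conj (Mem 1 4) ps))))):replacement" unfolding replacement_def
  by (intro CollectI, rule_tac exI[of _ 0], rule_tac exI[of _ 1], rule_tac exI[of _ 2], rule_tac exI[of _ 3], rule_tac exI[of _ 4], rule_tac exI[of _ ps], simp)
 then have "Imp (All 0 (Imp (Mem 0 3) (Ex 2 (All 1 (Iff ps (Eq 1 2))))))
    (Ex 4 (All 0 (Imp (Mem 0 3) (Ex 1 (Conj (Mem 1 4) ps))))):ZFC" unfolding ZFC_def by blast
 moreover let ?v = "%n. if n < 5 then a else w (n - 5)"
 have "?v:UNIV \<rightarrow> M" using w assms(1) by (auto simp: Pi_iff)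
 ultimately have s: "sat M E (Imp (All 0 (Imp (Mem 0 3) (Ex 2 (All 1 (Iff ps (Eq 1 2))))))
    (Ex 4 (All 0 (Imp (Mem 0 3) (Ex 1 (Conj (Mem 1 4) ps)))))) ?v" by (rule axiom)
 have *: "sat M E ps (?v(0 := x, 2 := z, 1 := y)) = R x y" "sat M E ps (?v(4 := z, 0 := x, 1 := y)) = R x y"
  if y: "y:M" "x:M" for x y z
 proof -
  have "(%n. (?v(0 := x, 2 := z, 1 := y)) (?r n)) = vmix (%n. if n = 1 then y else x) w"
    "(%n. (?v(4 := z, 0 := x, 1 := y)) (?r n)) = vmix (%n. if n = 1 then y else x) w"
   by (auto simp: vmix_def fun_eq_iff)
  then show "sat M E ps (?v(0 := x, 2 := z, 1 := y)) = R x y" "sat M E ps (?v(4 := z, 0 := x, 1 := y)) = R x y"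
   using R[of "%n. if n = 1 then y else x"] y unfolding p(2) by auto
 qed
 have "ALL x:M. E x a --> (EX z:M. ALL y:M. R x y = (y = z))" using assms(3) by (metis E_iff)
 then obtain b where "b:M" "ALL x:M. E x a --> (EX y:M. E y b & R x y)" using s by (simp add: *[simplified] cong: bex_cong ball_cong) blast
 then show ?thesis by (metis E_iff elM)
qed

lemma isset_image: assumes "x:M" "Tm M (%v. f (v 0))" shows "isset (f ` el x)"
proof -
 have f: "f y:M" if "y:M" for y using Tm_in[OF assms(2), of "%_. y"] that by auto
 have d: "D M (%v. v 1 = f (v 0))" by (intro D_eq Tm_var assms)
 obtain b where b: "b:M" "ALL y:el x. EX z:el b. z = f y"
  using replacement[of x "%y z. z = f y", OF assms(1) d] f elM by (metis (no_types, lifting))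
 have "D M (%v. EX y:el x. v 0 = f y)"
  by (intro D_bex D_eq Tm_constM assms(1) Tm_var Tm1[OF Tm_var assms(2)])
 from issetI[OF b(1) this] b(2) have "isset {z:M. EX y:el x. z = f y}" by fast
 also have "{z:M. EX y:el x. z = f y} = f ` el x" using f by (auto dest: elM)
 finally show ?thesis .
qed

lemma isset_UN: assumes "x:M" "Tm M (%v. f (v 0))" shows "isset (UN y:el x. el (f y))"
 using isset_Union[OF mk_in, of "f ` el x"] isset_image[OF assms] by simp

lemma isset_Bex: assumes "a:M" "D M (%v. R (v 0) (v 1))" "!!x. x:el a ==> isset {y:M. R x y}"
 shows "isset {y:M. EX x:el a. R x y}"
proof -
 have "Tm M (%v. mk {y:M. R (v 0) y})" 
  by (intro Tm_mk D2[OF Tm_var Tm_var assms(2)])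
 from isset_UN[OF assms(1) this] have "isset (UN x:el a. el (mk {y:M. R x y}))" .
 also have "(UN x:el a. el (mk {y:M. R x y})) = {y:M. EX x:el a. R x y}" using assms(3) by auto
 finally show ?thesis .
qed

declare elM [simp]

section \<open>Pairs, unions, power sets, products and functions inside the model\<close>

definition emp where "emp = mk {y:M. False}"
definition up where "up x y = mk {z:M. z = x | z = y}"
definition UU where "UU x = mk {z:M. EX y:el x. z:el y}"
definition un where "un x y = mk {z:M. z:el x | z:el y}"
definition pw where "pw x = mk {z:M. el z <= el x}"
definition suc where "suc x = mk {z:M. z:el x | z = x}"
definition pr where "pr x y = up (up x x) (up x y)"

lemma dfn1 [dfn]: "Tm A (%v. emp)" "Tm A s ==> Tm A t ==> Tm A (%v. up (s v) (t v))" "Tm A s ==> Tm A (%v. UU (s v))"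
  "Tm A s ==> Tm A t ==> Tm A (%v. un (s v) (t v))" "Tm A s ==> Tm A (%v. pw (s v))" "Tm A s ==> Tm A (%v. suc (s v))"
 subgoal unfolding emp_def by (intro dfn)
 subgoal by (rule Tm2[where f = up]; (assumption | (unfold up_def, intro dfn)))
 subgoal by (rule Tm1[where f = UU]; (assumption | (unfold UU_def, intro dfn)))
 subgoal by (rule Tm2[where f = un]; (assumption | (unfold un_def, intro dfn)))
 subgoal by (rule Tm1[where f = pw]; (assumption | (unfold pw_def, intro dfn)))
 subgoal by (rule Tm1[where f = suc]; (assumption | (unfold suc_def, intro dfn)))
 done
lemma dfn_pr [dfn]: "Tm A s ==> Tm A t ==> Tm A (%v. pr (s v) (t v))"
 unfolding pr_def by (intro dfn)

lemma op_in [simp, intro]: "emp:M" "up x y:M" "UU x:M" "un x y:M" "pw x:M" "suc x:M" "pr x y:M"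
 by (auto simp: emp_def up_def UU_def un_def pw_def suc_def pr_def)

lemma el_emp [simp]: "el emp = {}"
 unfolding emp_def by simp
lemma el_up [simp]: "x:M ==> y:M ==> el (up x y) = {x, y}"
proof -
 assume a: "x:M" "y:M"
 then have "{z:M. z = x | z = y} = {x, y}" by auto
 with a isset_up show ?thesis unfolding up_def by simp
qed
lemma el_UU [simp]: "x:M ==> el (UU x) = (UN y:el x. el y)"
proof -
 assume a: "x:M"
 have "{z:M. EX y:el x. z:el y} = (UN y:el x. el y)" by auto
 with isset_Union[OF a] show ?thesis unfolding UU_def by simp
qed
lemma el_un [simp]: "x:M ==> y:M ==> el (un x y) = el x Un el y"
proof -
 assume a: "x:M" "y:M"
 have "{z:M. z:el x | z:el y} = el (UU (up x y))" using a by auto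
 then have "un x y = UU (up x y)" unfolding un_def by (simp only: mk_el op_in)
 then show ?thesis by (simp add: a)
qed
lemma el_pw [simp]: "x:M ==> el (pw x) = {y:M. el y <= el x}"
 unfolding pw_def by (rule el_mk[OF isset_Pow])
lemma el_suc [simp]: "x:M ==> el (suc x) = insert x (el x)"
proof -
 assume a: "x:M"
 have "{z:M. z:el x | z = x} = el (un x (up x x))" using a by auto
 then have "suc x = un x (up x x)" unfolding suc_def by (simp only: mk_el op_in)
 then show ?thesis by (simp add: a)
qed

lemma pr_inj [simp]: "x:M ==> y:M ==> x':M ==> y':M ==> pr x y = pr x' y' <-> x = x' & y = y'"
proof
 assume a: "x:M" "y:M" "x':M" "y':M" and p: "pr x y = pr x' y'"
 have "{up x x, up x y} = {up x' x', up x' y'}" using arg_cong[OF p, of el] a unfolding pr_def by simp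
 moreover have "up u v = up u' v' ==> {u,v} = {u',v'}" if "u:M" "v:M" "u':M" "v':M" for u v u' v'
  using that el_up by metis
 ultimately show "x = x' & y = y'" using a by (metis (no_types, lifting) doubleton_eq_iff)
qed auto

text \<open>Projections and application collect the elements of the intended value instead of
  describing the value itself. This makes them total operations with values in \<open>M\<close>,
  also on arguments that are not pairs or functions.\<close>

definition ft where "ft z = mk {w:M. EX x:M. EX y:M. z = pr x y & w:el x}"
definition sn where "sn z = mk {w:M. EX x:M. EX y:M. z = pr x y & w:el y}"
definition pd where "pd X Y = mk {z:M. EX x:el X. EX y:el Y. z = pr x y}"
definition app where "app f x = mk {z:M. EX y:M. pr x y:el f & z:el y}"

lemma dfn2 [dfn]: "Tm A s ==> Tm A (%v. ft (s v))" "Tm A s ==> Tm A (%v. sn (s v))"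
  "Tm A s ==> Tm A t ==> Tm A (%v. pd (s v) (t v))" "Tm A s ==> Tm A t ==> Tm A (%v. app (s v) (t v))"
 subgoal by (rule Tm1[where f = ft]; (assumption | (unfold ft_def, intro dfn)))
 subgoal by (rule Tm1[where f = sn]; (assumption | (unfold sn_def, intro dfn)))
 subgoal by (rule Tm2[where f = pd]; (assumption | (unfold pd_def, intro dfn)))
 subgoal by (rule Tm2[where f = app]; (assumption | (unfold app_def, intro dfn)))
 done
lemma op_in2 [simp, intro]: "ft z:M" "sn z:M" "pd x y:M" "app x y:M"
 by (auto simp: ft_def sn_def pd_def app_def)
lemma ft_pr [simp]: "x:M ==> y:M ==> ft (pr x y) = x"
proof -
 assume a: "x:M" "y:M"
 then have "{w:M. EX x':M. EX y':M. pr x y = pr x' y' & w:el x'} = el x" by auto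
 with a show ?thesis unfolding ft_def by simp
qed
lemma sn_pr [simp]: "x:M ==> y:M ==> sn (pr x y) = y"
proof -
 assume a: "x:M" "y:M"
 then have "{w:M. EX x':M. EX y':M. pr x y = pr x' y' & w:el y'} = el y" by auto
 with a show ?thesis unfolding sn_def by simp
qed
lemma el_pd [simp]: "x:M ==> y:M ==> el (pd x y) = {z:M. EX a:el x. EX b:el y. z = pr a b}"
proof -
 assume a: "x:M" "y:M"
 have "isset {z:M. EX b:el y. z = pr a b}" if "a:el x" for a
 proof -
  have "{z:M. EX b:el y. z = pr a b} = pr a ` el y" by auto
  moreover have "isset (pr a ` el y)" using a that by (intro isset_image) (auto intro!: dfn)
  ultimately show ?thesis by simp
 qed
 then have "isset {z:M. EX u:el x. EX b:el y. z = pr u b}"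
  using a by (intro isset_Bex[where R = "%u z. EX b:el y. z = pr u b"]) (auto intro!: dfn)
 then show ?thesis unfolding pd_def by simp
qed

definition fun1 where "fun1 f <-> (ALL x:M. ALL y:M. ALL z:M. pr x y:el f & pr x z:el f --> y = z)"
lemma D_fun1 [dfn]: "Tm A s ==> D A (%v. fun1 (s v))"
 by (rule D1[where Q = fun1]; (assumption | (unfold fun1_def, intro dfn)))
lemma app_eq: assumes "fun1 f" "pr x y:el f" "x:M" "y:M" shows "app f x = y"
proof -
 have "{z:M. EX y:M. pr x y:el f & z:el y} = el y" using assms unfolding fun1_def by auto
 then show ?thesis unfolding app_def using assms by simp
qed

definition lam :: "'a => ('a => 'a) => 'a" where
 "lam X f = mk {z:M. EX x:el X. z = pr x (f x)}"
lemma Tm_lam [dfn]: assumes "Tm A t" "Tm A (%v. f (v 0) (%n. v (Suc n)))" shows "Tm A (%v. lam (t v) (%x. f x v))"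
proof -
 have "Tm A (%v. f (v 0) (%n. v (Suc (Suc n))))"
  using Tm_rename[OF assms(2), of "%n. if n = 0 then 0 else Suc n"] by simp
 then show ?thesis unfolding lam_def by (intro Tm_mk D_bex Tm_shift[OF assms(1)] D_eq dfn_pr Tm_var)
qed
lemma lam_in [simp, intro]: "lam X f:M"
 by (simp add: lam_def)

lemma Tm1M: "Tm M (%v. f (v 0)) ==> x:M ==> f x:M"
 using Tm_in[of M "%v. f (v 0)" "%_. x"] by auto
lemma isset_lam: assumes "X:M" "Tm M (%v. f (v 0))" shows "isset {z:M. EX x:el X. z = pr x (f x)}"
proof -
 have "{z:M. EX x:el X. z = pr x (f x)} = (%x. pr x (f x)) ` el X" by auto
 moreover have "Tm M (%v. pr (v 0) (f (v 0)))" by (intro dfn_pr Tm_var assms)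
 ultimately show ?thesis using isset_image[OF assms(1), of "%x. pr x (f x)"] by simp
qed
lemma el_lam: "X:M ==> Tm M (%v. f (v 0)) ==> el (lam X f) = {z:M. EX x:el X. z = pr x (f x)}"
 unfolding lam_def by (rule el_mk[OF isset_lam])
lemma fun1_lam: "X:M ==> Tm M (%v. f (v 0)) ==> fun1 (lam X f)"
 using Tm1M[of f] by (auto simp: fun1_def el_lam)
lemma app_lam: "X:M ==> Tm M (%v. f (v 0)) ==> x:el X ==> app (lam X f) x = f x"
 using Tm1M[of f] by (intro app_eq fun1_lam) (auto simp: el_lam)
lemma lam_cong: "(!!x. x:el X ==> f x = g x) ==> lam X f = lam X g"
 unfolding lam_def by (rule arg_cong[where f = mk]) auto

lemma mem_irrefl: "x:M ==> x ~: el x"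
 using foundation[of "up x x"] by auto
lemma mem_asym: "x:M ==> y:M ==> x:el y ==> y ~: el x"
 using foundation[of "up x y"] by auto
lemma mem_cycle3: "x:M ==> y:M ==> z:M ==> x:el y ==> y:el z ==> z ~: el x"
 using foundation[of "un (up x y) (up z z)"] by auto

lemma set_min: assumes "x:M" "D M (%v. R (v 0))" "y:el x" "R y"
 shows "EX y:el x. R y & (ALL z:el y. z:el x --> ~ R z)"
proof -
 have i: "isset {y:M. y:el x & R y}" by (rule isset_sep[OF assms(1,2)])
 have "el (mk {y:M. y:el x & R y}) ~= {}" using assms el_mk[OF i] by auto
 from foundation[OF mk_in this] show ?thesis unfolding el_mk[OF i] by (auto simp: disjoint_iff)
qed

end

section \<open>Ordinals and recursion\<close>

context zfc
begin

definition tra where "tra t <-> (ALL x:el t. el x <= el t)"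
definition Ord where "Ord x <-> x:M & tra x & (ALL y:el x. ALL z:el x. y:el z | y = z | z:el y)"

lemma D_tra [dfn]: "Tm A s ==> D A (%v. tra (s v))"
 by (rule D1[where Q = tra]; (assumption | (unfold tra_def, intro dfn)))
lemma D_Ord [dfn]: "Tm A s ==> D A (%v. Ord (s v))"
 by (rule D1[where Q = Ord]; (assumption | (unfold Ord_def, intro dfn)))

lemma OrdM [simp]: "Ord a ==> a:M"
 unfolding Ord_def by blast
lemma Ord_trans: "Ord a ==> b:el a ==> c:el b ==> c:el a"
 unfolding Ord_def tra_def by blast
lemma Ord_in: assumes "Ord a" "b:el a" shows "Ord b"
proof -
 have "d:el b" if "c:el b" "d:el c" for c d
 proof -
  have "d:el a" "c:el a" using assms that Ord_trans by blast+
  then have "d:el b | d = b | b:el d" using assms unfolding Ord_def by blast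
  then show ?thesis using that mem_asym[of c b] mem_cycle3[of b d c] by auto
 qed
 moreover have "el b <= el a" using assms Ord_trans by blast
 moreover have "b:M" using assms by simp
 ultimately show ?thesis using assms unfolding Ord_def tra_def by blast
qed

lemma Ord_min: assumes "D M (%v. R (v 0))" "Ord a" "R a"
 obtains b where "Ord b" "R b" "!!c. c:el b ==> ~ R c" "b = a | b:el a"
proof -
 have "EX y:el (suc a). R y & (ALL z:el y. z:el (suc a) --> ~ R z)"
  by (rule set_min[OF _ assms(1), of _ a]) (use assms in auto)
 then obtain y where y: "y:el (suc a)" "R y" "!!z. z:el y ==> z:el (suc a) ==> ~ R z" by blast
 have "y = a | y:el a" using y(1) assms by auto
 moreover have "z:el (suc a)" if "z:el y" for z using calculation assms(2) that Ord_trans by auto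
 ultimately show thesis using that[of y] y assms(2) Ord_in by blast
qed

lemma Ord_induct: assumes "Ord a" "D M (%v. R (v 0))" "!!a. Ord a ==> (!!b. b:el a ==> R b) ==> R a" shows "R a"
proof (rule ccontr)
 assume "~ R a"
 then obtain b where "Ord b" "~ R b" "!!c. c:el b ==> ~  ~ R c" using Ord_min[OF D_not[OF assms(2)] assms(1)] by metis
 then show False using assms(3) by blast
qed

lemma Ord_sub: assumes "Ord a" "Ord b" "el a <= el b" shows "a = b | a:el b"
proof (rule ccontr)
 assume n: "~ (a = b | a:el b)"
 then have "el a ~= el b" using ext assms by auto
 then obtain d where "d:el b" "d ~: el a" using assms by blast
 then have "EX y:el b. y ~: el a & (ALL z:el y. z:el b --> ~ z ~: el a)"
  using assms by (intro set_min) (auto intro!: dfn)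
 then obtain c where c: "c:el b" "c ~: el a" "!!z. z:el c ==> z:el b ==> z:el a" by blast
 have "el c <= el a" using c Ord_trans assms by blast
 moreover have "d:el c" if "d:el a" for d
 proof -
  have "d:el c | d = c | c:el d" using assms c that unfolding Ord_def by blast
  then show ?thesis using that c assms Ord_trans by blast
 qed
 ultimately have "c = a" using c assms by (intro ext) auto
 then show False using n c by simp
qed

lemma Ord_linear: assumes "Ord a" "Ord b" shows "a:el b | a = b | b:el a"
proof -
 have i: "isset {x:M. x:el a & x:el b}" using assms by (intro isset_sep) (auto intro!: dfn)
 define c where "c = mk {x:M. x:el a & x:el b}"
 have e: "el c = el a Int el b" and c: "c:M" using i by (auto simp: c_def)
 have "Ord c" unfolding Ord_def tra_def e using assms c by (auto simp: Ord_def tra_def)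
 then have "c = a | c:el a" "c = b | c:el b" using Ord_sub assms e by auto
 then have "c = a | c = b" using mem_irrefl[OF c] e by auto
 then show ?thesis using e assms Ord_sub[of a b] Ord_sub[of b a] by auto
qed

lemma OrdI: assumes "x:M" "tra x" "!!y. y:el x ==> Ord y" shows "Ord x"
 using assms Ord_linear unfolding Ord_def[of x] by blast
lemma Ord_sub_iff: "Ord a ==> Ord b ==> el a <= el b <-> a = b | a:el b"
 using Ord_sub Ord_trans by blast
lemma Ord_not_in: "Ord a ==> Ord b ==> b ~: el a ==> el a <= el b"
 using Ord_linear Ord_sub_iff by blast
lemma Ord_emp [simp]: "Ord emp"
 by (auto simp: Ord_def tra_def)
lemma Ord_suc [simp]: "Ord a ==> Ord (suc a)"
 by (rule OrdI) (auto simp: tra_def intro: Ord_in Ord_trans)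
lemma Ord_UU: assumes s: "s:M" "!!x. x:el s ==> Ord x" shows "Ord (UU s)"
proof (rule OrdI)
 show "tra (UU s)" unfolding tra_def el_UU[OF s(1)] using s(2) Ord_trans by blast
 show "Ord y" if "y:el (UU s)" for y using that s(2) Ord_in unfolding el_UU[OF s(1)] by blast
qed simp
lemma suc_sub: "Ord a ==> Ord b ==> a:el b ==> suc a = b | suc a:el b"
 by (intro Ord_sub) (auto intro: Ord_trans)

section \<open>Recursion along membership\<close>

definition rec :: "('a => 'a => 'a => 'a) => 'a => 'a => 'a" where
 "rec H p x = mk {z:M. EX g:M. EX t:M. tra t & x:el t &
  (ALL y:el t. app g y = H p y (lam y (app g))) & z:el (app g x)}"

lemma Tm_rec: assumes "Tm A (%v. H (v 0) (v 1) (v 2))" "Tm A s" "Tm A t" shows "Tm A (%v. rec H (s v) (t v))"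
proof (rule Tm2[where f = "rec H", OF assms(2,3)])
 have [dfn]: "Tm A s ==> Tm A t ==> Tm A u ==> Tm A (%v. H (s v) (t v) (u v))" for s t u
  using Tm3[OF _ _ _ assms(1)] by blast
 show "Tm A (%v. rec H (v 0) (v 1))" unfolding rec_def by (intro dfn)
qed
lemma rec_in [simp]: "rec H p x:M"
 unfolding rec_def by simp

context
 fixes H p assumes H: "Tm M (%v. H (v 0) (v 1) (v 2))" and p: "p:M"
begin

definition apx where "apx g t <-> g:M & t:M & tra t & (ALL y:el t. app g y = H p y (lam y (app g)))"

lemma apx_unique: assumes "apx g t" "apx g' t'" "x:el t" "x:el t'" shows "app g x = app g' x"
proof (rule ccontr)
 assume n: "app g x ~= app g' x"
 have "EX y:el t. (y:el t' & app g y ~= app g' y) & (ALL z:el y. z:el t --> ~ (z:el t' & app g z ~= app g' z))"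
  using assms n by (intro set_min[of _ _ x]) (auto simp: apx_def intro!: dfn)
 then obtain y where y: "y:el t" "y:el t'" "app g y ~= app g' y"
  "!!z. z:el y ==> z:el t ==> z:el t' ==> app g z = app g' z" by blast
 then have "app g z = app g' z" if "z:el y" for z using that assms unfolding apx_def tra_def by blast
 then have "lam y (app g) = lam y (app g')" by (rule lam_cong)
 then show False using y assms unfolding apx_def by metis
qed

lemma rec_apx: assumes "apx g t" "x:el t" shows "rec H p x = app g x"
proof -
 have "{z:M. EX g:M. EX t:M. tra t & x:el t & (ALL y:el t. app g y = H p y (lam y (app g))) & z:el (app g x)} = el (app g x)"
  (is "?S = _")
 proof -
  have *: "app g' x = app g x" if "g':M" "t':M" "tra t'" "x:el t'" "ALL y:el t'. app g' y = H p y (lam y (app g'))" for g' t'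
   using apx_unique[of g' t' g t x] that assms unfolding apx_def by blast
  have "z:?S <-> z:el (app g x)" for z
  proof
   assume "z:?S"
   then obtain g' t' where "g':M" "t':M" "tra t'" "x:el t'" "ALL y:el t'. app g' y = H p y (lam y (app g'))" "z:el (app g' x)" by blast
   then show "z:el (app g x)" using *[of g' t'] by simp
  next
   assume "z:el (app g x)" then show "z:?S" using assms unfolding apx_def by (blast intro: elM)
  qed
  then show ?thesis by blast
 qed
 then show ?thesis unfolding rec_def by simp
qed

lemma rec_apx_eq: assumes "apx g t" "x:el t" shows "rec H p x = H p x (lam x (rec H p))"
proof -
 have "lam x (app g) = lam x (rec H p)"
  using assms by (intro lam_cong) (metis apx_def rec_apx subsetD tra_def)
 then show ?thesis using assms rec_apx unfolding apx_def by metis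
qed

text \<open>For a minimal bad \<open>y\<close> all elements are good, and by uniqueness the
  approximations at good elements agree with \<open>rec\<close>. So the single function
  \<open>F\<close> on \<open>y\<close> together with the good elements of \<open>t\<close> is an
  approximation at \<open>y\<close>.\<close>

lemma apx_ex: assumes "t:M" "tra t" "x:el t" shows "EX g:M. EX s:M. apx g s & x:el s"
proof (rule ccontr)
 let ?good = "%x. EX g:M. EX s:M. apx g s & x:el s"
 have Hd: "Tm M s ==> Tm M t ==> Tm M u ==> Tm M (%v. H (s v) (t v) (u v))" for s t u
  using Tm3[OF _ _ _ H] by blast
 have gd: "D M (%v. ?good (v 0))" using p unfolding apx_def by (intro dfn Hd)
 assume "~  ?good x"
 then have "EX y:el t. ~  ?good y & (ALL z:el y. z:el t --> ~  ~  ?good z)"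
  using assms by (intro set_min[of _ _ x] D_not[OF gd]) auto
 then obtain y where y: "y:el t" "~  ?good y" "!!z. z:el y ==> z:el t ==> ?good z" by blast
 then have yg: "?good z" "z:el t" if "z:el y" for z using that assms unfolding tra_def by blast+
 have i: "isset {z:M. z:el t & ?good z}" by (rule isset_sep[OF assms(1) gd])
 define s where "s = un (up y y) (mk {z:M. z:el t & ?good z})"
 have s: "el s = insert y {z:el t. ?good z}" and sM: "s:M" using i y by (auto simp: s_def)
 define F where "F = (%w. H p w (lam w (rec H p)))"
 have F: "Tm M (%v. F (v 0))" using p unfolding F_def by (intro dfn Hd Tm_rec H)
 have good: "F w = rec H p w" if "?good w" for w using that rec_apx_eq unfolding F_def by metis
 have good_in: "?good z" if "?good w" "z:el w" for z w using that unfolding apx_def tra_def by (meson subsetD)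
 have els: "?good z & z:el s" if "w:el s" "z:el w" for w z
  using that yg[of z] good_in[of w z] assms(1,2) unfolding s tra_def by blast
 have "app (lam s F) w = H p w (lam w (app (lam s F)))" if w: "w:el s" for w
 proof -
  have "lam w (app (lam s F)) = lam w (rec H p)"
   using els[OF w] by (intro lam_cong) (simp add: app_lam[OF sM F] good)
  then show ?thesis using app_lam[OF sM F w] by (simp add: F_def)
 qed
 then have "apx (lam s F) s" unfolding apx_def tra_def using els sM by blast
 then have "?good y" using s sM by blast
 then show False using y by simp
qed

lemma rec_eq': "t:M ==> tra t ==> x:el t ==> rec H p x = H p x (lam x (rec H p))"
 using apx_ex rec_apx_eq by meson

end

section \<open>Limit ordinals, omega, transitive closure and rank\<close>

definition Lim where "Lim x <-> Ord x & el x ~= {} & (ALL y:el x. suc y:el x)"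
lemma D_Lim [dfn]: "Tm A s ==> D A (%v. Lim (s v))"
proof (rule D1[where Q = Lim])
 have "Lim x <-> Ord x & x ~= emp & (ALL y:el x. suc y:el x)" for x
  unfolding Lim_def by (metis OrdM el_emp ext op_in(1))
 then show "D A (%v. Lim (v 0))" by (simp only:) (intro dfn)
qed

lemma Lim_ex: "EX x. Lim x"
proof -
 obtain a where "sat M E infinity (%_. a)" using sentence[of infinity] by (auto simp: ZFC_def)
 then obtain I where I: "I:M" "EX e:M. (ALL z:M. ~ E z e) & E e I" 
  "ALL y:M. E y I --> (EX s:M. (ALL z:M. E z s <-> E z y | z = y) & E s I)"
  unfolding infinity_def f_defs f_empty_def f_succ_def by auto
 have eI: "emp:el I"
 proof -
  obtain e where e: "e:M" "ALL z:M. ~ E z e" "E e I" using I by blast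
  then have "el e = {}" by (auto simp: el_def simp del: elM)
  then have "e = emp" using e ext[of e emp] by auto
  then show ?thesis using e E_iff by blast
 qed
 have sI: "suc y:el I" if y: "y:el I" for y
 proof -
  obtain s where s: "s:M" "ALL z:M. E z s <-> E z y | z = y" "E s I" using I(3) y by (metis E_iff elM)
  have "el s = el (suc y)" using s y E_iff elM[OF y] elM by (auto simp: E_iff)
  then have "s = suc y" using s ext by auto
  then show ?thesis using s E_iff by blast
 qed
 let ?S = "{n:M. n:el I & Ord n & (ALL m:el n. m:el I)}"
 have i: "isset ?S" using I by (intro isset_sep) (auto intro!: dfn)
 have "Ord (mk ?S)" by (rule OrdI) (auto simp: i tra_def intro: Ord_in Ord_trans)
 moreover have "emp:el (mk ?S)" using eI by (simp add: i)
 moreover have "suc y:el (mk ?S)" if "y:el (mk ?S)" for y using that sI by (auto simp: i)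
 ultimately have "Lim (mk ?S)" unfolding Lim_def by blast
 then show ?thesis by blast
qed

definition om where "om = mk {x:M. ALL l:M. Lim l --> x:el l}"
lemma dfn_om [dfn]: "Tm A (%v. om)"
 unfolding om_def by (intro dfn)
lemma om_in [simp]: "om:M"
 by (simp add: om_def)
lemma Lim_om: "Lim om" and om_least: "!!k. Lim k ==> el om <= el k"
proof -
 obtain l where l: "Lim l" using Lim_ex by blast
 then have "Ord l" by (simp add: Lim_def)
 from Ord_min[OF D_Lim[OF Tm_var] this l] obtain b where b: "Lim b" "!!c. c:el b ==> ~ Lim c" by metis
 have "el b <= el k" if "Lim k" for k using b that Ord_not_in[of b k] unfolding Lim_def by blast
 then have "{x:M. ALL l:M. Lim l --> x:el l} = el b" using b by (auto simp: Lim_def)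
 then have "om = b" using b unfolding om_def by (simp add: Lim_def)
 then show "Lim om" "Lim k ==> el om <= el k" for k using b \<open>!!k. Lim k ==> el b <= el k\<close> by auto
qed
lemma Ord_om [simp]: "Ord om"
 using Lim_om by (simp add: Lim_def)
lemma om_not_Lim: "x:el om ==> ~ Lim x"
 using om_least[of x] mem_irrefl[of x] by auto
lemma Lim_emp: "Lim l ==> emp:el l"
 using Ord_linear[of emp l] unfolding Lim_def by auto

text \<open>So far recursion works only within a transitive set. Since \<open>om\<close> is one,
  unions can be iterated along it, and the transitive set obtained around \<open>x\<close> lifts the
  restriction.\<close>

lemma hull: assumes x: "x:M" shows "EX t:M. tra t & x:el t"
proof -
 let ?H = "%p n g. mk {z:M. z = p | (EX m:el n. EX y:el (app g m). z:el y)}"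
 have H: "Tm M (%v. ?H (v 0) (v 1) (v 2))" by (intro dfn)
 have R: "Tm M (%v. rec ?H x (v 0))" using x by (intro Tm_rec[OF H] dfn)
 let ?f = "rec ?H x"
 have f: "el (?f n) = insert x (UN m:el n. UN y:el (?f m). el y)" if n: "n:el om" for n
 proof -
  have "?f n = ?H x n (lam n ?f)" using Lim_om by (intro rec_eq'[OF H x, of om]) (auto simp: Lim_def Ord_def n)
  also have "{z:M. z = x | (EX m:el n. EX y:el (app (lam n ?f) m). z:el y)} = insert x (UN m:el n. UN y:el (?f m). el y)"
   using app_lam[OF elM[OF n] R] x by auto
  moreover have "isset (insert x (UN m:el n. UN y:el (?f m). el y))"
  proof -
   have "isset (UN m:el n. el (UU (?f m)))" using n by (intro isset_UN dfn R) auto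
   then have "el (un (up x x) (mk (UN m:el n. el (UU (?f m))))) = insert x (UN m:el n. UN y:el (?f m). el y)" using x by simp
   then show ?thesis unfolding isset_def by blast
  qed
  ultimately show ?thesis by simp
 qed
 have i: "isset (UN n:el om. el (?f n))" by (intro isset_UN R) auto
 have "z:(UN n:el om. el (?f n))" if "n:el om" "y:el (?f n)" "z:el y" for n y z
 proof -
  have s: "suc n:el om" using that Lim_om by (auto simp: Lim_def)
  then have "z:el (?f (suc n))" using f[OF s] that by auto
  then show ?thesis using s by blast
 qed
 then have "tra (mk (UN n:el om. el (?f n)))" unfolding tra_def el_mk[OF i] by blast
 moreover have "x:el (mk (UN n:el om. el (?f n)))" using f[OF Lim_emp[OF Lim_om]] Lim_emp[OF Lim_om] by (auto simp: i)
 ultimately show ?thesis by blast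
qed

lemma rec_eq: "Tm M (%v. H (v 0) (v 1) (v 2)) ==> p:M ==> x:M ==> rec H p x = H p x (lam x (rec H p))"
 using hull rec_eq' by meson

lemma Tm_recM: "Tm M (%v. H (v 0) (v 1) (v 2)) ==> p:M ==> Tm M (%v. rec H p (v 0))"
 by (intro Tm_rec dfn)


lemma eps_induct: assumes "x:M" "D M (%v. R (v 0))" "!!x. x:M ==> (!!y. y:el x ==> R y) ==> R x" shows "R x"
proof (rule ccontr)
 assume n: "~ R x"
 obtain t where t: "t:M" "tra t" "x:el t" using hull assms by blast
 have "EX y:el t. ~ R y & (ALL z:el y. z:el t --> ~  ~ R z)" by (rule set_min[OF t(1) D_not[OF assms(2)] t(3) n])
 then show False using assms(3) t unfolding tra_def by (metis elM subsetD)
qed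

definition rk where "rk = rec (%p x g. mk {z:M. EX y:el x. z:el (app g y) | z = app g y}) emp"
lemma rk_H: "Tm A (%v. (%p x g. mk {z:M. EX y:el x. z:el (app g y) | z = app g y}) (v 0) (v 1) (v 2))"
 by (intro dfn)
lemma dfn_rk [dfn]: "Tm A s ==> Tm A (%v. rk (s v))"
 unfolding rk_def by (intro Tm_rec rk_H dfn)
lemma rk_in [simp]: "rk x:M"
 by (simp add: rk_def)
lemma el_rk: "x:M ==> el (rk x) = (UN y:el x. insert (rk y) (el (rk y)))"
proof -
 assume x: "x:M"
 have "rk x = mk {z:M. EX y:el x. z:el (app (lam x rk) y) | z = app (lam x rk) y}"
  unfolding rk_def using rec_eq[OF rk_H, of emp x] x by simp
 also have "{z:M. EX y:el x. z:el (app (lam x rk) y) | z = app (lam x rk) y} = (UN y:el x. insert (rk y) (el (rk y)))"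
  using x by (auto simp: app_lam[OF _ dfn_rk[OF Tm_var]])
 finally show ?thesis using isset_UN[of x "%y. suc (rk y)"] x by (simp add: dfn)
qed
lemma Ord_rk [simp]: "x:M ==> Ord (rk x)"
proof (rule eps_induct[where R = "%x. Ord (rk x)"])
 show "D M (%v. Ord (rk (v 0)))" by (intro dfn)
 fix x assume x: "x:M" "!!y. y:el x ==> Ord (rk y)"
 have i: "isset ((%y. suc (rk y)) ` el x)" using x by (intro isset_image dfn)
 have "el (rk x) = el (UU (mk ((%y. suc (rk y)) ` el x)))" unfolding el_rk[OF x(1)] using i by simp
 then have "rk x = UU (mk ((%y. suc (rk y)) ` el x))" by (intro ext) auto
 moreover have "Ord (UU (mk ((%y. suc (rk y)) ` el x)))" using x(2) i by (intro Ord_UU) auto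
 ultimately show "Ord (rk x)" by simp
qed
lemma rk_mem: "x:M ==> y:el x ==> rk y:el (rk x)"
 by (auto simp: el_rk)
lemma rk_least: assumes "x:M" "Ord a" "!!y. y:el x ==> rk y:el a" shows "el (rk x) <= el a"
 unfolding el_rk[OF assms(1)] using assms(2,3) Ord_trans by blast
lemma rk_Ord: "Ord a ==> rk a = a"
proof (rule Ord_induct[where R = "%a. rk a = a"])
 fix a assume a: "Ord a" "!!b. b:el a ==> rk b = b"
 have "el (rk a) = el a" unfolding el_rk[OF OrdM[OF a(1)]] using a Ord_trans[OF a(1)] by auto
 then show "rk a = a" using a by (intro ext) auto
qed (auto intro!: dfn)

definition V where "V a = mk {x:M. rk x:el a}"
lemma dfn_V [dfn]: "Tm A s ==> Tm A (%v. V (s v))"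
 by (rule Tm1[where f = V]; (assumption | (unfold V_def, intro dfn)))
lemma V_in [simp]: "V a:M"
 by (simp add: V_def)
lemma el_V: assumes "Ord a" shows "el (V a) = {x:M. rk x:el a}"
proof -
 have "EX s:M. ALL x:M. x:el s <-> rk x:el a"
 proof (rule Ord_induct[OF assms, where R = "%a. EX s:M. ALL x:M. x:el s <-> rk x:el a"])
  fix a assume a: "Ord a" "!!b. b:el a ==> EX s:M. ALL x:M. x:el s <-> rk x:el b"
  have 1: "isset {x:M. rk x:el b}" if b: "b:el a" for b
  proof -
   obtain s where s: "s:M" "ALL x:M. x:el s <-> rk x:el b" using a(2)[OF b] by blast
   then show ?thesis by (intro issetI[OF s(1)]) (use b in \<open>auto intro!: dfn\<close>)
  qed
  have 2: "isset (UN b:el a. el (pw (V b)))" using a by (intro isset_UN dfn) auto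
  have "x:el (mk (UN b:el a. el (pw (V b))))" if "x:M" "rk x:el a" for x
   using that 1 2 rk_mem[OF that(1)] by (auto simp: V_def intro!: bexI[of _ "rk x"])
  then have "isset {x:M. rk x:el a}" by (intro issetI[of "mk (UN b:el a. el (pw (V b)))"]) (use a in \<open>auto intro!: dfn\<close>)
  then show "EX s:M. ALL x:M. x:el s <-> rk x:el a" by (intro bexI[of _ "mk {x:M. rk x:el a}"]) auto
 qed (intro dfn)
 then obtain s where s: "s:M" "ALL x:M. x:el s <-> rk x:el a" by blast
 then have "isset {x:M. rk x:el a}" by (intro issetI[OF s(1)]) (use assms in \<open>auto intro!: dfn\<close>)
 then show ?thesis unfolding V_def by simp
qed

text \<open>Scott's trick: the elements of least rank of a class.\<close>

definition sct :: "('a => bool) => 'a" where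
 "sct R = mk {y:M. R y & (ALL z:M. R z --> el (rk y) <= el (rk z))}"

lemma Tm_sct [dfn]: assumes "D A (%v. R (v 0) (%n. v (Suc n)))" shows "Tm A (%v. sct (%x. R x v))"
proof -
 have "D A (%v. R (v 0) (%n. v (Suc (Suc n))))"
  using D_rename[OF assms, of "%n. if n = 0 then 0 else Suc n"] by auto
 then show ?thesis unfolding sct_def by (intro dfn assms)
qed
lemma sct: assumes "D M (%v. R (v 0))" "x:M" "R x"
 shows "el (sct R) = {y:M. R y & (ALL z:M. R z --> el (rk y) <= el (rk z))}" "el (sct R) ~= {}"
proof -
 have R: "Tm M s ==> D M (%v. R (s v))" for s using D1[OF _ assms(1)] .
 have "isset {y:M. R y & (ALL z:M. R z --> el (rk y) <= el (rk z))}"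
  by (rule issetI[of "V (suc (rk x))"]) (use assms Ord_sub_iff in \<open>auto simp: el_V intro!: dfn R\<close>)
 then show 1: "el (sct R) = {y:M. R y & (ALL z:M. R z --> el (rk y) <= el (rk z))}" by (simp add: sct_def)
 have "D M (%v. EX y:M. R y & rk y = v 0)" by (intro dfn R)
 from Ord_min[OF this, of "rk x"] obtain b where b: "Ord b" "EX y:M. R y & rk y = b" "!!c. c:el b ==> ~ (EX y:M. R y & rk y = c)"
  using assms by (metis Ord_rk)
 then obtain y where y: "y:M" "R y" "rk y = b" by blast
 have "el b <= el (rk z)" if "z:M" "R z" for z
 proof -
  have "rk z ~: el b" using b(3) that by blast
  then show ?thesis using Ord_not_in[of b "rk z"] b(1) that by simp
 qed
 then show "el (sct R) ~= {}" unfolding 1 using y by auto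
qed

lemma collection: assumes "a:M" "D M (%v. R (v 0) (v 1))" "!!x. x:el a ==> EX y:M. R x y"
 shows "EX b:M. ALL x:el a. EX y:el b. R x y"
proof -
 have Rd: "Tm M s ==> Tm M t ==> D M (%v. R (s v) (t v))" for s t using D2[OF _ _ assms(2)] .
 have "Tm M (%v. sct (R (v 0)))" by (intro dfn Rd)
 then have i: "isset (UN x:el a. el (sct (R x)))" by (rule isset_UN[OF assms(1)])
 have "EX y:el (mk (UN x:el a. el (sct (R x)))). R x y" if x: "x:el a" for x
 proof -
  obtain y where "y:M" "R x y" using assms(3)[OF x] by blast
  moreover have "D M (%v. R x (v 0))" using x by (intro dfn Rd) auto
  ultimately obtain z where z: "z:el (sct (R x))" using sct(2)[of "R x" y] by blast
  then have "R x z" using sct(1)[of "R x" y] \<open>D M (%v. R x (v 0))\<close> \<open>y : M\<close> \<open>R x y\<close> by auto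
  then show ?thesis using z x unfolding el_mk[OF i] by blast
 qed
 then show ?thesis by blast
qed

section \<open>Choice functions and dependent choice of ordinal length\<close>

lemma choice_fun: assumes s: "s:M" "!!y. y:el s ==> el y ~= {}"
 shows "EX c:M. ALL y:el s. app c y:el y"
proof -
 obtain a where "sat M E choice (%_. a)" using sentence[of choice] by (auto simp: ZFC_def)
 then have ch: "ALL x:M. (ALL y:M. E y x --> (EX z:M. E z y)) & (ALL y:M. ALL y':M. E y x & E y' x & (EX z:M. E z y & E z y') --> y = y')
  --> (EX c:M. ALL y:M. E y x --> (EX u:M. ALL z:M. E z y & E z c <-> z = u))"
  unfolding choice_def f_defs by simp
 \<comment> \<open>The axiom of choice speaks of disjoint families; tagging the elements of
   \<open>y\<close> with \<open>y\<close> makes the family disjoint.\<close>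
 let ?f = "%y. pd (up y y) y"
 have i: "isset (?f ` el s)" using s by (intro isset_image dfn)
 have fe: "el (?f y) = {z:M. EX w:el y. z = pr y w}" if "y:el s" for y using that by auto
 have "(ALL y:M. E y (mk (?f ` el s)) --> (EX z:M. E z y)) & (ALL y:M. ALL y':M. E y (mk (?f ` el s)) & E y' (mk (?f ` el s)) & (EX z:M. E z y & E z y') --> y = y')"
 proof (intro conjI ballI impI)
  fix y assume "y:M" "E y (mk (?f ` el s))"
  then obtain u where u: "u:el s" "y = ?f u" by (auto simp: E_iff i)
  obtain w where "w:el u" using s u by blast
  then have "pr u w:el y" using u fe by auto
  then show "EX z:M. E z y" using E_iff elM by blast
 next
  fix y y' assume "y:M" "y':M" "E y (mk (?f ` el s)) & E y' (mk (?f ` el s)) & (EX z:M. E z y & E z y')"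
  then obtain u u' z where u: "u:el s" "y = ?f u" "u':el s" "y' = ?f u'" "z:el y" "z:el y'" by (auto simp: E_iff i)
  then obtain w w' where "w:el u" "z = pr u w" "w':el u'" "z = pr u' w'" using fe[OF u(1)] fe[OF u(3)] by blast
  then show "y = y'" using u pr_inj elM by metis
 qed
 then obtain c where c: "c:M" "ALL y:M. E y (mk (?f ` el s)) --> (EX u:M. ALL z:M. E z y & E z c <-> z = u)" using ch by blast
 have c': "EX w:el y. pr y w:el c & (ALL w':el y. pr y w':el c --> w' = w)" if y: "y:el s" for y
 proof -
  have "?f y:el (mk (?f ` el s))" using y by (simp add: i)
  then obtain u where "u:M" "ALL z:M. E z (?f y) & E z c <-> z = u" using c E_iff by blast
  then have u: "u:el (?f y)" "u:el c" "!!z. z:el (?f y) ==> z:el c ==> z = u" by (auto simp: E_iff)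
  then obtain w where w: "w:el y" "u = pr y w" using fe[OF y] by blast
  have "w' = w" if "w':el y" "pr y w':el c" for w'
  proof -
   have "pr y w' = u" using that y by (intro u(3)) (auto simp: fe)
   then show ?thesis using w y that by simp
  qed
  moreover have "pr y w:el c" using w u(2) by simp
  ultimately show ?thesis using w by blast
 qed
 let ?g = "{z:M. z:el c & (EX y:el s. EX w:el y. z = pr y w)}"
 have g: "isset ?g" using c s by (intro isset_sep) (auto intro!: dfn)
 have "fun1 (mk ?g)" unfolding fun1_def el_mk[OF g]
 proof (intro ballI impI)
  fix x y z assume m: "x:M" "y:M" "z:M" and "pr x y:?g & pr x z:?g"
  then have "x:el s" "y:el x" "z:el x" "pr x y:el c" "pr x z:el c" by auto
  then show "y = z" using c' by blast
 qed
 then have "app (mk ?g) y:el y" if "y:el s" for y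
  using c'[OF that] that app_eq[of "mk ?g" y] by (auto simp: g)
 then show ?thesis by blast
qed

text \<open>The candidates at a step may form a proper class. \<open>Y\<close> keeps those of least
  rank, the partial runs \<open>G\<close> through \<open>Y\<close> then form a set, one choice
  function serves all of them, and recursion assembles the run. The premise \<open>step\<close> is
  only asked for sequences that have obeyed \<open>R\<close> so far.\<close>

lemma dependent_choice: assumes d: "Ord d" and R: "D M (%v. R (v 0) (v 1) (v 2))"
 and step: "!!x g. x:el d ==> g:M ==> g = lam x (app g) ==> (!!y. y:el x ==> R y (lam y (app g)) (app g y)) ==> EX z:M. R x g z"
 shows "EX g:M. g = lam d (app g) & (ALL y:el d. R y (lam y (app g)) (app g y))"
proof -
 have Rd: "Tm M s ==> Tm M t ==> Tm M u ==> D M (%v. R (s v) (t v) (u v))" for s t u using D3[OF _ _ _ R] .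
 define Y where "Y = (%x g. sct (R x g))"
 have Yd: "Tm M s ==> Tm M t ==> Tm M (%v. Y (s v) (t v))" for s t
  by (rule Tm2[where f = Y]; (assumption | (unfold Y_def, intro dfn Rd)))
 have YR: "R x g z" if "z:el (Y x g)" for x g z
  using that by (auto simp: Y_def sct_def el_mk' split: if_splits)
 have Yne: "el (Y x g) ~= {}" if "z:M" "R x g z" "x:M" "g:M" for x g z
  unfolding Y_def using that by (intro sct(2)[of _ z] Rd dfn)
 define G where "G x g <-> g = lam x (app g) & (ALL y:el x. app g y:el (Y y (lam y (app g))))" for x g
 have Gd: "Tm M s ==> Tm M t ==> D M (%v. G (s v) (t v))" for s t
  by (rule D2[where Q = G]; (assumption | (unfold G_def, intro dfn Yd)))
 have res: "lam z (app (lam y (app g))) = lam z (app g)" if "z:el y" "y:el x" "g:M" "Ord x" for x y z g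
 proof (rule lam_cong)
  fix w assume "w:el z"
  then have "w:el y" using that Ord_trans Ord_in by blast
  then show "app (lam y (app g)) w = app g w" using that by (intro app_lam dfn) auto
 qed
 have G_res: "G y (lam y (app g))" if "G x g" "y:el x" "Ord x" "g:M" for x y g
 proof -
  have a: "app (lam y (app g)) z = app g z" if "z:el y" for z using that \<open>g : M\<close> \<open>y : el x\<close> by (intro app_lam dfn) auto
  have b: "app g z:el (Y z (lam z (app g)))" if "z:el y" for z using that \<open>G x g\<close> \<open>y : el x\<close> Ord_trans[OF \<open>Ord x\<close>] unfolding G_def by blast
  have "app (lam y (app g)) z:el (Y z (lam z (app (lam y (app g)))))" if "z:el y" for z
   unfolding a[OF that] res[OF that \<open>y : el x\<close> \<open>g : M\<close> \<open>Ord x\<close>] by (rule b[OF that])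
  moreover have "lam y (app g) = lam y (app (lam y (app g)))" using a by (intro lam_cong) simp
  ultimately show ?thesis unfolding G_def by blast
 qed
 \<comment> \<open>Runs of length \<open>x\<close> are bounded by a set: each is a set of pairs
   whose second components are candidates for shorter runs, and those runs form a set by
   induction.\<close>
 have U: "EX s:M. ALL g:M. G x g --> g:el s" if "Ord x" for x
 proof (rule Ord_induct[OF that])
  show "D M (%v. EX s:M. ALL g:M. G (v 0) g --> g:el s)" by (intro dfn Gd)
  fix x assume x: "Ord x" and IH: "!!y. y:el x ==> EX s:M. ALL g:M. G y g --> g:el s"
  have 1: "isset {z:M. EX h:M. G y h & (EX w:el (Y y h). z = pr y w)}" if y: "y:el x" for y
  proof -
   obtain s where s: "s:M" "ALL g:M. G y g --> g:el s" using IH[OF y] by blast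
   have "isset (UN h:el s. el (pd (up y y) (Y y h)))" using s y by (intro isset_UN dfn Yd) auto
   then have i: "el (mk (UN h:el s. el (pd (up y y) (Y y h)))) = (UN h:el s. el (pd (up y y) (Y y h)))" by simp
   have "pr y w:el (pd (up y y) (Y y h))" if "w:el (Y y h)" for w h
    using that y by (auto simp: Y_def sct_def)
   then show ?thesis by (intro issetI[of "mk (UN h:el s. el (pd (up y y) (Y y h)))"]) (use s y in \<open>auto simp: i intro!: dfn Gd Yd\<close>)
  qed
  have B: "isset {z:M. EX y:el x. EX h:M. G y h & (EX w:el (Y y h). z = pr y w)}" (is "isset ?B")
   by (intro isset_Bex 1) (use x in \<open>auto intro!: dfn Gd Yd\<close>)
  have "g:el (pw (mk ?B))" if g: "g:M" "G x g" for g
  proof -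
   have "z:?B" if "z:el g" for z
   proof -
    have "z:el (lam x (app g))" using that g unfolding G_def by metis
    moreover have "el (lam x (app g)) = {z:M. EX y:el x. z = pr y (app g y)}" using g x by (intro el_lam dfn) auto
    ultimately obtain y where y: "y:el x" "z = pr y (app g y)" by blast
    moreover have "G y (lam y (app g))" using G_res[OF g(2) y(1) x g(1)] .
    moreover have "app g y:el (Y y (lam y (app g)))" using g y unfolding G_def by blast
    ultimately show ?thesis using that by (blast intro: elM)
   qed
   then have "el g <= ?B" by blast
   then show ?thesis using g(1) B by simp
  qed
  then show "EX s:M. ALL g:M. G x g --> g:el s" by blast
 qed
 have GR: "EX z:M. R x g z" if "x:el d" "g:M" "G x g" for x g
  using that by (intro step) (auto simp: G_def intro: YR)
 have i: "isset {q:M. EX y:el d. EX h:M. G y h & q = Y y h}"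
 proof (intro isset_Bex)
  fix y assume y: "y:el d"
  then obtain s where s: "s:M" "ALL g:M. G y g --> g:el s" using U Ord_in d by blast
  have "isset (Y y ` el s)" using s y by (intro isset_image dfn Yd) auto
  then show "isset {q:M. EX h:M. G y h & q = Y y h}" by (intro issetI[of "mk (Y y ` el s)"]) (use s y in \<open>auto intro!: dfn Gd Yd\<close>)
 qed (use d in \<open>auto intro!: dfn Gd Yd\<close>)
 have "EX c:M. ALL q:el (mk {q:M. EX y:el d. EX h:M. G y h & q = Y y h}). app c q:el q"
 proof (rule choice_fun)
  fix q assume "q:el (mk {q:M. EX y:el d. EX h:M. G y h & q = Y y h})"
  then obtain y h where yh: "y:el d" "h:M" "G y h" "q = Y y h" by (auto simp: i)
  obtain z where "z:M" "R y h z" using GR yh by blast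
  then show "el q ~= {}" using Yne yh by simp
 qed simp
 then obtain c where cM: "c:M" and c0: "ALL q:{q:M. EX y:el d. EX h:M. G y h & q = Y y h}. app c q:el q"
  unfolding el_mk[OF i] by blast
 have "Y y h:M" for y h by (simp add: Y_def sct_def)
 then have "app c (Y y h):el (Y y h)" if "y:el d" "h:M" "G y h" for y h using c0 that by blast
 note c = cM this
 let ?f = "rec (%c x g. app c (Y x g)) c"
 have H: "Tm M (%v. (%c x g. app c (Y x g)) (v 0) (v 1) (v 2))" by (intro dfn Yd)
 note fT = Tm_recM[OF H c(1)]
 have f: "?f y = app c (Y y (lam y ?f))" if "y:M" for y using rec_eq[OF H c(1) that] .
 have fl: "app (lam x ?f) y = ?f y" "lam y (app (lam x ?f)) = lam y ?f" if "y:el x" "Ord x" for x y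
 proof -
  show 1: "app (lam x ?f) y = ?f y" using that by (intro app_lam fT) auto
  show "lam y (app (lam x ?f)) = lam y ?f"
  proof (rule lam_cong)
   fix z assume "z:el y"
   then have "z:el x" using that Ord_trans by blast
   then show "app (lam x ?f) z = ?f z" using that by (intro app_lam fT) auto
  qed
 qed
 have main: "G x (lam x ?f)" if "Ord x" "x = d | x:el d" for x
 proof -
  have "x = d | x:el d --> G x (lam x ?f)"
  proof (rule Ord_induct[OF \<open>Ord x\<close>])
   show "D M (%v. v 0 = d | v 0:el d --> G (v 0) (lam (v 0) ?f))" using d c(1) by (intro dfn Gd Tm_rec[OF H]) auto
   fix x assume x: "Ord x" and IH: "!!y. y:el x ==> y = d | y:el d --> G y (lam y ?f)"
   show "x = d | x:el d --> G x (lam x ?f)"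
    unfolding G_def
   proof (intro impI conjI ballI)
    assume xd: "x = d | x:el d"
    show "lam x ?f = lam x (app (lam x ?f))" using fl(1) x by (intro lam_cong) simp
    fix y assume y: "y:el x"
    then have yd: "y:el d" using xd d Ord_trans by blast
    then have "?f y:el (Y y (lam y ?f))" using f[of y] c(2)[of y "lam y ?f"] IH[OF y] y by simp
    then show "app (lam x ?f) y:el (Y y (lam y (app (lam x ?f))))" unfolding fl[OF y x] .
   qed
  qed
  then show ?thesis using that by blast
 qed
 show ?thesis using main[OF d] YR unfolding G_def by (intro bexI[of _ "lam d ?f"]) auto
qed

end

section \<open>Cardinal comparison\<close>

context zfc
begin

lemma Tm_appM [dfn]: "f:M ==> Tm M (%v. app f (v n))"
 by (intro dfn)

text \<open>The injection is given by the values of \<open>app f\<close> on \<open>X\<close>;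
  \<open>lam\<close> replaces \<open>f\<close> by a genuine function with domain \<open>X\<close>
  where the graph matters.\<close>

definition inj where "inj f X Y <-> (ALL x:el X. app f x:el Y) & (ALL x:el X. ALL y:el X. app f x = app f y --> x = y)"
definition lep where "lep X Y <-> (EX f:M. inj f X Y)"

lemma D_inj [dfn]: "Tm A s ==> Tm A t ==> Tm A u ==> D A (%v. inj (s v) (t v) (u v))"
 by (rule D3[where Q = inj]; (assumption | (unfold inj_def, intro dfn)))
lemma D_lep [dfn]: "Tm A s ==> Tm A t ==> D A (%v. lep (s v) (t v))"
 by (rule D2[where Q = lep]; (assumption | (unfold lep_def, intro dfn)))

lemma inj_lam: assumes "X:M" "Tm M (%v. f (v 0))" "!!x. x:el X ==> f x:el Y" "!!x y. x:el X ==> y:el X ==> f x = f y ==> x = y"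
 shows "inj (lam X f) X Y"
 unfolding inj_def using app_lam[OF assms(1,2)] assms(3,4) by auto
lemma lepI: assumes "X:M" "Tm M (%v. f (v 0))" "!!x. x:el X ==> f x:el Y" "!!x y. x:el X ==> y:el X ==> f x = f y ==> x = y"
 shows "lep X Y"
 unfolding lep_def using inj_lam[OF assms] by blast
lemma lep_sub: "X:M ==> el X <= el Y ==> lep X Y"
 by (rule lepI[where f = "%x. x"]) (auto intro!: dfn)
lemma lep_trans: assumes "X:M" "lep X Y" "lep Y Z" shows "lep X Z"
proof -
 obtain f g where f: "f:M" "inj f X Y" and g: "g:M" "inj g Y Z" using assms unfolding lep_def by blast
 show ?thesis by (rule lepI[OF assms(1), where f = "%x. app g (app f x)"]) (use f g in \<open>auto simp: inj_def intro!: dfn\<close>)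
qed

lemma lep_surj: assumes "X:M" "Y:M" "Tm M (%v. g (v 0))" "!!x. x:el X ==> EX y:el Y. g y = x" shows "lep X Y"
proof -
 have gd: "Tm M s ==> Tm M (%v. g (s v))" for s using Tm1[OF _ assms(3)] .
 define S where "S = (%x. mk {y:M. y:el Y & g y = x})"
 have S: "el (S x) = {y:M. y:el Y & g y = x}" if "x:M" for x
  unfolding S_def using assms that by (intro el_mk isset_sep dfn gd)
 have Sd: "Tm M s ==> Tm M (%v. S (s v))" for s
  by (rule Tm1[where f = S]; (assumption | (unfold S_def, use assms in \<open>intro dfn gd\<close>)))
 have i: "isset (S ` el X)" using assms by (intro isset_image Sd dfn)
 have "EX c:M. ALL y:el (mk (S ` el X)). app c y:el y" 
 proof (rule choice_fun)
  fix y assume "y:el (mk (S ` el X))"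
  then obtain x where x: "x:el X" "y = S x" using i by auto
  then show "el y ~= {}" using S[of x] assms(4)[of x] by auto
 qed simp
 then obtain c where c: "c:M" "!!x. x:el X ==> app c (S x):el (S x)" using i by auto
 then have "app c (S x):el Y" "g (app c (S x)) = x" if "x:el X" for x using S that by auto
 note * = this
 show ?thesis
 proof (rule lepI[OF assms(1), where f = "%x. app c (S x)"])
  show "Tm M (%v. app c (S (v 0)))" using c by (intro dfn Sd)
  show "x = y" if "x:el X" "y:el X" "app c (S x) = app c (S y)" for x y using *(2)[OF that(1)] *(2)[OF that(2)] that(3) by argo
 qed (rule *(1))
qed

lemma lep_image: "X:M ==> Tm M (%v. g (v 0)) ==> lep (mk (g ` el X)) X"
 by (rule lep_surj) (auto simp: isset_image)


text \<open>The premise that \<open>W\<close> absorbs pairs stands in for cardinal arithmetic. Sizes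
  are measured throughout by comparison with such sets \<open>W\<close> rather than by cardinal
  numbers.\<close>

lemma lep_UN: assumes "I:M" "W:M" "Tm M (%v. F (v 0))" "lep I W" "!!i. i:el I ==> lep (F i) W" "lep (pd W W) W"
 shows "lep (mk (UN i:el I. el (F i))) W"
proof -
 have Fd: "Tm M s ==> Tm M (%v. F (s v))" for s using Tm1[OF _ assms(3)] .
 have FM: "F i:M" if "i:M" for i using Tm1M[OF assms(3) that] .
 define S where "S = (%i. sct (%f. inj f (F i) W))"
 have Sd: "Tm M s ==> Tm M (%v. S (s v))" for s
  by (rule Tm1[where f = S]; (assumption | (unfold S_def, use assms in \<open>intro dfn Fd\<close>)))
 have S: "el (S i) ~= {}" "!!f. f:el (S i) ==> inj f (F i) W" if i: "i:el I" for i
 proof -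
  obtain f where f: "f:M" "inj f (F i) W" using assms(5)[OF i] unfolding lep_def by blast
  have d: "D M (%v. inj (v 0) (F i) W)" using assms FM i by (intro dfn) auto
  show "el (S i) ~= {}" "!!f. f:el (S i) ==> inj f (F i) W" unfolding S_def sct(1)[of "%f. inj f (F i) W", OF d f] using sct[of "%f. inj f (F i) W", OF d f] by auto
 qed
 have i: "isset (S ` el I)" using assms by (intro isset_image Sd dfn)
 have "EX c:M. ALL y:el (mk (S ` el I)). app c y:el y" by (rule choice_fun) (use S i in auto)
 then obtain c where c: "c:M" "!!x. x:el I ==> app c (S x):el (S x)" using i by auto
 then have cj: "inj (app c (S i)) (F i) W" if "i:el I" for i using S that by blast
 obtain j where j: "j:M" "inj j I W" using assms unfolding lep_def by blast
 have iT: "isset (UN i:el I. el (pd (up i i) (F i)))" using assms by (intro isset_UN dfn Fd)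
 define T where "T = mk (UN i:el I. el (pd (up i i) (F i)))"
 have T: "el T = {z:M. EX i:el I. EX x:el (F i). z = pr i x}" unfolding T_def el_mk[OF iT] using FM by auto
 have TM: "T:M" by (simp add: T_def)
 have iU: "isset (UN i:el I. el (F i))" using assms by (intro isset_UN)
 have "lep (mk (UN i:el I. el (F i))) T"
 proof (rule lep_surj[where g = sn])
  fix x assume "x:el (mk (UN i:el I. el (F i)))"
  then obtain i where "i:el I" "x:el (F i)" using iU by auto
  then show "EX y:el T. sn y = x" unfolding T by (intro bexI[of _ "pr i x"]) auto
 qed (use TM in \<open>auto intro!: dfn\<close>)
 moreover have "lep T (pd W W)"
 proof (rule lepI[OF TM, where f = "%z. pr (app j (ft z)) (app (app c (S (ft z))) (sn z))"])
  show "Tm M (%v. pr (app j (ft (v 0))) (app (app c (S (ft (v 0)))) (sn (v 0))))" using j c by (intro dfn Sd)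
  fix z assume "z:el T"
  then obtain i x where z: "i:el I" "x:el (F i)" "z = pr i x" unfolding T by blast
  then have z': "ft z = i" "sn z = x" by auto
  have "app j i:el W" "app (app c (S i)) x:el W" using cj[OF z(1)] j z unfolding inj_def by blast+
  then show "pr (app j (ft z)) (app (app c (S (ft z))) (sn z)):el (pd W W)" unfolding z' using assms(2) by auto
  fix y assume "y:el T" and e: "pr (app j (ft z)) (app (app c (S (ft z))) (sn z)) = pr (app j (ft y)) (app (app c (S (ft y))) (sn y))"
  then obtain i' x' where y: "i':el I" "x':el (F i')" "y = pr i' x'" unfolding T by blast
  then have y': "ft y = i'" "sn y = x'" by auto
  have "app j i = app j i'" "app (app c (S i)) x = app (app c (S i')) x'" using e unfolding z' y' by auto
  moreover then have "i = i'" using j z y unfolding inj_def by blast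
  ultimately show "z = y" using cj[OF z(1)] z y unfolding inj_def by blast
 qed
 ultimately show ?thesis using lep_trans assms(6) TM by (meson mk_in)
qed

lemma lep_un: assumes "X:M" "Y:M" "W:M" "lep X W" "lep Y W" "lep (pd W W) W" "lep (up emp (suc emp)) W" shows "lep (un X Y) W"
proof -
 define F where "F = (%i. mk {z:M. (i = emp & z:el X) | (i ~= emp & z:el Y)})"
 have F: "F emp = X" "F (suc emp) = Y"
 proof -
  have "{z:M. (emp = emp & z:el X) | (emp ~= emp & z:el Y)} = el X" by auto
  then show "F emp = X" using assms(1) unfolding F_def by simp
  have "suc emp ~= emp" by (metis el_emp el_suc insert_not_empty op_in(1))
  then have "{z:M. (suc emp = emp & z:el X) | (suc emp ~= emp & z:el Y)} = el Y" by auto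
  then show "F (suc emp) = Y" using assms(2) unfolding F_def by simp
 qed
 have "lep (mk (UN i:el (up emp (suc emp)). el (F i))) W"
  by (rule lep_UN) (use F assms in \<open>auto simp: F_def[abs_def] intro!: dfn\<close>)
 moreover have "(UN i:el (up emp (suc emp)). el (F i)) = el (un X Y)" using F assms by simp
 ultimately show ?thesis by (simp only: mk_el op_in)
qed

section \<open>Hartogs numbers and well-orderings\<close>

definition har where "har X = mk {a:M. Ord a & lep a X}"
lemma dfn_har [dfn]: "Tm A s ==> Tm A (%v. har (s v))"
 by (rule Tm1[where f = har]; (assumption | (unfold har_def, intro dfn)))
lemma har_in [simp]: "har X:M"
 by (simp add: har_def)

text \<open>The order of \<open>a\<close> transported to the range of \<open>f\<close>. It is taken
  reflexive so that it records the range even when \<open>a\<close> has a single element.\<close>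

definition irel where "irel f a = mk {q:M. EX y:el a. EX z:el a. (y:el z | y = z) & q = pr (app f y) (app f z)}"
lemma dfn_irel [dfn]: "Tm A s ==> Tm A t ==> Tm A (%v. irel (s v) (t v))"
 by (rule Tm2[where f = irel]; (assumption | (unfold irel_def, intro dfn)))
lemma el_irel: "f:M ==> a:M ==> el (irel f a) = {q:M. EX y:el a. EX z:el a. (y:el z | y = z) & q = pr (app f y) (app f z)}"
proof -
 assume f: "f:M" "a:M"
 have i: "isset (app f ` el a)" using f by (intro isset_image dfn)
 have "isset {q:M. EX y:el a. EX z:el a. (y:el z | y = z) & q = pr (app f y) (app f z)}"
  by (rule issetI[of "pd (mk (app f ` el a)) (mk (app f ` el a))"]) (use f i in \<open>auto intro!: dfn\<close>)
 then show ?thesis by (simp add: irel_def)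
qed

lemma irel_agree: assumes "Ord a" "Ord b" "f:M" "g:M" "inj f a X" "inj g b X" "irel f a = irel g b" "y:el a" "y:el b"
 shows "app f y = app g y"
proof (rule ccontr)
 assume n: "app f y ~= app g y"
 have aM: "a:M" "b:M" using assms by auto
 have "D M (%v. v 0:el a & v 0:el b & app f (v 0) ~= app g (v 0))" using assms by (intro dfn) auto
 from Ord_min[OF this Ord_in[OF assms(1,8)]] obtain x where x: "x:el a" "x:el b" "app f x ~= app g x" and
  xm: "!!c. c:el x ==> ~ (c:el a & c:el b & app f c ~= app g c)" using assms n by metis
 have xm': "app f z = app g z" if "z:el x" for z using xm[OF that] x assms Ord_trans that by blast
 have r: "pr u w:el (irel f a) <-> (EX y:el a. EX z:el a. (y:el z | y = z) & u = app f y & w = app f z)"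
  "pr u w:el (irel g b) <-> (EX y:el b. EX z:el b. (y:el z | y = z) & u = app g y & w = app g z)" if "u:M" "w:M" for u w
  using that el_irel[OF assms(3) aM(1)] el_irel[OF assms(4) aM(2)] by auto
 obtain w where w: "w:el b" "app f x = app g w" using r[of "app f x" "app f x"] x assms(7) by auto
 obtain u where u: "u:el a" "app g x = app f u" using r[of "app g x" "app g x"] x assms(7) by auto
 have "w ~: el x" using w xm'[of w] x assms(1,5) mem_irrefl[of x] Ord_trans[OF assms(1) x(1), of w] unfolding inj_def by (metis elM)
 then have xw: "x:el w" using Ord_linear[of w x] w x assms Ord_in by metis
 have "u ~: el x" using u xm'[of u] x assms(2,6) mem_irrefl[of x] Ord_trans[OF assms(2) x(2), of u] unfolding inj_def by (metis elM)
 then have xu: "x:el u" using Ord_linear[of u x] u x assms Ord_in by metis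
 have "pr (app g x) (app g w):el (irel f a)" using r[of "app g x" "app g w"] x w xw assms(7) by auto
 then have "pr (app f u) (app f x):el (irel f a)" using u w by simp
 then obtain y z where "y:el a" "z:el a" "y:el z | y = z" "app f u = app f y" "app f x = app f z" using r[of "app f u" "app f x"] by auto
 then have "u:el x | u = x" using assms(5) u x unfolding inj_def by blast
 then show False using xu mem_irrefl mem_asym u x by (meson elM)
qed

text \<open>Distinct ordinals leave distinct traces in \<open>pw (pd X X)\<close>. This bounds the
  ordinals embeddable in \<open>X\<close> by a set and is what makes \<open>har X\<close>
  exist.\<close>

lemma irel_unique: assumes "Ord a" "Ord b" "f:M" "g:M" "inj f a X" "inj g b X" "irel f a = irel g b" shows "a = b"
proof -
 have *: "a ~: el b" if t: "Ord a" "Ord b" "f:M" "g:M" "inj f a X" "inj g b X" "irel f a = irel g b" for a b f g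
 proof
  assume ab: "a:el b"
  have "pr (app g a) (app g a):el (irel f a)" using t ab by (auto simp: el_irel)
  then obtain y where y: "y:el a" "app g a = app f y" unfolding el_irel[OF t(3) OrdM[OF t(1)]] by auto
  have yb: "y:el b" using y ab t Ord_trans by blast
  have "app f y = app g y" using irel_agree[OF t y(1) yb] .
  then have "a = y" using y yb ab t(6) unfolding inj_def by metis
  then show False using y mem_irrefl[OF elM[OF y(1)]] by simp
 qed
 show ?thesis using Ord_linear[OF assms(1,2)] *[OF assms] *[OF assms(2,1,4,3,6,5) assms(7)[symmetric]] by blast
qed

lemma el_har: assumes "X:M" shows "el (har X) = {a:M. Ord a & lep a X}"
proof -
 let ?S = "{a:M. EX r:el (pw (pd X X)). Ord a & (EX f:M. inj f a X & r = irel f a)}"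
 have i: "isset {a:M. EX r:el (pw (pd X X)). Ord a & (EX f:M. inj f a X & r = irel f a)}"
 proof (intro isset_Bex)
  fix r
  show "isset {a:M. Ord a & (EX f:M. inj f a X & r = irel f a)}"
  proof (cases "EX a f. Ord a & f:M & inj f a X & r = irel f a")
   case True
   then obtain a f where a: "Ord a" "f:M" "inj f a X" "r = irel f a" by blast
   then have "{a:M. Ord a & (EX f:M. inj f a X & r = irel f a)} = {a}" using irel_unique by auto
   also have "{a} = el (up a a)" using a by simp
   finally show ?thesis by (metis isset_el op_in(2))
  next
   case False
   then have "{a:M. Ord a & (EX f:M. inj f a X & r = irel f a)} = {}" by blast
   then show ?thesis by (simp only: isset_empty)
  qed
 qed (use assms in \<open>auto intro!: dfn\<close>)
 have "isset {a:M. Ord a & lep a X}"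
 proof (rule issetI[of "mk ?S"])
  show "D M (%v. Ord (v 0) & lep (v 0) X)" using assms by (intro dfn)
  fix a assume a: "a:M" "Ord a & lep a X"
  then obtain f where f: "f:M" "inj f a X" unfolding lep_def by blast
  have "irel f a:el (pw (pd X X))" using f a assms by (auto simp: el_irel inj_def) (simp add: irel_def)
  then show "a:el (mk ?S)" unfolding el_mk[OF i] using f a by blast
 qed simp
 then show ?thesis unfolding har_def by simp
qed

lemma Ord_har [simp]: assumes "X:M" shows "Ord (har X)"
proof (rule OrdI)
 show "tra (har X)" unfolding tra_def el_har[OF assms]
 proof safe
  fix a b assume a: "a:M" "Ord a" "lep a X" "b:el a"
  then have "el b <= el a" using Ord_trans by blast
  then have "lep b X" using a lep_trans[of b a X] lep_sub[of b a] by simp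
  then show "Ord b" "lep b X" "b:M" using a Ord_in by auto
 qed
qed (auto simp: el_har assms)
lemma not_lep_har: "X:M ==> ~ lep (har X) X"
 using el_har[of X] mem_irrefl[of "har X"] by auto

lemma well_order: assumes X: "X:M"
 shows "EX a. EX f:M. Ord a & inj f a X & (ALL x:el X. EX y:el a. app f y = x)"
proof (rule ccontr)
 assume no: "~  ?thesis"
 have "EX g:M. g = lam (har X) (app g) & (ALL y:el (har X). app g y:el X & (ALL z:el y. app (lam y (app g)) z ~= app g y))"
 proof (rule dependent_choice[where R = "%x g z. z:el X & (ALL y:el x. app g y ~= z)"])
  show "D M (%v. v 2:el X & (ALL y:el (v 0). app (v 1) y ~= v 2))" using X by (intro dfn)
  fix x g assume x: "x:el (har X)" and g: "g:M" "g = lam x (app g)"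
   and R: "!!y. y:el x ==> app g y:el X & (ALL z:el y. app (lam y (app g)) z ~= app g y)"
  have o: "Ord x" using x X by (simp add: el_har)
  have d: "app g z ~= app g y" if "y:el x" "z:el y" for y z
   using R[OF that(1)] that g by (simp add: app_lam[OF _ Tm_appM])
  have "inj g x X" unfolding inj_def using R d Ord_linear Ord_in[OF o] by metis
  then obtain z where "z:el X" "ALL y:el x. app g y ~= z" using no g o by blast
  then show "EX z:M. z:el X & (ALL y:el x. app g y ~= z)" by auto
 qed (use X in simp)
 then obtain g where g: "g:M" "!!y. y:el (har X) ==> app g y:el X & (ALL z:el y. app (lam y (app g)) z ~= app g y)" by blast
 have d: "app g z ~= app g y" if "y:el (har X)" "z:el y" for y z
  using g(2)[OF that(1)] that g(1) by (simp add: app_lam[OF _ Tm_appM])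
 have "inj g (har X) X" unfolding inj_def using g(2) d Ord_linear Ord_in[OF Ord_har[OF X]] by metis
 then show False using not_lep_har[OF X] g(1) unfolding lep_def by blast
qed

end

section \<open>The cardinals \<open>\<kappa>\<^sub>c\<close>\<close>

context zfc
begin

text \<open>This is \<open>W c\<close> computed from the values \<open>g\<close> of \<open>K\<close>
  below \<open>c\<close>, as the recursion requires. The level \<open>om\<close> provides an
  infinite set at the start, where no earlier \<open>K d\<close> exists.\<close>

definition Wg where "Wg c g = mk {x:M. el x <= el (V om) | (EX d:el c. el x <= el (V (app g d)))}"
definition K where "K = rec (%p c g. har (Wg c g)) emp"
definition W where "W c = Wg c (lam c K)"
definition R where "R c = pw (V (K c))"

lemma dfn_Wg [dfn]: "Tm A s ==> Tm A t ==> Tm A (%v. Wg (s v) (t v))"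
 by (rule Tm2[where f = Wg]; (assumption | (unfold Wg_def, intro dfn)))
lemma K_H: "Tm A (%v. (%p c g. har (Wg c g)) (v 0) (v 1) (v 2))"
 by (intro dfn)
lemma dfn_K [dfn]: "Tm A s ==> Tm A (%v. K (s v))"
 unfolding K_def by (intro Tm_rec K_H dfn)
lemma dfn_W [dfn]: "Tm A s ==> Tm A (%v. W (s v))"
 by (rule Tm1[where f = W]; (assumption | (unfold W_def, intro dfn)))
lemma dfn_R [dfn]: "Tm A s ==> Tm A (%v. R (s v))"
 unfolding R_def by (intro dfn)
lemma KWR_in [simp, intro]: "K c:M" "W c:M" "R c:M"
 by (auto simp: K_def W_def Wg_def R_def)
lemma K_eq: "c:M ==> K c = har (W c)"
 unfolding W_def K_def using rec_eq[OF K_H, of emp c] by simp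
lemma Ord_K [simp]: "c:M ==> Ord (K c)"
 by (simp add: K_eq)

definition lev where "lev c l <-> l = om | (EX d:el c. l = K d)"

lemma el_W: assumes "c:M" shows "el (W c) = {x:M. EX l:M. lev c l & el x <= el (V l)}"
proof -
 have a: "app (lam c K) d = K d" if "d:el c" for d using that assms by (intro app_lam dfn)
 have i: "isset (UN d:el c. el (pw (V (K d))))" using assms by (intro isset_UN dfn)
 have "isset {x:M. el x <= el (V om) | (EX d:el c. el x <= el (V (app (lam c K) d)))}"
  by (rule issetI[of "un (pw (V om)) (mk (UN d:el c. el (pw (V (K d)))))"]) (use i assms a in \<open>auto intro!: dfn\<close>)
 then have "el (W c) = {x:M. el x <= el (V om) | (EX d:el c. el x <= el (V (app (lam c K) d)))}" unfolding W_def Wg_def by simp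
 moreover have "(EX d:el c. el x <= el (V (app (lam c K) d))) <-> (EX d:el c. el x <= el (V (K d)))" for x using a by simp
 ultimately show ?thesis by (auto simp: lev_def)
qed

lemma el_K: "c:M ==> el (K c) = {a:M. Ord a & lep a (W c)}"
 by (simp add: K_eq el_har)

lemma lev_Ord: "Ord c ==> lev c l ==> Ord l"
 unfolding lev_def by auto

lemma V_mono: "Ord a ==> Ord b ==> el a <= el b ==> el (V a) <= el (V b)"
 by (auto simp: el_V)
lemma V_sub: "Ord a ==> x:M ==> el x <= el (V a) ==> rk x = a | rk x:el a"
 using rk_least[of x a] Ord_sub_iff[of "rk x" a] by (auto simp: el_V)
lemma Ord_sub_V: "Ord a ==> Ord l ==> el a <= el l ==> el a <= el (V l)"
 using rk_Ord Ord_in by (auto simp: el_V)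
lemma Lim_suc: "Lim l ==> a:el l ==> suc a:el l"
 unfolding Lim_def by blast
lemma V_up: assumes "Lim l" "x:el (V l)" "y:el (V l)" shows "up x y:el (V l)"
proof -
 have o: "Ord l" using assms by (simp add: Lim_def)
 have m: "x:M" "y:M" "rk x:el l" "rk y:el l" using assms o by (auto simp: el_V)
 have "EX a. Ord a & a:el l & rk x:el (suc a) & rk y:el (suc a)"
  using Ord_linear[of "rk x" "rk y"] m by (metis Ord_rk OrdM el_suc insertCI)
 then obtain a where a: "Ord a" "a:el l" "rk x:el (suc a)" "rk y:el (suc a)" by blast
 have "el (rk (up x y)) <= el (suc a)" using a m by (intro rk_least) auto
 then have "rk (up x y):el (suc (suc a))" using Ord_sub[of "rk (up x y)" "suc a"] a by auto
 moreover have "suc (suc a):el l" using Lim_suc[OF assms(1)] a by blast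
 ultimately show ?thesis using o Ord_trans[OF o] by (simp add: el_V)
qed
lemma V_pr: "Lim l ==> x:el (V l) ==> y:el (V l) ==> pr x y:el (V l)"
 unfolding pr_def by (intro V_up)

text \<open>Coding a pair of subsets of \<open>V\<^sub>l\<close>, for limit \<open>l\<close>, by one subset of \<open>V\<^sub>l\<close>.\<close>

definition tg where "tg A B = mk {w:M. (EX a:el A. w = pr emp a) | (EX b:el B. w = pr (suc emp) b)}"
lemma dfn_tg [dfn]: "Tm A s ==> Tm A t ==> Tm A (%v. tg (s v) (t v))"
 by (rule Tm2[where f = tg]; (assumption | (unfold tg_def, intro dfn)))
lemma tg_in [simp]: "tg A B:M"
 by (simp add: tg_def)
lemma suc_emp: "suc emp ~= emp"
 by (metis el_emp el_suc insert_not_empty op_in(1))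
lemma el_tg: assumes "A:M" "B:M" shows "el (tg A B) = {w:M. (EX a:el A. w = pr emp a) | (EX b:el B. w = pr (suc emp) b)}"
 unfolding tg_def
 by (intro el_mk issetI[of "un (pd (up emp emp) A) (pd (up (suc emp) (suc emp)) B)"]) (use assms in \<open>auto intro!: dfn\<close>)
lemma tg_inj: assumes "A:M" "B:M" "A':M" "B':M" "tg A B = tg A' B'" shows "A = A' & B = B'"
proof -
 have 1: "a:el A <-> pr emp a:el (tg A B)" "a:el B <-> pr (suc emp) a:el (tg A B)" if "a:M" "A:M" "B:M" for a A B
  using that suc_emp suc_emp[symmetric] by (auto simp: el_tg)
 have "a:el A <-> a:el A'" "a:el B <-> a:el B'" for a
  using 1[of a A B] 1[of a A' B'] assms by (metis elM)+
 then show ?thesis using assms by (auto intro!: ext)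
qed
lemma tg_V: assumes l: "Lim l" and "A:M" "B:M" "el A <= el (V l)" "el B <= el (V l)" shows "el (tg A B) <= el (V l)"
proof -
 have "emp:el (V l)" "suc emp:el (V l)" using l Lim_emp[OF l] Lim_suc[OF l Lim_emp[OF l]] rk_Ord[OF Ord_emp] rk_Ord[of "suc emp"]
  by (auto simp: Lim_def el_V)
 then show ?thesis using assms V_pr[OF l] unfolding el_tg[OF assms(2,3)] by blast
qed

lemma lev_linear: assumes "Ord c" "lev c l" "lev c l'" shows "EX m. lev c m & el (V l) <= el (V m) & el (V l') <= el (V m)"
 using Ord_linear[of l l'] V_mono[of l l'] V_mono[of l' l] lev_Ord[OF assms(1)] assms Ord_trans by (metis order_refl subsetI)

text \<open>Two elements of \<open>W c\<close> are subsets of one common level, where tagging merges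
  them. This needs limit levels, and that \<open>K d\<close> is a limit is proved only with the help
  of this lemma at \<open>d\<close>; hence the second premise, which \<open>W_pairs\<close>
  discharges.\<close>

lemma W_pairs': assumes c: "Ord c" "!!d. d:el c ==> Lim (K d)" shows "lep (pd (W c) (W c)) (W c)"
proof -
 have lv: "Lim l" if "lev c l" for l using that c Lim_om unfolding lev_def by blast
 show ?thesis
 proof (rule lepI[where f = "%z. tg (ft z) (sn z)"])
  fix z assume "z:el (pd (W c) (W c))"
  then obtain A B where z: "A:el (W c)" "B:el (W c)" "z = pr A B" by auto
  then have m: "A:M" "B:M" by auto
  obtain l l' where "lev c l" "el A <= el (V l)" "lev c l'" "el B <= el (V l')" using z(1,2) c by (auto simp: el_W)
  then obtain m where "lev c m" "el A <= el (V m)" "el B <= el (V m)" using lev_linear[OF c(1), of l l'] by (metis order_trans)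
  then have "tg A B:el (W c)" using tg_V[OF lv m] OrdM[OF lev_Ord[OF c(1)]] unfolding el_W[OF OrdM[OF c(1)]] by (blast intro: tg_in)
  then show "tg (ft z) (sn z):el (W c)" using z m by simp
 next
  fix x y assume "x:el (pd (W c) (W c))" "y:el (pd (W c) (W c))" "tg (ft x) (sn x) = tg (ft y) (sn y)"
  moreover then obtain A B A' B' where "A:el (W c)" "B:el (W c)" "x = pr A B" "A':el (W c)" "B':el (W c)" "y = pr A' B'" by auto
  ultimately show "x = y" using tg_inj[of A B A' B'] by auto
 qed (auto intro!: dfn)
qed

lemma W_two: assumes "Ord c" shows "lep (up emp (suc emp)) (W c)"
proof -
 have "emp:el (W c)" "suc emp:el (W c)" using assms Lim_emp[OF Lim_om] rk_Ord[OF Ord_emp] by (auto simp: el_W el_V lev_def intro!: bexI[of _ om])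
 then show ?thesis by (intro lep_sub) auto
qed

lemma Lim_K: assumes "Ord c" shows "Lim (K c)"
proof (rule Ord_induct[OF assms])
 fix c assume c: "Ord c" "!!d. d:el c ==> Lim (K d)"
 have e: "emp:el (K c)" using c by (auto simp: el_K intro!: lep_sub)
 have "suc a:el (K c)" if a: "a:el (K c)" for a
 proof -
  have a': "Ord a" "lep a (W c)" using a c by (auto simp: el_K)
  have "lep (up a a) (W c)"
  proof (rule lepI[where f = "%x. emp"])
   show "emp:el (W c)" using c by (auto simp: el_W lev_def intro!: bexI[of _ om])
  qed (use a' in \<open>auto intro!: dfn\<close>)
  then have "lep (un a (up a a)) (W c)" using lep_un[OF _ _ _ a'(2) _ W_pairs'[OF c] W_two[OF c(1)]] a' by simp
  moreover have "un a (up a a) = suc a" using a' by (intro ext) auto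
  ultimately show ?thesis using a' c by (simp add: el_K)
 qed
 then show "Lim (K c)" unfolding Lim_def using e c by auto
qed (intro dfn)

lemma W_pairs: "Ord c ==> lep (pd (W c) (W c)) (W c)"
 using W_pairs' Lim_K Ord_in by blast

lemma W_mono: "Ord c ==> Ord d ==> el c <= el d ==> el (W c) <= el (W d)"
 unfolding el_W[OF OrdM] lev_def by blast

lemma om_in_K: assumes "Ord c" shows "om:el (K c)"
proof -
 have "x:el (W c)" if "x:el om" for x
 proof -
  have "Ord x" "el x <= el om" using that Ord_in Ord_trans Ord_om by blast+
  then have "el x <= el (V om)" by (intro Ord_sub_V) auto
  then show ?thesis using assms that by (auto simp: el_W lev_def intro!: bexI[of _ om])
 qed
 then have "lep om (W c)" by (intro lep_sub) auto
 then show ?thesis using assms by (simp add: el_K)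
qed

lemma K_mono: assumes "Ord c" "d:el c" shows "K d:el (K c)"
proof -
 have d: "Ord d" using assms Ord_in by blast
 have "x:el (W c)" if "x:el (K d)" for x
 proof -
  have "Ord x" "el x <= el (K d)" using Ord_in[OF Ord_K[OF OrdM[OF d]] that] Ord_trans[OF Ord_K[OF OrdM[OF d]] that] by blast+
  then have "el x <= el (V (K d))" using d by (intro Ord_sub_V) auto
  moreover have "lev c (K d)" using assms unfolding lev_def by blast
  ultimately show ?thesis using that unfolding el_W[OF OrdM[OF assms(1)]] by (blast intro: elM KWR_in)
 qed
 then have "lep (K d) (W c)" by (intro lep_sub) auto
 then show ?thesis using assms d by (simp add: el_K)
qed

lemma K_sub: "Ord c ==> Ord d ==> el c <= el d ==> el (K c) <= el (K d)"
 using K_mono Ord_sub_iff[of c d] Ord_trans[OF Ord_K[OF OrdM]] by (metis order_refl subsetI)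

lemma le_K: assumes "Ord c" shows "el c <= el (K c)"
proof (rule Ord_induct[OF assms, where R = "%c. el c <= el (K c)"])
 fix c assume c: "Ord c" "!!b. b:el c ==> el b <= el (K b)"
 show "el c <= el (K c)"
 proof
  fix b assume b: "b:el c"
  have "b = K b | b:el (K b)" using c(2)[OF b] Ord_sub[of b "K b"] Ord_in[OF c(1) b] by simp
  then show "b:el (K c)" using K_mono[OF c(1) b] Ord_trans[OF Ord_K[OF OrdM[OF c(1)]]] by auto
 qed
qed (intro dfn)

lemma W_sub_V: assumes "Ord c" shows "el (W c) <= el (V (K c))"
proof
 fix x assume x: "x:el (W c)"
 then obtain l where l: "lev c l" "el x <= el (V l)" using assms by (auto simp: el_W)
 have "l:el (K c)" using l(1) om_in_K[OF assms] K_mono[OF assms] unfolding lev_def by blast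
 then show "x:el (V (K c))" using V_sub[of l x] l x lev_Ord[OF assms l(1)] assms Ord_trans[OF Ord_K] by (auto simp: el_V)
qed

lemma V_sub_R: assumes "Ord c" shows "el (V (K c)) <= el (R c)"
 using rk_mem Ord_trans[OF Ord_K[OF OrdM[OF assms]]] assms unfolding R_def by (auto simp: el_V)

lemma W_suc: assumes "Ord c" shows "W (suc c) = R c"
proof (rule ext)
 have "el (V l) <= el (V (K c))" if "lev (suc c) l" for l
  using that V_mono[of l "K c"] K_mono[OF assms] om_in_K[OF assms] Ord_trans[OF Ord_K[OF OrdM[OF assms]]] lev_Ord[OF Ord_suc[OF assms] that] assms
  unfolding lev_def by auto
 moreover have "lev (suc c) (K c)" using assms unfolding lev_def by auto
 ultimately show "el (W (suc c)) = el (R c)" unfolding R_def el_W[OF op_in(6)] el_pw[OF V_in] by blast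
qed auto

lemma R_pairs: "Ord c ==> lep (pd (R c) (R c)) (R c)"
 using W_pairs[of "suc c"] W_suc by simp
lemma lep_K_R: assumes "Ord c" shows "lep (K c) (R c)"
proof -
 have "el (K c) <= el (V (K c))" using assms by (intro Ord_sub_V) auto
 then show ?thesis using V_sub_R[OF assms] by (intro lep_sub) auto
qed
lemma W_lep_R: "Ord c ==> lep X (W c) ==> X:M ==> lep X (R c)"
 using lep_trans[of X "W c" "R c"] lep_sub[of "W c" "R c"] W_sub_V V_sub_R by (meson KWR_in(2) order_trans)
lemma lep_W_mono: "lep X (W c) ==> Ord c ==> Ord d ==> el c <= el d ==> X:M ==> lep X (W d)"
 using lep_trans[of X "W c" "W d"] lep_sub[of "W c" "W d"] W_mono by blast
lemma K_lep_W: "Ord c ==> a:el (K c) ==> lep a (W c)"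
 by (simp add: el_K)

text \<open>Regularity of \<open>K c\<close> for sets of size \<open>W c\<close>: the union of such
  a set of ordinals still embeds in \<open>W c\<close>, so it is an ordinal below the Hartogs
  number.\<close>

lemma K_bounded: assumes c: "Ord c" and X: "X:M" "el X <= el (K c)" "lep X (W c)" shows "EX b:el (K c). el X <= el b"
proof -
 have "lep (mk (UN i:el X. el i)) (W c)"
  by (rule lep_UN[where F = "%x. x"]) (use X c W_pairs[OF c] K_lep_W[OF c] in \<open>auto intro!: dfn\<close>)
 moreover have "(UN i:el X. el i) = el (UU X)" using X by simp
 ultimately have l: "lep (UU X) (W c)" by (simp only: mk_el op_in)
 have ox: "Ord x" if "x:el X" for x using Ord_in[OF Ord_K[OF OrdM[OF c]]] X(2) that by blast
 have o: "Ord (UU X)" by (rule Ord_UU[OF X(1) ox])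
 then have "UU X:el (K c)" using l c by (simp add: el_K)
 then have s: "suc (UU X):el (K c)" using Lim_suc[OF Lim_K[OF c]] by blast
 have "x:el (suc (UU X))" if "x:el X" for x
  using Ord_sub[OF ox[OF that] o] that X(1) by auto
 then show ?thesis using s by blast
qed

definition smalls where "smalls B c = mk {S:M. el S <= el B & lep S (W c)}"
lemma el_smalls: "B:M ==> c:M ==> el (smalls B c) = {S:M. el S <= el B & lep S (W c)}"
 unfolding smalls_def by (intro el_mk issetI[of "pw B"]) (auto intro!: dfn)

definition dec where "dec C = mk {x:M. EX w:M. pr w emp:el C & x = mk {a:M. pr w (up a a):el C}}"
lemma dfn_dec [dfn]: "Tm A s ==> Tm A (%v. dec (s v))"
 by (rule Tm1[where f = dec]; (assumption | (unfold dec_def, intro dfn)))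

text \<open>A small family of subsets of \<open>V\<^sub>\<kappa>\<close> is coded by a subset of \<open>V\<^sub>\<kappa>\<close> by listing it with indices from \<open>W c\<close>; \<open>dec\<close> decodes.\<close>

lemma smalls_R: assumes c: "Ord c" shows "lep (smalls (R c) c) (R c)"
proof (rule lep_surj[where g = dec])
 fix S assume "S:el (smalls (R c) c)"
 then have S: "S:M" "el S <= el (R c)" "lep S (W c)" using c by (auto simp: el_smalls)
 then obtain f where f: "f:M" "inj f S (W c)" unfolding lep_def by blast
 define C where "C = mk {q:M. EX x:el S. q = pr (app f x) emp | (EX a:el x. q = pr (app f x) (up a a))}"
 have L: "Lim (K c)" by (rule Lim_K[OF c])
 have fV: "app f x:el (V (K c))" if "x:el S" for x using f that W_sub_V[OF c] unfolding inj_def by blast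
 have sV: "el x <= el (V (K c))" if "x:el S" for x using S(2) that unfolding R_def by auto
 have eV: "emp:el (V (K c))" using Lim_emp[OF L] rk_Ord[OF Ord_emp] c by (auto simp: el_V)
 have qV: "q:el (V (K c))" if "EX x:el S. q = pr (app f x) emp | (EX a:el x. q = pr (app f x) (up a a))" for q
  using that fV sV eV V_pr[OF L] V_up[OF L] by blast
 have C: "el C = {q:M. EX x:el S. q = pr (app f x) emp | (EX a:el x. q = pr (app f x) (up a a))}"
  unfolding C_def by (intro el_mk issetI[of "V (K c)"] qV) (use f S in \<open>auto intro!: dfn\<close>)
 have CR: "C:el (R c)" using C qV unfolding R_def by (auto simp: C_def)
 have up_ne: "up a a ~= emp" if "a:M" for a using el_up[OF that that] by (metis el_emp insert_not_empty)
 have up_inj: "a = b" if "up a a = up b b" "a:M" "b:M" for a b using that el_up by (metis singletonD singletonI insert_absorb2)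
 have C1: "pr w u:el C <-> (EX x:el S. w = app f x & (u = emp | (EX a:el x. u = up a a)))" if "w:M" "u:M" for w u
  using that unfolding C by auto
 have "pr (app f x) (up a a):el C <-> a:el x" if x: "x:el S" and a: "a:M" for x a
  using C1[of "app f x" "up a a"] x up_ne[OF a] up_inj[OF _ a elM] f(2) unfolding inj_def by (metis op_in(2) op_in2(4))
 then have "{a:M. pr (app f x) (up a a):el C} = el x" if x: "x:el S" for x using x by auto
 then have u: "mk {a:M. pr (app f x) (up a a):el C} = x" if "x:el S" for x using that by simp
 have "pr w emp:el C <-> (EX x:el S. w = app f x)" if "w:M" for w
  using C1[OF that, of emp] by auto
 then have "{x:M. EX w:M. pr w emp:el C & x = mk {a:M. pr w (up a a):el C}} = el S" using u by auto
 then have "dec C = S" unfolding dec_def using S by simp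
 then show "EX y:el (R c). dec y = S" using CR by blast
qed (auto simp: smalls_def intro!: dfn)

lemma smalls_lep: assumes c: "Ord c" and B: "B:M" "lep B (R c)" shows "lep (smalls B c) (R c)"
proof -
 obtain f where f: "f:M" "inj f B (R c)" using B unfolding lep_def by blast
 have cM: "c:M" using c by simp
 have i: "isset (app f ` el S)" if "S:M" for S using that f by (intro isset_image dfn)
 define I where "I S = mk {y:M. EX x:el S. y = app f x}" for S
 have I: "I S = mk (app f ` el S)" for S unfolding I_def by (rule arg_cong[where f = mk]) auto
 have "lep (smalls B c) (smalls (R c) c)"
 proof (rule lepI[where f = I])
  fix S assume "S:el (smalls B c)"
  then have S: "S:M" "el S <= el B" "lep S (W c)" using B cM by (auto simp: el_smalls)
  have "lep (I S) (W c)" unfolding I using lep_image[OF S(1), of "app f"] lep_trans[OF _ _ S(3)] f by (auto intro!: dfn)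
  moreover have "el (I S) <= el (R c)" unfolding I el_mk[OF i[OF S(1)]] using f S unfolding inj_def by blast
  ultimately show "I S:el (smalls (R c) c)" using cM by (auto simp: el_smalls I_def)
  fix T assume "T:el (smalls B c)" and e: "I S = I T"
  then have T: "T:M" "el T <= el B" using B cM by (auto simp: el_smalls)
  have e': "app f ` el S = app f ` el T" using e unfolding I using el_mk[OF i[OF S(1)]] el_mk[OF i[OF T(1)]] by metis
  have "inj_on (app f) (el B)" using f unfolding inj_def inj_on_def by blast
  then have "el S = el T" using inj_on_image_eq_iff[OF _ S(2) T(2)] e' by blast
  then show "S = T" using ext S T by blast
 qed (use f in \<open>auto simp: smalls_def I_def[abs_def] intro!: dfn\<close>)
 then show ?thesis using lep_trans[OF _ _ smalls_R[OF c]] by (simp add: smalls_def)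
qed

end

section \<open>A chain condition for small partial functions\<close>

context zfc
begin

text \<open>The closing-off argument for the chain condition: \<open>Z\<close> is exhausted in \<open>K c\<close> steps, where each step adds
 for every trace of an element of \<open>Z\<close> on the keys used so far one element of \<open>Z\<close> with this trace.\<close>

lemma chain_condition:
 assumes c: "Ord c" and Z: "Z:M" and k: "Tm M (%v. k (v 0))"
  and small: "!!z. z:el Z ==> lep z (W c)"
  and keys: "!!e. e:el (UU Z) ==> lep (mk {e':M. e':el (UU Z) & k e' = k e}) (R c)"
  and func: "!!z e e'. z:el Z ==> e:el z ==> e':el z ==> k e = k e' ==> e = e'"
  and inc: "!!z z'. z:el Z ==> z':el Z ==> z ~= z' ==> EX e:el z. EX e':el z'. k e = k e' & e ~= e'"
 shows "lep Z (R c)"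
proof -
 have kd: "Tm M s ==> Tm M (%v. k (s v))" for s using Tm1[OF _ k] .
 have cM: "c:M" using c by simp
 define B where "B = UU Z"
 have B: "B:M" "el B = (UN z:el Z. el z)" using Z by (auto simp: B_def)
 define ky where "ky x = mk {e:M. e:el B & k e = k x}" for x
 have kyd: "Tm M s ==> Tm M (%v. ky (s v))" for s
  by (rule Tm1[where f = ky]; (assumption | (unfold ky_def, use B in \<open>intro dfn kd\<close>)))
 have ky: "el (ky x) = {e:M. e:el B & k e = k x}" if "x:M" for x
  unfolding ky_def using B that Tm1M[OF k] by (intro el_mk isset_sep dfn kd; simp)
 \<comment> \<open>The part of \<open>B\<close> over the keys occurring in \<open>S\<close>, with
   every possible value; traces of elements of \<open>Z\<close> are compared on it.\<close>
 define cl where "cl S = mk {e:M. e:el B & (EX z:el S. EX x:el z. k e = k x)}" for S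
 have cld: "Tm M s ==> Tm M (%v. cl (s v))" for s
  by (rule Tm1[where f = cl]; (assumption | (unfold cl_def, use B in \<open>intro dfn kd\<close>)))
 have cl: "el (cl S) = {e:M. e:el B & (EX z:el S. EX x:el z. k e = k x)}" if "S:M" for S
  unfolding cl_def using B that by (intro el_mk isset_sep dfn kd)
 define rs where "rs z S = mk {e:M. e:el z & e:el S}" for z S
 have rsd: "Tm M s ==> Tm M t ==> Tm M (%v. rs (s v) (t v))" for s t
  by (rule Tm2[where f = rs]; (assumption | (unfold rs_def, intro dfn)))
 have rs: "el (rs z S) = el z Int el S" if "z:M" "S:M" for z S
  unfolding rs_def by (subst el_mk) (use that in \<open>auto intro!: isset_sep dfn\<close>)
 have [simp]: "cl S:M" "rs z S:M" "ky x:M" for S z x by (auto simp: cl_def rs_def ky_def)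
 have "EX c0:M. ALL y:el (mk {y:M. y:el (pw Z) & y ~= emp}). app c0 y:el y"
 proof (rule choice_fun)
  have i: "isset {y:M. y:el (pw Z) & y ~= emp}" by (intro isset_sep dfn) auto
  fix y assume "y:el (mk {y:M. y:el (pw Z) & y ~= emp})"
  then show "el y ~= {}" unfolding el_mk[OF i] using ext[of y emp] by auto
 qed simp
 then obtain c0 where c0: "c0:M" "!!y. y:el (mk {y:M. y:el (pw Z) & y ~= emp}) ==> app c0 y:el y" by blast
 have ch: "app c0 y:el y" if "y:M" "el y <= el Z" "el y ~= {}" for y
 proof (rule c0(2))
  have i: "isset {y:M. y:el (pw Z) & y ~= emp}" by (intro isset_sep dfn) auto
  show "y:el (mk {y:M. y:el (pw Z) & y ~= emp})" unfolding el_mk[OF i] using that Z by auto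
 qed
 define tr where "tr S t = mk {u:M. u:el Z & rs u (cl S) = t}" for S t
 have trd: "Tm M s ==> Tm M t ==> Tm M (%v. tr (s v) (t v))" for s t
  by (rule Tm2[where f = tr]; (assumption | (unfold tr_def, use Z in \<open>intro dfn rsd cld\<close>)))
 have tr: "el (tr S t) = {u:M. u:el Z & rs u (cl S) = t}" if "S:M" "t:M" for S t
  unfolding tr_def using Z that by (intro el_mk isset_sep dfn rsd cld; simp)
 define st where "st S = mk {u:M. EX z:el Z. u = app c0 (tr S (rs z (cl S)))}" for S
 have std: "Tm M s ==> Tm M (%v. st (s v))" for s
  by (rule Tm1[where f = st]; (assumption | (unfold st_def, use Z c0 in \<open>intro dfn rsd cld trd\<close>)))
 have [simp]: "st S:M" "tr S t:M" for S t by (auto simp: st_def tr_def)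
 have trZ: "app c0 (tr S (rs z (cl S))):el Z" "rs (app c0 (tr S (rs z (cl S)))) (cl S) = rs z (cl S)" if "z:el Z" "S:M" for z S
 proof -
  have "app c0 (tr S (rs z (cl S))):el (tr S (rs z (cl S)))" using that by (intro ch) (auto simp: tr)
  then show "app c0 (tr S (rs z (cl S))):el Z" "rs (app c0 (tr S (rs z (cl S)))) (cl S) = rs z (cl S)" using that by (auto simp: tr)
 qed
 have st: "el (st S) = (%z. app c0 (tr S (rs z (cl S)))) ` el Z" if "S:M" for S
 proof -
  have "{u:M. EX z:el Z. u = app c0 (tr S (rs z (cl S)))} = (%z. app c0 (tr S (rs z (cl S)))) ` el Z" by auto
  moreover have "isset ((%z. app c0 (tr S (rs z (cl S)))) ` el Z)" using Z c0(1) that by (intro isset_image dfn trd rsd cld; simp)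
  ultimately show ?thesis unfolding st_def by simp
 qed
 have cl_lep: "lep (cl S) (R c)" if S: "S:M" "el S <= el Z" "lep S (R c)" for S
 proof -
  define q where "q z = mk {e:M. EX x:el z. e:el (ky x)}" for z
  have qd: "Tm M s ==> Tm M (%v. q (s v))" for s
   by (rule Tm1[where f = q]; (assumption | (unfold q_def, intro dfn kyd)))
  have q0: "{e:M. EX x:el z. e:el (ky x)} = (UN x:el z. el (ky x))" for z by auto
  have q: "el (q z) = (UN x:el z. el (ky x))" if "z:M" for z
   unfolding q_def q0 using that by (intro el_mk isset_UN kyd dfn)
  have "lep (q z) (R c)" if z: "z:el S" for z
   unfolding q_def q0
  proof (rule lep_UN)
   have zZ: "z:el Z" using z S by blast
   show "lep z (R c)" using W_lep_R[OF c small] zZ by simp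
   show "lep (ky x) (R c)" if "x:el z" for x
    using keys[of x] that zZ B unfolding ky_def B_def by auto
  qed (use z c R_pairs in \<open>auto intro!: kyd dfn\<close>)
  then have "lep (mk (UN z:el S. el (q z))) (R c)" using S c R_pairs by (intro lep_UN qd dfn) auto
  moreover have "el (cl S) = (UN z:el S. el (q z))"
  proof -
   have "(UN z:el S. el (q z)) = (UN z:el S. UN x:el z. el (ky x))" using q by auto
   also have "\<dots> = el (cl S)" unfolding cl[OF S(1)] using ky by auto
   finally show ?thesis by simp
  qed
  ultimately show ?thesis by (metis mk_el \<open>!!S. cl S : M\<close>)
 qed
 have st_lep: "lep (st S) (R c)" if S: "S:M" "el S <= el Z" "lep S (R c)" for S
 proof -
  have "lep (st S) (smalls (cl S) c)"
  proof (rule lep_surj[where g = "%t. app c0 (tr S t)"])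
   fix u assume "u:el (st S)"
   then obtain z where z: "z:el Z" "u = app c0 (tr S (rs z (cl S)))" using st[OF S(1)] by auto
   have "lep (rs z (cl S)) (W c)" using lep_trans[OF _ lep_sub small[OF z(1)], of "rs z (cl S)"] z rs[of z "cl S"] by simp
   then have "rs z (cl S):el (smalls (cl S) c)" using cM z by (simp add: el_smalls rs)
   then show "EX y:el (smalls (cl S) c). app c0 (tr S y) = u" using z by blast
  qed (use S c0 in \<open>auto simp: smalls_def intro!: dfn trd\<close>)
  then show ?thesis using lep_trans[OF _ _ smalls_lep[OF c _ cl_lep[OF S]]] by (simp add: smalls_def)
 qed
 define H where "H p x g = mk {z:M. EX y:el x. z:el (app g y) | z:el (st (app g y))}" for p x g :: 'a
 have Hd: "Tm M (%v. H (v 0) (v 1) (v 2))" unfolding H_def by (intro dfn std)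
 define Zr where "Zr = rec H emp"
 have Zrd: "Tm M s ==> Tm M (%v. Zr (s v))" for s unfolding Zr_def by (intro Tm_rec Hd dfn; simp)
 have [simp]: "Zr x:M" for x by (simp add: Zr_def)
 have Zr: "el (Zr x) = (UN y:el x. el (Zr y) Un el (st (Zr y)))" if x: "x:M" for x
 proof -
  have "Zr x = H emp x (lam x Zr)" unfolding Zr_def using rec_eq[OF Hd _ x] by simp
  also have "\<dots> = mk (UN y:el x. el (un (Zr y) (st (Zr y))))" unfolding H_def
   using app_lam[OF x Zrd[OF Tm_var]] by (intro arg_cong[where f = mk]) auto
  finally have "Zr x = mk (UN y:el x. el (un (Zr y) (st (Zr y))))" .
  moreover have "isset (UN y:el x. el (un (Zr y) (st (Zr y))))" using x by (intro isset_UN dfn Zrd std)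
  ultimately show ?thesis by simp
 qed
 have stZ: "el (st S) <= el Z" if "S:M" for S using st[OF that] trZ[OF _ that] by auto
 have ZrZ: "el (Zr x) <= el Z" if "Ord x" for x
 proof (rule Ord_induct[OF that, where R = "%x. el (Zr x) <= el Z"])
  fix a assume "Ord a" "!!b. b:el a ==> el (Zr b) <= el Z"
  then show "el (Zr a) <= el Z" using stZ[of "Zr _"] unfolding Zr[OF OrdM[OF \<open>Ord a\<close>]] by auto
 qed (use Z in \<open>intro dfn Zrd\<close>)
 have Zr_mono: "el (Zr y) <= el (Zr x)" "el (st (Zr y)) <= el (Zr x)" if "y:el x" "x:M" for x y using Zr[OF that(2)] that(1) by blast+
 have Zr_lep: "Ord x ==> el x <= el (K c) --> lep (Zr x) (R c)" for x
 proof (rule Ord_induct[where R = "%x. el x <= el (K c) --> lep (Zr x) (R c)"])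
  show "D M (%v. el (v 0) <= el (K c) --> lep (Zr (v 0)) (R c))" using cM by (intro dfn Zrd; simp)
  fix x assume x: "Ord x" and IH: "!!y. y:el x ==> el y <= el (K c) --> lep (Zr y) (R c)"
  show "el x <= el (K c) --> lep (Zr x) (R c)"
  proof
   assume xK: "el x <= el (K c)"
   have "lep x (R c)" using lep_trans[OF _ lep_sub[OF _ xK] lep_K_R[OF c]] x by simp
   moreover have "lep (un (Zr y) (st (Zr y))) (R c)" if y: "y:el x" for y
   proof -
    have "el y <= el (K c)" using y xK Ord_trans[OF Ord_K[OF cM]] by blast
    then have l: "lep (Zr y) (R c)" using IH[OF y] by blast
    then have "lep (st (Zr y)) (R c)" using st_lep ZrZ Ord_in[OF x y] by simp
    then show ?thesis using l lep_un R_pairs[OF c] W_two[OF Ord_suc[OF c]] W_suc[OF c] by simp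
   qed
   ultimately have "lep (mk (UN y:el x. el (un (Zr y) (st (Zr y))))) (R c)" using x c R_pairs by (intro lep_UN dfn Zrd std) auto
   moreover have "(UN y:el x. el (un (Zr y) (st (Zr y)))) = el (Zr x)" using Zr[OF OrdM[OF x]] by simp
   ultimately show "lep (Zr x) (R c)" by simp
  qed
 qed
 have oK: "Ord (K c)" using cM by simp
 have "z:el (Zr (K c))" if z: "z:el Z" for z
 proof -
  define P where "P e y <-> y:el (K c) & e:el (cl (Zr y))" for e y
  have Pd: "Tm M s ==> Tm M t ==> D M (%v. P (s v) (t v))" for s t
   by (rule D2[where Q = P]; (assumption | (unfold P_def, (intro dfn cld Zrd; simp add: cM))))
  define ix where "ix e = mk {x:M. EX y:M. P e y & (ALL w:el y. ~ P e w) & x:el y}" for e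
  have ixd: "Tm M s ==> Tm M (%v. ix (s v))" for s
   by (rule Tm1[where f = ix]; (assumption | (unfold ix_def, intro dfn Pd)))
  have clmono: "el (cl (Zr y)) <= el (cl (Zr x))" if "y:el x" "x:M" for x y using Zr_mono[OF that] by (auto simp: cl)
  have ix: "ix e:el (K c) & e:el (cl (Zr (ix e)))" if e: "e:el z" "e:el (cl (Zr (K c)))" for e
  proof -
   obtain u x where u: "u:el (Zr (K c))" "x:el u" "k e = k x" "e:el B" using e(2) by (auto simp: cl)
   then obtain y where y: "y:el (K c)" "u:el (Zr y) Un el (st (Zr y))" using Zr[OF KWR_in(1), of c] by blast
   have sy: "suc y:el (K c)" using Lim_suc[OF Lim_K[OF c] y(1)] .
   have "u:el (Zr (suc y))" using y Zr_mono[of y "suc y"] by auto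
   then have "P e (suc y)" unfolding P_def using sy u by (auto simp: cl)
   moreover have "D M (%v. P e (v 0))" using e by (intro Pd dfn) auto
   ultimately obtain w where w: "Ord w" "P e w" "!!x. x:el w ==> ~ P e x" using Ord_min[of "P e" "suc y"] Ord_in[OF oK] y by (metis Ord_suc)
   have "w' = w" if "w':M" "P e w'" "ALL x:el w'. ~ P e x" for w'
    using Ord_linear[of w w'] w that Ord_in[OF oK] unfolding P_def by blast
   then have "{x:M. EX y:M. P e y & (ALL w:el y. ~ P e w) & x:el y} = el w" using w by auto
   then have "ix e = w" unfolding ix_def using w by simp
   then show ?thesis using w unfolding P_def by simp
  qed
  \<comment> \<open>The steps at which entries of \<open>z\<close> are first captured. As
    \<open>z\<close> is small and \<open>K c\<close> is regular, they are bounded by some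
    \<open>b\<close>: all keys that \<open>z\<close> shares with the whole construction are present
    by then.\<close>
  define Y where "Y = mk (ix ` el (rs z (cl (Zr (K c)))))"
  have iY: "isset (ix ` el (rs z (cl (Zr (K c)))))" by (intro isset_image ixd dfn) auto
  have rz: "el (rs z (cl (Zr (K c)))) = el z Int el (cl (Zr (K c)))" using z by (simp add: rs)
  have Yel: "el Y = ix ` (el z Int el (cl (Zr (K c))))" unfolding Y_def using iY rz by simp
  have "lep Y (rs z (cl (Zr (K c))))" unfolding Y_def by (intro lep_image ixd dfn) auto
  moreover have "lep (rs z (cl (Zr (K c)))) z" using rz by (intro lep_sub) auto
  ultimately have "lep Y (W c)" using small[OF z] lep_trans by (metis Y_def mk_in elM[OF z] \<open>!!z S. rs z S : M\<close>)
  moreover have "el Y <= el (K c)" unfolding Yel using ix by auto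
  ultimately obtain b where b: "b:el (K c)" "el Y <= el b" using K_bounded[OF c, of Y] by (auto simp: Y_def)
  have sub: "e:el (cl (Zr b))" if "e:el z" "e:el (cl (Zr (K c)))" for e
  proof -
   have "ix e:el b" using b(2) that unfolding Yel by blast
   then show ?thesis using ix[OF that] clmono[of "ix e" b] b by auto
  qed
  \<comment> \<open>The representative of the trace of \<open>z\<close> at step \<open>b\<close>. If
    it were different from \<open>z\<close>, the two would disagree at some key; that key is already
    present at step \<open>b\<close>, where the traces coincide.\<close>
  define z' where "z' = app c0 (tr (Zr b) (rs z (cl (Zr b))))"
  have z': "z':el Z" "rs z' (cl (Zr b)) = rs z (cl (Zr b))" using trZ[OF z, of "Zr b"] unfolding z'_def by auto
  have "z':el (st (Zr b))" unfolding z'_def using z st[of "Zr b"] by auto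
  then have zK: "z':el (Zr (K c))" using Zr_mono[of b "K c"] b by auto
  have "z = z'"
  proof (rule ccontr)
   assume "z ~= z'"
   then obtain e e' where e: "e:el z" "e':el z'" "k e = k e'" "e ~= e'" using inc[OF z z'(1)] by blast
   have "e:el B" using e z B by blast
   then have "e:el (cl (Zr (K c)))" using e zK by (auto simp: cl)
   then have "e:el (cl (Zr b))" using sub e by blast
   then have "e:el (rs z (cl (Zr b)))" using e z by (simp add: rs)
   then have "e:el z'" using z' rs[of z' "cl (Zr b)"] by (metis Int_iff elM \<open>!!S. cl S : M\<close>)
   then show False using func[OF z'(1)] e by blast
  qed
  then show ?thesis using zK by simp
 qed
 then have "el Z <= el (Zr (K c))" by blast
 then show ?thesis using lep_trans[OF Z lep_sub[OF Z]] Zr_lep[OF oK] by blast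
qed

end

section \<open>The forcing notion\<close>

context zfc
begin

text \<open>A condition \<open>cn l b f\<close> has length \<open>l\<close>. An element \<open>(c, ((x, n), y))\<close> of \<open>f\<close> says that row \<open>x\<close> of stage \<open>c\<close> has the
 value \<open>y\<close> at \<open>n\<close>; row \<open>0\<close> is the collapse. A pair \<open>(c, g)\<close> in \<open>b\<close> says that stage \<open>c\<close> is switched off if the generic
 object below \<open>c\<close> extends \<open>g\<close>. The order is weak at such stages: in \<open>le b g f\<close>, the entries of \<open>f\<close> outside row \<open>0\<close> that
 belong to stages which \<open>g\<close> switches off are ignored.\<close>

definition rs where "rs f c = mk {e:M. e:el f & ft e:el c}"
definition U where "U c = pd (pd (K (suc (suc c))) (K c)) (R c)"
definition key where "key e = pr (ft e) (ft (sn e))"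
definition row0 where "row0 e <-> ft (ft (sn e)) = emp"
text \<open>The last clause is a support condition in the style of Easton. It counts the entries at
  all stages up to and including \<open>c\<close>, so the lower part of a condition is smaller than
  \<open>K c\<close>, while a condition may have entries at unboundedly many stages below its
  length.\<close>

definition PC where "PC l f <-> f:M & (ALL e:el f. ft e:el l & (EX u:el (U (ft e)). e = pr (ft e) u)) &
 (ALL e:el f. ALL e':el f. key e = key e' --> e = e') & (ALL c:el l. lep (rs f (suc c)) (W c))"
definition le where "le b g f <-> (ALL e:el f. e:el g | (~ row0 e & pr (ft e) (rs g (ft e)):el b))"
text \<open>The last clause makes the set that switches off stage \<open>c\<close> open with respect
  to \<open>le b\<close>. There is no circularity, since on conditions below \<open>c\<close> this
  order consults only switches below \<open>c\<close>. Openness is the reason that the order is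
  transitive.\<close>

definition valid where "valid b l <-> b:M & (ALL z:el b. EX c:el l. EX g:M. PC c g & z = pr c g) &
 (ALL c:el l. ALL f:M. ALL g:M. pr c f:el b & PC c g & le b g f --> pr c g:el b)"

lemma dfn_rs [dfn]: "Tm A s ==> Tm A t ==> Tm A (%v. rs (s v) (t v))"
 by (rule Tm2[where f = rs]; (assumption | (unfold rs_def, intro dfn)))
lemma dfn_U [dfn]: "Tm A s ==> Tm A (%v. U (s v))"
 unfolding U_def by (intro dfn)
lemma dfn_key [dfn]: "Tm A s ==> Tm A (%v. key (s v))"
 unfolding key_def by (intro dfn)
lemma D_row0 [dfn]: "Tm A s ==> D A (%v. row0 (s v))"
 unfolding row0_def by (intro dfn)
lemma D_PC [dfn]: "Tm A s ==> Tm A t ==> D A (%v. PC (s v) (t v))"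
 by (rule D2[where Q = PC]; (assumption | (unfold PC_def, intro dfn)))
lemma D_le [dfn]: "Tm A s ==> Tm A t ==> Tm A u ==> D A (%v. le (s v) (t v) (u v))"
 by (rule D3[where Q = le]; (assumption | (unfold le_def, intro dfn)))
lemma D_valid [dfn]: "Tm A s ==> Tm A t ==> D A (%v. valid (s v) (t v))"
 by (rule D2[where Q = valid]; (assumption | (unfold valid_def, intro dfn)))
lemma rs_in [simp]: "rs f c:M" and key_in [simp]: "key e:M" and U_in [simp]: "U c:M"
 by (auto simp: rs_def key_def U_def)

lemma el_rs [simp]: "f:M ==> c:M ==> el (rs f c) = {e:el f. ft e:el c}"
proof -
 assume a: "f:M" "c:M"
 have "{e:M. e:el f & ft e:el c} = {e:el f. ft e:el c}" by auto
 then show ?thesis unfolding rs_def using isset_sep[OF a(1), of "%e. ft e:el c"] a by (simp add: dfn)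
qed
lemma rs_rs: "f:M ==> a:M ==> b:M ==> el b <= el a ==> rs (rs f a) b = rs f b"
 by (rule ext) auto
lemma rs_id: "f:M ==> a:M ==> (!!e. e:el f ==> ft e:el a) ==> rs f a = f"
 by (rule ext) auto

lemma Ord_el_sub: "Ord a ==> b:el a ==> el b <= el a"
 using Ord_trans by blast

lemma PC_M: "PC l f ==> f:M"
 by (simp add: PC_def)
lemma PC_ft: "PC l f ==> e:el f ==> ft e:el l"
 by (simp add: PC_def)
lemma PC_key: "PC l f ==> e:el f ==> e':el f ==> key e = key e' ==> e = e'"
 unfolding PC_def by blast
lemma key_row0: "key e = key e' ==> row0 e = row0 e' & ft e = ft e'"
 unfolding key_def row0_def by simp

lemma c_in_K: assumes "Ord c" shows "c:el (K c)"
proof -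
 have "d:el (W c)" if d: "d:el c" for d
 proof -
  have "Ord d" using assms d Ord_in by blast
  then have "el d <= el (V (K d))" using le_K by (intro Ord_sub_V) auto
  moreover have "lev c (K d)" using d unfolding lev_def by blast
  ultimately show ?thesis using d unfolding el_W[OF OrdM[OF assms]] by (blast intro: elM KWR_in)
 qed
 then have "lep c (W c)" using assms by (intro lep_sub) auto
 then show ?thesis using assms by (simp add: el_K)
qed

lemma PC_rs: assumes "PC l f" "Ord l" "Ord c" "el c <= el l" shows "PC c (rs f c)"
proof -
 have "lep (rs (rs f c) (suc d)) (W d)" if "d:el c" for d
 proof -
  have "el (suc d) <= el c" using that assms(3) Ord_trans by auto
  then have "rs (rs f c) (suc d) = rs f (suc d)" using assms PC_M by (intro rs_rs) auto
  then show ?thesis using assms(1,4) that unfolding PC_def by auto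
 qed
 then show ?thesis using assms unfolding PC_def by auto
qed

lemma PC_small: assumes "PC l f" "Ord l" shows "lep f (W l)"
proof -
 have "lep (mk (UN c:el l. el (rs f (suc c)))) (W l)"
 proof (rule lep_UN)
  fix c assume c: "c:el l"
  then have "lep (rs f (suc c)) (W c)" using assms unfolding PC_def by blast
  then show "lep (rs f (suc c)) (W l)" using lep_W_mono[of _ c l] c assms Ord_in Ord_trans by (metis rs_in subsetI)
 qed (use assms W_pairs PC_M K_lep_W[OF assms(2) c_in_K] in \<open>auto intro!: dfn\<close>)
 moreover have "(UN c:el l. el (rs f (suc c))) = el f" using assms PC_ft[OF assms(1)] PC_M[OF assms(1)] by (auto intro!: bexI[of _ "ft _"])
 ultimately show ?thesis using PC_M[OF assms(1)] by simp
qed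

lemma PC_mono: assumes "PC l f" "Ord l" "Ord l'" "el l <= el l'" shows "PC l' f"
proof -
 have "lep (rs f (suc c)) (W c)" if c: "c:el l'" for c
 proof (cases "c:el l")
  case False
  have o: "Ord c" using c assms(3) Ord_in by blast
  then have "el l <= el c" using Ord_not_in assms(2) False by blast
  then have "lep f (W c)" using lep_W_mono[OF PC_small[OF assms(1,2)] assms(2) o] PC_M assms(1) by blast
  moreover have "lep (rs f (suc c)) f" using PC_M[OF assms(1)] c by (intro lep_sub) auto
  ultimately show ?thesis using lep_trans by (metis rs_in)
 qed (use assms in \<open>simp add: PC_def\<close>)
 then show ?thesis using assms unfolding PC_def by blast
qed

lemma PC_subset: assumes "PC l f" "g:M" "el g <= el f" "Ord l" shows "PC l g"
proof -
 have "lep (rs g (suc c)) (W c)" if "c:el l" for c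
 proof -
  have "lep (rs g (suc c)) (rs f (suc c))" using assms PC_M[OF assms(1)] by (intro lep_sub) auto
  moreover have "lep (rs f (suc c)) (W c)" using assms that by (simp add: PC_def)
  ultimately show ?thesis using lep_trans by (metis rs_in)
 qed
 then show ?thesis using assms unfolding PC_def by blast
qed

lemma PC_un: assumes "PC l f" "PC l g" "Ord l" "!!e e'. e:el f ==> e':el g ==> key e = key e' ==> e = e'" shows "PC l (un f g)"
proof -
 have m: "f:M" "g:M" using assms PC_M by auto
 have "lep (rs (un f g) (suc c)) (W c)" if c: "c:el l" for c
 proof -
  have o: "Ord c" using c assms(3) Ord_in by blast
  have "lep (un (rs f (suc c)) (rs g (suc c))) (W c)"
   using assms(1,2) c W_pairs[OF o] W_two[OF o] by (intro lep_un) (auto simp: PC_def)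
  moreover have "rs (un f g) (suc c) = un (rs f (suc c)) (rs g (suc c))" using m c by (intro ext) auto
  ultimately show ?thesis by simp
 qed
 moreover have "e = e'" if "e:el (un f g)" "e':el (un f g)" "key e = key e'" for e e'
  using that m assms(4) PC_key[OF assms(1)] PC_key[OF assms(2)] by (metis UnE el_un)
 ultimately show ?thesis using assms(1,2) m unfolding PC_def by auto
qed

lemma le_refl [simp]: "le b f f"
 by (simp add: le_def)
lemma le_superset: "el f <= el g ==> le b g f"
 by (auto simp: le_def)
lemma le_rs_b: assumes "!!e. e:el f ==> ft e:el l" "b:M" "l:M" shows "le (rs b l) g f = le b g f"
 using assms unfolding le_def by auto
lemma le_rs_g: assumes "!!e. e:el f ==> ft e:el l" "g:M" "Ord l" shows "le b (rs g l) f = le b g f"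
proof -
 have "rs (rs g l) (ft e) = rs g (ft e)" if "e:el f" for e using Ord_el_sub[OF assms(3) assms(1)[OF that]] assms(2,3) by (intro rs_rs) auto
 then show ?thesis using assms unfolding le_def by auto
qed
lemma le_subset: "le b g f ==> el f' <= el f ==> le b g f'"
 unfolding le_def by blast
lemma le_rs: "le b g f ==> g:M ==> f:M ==> Ord c ==> le b (rs g c) (rs f c)"
 using le_rs_g[of "rs f c" c g b] le_subset[of b g f "rs f c"] by auto

lemma valid_M: "valid b l ==> b:M"
 by (simp add: valid_def)
lemma valid_ft: "valid b l ==> z:el b ==> ft z:el l"
 unfolding valid_def by (metis PC_M elM ft_pr)
lemma valid_open: "valid b l ==> pr c f:el b ==> c:M ==> f:M ==> PC c g ==> le b g f ==> pr c g:el b"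
 using valid_ft[of b l "pr c f"] PC_M[of c g] unfolding valid_def by (metis ft_pr)
lemma valid_rs: assumes "valid b l" "Ord l" "Ord c" "el c <= el l" shows "valid (rs b c) c"
 unfolding valid_def
proof (intro conjI ballI impI)
 have b: "b:M" using assms valid_M by blast
 fix z assume "z:el (rs b c)"
 then have z: "z:el b" "ft z:el c" using b assms by auto
 then obtain d g where "d:el l" "PC d g" "z = pr d g" "g:M" using assms(1) unfolding valid_def by blast
 then show "EX c:el c. EX g:M. PC c g & z = pr c g" using z by auto
next
 have b: "b:M" using assms valid_M by blast
 fix d f g assume d: "d:el c" and f: "f:M" "g:M" and *: "pr d f:el (rs b c) & PC d g & le (rs b c) g f"
 have 1: "pr d f:el b" using * b assms by auto
 then obtain d' f' where "d':el l" "f':M" "PC d' f'" "pr d f = pr d' f'" using assms(1) unfolding valid_def by blast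
 then have "PC d f" using d f by auto
 then have "ft e:el c" if "e:el f" for e using PC_ft[OF _ that, of d] d assms Ord_trans by blast
 then have "le b g f" using * le_rs_b[of f c b g] b assms by simp
 then show "pr d g:el (rs b c)" using valid_open[OF assms(1) 1] * d f b assms by auto
qed simp

lemma le_trans: assumes "valid b l" "Ord l" "PC l h" "PC l g" "le b h g" "le b g f" "!!e. e:el f ==> ft e:el l" shows "le b h f"
 unfolding le_def
proof
 fix e assume e: "e:el f"
 consider "e:el g" | "~ row0 e" "pr (ft e) (rs g (ft e)):el b" using assms(6) e unfolding le_def by blast
 then show "e:el h | (~ row0 e & pr (ft e) (rs h (ft e)):el b)"
 proof cases
  case 1 then show ?thesis using assms(5) unfolding le_def by blast
 next
  case 2
  have o: "Ord (ft e)" "el (ft e) <= el l" using assms(2,7) e Ord_in Ord_trans by blast+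
  have "pr (ft e) (rs h (ft e)):el b" by (rule valid_open[OF assms(1) 2(2)])
   (use o assms PC_M in \<open>auto intro!: PC_rs le_rs\<close>)
  then show ?thesis using 2 by blast
 qed
qed

definition ll where "ll p = ft p"
definition bb where "bb p = ft (sn p)"
definition ff where "ff p = sn (sn p)"
definition cn where "cn l b f = pr l (pr b f)"
definition Cn where "Cn p <-> p = cn (ll p) (bb p) (ff p) & Ord (ll p) & valid (bb p) (ll p) & PC (ll p) (ff p)"
text \<open>New switches may appear only at stages beyond the old length. So \<open>p\<close> fixes
  for every stage below \<open>ll p\<close> which lower conditions switch it off, and only the
  generic object decides whether that happens.\<close>

definition lq where "lq q p <-> Cn q & Cn p & el (ll p) <= el (ll q) & rs (bb q) (ll p) = bb p & le (bb q) (ff q) (ff p)"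

lemma dfn_parts [dfn]: "Tm A s ==> Tm A (%v. ll (s v))" "Tm A s ==> Tm A (%v. bb (s v))" "Tm A s ==> Tm A (%v. ff (s v))"
 "Tm A s ==> Tm A t ==> Tm A u ==> Tm A (%v. cn (s v) (t v) (u v))"
 unfolding ll_def bb_def ff_def cn_def by (intro dfn; assumption)+
lemma D_Cn [dfn]: "Tm A s ==> D A (%v. Cn (s v))"
 by (rule D1[where Q = Cn]; (assumption | (unfold Cn_def, intro dfn)))
lemma D_lq [dfn]: "Tm A s ==> Tm A t ==> D A (%v. lq (s v) (t v))"
 by (rule D2[where Q = lq]; (assumption | (unfold lq_def, intro dfn)))
lemma parts_in [simp]: "ll p:M" "bb p:M" "ff p:M" "cn l b f:M"
 by (auto simp: ll_def bb_def ff_def cn_def)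
lemma parts_cn [simp]: "l:M ==> b:M ==> f:M ==> ll (cn l b f) = l" "l:M ==> b:M ==> f:M ==> bb (cn l b f) = b"
 "l:M ==> b:M ==> f:M ==> ff (cn l b f) = f"
 by (auto simp: ll_def bb_def ff_def cn_def)
lemma Cn_M [simp]: "Cn p ==> p:M"
 unfolding Cn_def by (metis parts_in(4))
lemma CnD: assumes "Cn p" shows "Ord (ll p)" "valid (bb p) (ll p)" "PC (ll p) (ff p)" "cn (ll p) (bb p) (ff p) = p"
 using assms unfolding Cn_def by auto
lemma Cn_cn: "Ord l ==> valid b l ==> PC l f ==> Cn (cn l b f)"
 unfolding Cn_def using PC_M valid_M by auto
lemma rs_bb: "Cn p ==> rs (bb p) (ll p) = bb p" and rs_ff: "Cn p ==> rs (ff p) (ll p) = ff p"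
 using valid_ft[OF CnD(2)] PC_ft[OF CnD(3)] by (auto intro!: rs_id)
lemma lqD: assumes "lq q p" shows "Cn q" "Cn p" "el (ll p) <= el (ll q)" "rs (bb q) (ll p) = bb p" "le (bb q) (ff q) (ff p)"
 using assms unfolding lq_def by auto
lemma lq_refl: "Cn p ==> lq p p"
 unfolding lq_def by (simp add: rs_bb)
lemma lq_trans: assumes "lq s q" "lq q p" shows "lq s p"
proof -
 note s = lqD[OF assms(1)] and q = lqD[OF assms(2)]
 have "rs (bb s) (ll p) = rs (rs (bb s) (ll q)) (ll p)" using q(3) by (intro rs_rs[symmetric]) auto
 then have 1: "rs (bb s) (ll p) = bb p" using s(4) q(4) by simp
 have "le (bb s) (ff q) (ff p)"
  using q(5) le_rs_b[of "ff p" "ll q" "bb s" "ff q"] s(4) PC_ft[OF CnD(3)[OF q(2)]] q(3) by auto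
 then have "le (bb s) (ff s) (ff p)"
  using s(3,5) q(3) PC_mono[OF CnD(3)[OF q(1)] CnD(1)[OF q(1)] CnD(1)[OF s(1)] s(3)] CnD[OF s(1)] PC_ft[OF CnD(3)[OF q(2)]]
  by (smt (verit, ccfv_SIG) Cn_def local.le_trans q(2) s(2) zfc.Ord_sub_iff zfc.Ord_trans zfc_axioms)
 then show ?thesis unfolding lq_def using s q 1 by blast
qed

definition mn where "mn a b = mk {x:M. x:el a & x:el b}"
text \<open>The projection to conditions of length at most \<open>l\<close>. Taking the minimum of
  the lengths makes it total, with short conditions left unchanged.\<close>

definition cut where "cut p l = cn (mn (ll p) l) (rs (bb p) l) (rs (ff p) l)"
lemma dfn_mn [dfn]: "Tm A s ==> Tm A t ==> Tm A (%v. mn (s v) (t v))"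
 by (rule Tm2[where f = mn]; (assumption | (unfold mn_def, intro dfn)))
lemma dfn_cut [dfn]: "Tm A s ==> Tm A t ==> Tm A (%v. cut (s v) (t v))"
 by (rule Tm2[where f = cut]; (assumption | (unfold cut_def, intro dfn)))
lemma el_mn: "a:M ==> b:M ==> el (mn a b) = el a Int el b"
 unfolding mn_def by (subst el_mk) (auto intro!: isset_sep dfn)
lemma mn_in [simp]: "mn a b:M" and cut_in [simp]: "cut p l:M"
 by (auto simp: mn_def cut_def)
lemma cut_small: assumes "Cn p" "l:M" "el (ll p) <= el l" shows "cut p l = p"
proof -
 have "mn (ll p) l = ll p" using assms by (intro ext) (auto simp: el_mn)
 moreover have "rs (bb p) l = bb p" "rs (ff p) l = ff p" using assms valid_ft[OF CnD(2)[OF assms(1)]] PC_ft[OF CnD(3)[OF assms(1)]] by (auto intro!: rs_id)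
 ultimately show ?thesis unfolding cut_def using CnD(4)[OF assms(1)] by simp
qed
lemma cut_big: assumes "Cn p" "l:M" "el l <= el (ll p)" shows "cut p l = cn l (rs (bb p) l) (rs (ff p) l)"
proof -
 have "mn (ll p) l = l" using assms by (intro ext) (auto simp: el_mn)
 then show ?thesis unfolding cut_def by simp
qed
lemma cut_cases: assumes "Cn p" "Ord l" obtains "el (ll p) <= el l" "cut p l = p" | "el l <= el (ll p)" "cut p l = cn l (rs (bb p) l) (rs (ff p) l)"
 using cut_small[OF assms(1)] cut_big[OF assms(1)] Ord_linear[OF assms(2) CnD(1)[OF assms(1)]] Ord_sub_iff assms CnD(1) by (metis OrdM order_refl)
lemma Cn_cut: "Cn p ==> Ord l ==> Cn (cut p l)"
 by (rule cut_cases[of p l]; simp add: Cn_cn CnD valid_rs[of _ "ll p"] PC_rs[of "ll p"])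
lemma ll_cut: "Cn p ==> Ord l ==> el (ll (cut p l)) <= el l"
 by (rule cut_cases[of p l]; simp)
lemma cut_mono: assumes "lq q p" "Ord l" shows "lq (cut q l) (cut p l)"
proof -
 note q = lqD[OF assms(1)]
 show ?thesis
 proof (rule cut_cases[OF q(1) assms(2)])
  assume 1: "el (ll q) <= el l" "cut q l = q"
  then have "cut p l = p" using q cut_small assms(2) by auto
  then show ?thesis using 1 assms by simp
 next
  assume 1: "el l <= el (ll q)" "cut q l = cn l (rs (bb q) l) (rs (ff q) l)"
  have Cq: "Cn (cut q l)" "Cn (cut p l)" using Cn_cut q assms by auto
  show ?thesis
  proof (rule cut_cases[OF q(2) assms(2)])
   assume 2: "el (ll p) <= el l" "cut p l = p"
   have "rs (rs (bb q) l) (ll p) = bb p" using rs_rs[of "bb q" l "ll p"] 2 q(4) assms(2) by simp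
   moreover have "le (rs (bb q) l) (rs (ff q) l) (ff p)"
    using q(5) le_rs_b[of "ff p" l "bb q"] le_rs_g[of "ff p" l "ff q"] PC_ft[OF CnD(3)[OF q(2)]] 2 assms(2) by auto
   ultimately show ?thesis unfolding lq_def using 1 2 Cq assms(2) by simp
  next
   assume 2: "el l <= el (ll p)" "cut p l = cn l (rs (bb p) l) (rs (ff p) l)"
   have "rs (rs (bb q) l) l = rs (bb q) l" using assms(2) by (intro rs_rs) auto
   also have "\<dots> = rs (bb p) l" using rs_rs[of "bb q" "ll p" l] 2 q(4) assms(2) by simp
   finally have "rs (rs (bb q) l) l = rs (bb p) l" .
   moreover have "le (rs (bb q) l) (rs (ff q) l) (rs (ff p) l)"
    using le_rs[OF q(5), of l] le_rs_b[of "rs (ff p) l" l "bb q"] assms(2) by auto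
   ultimately show ?thesis unfolding lq_def using 1 2 Cq assms(2) by simp
  qed
 qed
qed
lemma cut_lq: "lq s q ==> Ord l ==> el (ll q) <= el l ==> lq (cut s l) q"
 using cut_mono[of s q l] cut_small[of q l] lqD(2) by auto

definition jn where "jn g f l = mk {e:M. (e:el g & ft e:el l) | (e:el f & ft e ~: el l)}"
lemma dfn_jn [dfn]: "Tm A s ==> Tm A t ==> Tm A u ==> Tm A (%v. jn (s v) (t v) (u v))"
 by (rule Tm3[where f = jn]; (assumption | (unfold jn_def, intro dfn)))
lemma jn_in [simp]: "jn g f l:M"
 by (simp add: jn_def)
lemma el_jn: "g:M ==> f:M ==> l:M ==> el (jn g f l) = {e:M. (e:el g & ft e:el l) | (e:el f & ft e ~: el l)}"
 unfolding jn_def by (intro el_mk issetI[of "un g f"]) (auto intro!: dfn)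
lemma rs_jn: "g:M ==> f:M ==> Ord l ==> el c <= el l ==> c:M ==> rs (jn g f l) c = rs g c"
 by (rule ext) (auto simp: el_jn)
lemma PC_jn: assumes "PC m g" "PC l f" "Ord m" "Ord l" "el m <= el l" shows "PC l (jn g f m)"
proof -
 have m: "g:M" "f:M" "m:M" using assms PC_M by auto
 have i: "isset {e:M. e:el f & ft e ~: el m}" using m by (intro isset_sep dfn)
 have "PC l (un g (mk {e:M. e:el f & ft e ~: el m}))"
 proof (rule PC_un)
  show "PC l g" using PC_mono assms by blast
  show "PC l (mk {e:M. e:el f & ft e ~: el m})" using assms i by (intro PC_subset[OF assms(2)]) auto
  show "e = e'" if "e:el g" "e':el (mk {e:M. e:el f & ft e ~: el m})" "key e = key e'" for e e'
   using that i PC_ft[OF assms(1), of e] key_row0[OF that(3)] by auto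
 qed (use assms in auto)
 moreover have "jn g f m = un g (mk {e:M. e:el f & ft e ~: el m})" using m i PC_ft[OF assms(1)] by (intro ext) (auto simp: el_jn)
 ultimately show ?thesis by simp
qed

text \<open>For \<open>r\<close> below the cut of \<open>q\<close> at the length of
  \<open>r\<close>, this is a greatest lower bound of \<open>q\<close> and \<open>r\<close>: below
  that length the entries come from \<open>r\<close>, above it from \<open>q\<close>.\<close>

definition ji where "ji r q = cn (ll q) (bb q) (jn (ff r) (ff q) (ll r))"
lemma dfn_ji [dfn]: "Tm A s ==> Tm A t ==> Tm A (%v. ji (s v) (t v))"
 by (rule Tm2[where f = ji]; (assumption | (unfold ji_def, intro dfn)))
lemma ji_in [simp]: "ji r q:M"
 by (simp add: ji_def)

lemma ji: assumes "Cn q" "lq r (cut q (ll r))" "el (ll r) <= el (ll q)"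
 shows "Cn (ji r q)" "lq (ji r q) q" "lq (ji r q) r" "!!w. lq w q ==> lq w r ==> lq w (ji r q)"
proof -
 note r = lqD[OF assms(2)]
 have o: "Ord (ll r)" "Ord (ll q)" using r(1) assms(1) CnD by auto
 have c: "cut q (ll r) = cn (ll r) (rs (bb q) (ll r)) (rs (ff q) (ll r))" using cut_big assms by simp
 have br: "bb r = rs (bb q) (ll r)" using r(4) rs_bb[OF r(1)] unfolding c by simp
 have lr: "le (bb q) (ff r) (rs (ff q) (ll r))" using r(5) le_rs_b[of "rs (ff q) (ll r)" "ll r" "bb q" "ff r"] unfolding c br by auto
 show C: "Cn (ji r q)" unfolding ji_def using assms r(1) o by (intro Cn_cn PC_jn) (auto simp: CnD)
 have L: "ll (ji r q) = ll q" "bb (ji r q) = bb q" "ff (ji r q) = jn (ff r) (ff q) (ll r)" by (auto simp: ji_def)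
 have rj: "rs (jn (ff r) (ff q) (ll r)) d = rs (ff r) d" if "d:el (ll r)" for d
  using that o Ord_el_sub[OF o(1)] by (intro rs_jn) auto
 have "e:el (jn (ff r) (ff q) (ll r)) | ~ row0 e & pr (ft e) (rs (jn (ff r) (ff q) (ll r)) (ft e)):el (bb q)" if e: "e:el (ff q)" for e
 proof (cases "ft e:el (ll r)")
  case True
  then have "e:el (rs (ff q) (ll r))" using e by simp
  then have "e:el (ff r) | ~ row0 e & pr (ft e) (rs (ff r) (ft e)):el (bb q)" using lr unfolding le_def by blast
  then show ?thesis using rj[OF True] True e by (auto simp: el_jn)
 qed (use e in \<open>auto simp: el_jn\<close>)
 then show "lq (ji r q) q" unfolding lq_def L using C assms(1) rs_bb[OF assms(1)] unfolding le_def by auto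
 have "el (ff r) <= el (jn (ff r) (ff q) (ll r))" using PC_ft[OF CnD(3)[OF r(1)]] by (auto simp: el_jn)
 then show "lq (ji r q) r" unfolding lq_def L using C r(1) assms(3) br le_superset by auto
 fix w assume w: "lq w q" "lq w r"
 then show "lq w (ji r q)" unfolding lq_def L using C unfolding le_def by (auto simp: el_jn)
qed

text \<open>This makes \<open>cut\<close> a projection in the sense of forcing, so density arguments
  among conditions of length at most \<open>l\<close> lift to all conditions.\<close>

lemma amalgam: assumes "Cn p" "Ord l" "lq q (cut p l)" "el (ll q) <= el l" shows "EX s:M. lq s p & lq s q"
proof (rule cut_cases[OF assms(1,2)])
 assume "cut p l = p"
 then show ?thesis using assms lq_refl[of q] lqD(1) by (metis Cn_M)
next
 assume 1: "el l <= el (ll p)" "cut p l = cn l (rs (bb p) l) (rs (ff p) l)"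
 have "ll q = l" using lqD(3)[OF assms(3)] assms(2,4) 1 by (intro ext) auto
 then show ?thesis using ji(2,3)[OF assms(1), of q] assms(3) 1(1) by (metis ji_in)
qed

lemma one: "Cn (cn emp emp emp)" "Cn p ==> lq p (cn emp emp emp)"
proof -
 show 1: "Cn (cn emp emp emp)" by (intro Cn_cn) (auto simp: valid_def PC_def)
 have "rs b emp = emp" if "b:M" for b using that by (intro ext) auto
 then show "Cn p ==> lq p (cn emp emp emp)" unfolding lq_def using 1 by (auto simp: le_def)
qed

lemma raise: assumes "Cn p" "Ord l" "el (ll p) <= el l" shows "Cn (cn l (bb p) (ff p))" "lq (cn l (bb p) (ff p)) p"
proof -
 have v: "valid (bb p) l" unfolding valid_def
 proof (intro conjI ballI impI)
  fix c f g assume "c:el l" "f:M" "g:M" "pr c f:el (bb p) & PC c g & le (bb p) g f"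
  then show "pr c g:el (bb p)" using valid_open[OF CnD(2)[OF assms(1)]] by auto
 next
  show "EX c:el l. EX g:M. PC c g & z = pr c g" if "z:el (bb p)" for z
   using CnD(2)[OF assms(1)] assms(3) that unfolding valid_def by blast
 qed simp
 show 1: "Cn (cn l (bb p) (ff p))" using assms(2) v PC_mono[OF CnD(3)[OF assms(1)] CnD(1)[OF assms(1)] assms(2,3)] by (intro Cn_cn)
 show "lq (cn l (bb p) (ff p)) p" unfolding lq_def using 1 assms rs_bb[OF assms(1)] by auto
qed

lemma long: assumes p: "Cn p" and c: "Ord c" shows "EX q:M. lq q p & Cn q & c:el (ll q) & el (suc c) <= el (ll q)"
proof -
 define l where "l = UU (up (ll p) (suc c))"
 have l: "Ord l" "el (ll p) <= el l" "el (suc c) <= el l" unfolding l_def using CnD(1)[OF p] c by (auto intro!: Ord_UU)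
 then show ?thesis using raise[OF p l(1,2)] c by (intro bexI[of _ "cn l (bb p) (ff p)"]) auto
qed

text \<open>Lengthening alone cannot be undone, so every condition has properly stronger ones. This
  later allows the preorder \<open>lq\<close> to be replaced by its strict part.\<close>

lemma strict: assumes "Cn p" shows "EX q:M. lq q p & ~ lq p q"
proof (intro bexI[of _ "cn (suc (ll p)) (bb p) (ff p)"] conjI)
 show "lq (cn (suc (ll p)) (bb p) (ff p)) p" using assms CnD(1)[OF assms] by (intro raise) auto
 show "~ lq p (cn (suc (ll p)) (bb p) (ff p))" using lqD(3)[of p "cn (suc (ll p)) (bb p) (ff p)"] mem_irrefl[of "ll p"] by auto
qed simp

end

section \<open>Pure extensions and fusion\<close>

context zfc
begin

text \<open>Entries below \<open>m\<close> stay fixed, and entries from \<open>m\<close> on grow by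
  inclusion instead of the weaker order \<open>le\<close>. Inclusion is what makes unions of chains
  functional in the keys, hence conditions again.\<close>

definition pure where "pure q p m <-> Cn q & Cn p & el m <= el (ll p) & el (ll p) <= el (ll q) & rs (bb q) (ll p) = bb p &
 el (ff p) <= el (ff q) & rs (ff q) m = rs (ff p) m"
lemma D_pure [dfn]: "Tm A s ==> Tm A t ==> Tm A u ==> D A (%v. pure (s v) (t v) (u v))"
 by (rule D3[where Q = pure]; (assumption | (unfold pure_def, intro dfn)))
lemma pureD: assumes "pure q p m" shows "Cn q" "Cn p" "el m <= el (ll p)" "el (ll p) <= el (ll q)" "rs (bb q) (ll p) = bb p"
 "el (ff p) <= el (ff q)" "rs (ff q) m = rs (ff p) m" "el m <= el (ll q)"
 using assms unfolding pure_def by auto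
lemma pure_lq: "pure q p m ==> lq q p"
 unfolding pure_def lq_def using le_superset by blast
lemma pure_refl: "Cn p ==> el m <= el (ll p) ==> pure p p m"
 unfolding pure_def using rs_bb by blast
lemma pure_trans: assumes "pure s q m" "pure q p m" shows "pure s p m"
proof -
 have "rs (bb s) (ll p) = bb p" using pureD(5)[OF assms(1)] pureD(5)[OF assms(2)] rs_rs[of "bb s" "ll q" "ll p"] pureD(4)[OF assms(2)] by simp
 then show ?thesis using assms unfolding pure_def by auto
qed
lemma pure_cut: assumes "pure q p m" "Ord m" shows "cut q m = cut p m"
proof -
 note p = pureD[OF assms(1)]
 have "rs (bb q) m = rs (bb p) m" using rs_rs[of "bb q" "ll p" m] p assms(2) by simp
 then show ?thesis using p cut_big[OF p(1) _ p(8)] cut_big[OF p(2) _ p(3)] assms(2) by simp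
qed

text \<open>The condition \<open>t\<close> is split at \<open>m\<close>: its lower part becomes
  \<open>r'\<close>, its upper part is absorbed by a pure extension \<open>q'\<close> of
  \<open>q\<close>. At stages that \<open>t\<close> switches off, its entries outside row 0 may
  contradict those of \<open>q\<close>; they are dropped, and the order ignores them anyway.\<close>

lemma merge: assumes q: "Cn q" "Ord m" "el m <= el (ll q)" and r: "lq r (cut q m)" "ll r = m" and t: "lq t (ji r q)"
 obtains r' q' where "pure q' q m" "lq r' r" "ll r' = m" "lq r' (cut q' m)" "lq (ji r' q') t"
proof -
 have j: "Cn (ji r q)" "lq (ji r q) q" "lq (ji r q) r" using ji[OF q(1), of r] r q by auto
 have tq: "lq t q" "lq t r" using j t lq_trans by blast+
 have T: "Cn t" "Ord (ll t)" "valid (bb t) (ll t)" "PC (ll t) (ff t)" using lqD(1)[OF t] CnD by auto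
 have lt: "el (ll q) <= el (ll t)" "el m <= el (ll t)" using lqD(3)[OF tq(1)] q by auto
 define off where "off d <-> pr d (rs (ff t) d):el (bb t)" for d
 define f' where "f' = mk {e:M. e:el (ff q) | (ft e ~: el m & e:el (ff t) & (row0 e | ~ off (ft e)))}"
 have f': "el f' = {e:M. e:el (ff q) | (ft e ~: el m & e:el (ff t) & (row0 e | ~ off (ft e)))}" and f'M: "f':M"
  unfolding f'_def off_def using q(2) Cn_M[OF q(1)] Cn_M[OF T(1)] by (auto intro!: el_mk issetI[of "un (ff q) (ff t)"] dfn)
 have qt: "e:el (ff t) | (~ row0 e & off (ft e))" if "e:el (ff q)" "ft e ~: el m" for e
 proof -
  have "e:el (ff (ji r q))" using that r using q(2) by (auto simp: ji_def el_jn)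
  then show ?thesis using lqD(5)[OF t] unfolding le_def off_def by blast
 qed
 have f'key: "e = e'" if e: "e:el f'" "e':el f'" "key e = key e'" for e e'
 proof -
  have k: "row0 e = row0 e'" "ft e = ft e'" using key_row0[OF e(3)] by auto
  consider "e:el (ff q)" "e':el (ff q)" | "e:el (ff t)" "e':el (ff t)"
   using e(1,2) qt[of e] qt[of e'] k unfolding f' by auto
  then show ?thesis using PC_key[OF T(4)] PC_key[OF CnD(3)[OF q(1)]] e(3) by metis
 qed
 have PCq: "PC (ll t) (ff q)" using PC_mono[OF CnD(3)[OF q(1)] CnD(1)[OF q(1)] T(2) lt(1)] .
 define f2 where "f2 = mk {e:M. e:el (ff t) & (ft e ~: el m & (row0 e | ~ off (ft e)))}"
 have f2: "el f2 = {e:M. e:el (ff t) & (ft e ~: el m & (row0 e | ~ off (ft e)))}" and f2M: "f2:M"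
  unfolding f2_def off_def using q(2) Cn_M[OF T(1)] by (auto intro!: el_mk isset_sep dfn)
 have "PC (ll t) (un (ff q) f2)"
  by (rule PC_un[OF PCq PC_subset[OF T(4) f2M]]) (use T f'key f2 f' in auto)
 moreover have "un (ff q) f2 = f'" using f' f2 f'M f2M by (intro ext) auto
 ultimately have PC': "PC (ll t) f'" by simp
 define q' where "q' = cn (ll t) (bb t) f'"
 have C': "Cn q'" unfolding q'_def using T PC' by (intro Cn_cn)
 have Q': "ll q' = ll t" "bb q' = bb t" "ff q' = f'" unfolding q'_def using f'M by auto
 have rsm: "rs f' m = rs (ff q) m" 
 proof (rule ext)
  show "el (rs f' m) = el (rs (ff q) m)" unfolding el_rs[OF f'M OrdM[OF q(2)]] el_rs[OF parts_in(3) OrdM[OF q(2)]] f' by auto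
 qed auto
 have P: "pure q' q m" unfolding pure_def Q' using C' q lt lqD(4)[OF tq(1)] rsm f' by auto
 define r' where "r' = cut t m"
 have r'e: "r' = cn m (rs (bb t) m) (rs (ff t) m)" unfolding r'_def using cut_big[OF T(1) _ lt(2)] q(2) by simp
 have R': "ll r' = m" "ff r' = rs (ff t) m" unfolding r'e using q(2) by auto
 have r'r: "lq r' r" unfolding r'_def using cut_lq[OF tq(2) q(2)] r by simp
 have r'q: "lq r' (cut q' m)" unfolding r'_def pure_cut[OF P q(2)] using cut_mono[OF tq(1) q(2)] .
 define h where "h = jn (rs (ff t) m) f' m"
 have hM: "h:M" by (simp add: h_def)
 have h: "el h = {e:M. (e:el (ff t) & ft e:el m) | (e:el f' & ft e ~: el m)}" unfolding h_def using f'M q(2) by (auto simp: el_jn)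
 have jh: "ji r' q' = cn (ll t) (bb t) h" unfolding ji_def Q' R' h_def ..
 have Cj: "Cn (ji r' q')" using ji(1)[OF C'] r'q R' lt Q' by simp
 have PCh: "PC (ll t) h" using CnD(3)[OF Cj] hM unfolding jh by simp
 \<comment> \<open>Dropped entries might have been the reason for a later stage being off. By
   induction this does no harm: below stage \<open>d\<close> the joined \<open>h\<close> is as
   strong as \<open>t\<close>, so openness of \<open>bb t\<close> keeps \<open>d\<close> switched
   off.\<close>
 have ind: "ALL e:el (ff t). ft e = d --> e:el h | (~ row0 e & pr d (rs h d):el (bb t))" if "Ord d" for d
 proof (rule Ord_induct[OF that])
  show "D M (%v. ALL e:el (ff t). ft e = v 0 --> e:el h | (~ row0 e & pr (v 0) (rs h (v 0)):el (bb t)))"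
   using hM by (intro dfn; simp)
  fix d assume d: "Ord d" and IH: "!!c. c:el d ==> ALL e:el (ff t). ft e = c --> e:el h | (~ row0 e & pr c (rs h c):el (bb t))"
  show "ALL e:el (ff t). ft e = d --> e:el h | (~ row0 e & pr d (rs h d):el (bb t))"
  proof (intro ballI impI)
   fix e assume e: "e:el (ff t)" "ft e = d"
   show "e:el h | (~ row0 e & pr d (rs h d):el (bb t))"
   proof (cases "d:el m | row0 e | ~ off d")
    case True then show ?thesis using e unfolding h f' by auto
   next
    case False
    have dl: "d:el (ll t)" using PC_ft[OF T(4)] e by blast
    have "le (bb t) h (rs (ff t) d)" unfolding le_def using IH d by auto
    then have "le (bb t) (rs h d) (rs (ff t) d)" using le_rs_g[of "rs (ff t) d" d h "bb t"] hM d by auto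
    moreover have "PC d (rs h d)" using PC_rs[OF PCh T(2) d] Ord_el_sub[OF T(2) dl] by simp
    ultimately have "pr d (rs h d):el (bb t)" using False valid_open[OF T(3), of d "rs (ff t) d"] d unfolding off_def by auto
    then show ?thesis using False by blast
   qed
  qed
 qed
 have "le (bb t) h (ff t)" unfolding le_def using ind Ord_in[OF T(2)] PC_ft[OF T(4)] by blast
 then have "lq (ji r' q') t" unfolding lq_def using Cj T(1) rs_bb[OF T(1)] hM unfolding jh by auto
 then show thesis using that P r'r R' r'q by blast
qed

text \<open>The closure of the upper part: below \<open>m\<close> all members agree, and at a stage
  from \<open>m\<close> on the union of at most \<open>W m\<close> many small sets is still
  small.\<close>

lemma chain_union: assumes Q: "Q:M" "q0:el Q" "Ord m" "lep Q (W m)"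
  and ch: "!!q q'. q:el Q ==> q':el Q ==> pure q q' m | pure q' q m"
 shows "EX u:M. ALL q:el Q. pure u q m"
proof -
 have C: "Cn q" "el m <= el (ll q)" if "q:el Q" for q using ch[OF that that] pureD by blast+
 have iL: "isset (UN q:el Q. el (ll q))" "isset (UN q:el Q. el (bb q))" "isset (UN q:el Q. el (ff q))"
  using Q(1) by (auto intro!: isset_UN dfn)
 define l where "l = mk (UN q:el Q. el (ll q))"
 define b where "b = mk (UN q:el Q. el (bb q))"
 define f where "f = mk (UN q:el Q. el (ff q))"
 have lbf: "el l = (UN q:el Q. el (ll q))" "el b = (UN q:el Q. el (bb q))" "el f = (UN q:el Q. el (ff q))"
  "l:M" "b:M" "f:M" using iL by (auto simp: l_def b_def f_def)
 have ol: "Ord l"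
 proof (rule OrdI)
  show "tra l" unfolding tra_def lbf using Ord_trans[OF CnD(1)[OF C(1)]] by blast
  show "Ord y" if "y:el l" for y using that Ord_in[OF CnD(1)[OF C(1)]] unfolding lbf by blast
 qed (use lbf in simp)
 have subl: "el (ll q) <= el l" if "q:el Q" for q using that lbf by blast
 have rb: "rs b (ll q) = bb q" if q: "q:el Q" for q
 proof (rule ext)
  have "z:el (bb q)" if z: "z:el b" "ft z:el (ll q)" for z
  proof -
   obtain q' where q': "q':el Q" "z:el (bb q')" using z lbf by blast
   show ?thesis using ch[OF q q'(1)]
   proof
    assume "pure q q' m"
    then have "bb q' = rs (bb q) (ll q')" using pureD by metis
    then show ?thesis using q' by auto
   next
    assume "pure q' q m"
    then have "bb q = rs (bb q') (ll q)" using pureD by metis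
    then show ?thesis using q' z by auto
   qed
  qed
  then show "el (rs b (ll q)) = el (bb q)" using lbf q valid_ft[OF CnD(2)[OF C(1)[OF q]]] by auto
 qed auto
 have rf: "rs f m = rs (ff q) m" if q: "q:el Q" for q
 proof (rule ext)
  have "e:el (ff q)" if e: "e:el f" "ft e:el m" for e
  proof -
   obtain q' where q': "q':el Q" "e:el (ff q')" using e lbf by blast
   have "rs (ff q') m = rs (ff q) m" using ch[OF q q'(1)] pureD(7) by metis
   moreover have "e:el (rs (ff q') m)" using q' e Q(3) by simp
   ultimately show ?thesis using Q(3) by (metis (no_types, lifting) OrdM el_rs mem_Collect_eq parts_in(3))
  qed
  then show "el (rs f m) = el (rs (ff q) m)" using lbf q Q(3) by auto
 qed auto
 have v: "valid b l" unfolding valid_def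
 proof (intro conjI ballI impI)
  fix z assume "z:el b"
  then obtain q where q: "q:el Q" "z:el (bb q)" using lbf by blast
  then obtain c g where "c:el (ll q)" "g:M" "PC c g" "z = pr c g" using CnD(2)[OF C(1)] unfolding valid_def by blast
  then show "EX c:el l. EX g:M. PC c g & z = pr c g" using subl[OF q(1)] by blast
 next
  fix c k g assume c: "c:el l" and k: "k:M" "g:M" and *: "pr c k:el b & PC c g & le b g k"
  then obtain q where q: "q:el Q" "pr c k:el (bb q)" using lbf by blast
  have v: "valid (bb q) (ll q)" using CnD(2)[OF C(1)[OF q(1)]] .
  then obtain c' k' where "c':el (ll q)" "k':M" "PC c' k'" "pr c k = pr c' k'" using q(2) unfolding valid_def by blast
  then have ck: "c:el (ll q)" "PC c k" using c k by auto
  have "ft e:el (ll q)" if "e:el k" for e using PC_ft[OF ck(2) that] ck(1) Ord_trans[OF CnD(1)[OF C(1)[OF q(1)]]] by blast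
  then have "le (bb q) g k" using le_rs_b[of k "ll q" b g] rb[OF q(1)] * lbf by simp
  then have "pr c g:el (bb q)" using valid_open[OF v q(2)] * c k by auto
  then show "pr c g:el b" using q lbf by blast
 qed (use lbf in simp)
 have PCf: "PC l f" unfolding PC_def
 proof (intro conjI ballI impI)
  fix e assume "e:el f"
  then obtain q where q: "q:el Q" "e:el (ff q)" using lbf by blast
  then show "ft e:el l" "EX u:el (U (ft e)). e = pr (ft e) u" using CnD(3)[OF C(1)[OF q(1)]] subl[OF q(1)] unfolding PC_def by blast+
  fix e' assume "e':el f" and k: "key e = key e'"
  then obtain q' where q': "q':el Q" "e':el (ff q')" using lbf by blast
  show "e = e'" using ch[OF q(1) q'(1)] pureD(6) q q' PC_key[OF CnD(3)[OF C(1)[OF q(1)]]] PC_key[OF CnD(3)[OF C(1)[OF q'(1)]]] k by (metis subsetD)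
 next
  fix c assume c: "c:el l"
  have oc: "Ord c" using c ol Ord_in by blast
  show "lep (rs f (suc c)) (W c)"
  proof (cases "c:el m")
   case True
   then have s: "el (suc c) <= el m" using Ord_el_sub[OF Q(3)] by auto
   have "rs f (suc c) = rs (ff q0) (suc c)" using rf[OF Q(2)] rs_rs[of f m "suc c"] rs_rs[of "ff q0" m "suc c"] s lbf Q(3) by simp
   moreover have "lep (rs (ff q0) (suc c)) (W c)" using CnD(3)[OF C(1)[OF Q(2)]] C(2)[OF Q(2)] True unfolding PC_def by blast
   ultimately show ?thesis by simp
  next
   case False
   have mc: "el m <= el c" using Ord_not_in[OF Q(3) oc False] .
   have "lep (mk (UN q:el Q. el (rs (ff q) (suc c)))) (W c)"
   proof (rule lep_UN)
    show "lep Q (W c)" using lep_W_mono[OF Q(4,3) oc mc Q(1)] .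
    fix q assume q: "q:el Q"
    have "PC l (ff q)" using PC_mono[OF CnD(3)[OF C(1)[OF q]] CnD(1)[OF C(1)[OF q]] ol subl[OF q]] .
    then show "lep (rs (ff q) (suc c)) (W c)" using c unfolding PC_def by blast
   qed (use Q oc W_pairs in \<open>auto intro!: dfn\<close>)
   moreover have "(UN q:el Q. el (rs (ff q) (suc c))) = el (rs f (suc c))" using lbf oc by auto
   ultimately show ?thesis by (simp only: mk_el rs_in)
  qed
 qed (use lbf in simp)
 have Cu: "Cn (cn l b f)" using Cn_cn[OF ol v PCf] .
 have "pure (cn l b f) q m" if q: "q:el Q" for q
  unfolding pure_def using Cu C[OF q] subl[OF q] rb[OF q] rf[OF q] lbf q by auto
 then show ?thesis by (intro bexI[of _ "cn l b f"]) auto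
qed

lemma compat_un: assumes "Cn r" "Cn r'" "ll r = ll r'" "bb r = bb r'" "!!e e'. e:el (ff r) ==> e':el (ff r') ==> key e = key e' ==> e = e'"
 shows "EX w:M. lq w r & lq w r'"
proof -
 have "PC (ll r) (un (ff r) (ff r'))" using CnD(3)[OF assms(1)] CnD(3)[OF assms(2)] assms(3,5) CnD(1)[OF assms(1)] by (intro PC_un) auto
 then have C: "Cn (cn (ll r) (bb r) (un (ff r) (ff r')))" using CnD[OF assms(1)] by (intro Cn_cn)
 then show ?thesis using assms rs_bb[OF assms(1)] by (intro bexI[of _ "cn (ll r) (bb r) (un (ff r) (ff r'))"]) (auto simp: lq_def intro!: le_superset)
qed

lemma antichain_lep: assumes c: "Ord c" and Z: "Z:M" and P: "!!f. f:el Z ==> PC (suc c) f"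
 and inc: "!!f g. f:el Z ==> g:el Z ==> f ~= g ==> EX e:el f. EX e':el g. key e = key e' & e ~= e'"
 shows "lep Z (R c)"
proof (rule chain_condition[OF c Z, where k = key])
 fix f assume f: "f:el Z"
 have "rs f (suc c) = f" using PC_ft[OF P[OF f]] f by (intro rs_id) auto
 then show "lep f (W c)" using P[OF f] c unfolding PC_def by (metis OrdM el_suc insertI1)
 show "e = e'" if "e:el f" "e':el f" "key e = key e'" for e e' using PC_key[OF P[OF f]] that by blast
next
 fix e assume e: "e:el (UU Z)"
 have i: "isset {e':M. e':el (UU Z) & key e' = key e}" by (intro isset_sep dfn; simp)
 have form: "EX x:M. EX y:el (R c). e' = pr (ft e') (pr x y) & x = ft (sn e') & y = sn (sn e')" if e': "e':el (UU Z)" for e'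
 proof -
  obtain f where f: "f:el Z" "e':el f" using e' Z by auto
  then obtain u where u: "u:el (U (ft e'))" "e' = pr (ft e') u" and d: "ft e':el (suc c)" using P[OF f(1)] unfolding PC_def by blast
  then obtain x y where xy: "x:M" "y:el (R (ft e'))" "u = pr x y" unfolding U_def by auto
  have "el (R (ft e')) <= el (R c)"
  proof -
   have o: "Ord (ft e')" "el (ft e') <= el c" using d c Ord_in[OF Ord_suc[OF c] d] Ord_el_sub[OF c] by auto
   then show ?thesis unfolding R_def using V_mono[of "K (ft e')" "K c"] K_sub[OF o(1) c o(2)] c by auto
  qed
  moreover have "sn e' = u" using u by (metis elM op_in2(1) sn_pr)
  ultimately show ?thesis using xy u by auto
 qed
 show "lep (mk {e':M. e':el (UU Z) & key e' = key e}) (R c)"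
 proof (rule lepI[where f = "%e. sn (sn e)"])
  fix x assume "x:el (mk {e':M. e':el (UU Z) & key e' = key e})"
  then have x: "x:el (UU Z)" "key x = key e" unfolding el_mk[OF i] by auto
  then show "sn (sn x):el (R c)" using form[OF x(1)] by auto
  fix y assume "y:el (mk {e':M. e':el (UU Z) & key e' = key e})" and s: "sn (sn x) = sn (sn y)"
  then have y: "y:el (UU Z)" "key y = key e" unfolding el_mk[OF i] by auto
  have "ft x = ft y" "ft (sn x) = ft (sn y)" using x y unfolding key_def by auto
  then show "x = y" using form[OF x(1)] form[OF y(1)] s by metis
 qed (auto intro!: dfn)
qed (use inc in \<open>auto intro!: dfn\<close>)

text \<open>Below \<open>q\<close>, entering \<open>Q\<close> is controlled by the lower part of the
  forcing: \<open>Z\<close> is predense below \<open>q\<close>, and each of its members together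
  with \<open>q\<close> leads into \<open>Q\<close>. The bound \<open>R c\<close> on the size of
  \<open>Z\<close> comes from the chain condition.\<close>

definition meets where "meets q p c Q <-> (EX Z:M. lep Z (R c) &
 (ALL r:el Z. Cn r & ll r = suc c & bb r = rs (bb p) (suc c) & (EX u:M. Q u & (ALL w. lq w q & lq w r --> lq w u))) &
 (ALL w. lq w q --> (EX r:el Z. EX w':M. lq w' w & lq w' r)))"

text \<open>The lower part of the forcing has the chain condition and the upper part is closed: thus a family of dense
 classes can be met by a pure extension together with small antichains of the lower part.\<close>

lemma fusion: assumes c: "Ord c" and p: "Cn p" "el (suc c) <= el (ll p)" and X: "X:M" "lep X (R c)"
 and Qd: "D M (%v. Q (v 0) (v 1))" and Qo: "!!x s t. x:el X ==> Q x s ==> lq t s ==> Q x t"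
 and Qe: "!!x s. x:el X ==> lq s p ==> EX t:M. lq t s & Q x t"
 shows "EX q:M. pure q p (suc c) & (ALL x:el X. meets q p c (Q x))"
proof -
 define m where "m = suc c"
 have m: "Ord m" "m:M" "el m <= el (ll p)" using c p by (auto simp: m_def)
 have pM: "p:M" using p by simp
 have WR: "W m = R c" unfolding m_def by (rule W_suc[OF c])
 have Qdd: "Tm M s ==> Tm M t ==> D M (%v. Q (s v) (t v))" for s t using D2[OF _ _ Qd] .
 \<comment> \<open>A step of the construction is coded as a triple: an index from \<open>X\<close>,
   a lower condition, and the pure extension reached so far.\<close>
 define xo ro qo where "xo y = ft y" and "ro y = ft (sn y)" and "qo y = sn (sn y)" for y
 have od: "Tm A s ==> Tm A (%v. xo (s v))" "Tm A s ==> Tm A (%v. ro (s v))" "Tm A s ==> Tm A (%v. qo (s v))" for A s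
  unfolding xo_def ro_def qo_def by (intro dfn; assumption)+
 have oM [simp]: "xo y:M" "ro y:M" "qo y:M" for y by (auto simp: xo_def ro_def qo_def)
 define ok where "ok y <-> xo y:el X & pure (qo y) p m & lq (ro y) (cut p m) & ll (ro y) = m & Q (xo y) (ji (ro y) (qo y))" for y
 define inc where "inc y z <-> (xo y = xo z --> ~ (EX w:M. lq w (ro z) & lq w (ro y)))" for y z
 define RR where "RR i g y <-> ok y & (ALL j:el i. pure (qo y) (qo (app g j)) m & inc (app g j) y)" for i g y
 have okd: "Tm M s ==> D M (%v. ok (s v))" for s
  by (rule D1[where Q = ok]; (assumption | (unfold ok_def, intro dfn od Qdd; simp add: X m pM)))
 have incd: "Tm M s ==> Tm M t ==> D M (%v. inc (s v) (t v))" for s t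
  by (rule D2[where Q = inc]; (assumption | (unfold inc_def, intro dfn od)))
 have RRd: "D M (%v. RR (v 0) (v 1) (v 2))" unfolding RR_def by (intro dfn od okd incd; simp add: m)
 have br: "bb (ro y) = rs (bb p) m" if "ok y" for y
 proof -
  have "lq (ro y) (cut p m)" "ll (ro y) = m" using that unfolding ok_def by auto
  then show ?thesis using lqD(4)[of "ro y" "cut p m"] cut_big[OF p(1) m(2,3)] rs_bb[OF lqD(1)] m by (metis parts_cn(1,2) rs_in)
 qed
 have okC: "Cn (ro y)" if "ok y" for y using that lqD(1) unfolding ok_def by blast
 have keys: "EX e:el (ff (ro y)). EX e':el (ff (ro z)). key e = key e' & e ~= e'" if "ok y" "ok z" "xo y = xo z" "inc y z | inc z y" for y z
 proof (rule ccontr)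
  assume "~  ?thesis"
  then have "EX w:M. lq w (ro y) & lq w (ro z)" using that okC br unfolding ok_def by (intro compat_un) auto
  then show False using that unfolding inc_def by auto
 qed
 \<comment> \<open>The construction stops before \<open>K m\<close>. Otherwise its steps would be
   split by their index from \<open>X\<close> into at most \<open>R c\<close> many antichains of
   lower conditions, each of size at most \<open>R c\<close>; then \<open>K m\<close> would embed in
   \<open>W m = R c\<close>, against its being the Hartogs number.\<close>
 have "EX i:el (K m). EX g:M. g = lam i (app g) & (ALL j:el i. RR j (lam j (app g)) (app g j)) & ~ (EX z:M. RR i g z)"
 proof (rule ccontr)
  assume no: "~  ?thesis"
  have "EX g:M. g = lam (K m) (app g) & (ALL y:el (K m). RR y (lam y (app g)) (app g y))"
  proof (rule dependent_choice[OF _ RRd])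
   fix x g assume "x:el (K m)" "g:M" "g = lam x (app g)" "!!y. y:el x ==> RR y (lam y (app g)) (app g y)"
   then show "EX z:M. RR x g z" using no by blast
  qed (use m in simp)
  then obtain g where g: "g:M" "!!j. j:el (K m) ==> RR j (lam j (app g)) (app g j)" by blast
  have ok: "ok (app g j)" if "j:el (K m)" for j using g(2)[OF that] unfolding RR_def by blast
  have oK: "Ord (K m)" using m by simp
  have i1: "inc (app g j) (app g j')" if "j':el (K m)" "j:el j'" for j j'
  proof -
   have "app (lam j' (app g)) j = app g j" using that g(1) by (intro app_lam dfn) auto
   then show ?thesis using g(2)[OF that(1)] that(2) unfolding RR_def by metis
  qed
  have i2: "inc (app g j) (app g j') | inc (app g j') (app g j)" if "j:el (K m)" "j':el (K m)" "j ~= j'" for j j'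
   using Ord_linear[of j j'] Ord_in[OF oK] that i1 by blast
  have kj: "EX e:el (ff (ro (app g j))). EX e':el (ff (ro (app g j'))). key e = key e' & e ~= e'"
   if "j:el (K m)" "j':el (K m)" "j ~= j'" "xo (app g j) = xo (app g j')" for j j'
   using keys[OF ok[OF that(1)] ok[OF that(2)] that(4) i2[OF that(1-3)]] .
  have PCj: "PC m (ff (ro (app g j)))" if "j:el (K m)" for j using CnD(3)[OF okC[OF ok[OF that]]] ok[OF that] unfolding ok_def by simp
  define J where "J x = mk {j:M. j:el (K m) & xo (app g j) = x}" for x
  have Jd: "Tm M (%v. J (v 0))" unfolding J_def using g(1) by (intro dfn od; simp)
  have J: "el (J x) = {j:M. j:el (K m) & xo (app g j) = x}" if "x:M" for x
   unfolding J_def using that g(1) by (intro el_mk isset_sep dfn od; simp)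
  have JM: "J x:M" for x by (simp add: J_def)
  have "lep (J x) (R c)" if x: "x:el X" for x
  proof -
   define Z where "Z = mk ((%j. ff (ro (app g j))) ` el (J x))"
   have iZ: "isset ((%j. ff (ro (app g j))) ` el (J x))" using JM[of x] g(1) by (intro isset_image dfn od)
   have "lep (J x) Z" unfolding Z_def
   proof (rule lepI[OF JM, where f = "%j. ff (ro (app g j))"])
    fix j j' assume "j:el (J x)" "j':el (J x)" "ff (ro (app g j)) = ff (ro (app g j'))"
    then show "j = j'" using kj[of j j'] PC_key[OF PCj[of j]] x by (auto simp: J)
   qed (use iZ g(1) in \<open>auto intro!: dfn od\<close>)
   moreover have "lep Z (R c)"
   proof (rule antichain_lep[OF c])
    fix f assume "f:el Z"
    then obtain j where j: "j:el (J x)" "f = ff (ro (app g j))" using iZ by (auto simp: Z_def)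
    then show "PC (suc c) f" using PCj[of j] x by (auto simp: J m_def)
    fix h assume "h:el Z" "f ~= h"
    then obtain j' where j': "j':el (J x)" "h = ff (ro (app g j'))" using iZ by (auto simp: Z_def)
    then have "j ~= j'" using \<open>f ~= h\<close> j by blast
    then show "EX e:el f. EX e':el h. key e = key e' & e ~= e'" using kj[of j j'] j j' x by (auto simp: J)
   qed (simp add: Z_def)
   ultimately show ?thesis using lep_trans[OF JM] by blast
  qed
  then have "lep (mk (UN x:el X. el (J x))) (R c)" using X R_pairs[OF c] by (intro lep_UN Jd) auto
  moreover have "el (K m) = (UN x:el X. el (J x))"
  proof -
   have "j:el (J (xo (app g j)))" "xo (app g j):el X" if "j:el (K m)" for j using that ok[OF that] J unfolding ok_def by auto
   moreover have "el (J x) <= el (K m)" if "x:el X" for x using J[of x] that by auto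
   ultimately show ?thesis by blast
  qed
  ultimately have "lep (K m) (W m)" unfolding WR by (metis KWR_in(1) mk_el)
  then show False using not_lep_har[of "W m"] K_eq m by simp
 qed
 then obtain i g where i: "i:el (K m)" and g: "g:M" "g = lam i (app g)" "!!j. j:el i ==> RR j (lam j (app g)) (app g j)"
  and stuck: "!!z. z:M ==> ~ RR i g z" by blast
 have oi: "Ord i" "i:M" using Ord_in[OF Ord_K i] m by auto
 have ok: "ok (app g j)" if "j:el i" for j using g(3)[OF that] unfolding RR_def by blast
 have pj: "pure (qo (app g j')) (qo (app g j)) m" if "j':el i" "j:el j'" for j j'
 proof -
  have "app (lam j' (app g)) j = app g j" using that g(1) by (intro app_lam dfn) auto
  then show ?thesis using g(3)[OF that(1)] that(2) unfolding RR_def by metis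
 qed
 have iQ: "isset ((%j. qo (app g j)) ` el i)" using oi g(1) by (intro isset_image dfn od)
 define QQ where "QQ = un (up p p) (mk ((%j. qo (app g j)) ` el i))"
 have QQ: "el QQ = insert p ((%j. qo (app g j)) ` el i)" "QQ:M" using iQ pM by (auto simp: QQ_def)
 have "EX u:M. ALL q:el QQ. pure u q m"
 proof (rule chain_union[OF QQ(2) _ m(1)])
  show "p:el QQ" using QQ by simp
  have "lep (mk ((%j. qo (app g j)) ` el i)) (W m)"
   using lep_trans[OF mk_in lep_image[OF oi(2) od(3)[OF Tm_appM[OF g(1)]]] K_lep_W[OF m(1) i]] .
  moreover have "lep (up p p) (W m)"
  proof (rule lepI[where f = "%x. emp"])
   show "emp:el (W m)" using m by (auto simp: el_W lev_def intro!: bexI[of _ om])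
  qed (use pM in \<open>auto intro!: dfn\<close>)
  ultimately show "lep QQ (W m)" unfolding QQ_def using W_pairs[OF m(1)] W_two[OF m(1)] by (intro lep_un) auto
  fix q q' assume "q:el QQ" "q':el QQ"
  moreover have "pure (qo (app g j)) p m" if "j:el i" for j using ok[OF that] unfolding ok_def by blast
  moreover have "pure (qo (app g j)) (qo (app g j')) m | pure (qo (app g j')) (qo (app g j)) m" if "j:el i" "j':el i" for j j'
   using Ord_linear[of j j'] Ord_in[OF oi(1)] that pj pure_refl[of "qo (app g j)" m] ok[OF that(1)] pureD(1,8) unfolding ok_def by metis
  ultimately show "pure q q' m | pure q' q m" using pure_refl[OF p(1) m(3)] unfolding QQ by auto
 qed
 then obtain q where q: "q:M" "pure q p m" "!!j. j:el i ==> pure q (qo (app g j)) m" unfolding QQ by blast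
 have qc: "cut q m = cut p m" using pure_cut[OF q(2) m(1)] .
 have "EX Z:M. lep Z (R c) & (ALL r:el Z. Cn r & ll r = m & bb r = rs (bb p) m & (EX u:M. Q x u & (ALL w. lq w q & lq w r --> lq w u))) &
  (ALL w. lq w q --> (EX r:el Z. EX w':M. lq w' w & lq w' r))" if x: "x:el X" for x
 proof -
  define J where "J = mk {j:M. j:el i & xo (app g j) = x}"
  have J: "el J = {j:M. j:el i & xo (app g j) = x}" "J:M"
   unfolding J_def using x g(1) oi by (auto intro!: el_mk isset_sep dfn od)
  define Z where "Z = mk ((%j. ro (app g j)) ` el J)"
  have iZ: "isset ((%j. ro (app g j)) ` el J)" using J g(1) by (intro isset_image dfn od)
  have Z: "el Z = (%j. ro (app g j)) ` el J" "Z:M" using iZ by (auto simp: Z_def)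
  have "lep Z J" unfolding Z_def using J g(1) by (intro lep_image dfn od)
  moreover have "lep J i" using J by (intro lep_sub) auto
  ultimately have "lep Z (R c)" using lep_trans Z(2) J(2) oi(2) K_lep_W[OF m(1) i] WR by metis
  moreover have "Cn r & ll r = m & bb r = rs (bb p) m & (EX u:M. Q x u & (ALL w. lq w q & lq w r --> lq w u))" if r: "r:el Z" for r
  proof -
   obtain j where j: "j:el i" "xo (app g j) = x" "r = ro (app g j)" using r Z J by auto
   note o = ok[OF j(1), unfolded ok_def]
   have "lq w (ji r (qo (app g j)))" if "lq w q" "lq w r" for w
   proof (rule ji(4))
    show "Cn (qo (app g j))" "el (ll r) <= el (ll (qo (app g j)))" using o j pureD(1,8)[of "qo (app g j)" p m] by simp_all
    have "cut (qo (app g j)) m = cut p m" using o pure_cut m(1) by blast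
    then show "lq r (cut (qo (app g j)) (ll r))" using o j by simp
    show "lq w (qo (app g j))" using lq_trans[OF that(1) pure_lq[OF q(3)[OF j(1)]]] .
   qed (rule that(2))
   then show ?thesis using o j okC[OF ok[OF j(1)]] br[OF ok[OF j(1)]] by (intro conjI bexI[of _ "ji r (qo (app g j))"]) auto
  qed
  moreover have "EX r:el Z. EX w':M. lq w' w & lq w' r" if w: "lq w q" for w
  proof (rule ccontr)
   assume no: "~  ?thesis"
   \<comment> \<open>If \<open>w\<close> were incompatible with all chosen lower conditions, joining
     its lower part with \<open>q\<close>, extending into \<open>Q x\<close> and splitting the
     result by \<open>merge\<close> would yield one more step, although none is possible.\<close>
   define r0 where "r0 = cut w m"
   have mq: "el m <= el (ll q)" "Cn q" using pureD[OF q(2)] by auto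
   have wC: "Cn w" "el m <= el (ll w)" using lqD[OF w] mq by auto
   have r0: "ll r0 = m" "lq r0 (cut q m)" unfolding r0_def using cut_big[OF wC(1) m(2) wC(2)] m(2) cut_mono[OF w m(1)] by auto
   have j0: "lq (ji r0 q) q" using ji(2)[OF mq(2), of r0] r0 mq by simp
   have "lq (ji r0 q) p" using lq_trans[OF j0 pure_lq[OF q(2)]] .
   then obtain t where t: "lq t (ji r0 q)" "Q x t" using Qe[OF x] by blast
   obtain r' q' where rq: "pure q' q m" "lq r' r0" "ll r' = m" "lq r' (cut q' m)" "lq (ji r' q') t"
    using merge[OF mq(2) m(1) mq(1) r0(2,1) t(1)] by blast
   define y where "y = pr x (pr r' q')"
   have rM: "r':M" "q':M" "x:M" using lqD(1)[OF rq(2)] pureD(1)[OF rq(1)] x by auto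
   then have y: "xo y = x" "ro y = r'" "qo y = q'" "y:M" by (auto simp: y_def xo_def ro_def qo_def)
   have "ok y" unfolding ok_def y using x rq pure_trans[OF rq(1) q(2)] pure_cut[OF rq(1) m(1)] qc Qo[OF x t(2) rq(5)] by simp
   moreover have "inc (app g j) y" if j: "j:el i" for j
    unfolding inc_def y
   proof (intro impI notI)
    assume xj: "xo (app g j) = x" and "EX w:M. lq w r' & lq w (ro (app g j))"
    then obtain s where s: "lq s r'" "lq s (ro (app g j))" by blast
    have rj: "ll (ro (app g j)) = m" "ro (app g j):el Z" using ok[OF j] Z J j xj unfolding ok_def by auto
    have s1: "lq (cut s m) r0" "lq (cut s m) (ro (app g j))" using cut_lq[OF lq_trans[OF s(1) rq(2)] m(1)] cut_lq[OF s(2) m(1)] r0 rj by auto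
    then obtain s2 where s2: "s2:M" "lq s2 w" "lq s2 (cut s m)" using amalgam[OF wC(1) m(1), of "cut s m"] ll_cut[OF lqD(1)[OF s(1)] m(1)] unfolding r0_def by blast
    then show False using no rj lq_trans[OF s2(3) s1(2)] by blast
   qed
   moreover have "pure q' (qo (app g j)) m" if "j:el i" for j using pure_trans[OF rq(1) q(3)[OF that]] .
   ultimately have "RR i g y" unfolding RR_def y by blast
   then show False using stuck y by blast
  qed
  ultimately show ?thesis using Z(2) by blast
 qed
 then show ?thesis unfolding meets_def m_def[symmetric] using q by blast
qed

end

section \<open>The forcing relation for atomic formulas\<close>

context zfc
begin

lemma pd_mem: "a:el X ==> b:el Y ==> X:M ==> Y:M ==> pr a b:el (pd X Y)"
 by auto

text \<open>Bounded length leaves only a set of conditions. This reduces atomic forcing from classes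
  to sets.\<close>

lemma isset_Pl: assumes "Ord l" shows "isset {p:M. Cn p & el (ll p) <= el l}"
proof -
 have i: "isset (UN c:el l. el (pd (up c c) (U c)))" using assms by (intro isset_UN dfn; simp)
 define B where "B = mk {f:M. PC l f}"
 have B: "el B = {f:M. PC l f}" unfolding B_def
 proof (intro el_mk issetI[of "pw (mk (UN c:el l. el (pd (up c c) (U c))))"])
  fix f assume f: "f:M" "PC l f"
  have "e:(UN c:el l. el (pd (up c c) (U c)))" if "e:el f" for e
  proof -
   have "ft e:el l" "EX u:el (U (ft e)). e = pr (ft e) u" using f that unfolding PC_def by blast+
   then show ?thesis using that by (intro UN_I[of "ft e"]) auto
  qed
  then show "f:el (pw (mk (UN c:el l. el (pd (up c c) (U c)))))" using f i by auto
 qed (use assms in \<open>auto intro!: dfn\<close>)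
 have BM: "B:M" by (simp add: B_def)
 show ?thesis
 proof (rule issetI[of "pd (suc l) (pd (pw (pd l B)) B)"])
  fix p assume p: "p:M" "Cn p & el (ll p) <= el l"
  then have C: "Cn p" and s: "el (ll p) <= el l" by auto
  note c = CnD[OF C]
  have "ll p:el (suc l)" using Ord_sub[OF c(1) assms s] assms by auto
  moreover have "ff p:el B" using B PC_mono[OF c(3,1) assms s] by simp
  moreover have "z:el (pd l B)" if "z:el (bb p)" for z
  proof -
   obtain d g where d: "d:el (ll p)" "g:M" "PC d g" "z = pr d g" using c(2) \<open>z : el (bb p)\<close> unfolding valid_def by blast
   have "PC l g" using PC_mono[OF d(3) Ord_in[OF c(1) d(1)] assms] Ord_el_sub[OF c(1) d(1)] s by blast
   then show ?thesis using d s B BM assms by auto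
  qed
  moreover then have "bb p:el (pw (pd l B))" unfolding el_pw[OF op_in2(3)] using parts_in(2)[of p] by blast
  ultimately have "pr (ll p) (pr (bb p) (ff p)):el (pd (suc l) (pd (pw (pd l B)) B))" using BM assms by (intro pd_mem) simp_all
  then show "p:el (pd (suc l) (pd (pw (pd l B)) B))" using c(4) unfolding cn_def by simp
 qed (use assms in \<open>auto intro!: dfn\<close>)
qed

definition Nm where "Nm x <-> x:M & (EX t:M. x:el t & (ALL y:el t. ALL z:el y. EX s:el t. EX p:M. Cn p & z = pr s p))"
definition BN where "BN l x <-> x:M & (EX t:M. x:el t & (ALL y:el t. ALL z:el y. EX s:el t. EX p:M. (Cn p & el (ll p) <= el l) & z = pr s p))"
lemma D_Nm [dfn]: "Tm A s ==> D A (%v. Nm (s v))"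
 by (rule D1[where Q = Nm]; (assumption | (unfold Nm_def, intro dfn)))
lemma D_BN [dfn]: "Tm A s ==> Tm A t ==> D A (%v. BN (s v) (t v))"
 by (rule D2[where Q = BN]; (assumption | (unfold BN_def, intro dfn)))
lemma Nm_M [simp]: "Nm x ==> x:M"
 by (simp add: Nm_def)
lemma Nm_z: "Nm x ==> z:el x ==> EX s p. Nm s & Cn p & z = pr s p"
 unfolding Nm_def by (metis elM)
lemma Nm_entry: "Nm x ==> pr s p:el x ==> s:M ==> p:M ==> Nm s & Cn p"
 using Nm_z[of x "pr s p"] by auto
lemma BN_M [simp]: "BN l x ==> x:M"
 by (simp add: BN_def)
lemma BN_z: "BN l x ==> z:el x ==> EX s p. BN l s & Cn p & el (ll p) <= el l & z = pr s p"
 unfolding BN_def by (metis elM)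
lemma BN_entry: "BN l x ==> pr s p:el x ==> s:M ==> p:M ==> BN l s & Cn p & el (ll p) <= el l"
 using BN_z[of l x "pr s p"] by auto
lemma BN_mono: "BN l x ==> el l <= el l' ==> BN l' x"
 unfolding BN_def by (meson subset_trans)
lemma tra_pr: "tra t ==> pr s p:el t ==> s:M ==> p:M ==> s:el t & p:el t"
proof -
 assume a: "tra t" "pr s p:el t" "s:M" "p:M"
 have "up s p:el (pr s p)" "s:el (up s p)" "p:el (up s p)" using a by (auto simp: pr_def)
 then show ?thesis using a unfolding tra_def by blast
qed
lemma rk_pr: "s:M ==> p:M ==> rk s:el (rk (pr s p)) & rk p:el (rk (pr s p))"
proof -
 assume a: "s:M" "p:M"
 have "up s p:el (pr s p)" "s:el (up s p)" "p:el (up s p)" using a by (auto simp: pr_def)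
 then show ?thesis using rk_mem Ord_trans[OF Ord_rk] op_in by meson
qed
lemma rk_entry: "x:M ==> pr s p:el x ==> s:M ==> p:M ==> rk s:el (rk x) & rk p:el (rk x)"
 using rk_pr rk_mem Ord_trans[OF Ord_rk] by meson

lemma Nm_BN: assumes "Nm x" shows "EX l. Ord l & BN l x"
proof -
 obtain t where t: "t:M" "x:el t" "ALL y:el t. ALL z:el y. EX s:el t. EX p:M. Cn p & z = pr s p" using assms unfolding Nm_def by blast
 have "el (ll p) <= el (rk t)" if "y:el t" "pr s p:el y" "Cn p" "s:M" for y s p
 proof -
  have p: "p = pr (ll p) (pr (bb p) (ff p))" using CnD(4)[OF that(3)] by (simp add: cn_def)
  have "rk (ll p):el (rk p)" using rk_pr[of "ll p" "pr (bb p) (ff p)"] p by simp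
  then have "rk (ll p):el (rk t)" using rk_entry[of y s p] that t rk_mem[OF t(1) that(1)] Ord_trans[OF Ord_rk] by (metis Cn_M elM)
  then show ?thesis using rk_Ord[OF CnD(1)[OF that(3)]] Ord_el_sub[OF Ord_rk[OF t(1)]] by simp
 qed
 then have "ALL y:el t. ALL z:el y. EX s:el t. EX p:M. (Cn p & el (ll p) <= el (rk t)) & z = pr s p" using t(3) by (metis elM)
 then show ?thesis using t assms unfolding BN_def by (intro exI[of _ "rk t"]) auto
qed
lemma Nm_BN2: assumes "Nm x" "Nm y" shows "EX l. Ord l & BN l x & BN l y"
proof -
 obtain l l' where l: "Ord l" "BN l x" "Ord l'" "BN l' y" using Nm_BN assms by blast
 then have "el l <= el l' | el l' <= el l" using Ord_linear[of l l'] Ord_sub_iff by blast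
 then show ?thesis using l BN_mono by blast
qed

lemma NmI: assumes "x:M" "!!z. z:el x ==> EX s p. Nm s & Cn p & z = pr s p" shows "Nm x"
proof -
 obtain t where t: "t:M" "tra t" "x:el t" using hull assms(1) by blast
 define T where "T = mk {y:M. y:el t & (Nm y | y = x)}"
 have T: "el T = {y:M. y:el t & (Nm y | y = x)}" unfolding T_def using t assms by (intro el_mk isset_sep dfn)
 have "EX s:el T. EX p:M. Cn p & z = pr s p" if y: "y:el T" and z: "z:el y" for y z
 proof -
  obtain s p where s: "Nm s" "Cn p" "z = pr s p" using y z Nm_z assms(2) unfolding T by blast
  have "z:el t" using t y z unfolding T tra_def by blast
  then have "s:el t" using tra_pr[OF t(2), of s p] s by simp
  then show ?thesis using s unfolding T by (auto intro!: bexI[of _ s] bexI[of _ p])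
 qed
 moreover have "x:el T" using T t assms by simp
 moreover have "T:M" by (simp add: T_def)
 ultimately show ?thesis unfolding Nm_def using assms(1) by blast
qed

lemma Nm_induct: assumes "Nm x" "D M (%v. Q (v 0))" "!!x. Nm x ==> (!!s p. pr s p:el x ==> Nm s ==> Cn p ==> Q s) ==> Q x" shows "Q x"
proof -
 have Qd: "Tm M s ==> D M (%v. Q (s v))" for s using D1[OF _ assms(2)] .
 have "ALL x:M. Nm x & rk x = a --> Q x" if "Ord a" for a
 proof (rule Ord_induct[OF that])
  show "D M (%v. ALL x:M. Nm x & rk x = v 0 --> Q x)" by (intro dfn Qd)
  fix a assume a: "Ord a" and IH: "!!b. b:el a ==> ALL x:M. Nm x & rk x = b --> Q x"
  show "ALL x:M. Nm x & rk x = a --> Q x"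
  proof (intro ballI impI)
   fix x assume x: "x:M" "Nm x & rk x = a"
   show "Q x"
   proof (rule assms(3))
    fix s p assume s: "pr s p:el x" "Nm s" "Cn p"
    then have "rk s:el a" using rk_entry[OF x(1) s(1)] x by simp
    then show "Q s" using IH s by auto
   qed (use x in simp)
  qed
 qed
 from this[of "rk x"] show ?thesis using assms(1) by simp
qed

definition tri where "tri p s t = pr p (pr s t)"
lemma dfn_tri [dfn]: "Tm A s ==> Tm A t ==> Tm A u ==> Tm A (%v. tri (s v) (t v) (u v))"
 unfolding tri_def by (intro dfn)

text \<open>\<open>memS\<close> and \<open>subS\<close> are the forcing clauses for membership and
  inclusion relative to a candidate set \<open>Y\<close> of triples and to conditions of length at
  most \<open>l\<close>. \<open>pfx\<close> makes \<open>Y\<close> a post-fixed point of these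
  clauses, and \<open>F\<close> is the union of all of them: a greatest fixed point that is
  definable because only sets are quantified over.\<close>

definition memS where "memS l Y p s t <-> (ALL p':M. lq p' p & el (ll p') <= el l -->
 (EX u:M. lq u p' & el (ll u) <= el l & (EX x:M. EX q:M. pr x q:el t & lq u q & tri u s x:el Y)))"
definition subS where "subS l Y p s t <-> (ALL x:M. ALL q:M. ALL u:M. pr x q:el s & lq u p & lq u q & el (ll u) <= el l --> memS l Y u x t)"
definition pfx where "pfx l Y <-> (ALL p:M. ALL s:M. ALL t:M. tri p s t:el Y --> Cn p & el (ll p) <= el l & BN l s & BN l t &
 subS l Y p s t & subS l Y p t s & (ALL q:M. lq q p & el (ll q) <= el l --> tri q s t:el Y))"
definition F where "F p s t <-> Cn p & Nm s & Nm t & (EX l:M. EX Y:M. Ord l & BN l s & BN l t & pfx l Y & tri (cut p l) s t:el Y)"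
definition memF where "memF Q p s t <-> (ALL p':M. lq p' p --> (EX u:M. lq u p' & (EX x:M. EX q:M. pr x q:el t & lq u q & Q u s x)))"
definition subF where "subF Q p s t <-> (ALL x:M. ALL q:M. ALL u:M. pr x q:el s & lq u p & lq u q --> memF Q u x t)"

lemma D_pfx [dfn]: "Tm A s ==> Tm A t ==> D A (%v. pfx (s v) (t v))"
 by (rule D2[where Q = pfx]; (assumption | (unfold pfx_def memS_def subS_def, intro dfn)))
lemma D_F [dfn]: "Tm A s ==> Tm A t ==> Tm A u ==> D A (%v. F (s v) (t v) (u v))"
 by (rule D3[where Q = F]; (assumption | (unfold F_def, intro dfn)))
lemma D_memF: assumes "Tm A s" "Tm A t" "Tm A u" "!!s t u. Tm A s ==> Tm A t ==> Tm A u ==> D A (%v. Q (s v) (t v) (u v))" shows "D A (%v. memF Q (s v) (t v) (u v))"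
 by (rule D3[where Q = "memF Q", OF assms(1-3)]) (unfold memF_def, intro dfn assms(4))
lemma D_subF: assumes "Tm A s" "Tm A t" "Tm A u" "!!s t u. Tm A s ==> Tm A t ==> Tm A u ==> D A (%v. Q (s v) (t v) (u v))" shows "D A (%v. subF Q (s v) (t v) (u v))"
 by (rule D3[where Q = "subF Q", OF assms(1-3)]) (unfold subF_def, intro dfn D_memF[OF _ _ _ assms(4)])
lemma memF_mono: "memF Q p s t ==> lq p' p ==> memF Q p' s t"
 unfolding memF_def using lq_trans by blast
lemma subF_mono: "subF Q p s t ==> lq p' p ==> subF Q p' s t"
 unfolding subF_def using lq_trans by blast

lemma F_D: assumes "F p s t" shows "Cn p" "Nm s" "Nm t"
 using assms unfolding F_def by auto

text \<open>Conditions of arbitrary length are cut at \<open>l\<close> in order to consult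
  \<open>Y\<close>, and the condition found there is lifted back by \<open>amalgam\<close>.\<close>

lemma F_post: assumes "F p s t" shows "subF F p s t & subF F p t s"
proof -
 obtain l Y where Y: "l:M" "Y:M" "Ord l" "pfx l Y" "tri (cut p l) s t:el Y" and C: "Cn p" "Nm s" "Nm t" using assms unfolding F_def by blast
 have pf: "Cn p & el (ll p) <= el l & BN l s & BN l t & subS l Y p s t & subS l Y p t s & (ALL q:M. lq q p & el (ll q) <= el l --> tri q s t:el Y)"
  if "tri p s t:el Y" "p:M" "s:M" "t:M" for p s t using Y(4) that unfolding pfx_def by blast
 have *: "subF F p s t" if "subS l Y (cut p l) s t" "BN l s" "BN l t" "Nm s" "Nm t" for s t
  unfolding subF_def memF_def
 proof (intro ballI impI)
  fix x q u p' assume xq: "x:M" "q:M" "u:M" "pr x q:el s & lq u p & lq u q" and p': "p':M" "lq p' u"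
  have q: "BN l x" "Cn q" "el (ll q) <= el l" "Nm x" using BN_entry[OF that(2)] Nm_entry[OF that(4)] xq by auto
  have "lq (cut p' l) (cut u l)" "lq (cut u l) (cut p l)" "lq (cut u l) q" using cut_mono p' xq Y(3) cut_lq[OF _ Y(3) q(3)] by auto
  moreover have "el (ll (cut u l)) <= el l" "el (ll (cut p' l)) <= el l" using ll_cut[OF _ Y(3)] lqD(1) p' xq by auto
  ultimately have "memS l Y (cut u l) x t" using that(1) xq(1,2,4) unfolding subS_def by (meson cut_in)
  then obtain w y q' where w: "w:M" "lq w (cut p' l)" "el (ll w) <= el l" "y:M" "q':M" "pr y q':el t" "lq w q'" "tri w x y:el Y"
   using \<open>lq (cut p' l) (cut u l)\<close> \<open>el (ll (cut p' l)) <= el l\<close> unfolding memS_def by (meson cut_in)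
  obtain w' where w': "w':M" "lq w' p'" "lq w' w" using amalgam[OF lqD(1)[OF p'(2)] Y(3) w(2,3)] by blast
  have y: "BN l y" "Nm y" using BN_entry[OF that(3) w(6)] Nm_entry[OF that(5) w(6)] w by auto
  have "tri (cut w' l) x y:el Y" using pf[OF w(8,1) xq(1) w(4)] cut_lq[OF w'(3) Y(3) w(3)] ll_cut[OF lqD(1)[OF w'(2)] Y(3)] by simp
  then have "F w' x y" unfolding F_def using Y q y lqD(1)[OF w'(2)] by blast
  then show "EX u:M. lq u p' & (EX xa:M. EX q:M. pr xa q:el t & lq u q & F u x xa)" using w w' lq_trans by blast
 qed
 show ?thesis using *[of s t] *[of t s] pf[OF Y(5)] C by simp
qed

text \<open>Coinduction for definable classes. The class \<open>Q\<close> is turned into a set by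
  restricting it to conditions of length at most \<open>l\<close> and to names in a transitive set
  around \<open>s\<close> and \<open>t\<close>.\<close>

lemma F_coinduct: assumes Q: "Q p s t" and Qd: "D M (%v. Q (v 0) (v 1) (v 2))" and Q1: "!!p s t. Q p s t ==> Cn p & Nm s & Nm t"
 and Qm: "!!p q s t. Q p s t ==> lq q p ==> Q q s t" and Qp: "!!p s t. Q p s t ==> subF Q p s t & subF Q p t s"
 shows "F p s t"
proof -
 note N = Q1[OF Q]
 obtain l where l: "Ord l" "BN l s" "BN l t" using Nm_BN2 N by blast
 obtain T where T: "T:M" "tra T" "pr s t:el T" using hull[OF op_in(7)] by blast
 have sT: "s:el T" "t:el T" using tra_pr[OF T(2,3)] N by auto
 have Qdd: "Tm M s ==> Tm M t ==> Tm M u ==> D M (%v. Q (s v) (t v) (u v))" for s t u using D3[OF _ _ _ Qd] .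
 \<comment> \<open>A cut of a condition in \<open>Q\<close> need not be in \<open>Q\<close> itself.
   The demand that every bounded extension has a further extension of any length in \<open>Q\<close>
   does survive the cut, by \<open>amalgam\<close>.\<close>
 define B where "B u x y <-> (Cn u & el (ll u) <= el l) & x:el T & y:el T & BN l x & BN l y & Nm x & Nm y &
  (ALL u':M. lq u' u & el (ll u') <= el l --> (EX w:M. lq w u' & Q w x y))" for u x y
 define Y where "Y = mk {z:M. EX u:M. EX x:M. EX y:M. z = tri u x y & B u x y}"
 have Y: "el Y = {z:M. EX u:M. EX x:M. EX y:M. z = tri u x y & B u x y}" unfolding Y_def
  by (intro el_mk issetI[of "pd (mk {p:M. Cn p & el (ll p) <= el l}) (pd T T)"])
   (use T l isset_Pl[OF l(1)] in \<open>auto simp: B_def tri_def intro!: dfn Qdd\<close>)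
 have Yt: "tri u x y:el Y <-> B u x y" if "u:M" "x:M" "y:M" for u x y unfolding Y using that by (auto simp: tri_def)
 have YM: "Y:M" by (simp add: Y_def)
 have sub: "subS l Y u x y" if Bu: "B u x y | B u y x" for u x y
  unfolding subS_def memS_def
 proof (intro ballI impI)
  fix x1 q u1 p' assume x1: "x1:M" "q:M" "u1:M" "pr x1 q:el x & lq u1 u & lq u1 q & el (ll u1) <= el l"
   and p': "p':M" "lq p' u1 & el (ll p') <= el l"
  have xy: "x:el T" "y:el T" "BN l x" "BN l y" "Nm x" "Nm y" using Bu unfolding B_def by auto
  have "lq p' u" using lq_trans p' x1 by blast
  then obtain w where w: "w:M" "lq w p'" "Q w x y | Q w y x" using Bu p' unfolding B_def by blast
  then have "subF Q w x y" using Qp by blast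
  moreover have "lq w q" using w p' x1 lq_trans by blast
  ultimately have "memF Q w x1 y" using x1 w lq_refl[OF lqD(1)[OF w(2)]] unfolding subF_def by blast
  then obtain w1 y1 q1 where w1: "w1:M" "lq w1 w" "y1:M" "q1:M" "pr y1 q1:el y" "lq w1 q1" "Q w1 x1 y1"
   using w lq_refl[OF lqD(1)[OF w(2)]] unfolding memF_def by blast
  have e: "BN l x1" "BN l y1" "el (ll q1) <= el l" "Nm x1" "Nm y1" using BN_entry[OF xy(3), of x1 q] BN_entry[OF xy(4) w1(5)] Nm_entry[OF xy(5), of x1 q] Nm_entry[OF xy(6) w1(5)] x1(1,2,4) w1(3,4) by simp_all
  have eT: "x1:el T" "y1:el T" using tra_pr[OF T(2)] T(2) xy(1,2) x1 w1 unfolding tra_def by blast+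
  have C: "Cn w1" using lqD(1)[OF w1(2)] .
  have c1: "lq (cut w1 l) p'" using cut_lq[OF lq_trans[OF w1(2) w(2)] l(1)] p' by blast
  have "B (cut w1 l) x1 y1" unfolding B_def
  proof (intro conjI ballI impI)
   show "EX w:M. lq w u' & Q w x1 y1" if "u':M" "lq u' (cut w1 l) & el (ll u') <= el l" for u'
    using amalgam[OF C l(1)] that Qm[OF w1(7)] by blast
  qed (use e eT C l Cn_cut ll_cut in auto)
  then have "tri (cut w1 l) x1 y1:el Y" using Yt x1 w1 by simp
  moreover have "lq (cut w1 l) q1" using cut_lq[OF w1(6) l(1) e(3)] .
  ultimately show "EX u:M. lq u p' & el (ll u) <= el l & (EX x:M. EX q:M. pr x q:el y & lq u q & tri u x1 x:el Y)"
   using c1 w1 ll_cut[OF C l(1)] by (intro bexI[of _ "cut w1 l"]) auto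
 qed
 have "pfx l Y" unfolding pfx_def
 proof (intro ballI impI)
  fix p s t assume m: "p:M" "s:M" "t:M" "tri p s t:el Y"
  then have B: "B p s t" using Yt by blast
  have "tri q s t:el Y" if "q:M" "lq q p & el (ll q) <= el l" for q
   using B that m Yt[of q s t] lqD(1) lq_trans unfolding B_def by blast
  then show "Cn p & el (ll p) <= el l & BN l s & BN l t & subS l Y p s t & subS l Y p t s & (ALL q:M. lq q p & el (ll q) <= el l --> tri q s t:el Y)"
   using B sub[of p s t] sub[of p t s] by (simp add: B_def)
 qed
 moreover have "B (cut p l) s t" unfolding B_def
 proof (intro conjI ballI impI)
  show "EX w:M. lq w u' & Q w s t" if "u':M" "lq u' (cut p l) & el (ll u') <= el l" for u'
   using amalgam[of p l u'] N l(1) that Qm[OF Q] by blast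
 qed (use N l sT Cn_cut ll_cut in auto)
 then have "tri (cut p l) s t:el Y" using Yt N by simp
 ultimately show ?thesis unfolding F_def using N l YM OrdM[OF l(1)] by blast
qed

lemma F_mono: "F p s t ==> lq q p ==> F q s t"
proof -
 assume F: "F p s t" and q: "lq q p"
 then obtain l Y where Y: "l:M" "Y:M" "Ord l" "BN l s" "BN l t" "pfx l Y" "tri (cut p l) s t:el Y" and N: "Nm s" "Nm t" unfolding F_def by blast
 have "tri (cut q l) s t:el Y" using Y(6,7) N cut_mono[OF q Y(3)] ll_cut[OF lqD(1)[OF q] Y(3)] unfolding pfx_def by (meson Nm_M cut_in)
 then show ?thesis unfolding F_def using Y N lqD(1)[OF q] by blast
qed

lemma F_fix: "F p s t <-> Cn p & Nm s & Nm t & subF F p s t & subF F p t s"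
proof
 show "F p s t ==> Cn p & Nm s & Nm t & subF F p s t & subF F p t s" using F_D F_post by blast
 let ?Q = "%p s t. Cn p & Nm s & Nm t & subF F p s t & subF F p t s"
 assume Q: "?Q p s t"
 show "F p s t"
 proof (rule F_coinduct[where Q = ?Q, OF Q])
  show "D M (%v. ?Q (v 0) (v 1) (v 2))" by (intro dfn D_subF)
  show "?Q q s t" if "?Q p s t" "lq q p" for p q s t using that subF_mono lqD(1) by blast
  have "memF ?Q p s t" if "memF F p s t" for p s t using that F_D F_post unfolding memF_def by blast
  then have "subF ?Q p s t" if "subF F p s t" for p s t using that unfolding subF_def by blast
  then show "subF ?Q p s t & subF ?Q p t s" if "?Q p s t" for p s t using that by blast
 qed blast
qed

lemma F_refl: "Cn p ==> Nm s ==> F p s s"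
proof (rule F_coinduct[where Q = "%p s t. s = t & Cn p & Nm s"])
 show "D M (%v. v 1 = v 2 & Cn (v 0) & Nm (v 1))" by (intro dfn)
 fix p s t assume a: "s = t & Cn p & Nm s"
 have "memF (%p s t. s = t & Cn p & Nm s) u x s" if x: "x:M" "q:M" "pr x q:el s & lq u p & lq u q" for x q u
  unfolding memF_def
 proof (intro ballI impI)
  fix p' assume p': "p':M" "lq p' u"
  then have "lq p' p'" "lq p' q" using lq_refl lqD(1) lq_trans x by blast+
  then show "EX w:M. lq w p' & (EX y:M. EX q:M. pr y q:el s & lq w q & x = y & Cn w & Nm x)" using x p' Nm_entry[of s x q] a lqD(1) by blast
 qed
 then show "subF (%p s t. s = t & Cn p & Nm s) p s t & subF (%p s t. s = t & Cn p & Nm s) p t s" using a unfolding subF_def by blast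
qed (use lqD(1) in auto)

lemma F_sym: "F p s t ==> F p t s"
 using F_fix by blast

lemma F_trans: "F p s t ==> F p t u ==> F p s u"
proof (rule F_coinduct[where Q = "%p s u. EX t:M. F p s t & F p t u"])
 let ?Q = "%p s u. EX t:M. F p s t & F p t u"
 show "D M (%v. ?Q (v 0) (v 1) (v 2))" by (intro dfn)
 have *: "subF ?Q p s u" if F: "F p s t" "F p t u" for p s t u
  unfolding subF_def memF_def
 proof (intro ballI impI)
  fix x q w p' assume x: "x:M" "q:M" "w:M" "pr x q:el s & lq w p & lq w q" and p': "p':M" "lq p' w"
  have "memF F w x t" using F_post[OF F(1)] x unfolding subF_def by blast
  then obtain w1 y q1 where w1: "w1:M" "lq w1 p'" "y:M" "q1:M" "pr y q1:el t" "lq w1 q1" "F w1 x y" using p' unfolding memF_def by blast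
  have "lq w1 p" using w1 p' x lq_trans by blast
  then have "memF F w1 y u" using F_post[OF F(2)] w1 unfolding subF_def by blast
  then obtain w2 z q2 where w2: "w2:M" "lq w2 w1" "z:M" "q2:M" "pr z q2:el u" "lq w2 q2" "F w2 y z"
   using w1 lq_refl[OF lqD(1)[OF w1(2)]] unfolding memF_def by blast
  then have "?Q w2 x z" using F_mono[OF w1(7) w2(2)] w1 by blast
  then show "EX v:M. lq v p' & (EX z:M. EX q:M. pr z q:el u & lq v q & ?Q v x z)" using w2 lq_trans[OF w2(2) w1(2)] by blast
 qed
 show "subF ?Q p s t & subF ?Q p t s" if "?Q p s t" for p s t using that *[of p s _ t] *[of p t _ s] F_sym by blast
 show "F p s t ==> F p t u ==> ?Q p s u" using F_D by auto
qed (use F_mono F_D in blast)+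

lemma F_dense: assumes "Cn p" "Nm s" "Nm t" "!!q. lq q p ==> EX r:M. lq r q & F r s t" shows "F p s t"
proof -
 have "subF F p s t" if a: "!!q. lq q p ==> EX r:M. lq r q & F r s t" for s t
  unfolding subF_def memF_def
 proof (intro ballI impI)
  fix x q u p' assume x: "x:M" "q:M" "u:M" "pr x q:el s & lq u p & lq u q" and p': "p':M" "lq p' u"
  obtain r where r: "r:M" "lq r p'" "F r s t" using a lq_trans x p' by blast
  have "memF F r x t" using F_post[OF r(3)] x r p' lq_refl[OF lqD(1)[OF r(2)]] lq_trans unfolding subF_def by meson
  then show "EX u:M. lq u p' & (EX xa:M. EX q:M. pr xa q:el t & lq u q & F u x xa)" using r lq_refl[OF lqD(1)[OF r(2)]] lq_trans unfolding memF_def by meson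
 qed
 from this[of s t] this[of t s] assms F_sym show ?thesis unfolding F_fix[of p] by meson
qed

definition Fm where "Fm = memF F"
lemma D_Fm [dfn]: "Tm A s ==> Tm A t ==> Tm A u ==> D A (%v. Fm (s v) (t v) (u v))"
 unfolding Fm_def by (intro D_memF D_F)
lemma Fm_mono: "Fm p s t ==> lq q p ==> Fm q s t"
 unfolding Fm_def by (rule memF_mono)
lemma Fm_dense: "(!!q. lq q p ==> EX r:M. lq r q & Fm r s t) ==> Fm p s t"
 unfolding Fm_def memF_def by (meson lqD(1) lq_refl lq_trans)
lemma Fm_entry: "pr s q:el t ==> Nm t ==> lq p q ==> s:M ==> Fm p s t"
 unfolding Fm_def memF_def using F_refl Nm_entry lq_refl lqD(1,2) lq_trans by (meson Cn_M)
lemma Fm_cong: assumes "Fm p s t" "F p s s'" "F p t t'" shows "Fm p s' t'"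
 unfolding Fm_def memF_def
proof (intro ballI impI)
 fix p' assume p': "p':M" "lq p' p"
 obtain w x q where w: "w:M" "lq w p'" "x:M" "q:M" "pr x q:el t" "lq w q" "F w s x" using assms(1) p' unfolding Fm_def memF_def by blast
 have wp: "lq w p" using w p' lq_trans by blast
 have "memF F w x t'" using F_post[OF assms(3)] w wp unfolding subF_def by blast
 then obtain w2 y q2 where w2: "w2:M" "lq w2 w" "y:M" "q2:M" "pr y q2:el t'" "lq w2 q2" "F w2 x y"
  using w lq_refl[OF lqD(1)[OF w(2)]] unfolding memF_def by blast
 have "F w2 s' y" using F_trans[OF F_sym[OF F_mono[OF assms(2) lq_trans[OF w2(2) wp]]] F_trans[OF F_mono[OF w(7) w2(2)] w2(7)]] .
 then show "EX u:M. lq u p' & (EX x:M. EX q:M. pr x q:el t' & lq u q & F u s' x)" using w2 lq_trans[OF w2(2) w(2)] by blast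
qed

end

section \<open>Forcing and truth\<close>

instance fm :: countable by countable_datatype

context struct
begin

lemma D_inst: assumes "D A Q" "!!n. a n:A" shows "D A (%v. Q (%n. case ro n of Some m => v m | None => a n))"
 unfolding D_def
proof
 assume A: "A <= M & A ~= {}"
 then obtain ph w where w: "w:UNIV \<rightarrow> A" and Q: "!!v. v:UNIV \<rightarrow> M ==> Q v = sat M E ph (vmix v w)"
  using assms unfolding D_def by metis
 let ?r = "%n. if even n then (case ro (n div 2) of Some m => 2 * m | None => 2 * (2 * (n div 2)) + 1) else 2 * (2 * (n div 2) + 1) + 1"
 obtain ps where p: "!!u. sat M E ps u = sat M E ph (%n. u (?r n))" using rename_fm[of ?r ph M E] by auto
 have "vmix a w:UNIV \<rightarrow> A" using w assms(2) by (auto simp: vmix_def Pi_iff)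
 moreover have "Q (%n. case ro n of Some m => v m | None => a n) = sat M E ps (vmix v (vmix a w))" if v: "v:UNIV \<rightarrow> M" for v
 proof -
  have "(%n. case ro n of Some m => v m | None => a n):UNIV \<rightarrow> M" using v assms(2) A by (auto simp: Pi_iff split: option.splits)
  moreover have "(%n. vmix v (vmix a w) (?r n)) = vmix (%n. case ro n of Some m => v m | None => a n) w"
   by (auto simp: vmix_def fun_eq_iff split: option.splits)
  ultimately show ?thesis using Q unfolding p by simp
 qed
 ultimately show "EX ph. EX w:UNIV \<rightarrow> A. ALL v:UNIV \<rightarrow> M. Q (%n. case ro n of Some m => v m | None => a n) = sat M E ph (vmix v w)" by blast
qed

lemma definableI: assumes "D M Q" "M ~= {}"
 shows "EX ph. EX v:UNIV \<rightarrow> M. ALL a:M. ALL b:M. ALL c:M. Q (%n. if n = 1 then b else if n = 2 then c else a) = sat M E ph (v(0 := a, 1 := b, 2 := c))"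
proof -
 obtain ph w where w: "w:UNIV \<rightarrow> M" and Q: "!!v. v:UNIV \<rightarrow> M ==> Q v = sat M E ph (vmix v w)" using assms unfolding D_def by (metis order_refl)
 let ?r = "%n. if even n then (if n = 2 then 1 else if n = 4 then 2 else 0) else n div 2 + 3"
 obtain ps where p: "!!u. sat M E ps u = sat M E ph (%n. u (?r n))" using rename_fm[of ?r ph M E] by auto
 have "Q (%n. if n = 1 then b else if n = 2 then c else a) = sat M E ps ((%n. w (n - 3))(0 := a, 1 := b, 2 := c))" if "a:M" "b:M" "c:M" for a b c
 proof -
  have "(%n. ((%n. w (n - 3))(0 := a, 1 := b, 2 := c)) (?r n)) = vmix (%n. if n = 1 then b else if n = 2 then c else a) w" by (auto simp: vmix_def fun_eq_iff)
  then show ?thesis using Q[of "%n. if n = 1 then b else if n = 2 then c else a"] that unfolding p by auto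
 qed
 then show ?thesis using w by (intro exI[of _ ps] bexI[of _ "%n. w (n - 3)"]) auto
qed

lemma definable3I: assumes "D M (%v. Q (v 0) (v 1) (v 2))" "M ~= {}" shows "definable3 M E {(a, b, c):M \<times> M \<times> M. Q a b c}"
proof -
 have "EX ph. EX v:UNIV \<rightarrow> M. ALL a:M. ALL b:M. ALL c:M. Q a b c = sat M E ph (v(0 := a, 1 := b, 2 := c))" using definableI[OF assms] by simp
 then obtain ph v where "v:UNIV \<rightarrow> M" "!!a b c. a:M ==> b:M ==> c:M ==> Q a b c = sat M E ph (v(0 := a, 1 := b, 2 := c))" by blast
 then show ?thesis unfolding definable3_def by (intro exI[of _ ph] bexI[of _ v]) auto
qed
lemma definable2I: assumes "D M (%v. Q (v 0) (v 1))" "M ~= {}" shows "definable2 M E {(a, b):M \<times> M. Q a b}"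
proof -
 have "EX ph. EX v:UNIV \<rightarrow> M. ALL a:M. ALL b:M. ALL c:M. Q a b = sat M E ph (v(0 := a, 1 := b, 2 := c))" using definableI[OF assms] by simp
 then obtain ph v where v: "v:UNIV \<rightarrow> M" "!!a b c. a:M ==> b:M ==> c:M ==> Q a b = sat M E ph (v(0 := a, 1 := b, 2 := c))" by blast
 have "v(0 := a, 1 := b, 2 := v 2) = v(0 := a, 1 := b)" for a b by auto
 then have "Q a b = sat M E ph (v(0 := a, 1 := b))" if "a:M" "b:M" for a b using v(2)[of a b "v 2"] v(1) that by (auto simp: Pi_iff)
 then show ?thesis unfolding definable2_def using v(1) by (intro exI[of _ ph] bexI[of _ v]) auto
qed
lemma definable1I: assumes "D M (%v. Q (v 0))" "M ~= {}" shows "definable1 M E {a:M. Q a}"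
proof -
 have "EX ph. EX v:UNIV \<rightarrow> M. ALL a:M. ALL b:M. ALL c:M. Q a = sat M E ph (v(0 := a, 1 := b, 2 := c))" using definableI[OF assms] by simp
 then obtain ph v where v: "v:UNIV \<rightarrow> M" "!!a b c. a:M ==> b:M ==> c:M ==> Q a = sat M E ph (v(0 := a, 1 := b, 2 := c))" by blast
 have "v(0 := a, 1 := v 1, 2 := v 2) = v(0 := a)" for a by auto
 then have "Q a = sat M E ph (v(0 := a))" if "a:M" for a using v(2)[of a "v 1" "v 2"] v(1) that by (auto simp: Pi_iff)
 then show ?thesis unfolding definable1_def using v(1) by (intro exI[of _ ph] bexI[of _ v]) auto
qed

lemma definable1D: assumes "definable1 M E C" shows "D M (%v. v 0:C)"
proof -
 obtain ph w where w: "w:UNIV \<rightarrow> M" and C: "C = {a:M. sat M E ph (w(0 := a))}" using assms unfolding definable1_def by blast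
 let ?r = "%n. if n = 0 then 0 else 2 * n + 1"
 obtain ps where p: "!!u. sat M E ps u = sat M E ph (%n. u (?r n))" using rename_fm[of ?r ph M E] by auto
 have "(v 0:C) = sat M E ps (vmix v w)" if "v:UNIV \<rightarrow> M" for v
 proof -
  have "(%n. vmix v w (?r n)) = w(0 := v 0)" by (auto simp: vmix_def fun_eq_iff)
  then show ?thesis unfolding p C using that by auto
 qed
 then show ?thesis unfolding D_def using w by blast
qed

end

context zfc
begin

definition PP where "PP = {p. Cn p}"
text \<open>\<open>lq\<close> is only a preorder, whereas a partial order is required. Instead of
  passing to equivalence classes, distinct conditions are compared strictly; by \<open>below\<close>
  this leaves the forcing relation unchanged.\<close>

definition rr where "rr = {(p, q). Cn p & Cn q & (p = q | (lq p q & ~ lq q p))}"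
definition FF where "FF = {(p, s, t). F p s t}"

lemma pair_in_iff: "pair_in M E z a b <-> a:M & b:M & z = pr a b"
proof -
 have "upair_in M E z a b <-> a:M & b:M & z = up a b" for z a b
 proof
  assume u: "upair_in M E z a b"
  then have "el z = {a, b}" "z:M" "a:M" "b:M" unfolding upair_in_def by (auto simp: el_def simp del: elM)
  then have "z = up a b" by (intro ext) simp_all
  then show "a:M & b:M & z = up a b" using u unfolding upair_in_def by simp
 qed (auto simp: upair_in_def E_iff)
 then show ?thesis unfolding pair_in_def pr_def by auto
qed
lemma has_entry_iff: "has_entry M E t s p <-> s:M & p:M & pr s p:el t"
 unfolding has_entry_def pair_in_iff by (auto simp: E_iff)
lemma names_iff: "names M E PP = {x. Nm x}"
proof -
 have "(ALL x:M. E x t --> (ALL z:M. E z x --> (EX si p. pair_in M E z si p & E si t & p:PP))) <->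
  (ALL y:el t. ALL z:el y. EX s:el t. EX p:M. Cn p & z = pr s p)" for t
 proof -
  have "(EX si p. pair_in M E z si p & E si t & p:PP) <-> (EX s:el t. EX p:M. Cn p & z = pr s p)" for z
   unfolding pair_in_iff PP_def el_def by blast
  then show ?thesis unfolding el_def by blast
 qed
 then show ?thesis unfolding names_def Nm_def by (auto simp: E_iff)
qed

lemma rr_lq: "(p, q):rr ==> lq p q"
 unfolding rr_def using lq_refl by auto
lemma below: "Cn p ==> EX p':M. lq p' p & (ALL q. lq p q --> (p', q):rr)"
proof -
 assume "Cn p"
 then obtain p' where p': "p':M" "lq p' p" "~ lq p p'" using strict by blast
 then have "(p', q):rr" if "lq p q" for q using that lq_trans lqD unfolding rr_def by blast
 then show ?thesis using p' by blast
qed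

lemma forces_mem_iff: "forces_mem M E rr FF p s t <-> Fm p s t"
proof
 assume f: "forces_mem M E rr FF p s t"
 show "Fm p s t" unfolding Fm_def memF_def
 proof (intro ballI impI)
  fix p' assume p': "p':M" "lq p' p"
  obtain p1 where p1: "lq p1 p'" "(p1, p):rr" using below[OF lqD(1)[OF p'(2)]] p' by blast
  then obtain u x q where "(u, p1):rr" "has_entry M E t x q" "(u, q):rr" "(u, s, x):FF" using f unfolding forces_mem_def by blast
  then have "lq u p'" "lq u q" "F u s x" "x:M" "q:M" "pr x q:el t" using lq_trans[OF rr_lq p1(1)] rr_lq by (auto simp: has_entry_iff FF_def)
  then show "EX u:M. lq u p' & (EX x:M. EX q:M. pr x q:el t & lq u q & F u s x)" using Cn_M[OF F_D(1)] by blast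
 qed
next
 assume f: "Fm p s t"
 show "forces_mem M E rr FF p s t" unfolding forces_mem_def
 proof (intro allI impI)
  fix p' assume "(p', p):rr"
  then have "lq p' p" "p':M" using rr_lq Cn_M[OF lqD(1)[OF rr_lq]] by blast+
  then obtain u x q where u: "u:M" "lq u p'" "x:M" "q:M" "pr x q:el t" "lq u q" "F u s x" using f unfolding Fm_def memF_def by blast
  obtain u' where u': "lq u' u" "ALL q. lq u q --> (u', q):rr" using below[OF lqD(1)[OF u(2)]] by blast
  then show "EX s'. (s', p'):rr & (EX ro q. has_entry M E t ro q & (s', q):rr & (s', s, ro):FF)"
   unfolding has_entry_iff FF_def using u F_mono[OF u(7) u'(1)] by blast
 qed
qed

lemma forces_subset_iff: "forces_subset M E rr FF p s t <-> subF F p s t"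
proof
 assume f: "forces_subset M E rr FF p s t"
 show "subF F p s t" unfolding subF_def
 proof (intro ballI impI)
  fix x q u assume x: "x:M" "q:M" "u:M" "pr x q:el s & lq u p & lq u q"
  show "memF F u x t" unfolding Fm_def[symmetric]
  proof (rule Fm_dense)
   fix v assume v: "lq v u"
   obtain v' where "v':M" "lq v' v" "ALL q. lq v q --> (v', q):rr" using below[OF lqD(1)[OF v]] by blast
   moreover have "lq v p" "lq v q" using v x lq_trans by blast+
   ultimately show "EX r:M. lq r v & Fm r x t" using f x unfolding forces_subset_def forces_mem_iff has_entry_iff by blast
  qed
 qed
next
 assume f: "subF F p s t"
 then show "forces_subset M E rr FF p s t" unfolding forces_subset_def forces_mem_iff has_entry_iff subF_def Fm_def
  using rr_lq lqD(1) by (meson Cn_M)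
qed

lemma class_forcing: "class_forcing M E PP rr"
proof -
 have "definable1 M E {a:M. Cn a}" by (rule definable1I[OF _ nonempty]) (intro dfn)
 moreover have "{a:M. Cn a} = PP" by (auto simp: PP_def)
 moreover have "definable2 M E {(a, b):M \<times> M. Cn a & Cn b & (a = b | (lq a b & ~ lq b a))}" by (rule definable2I[OF _ nonempty]) (intro dfn)
 moreover have "{(a, b):M \<times> M. Cn a & Cn b & (a = b | (lq a b & ~ lq b a))} = rr" by (auto simp: rr_def)
 moreover have "proper_class M E PP" unfolding proper_class_def
 proof
  assume "EX s:M. PP = {x:M. E x s}"
  then obtain s where s: "s:M" "PP = el s" unfolding el_def by blast
  \<comment> \<open>A condition longer than the rank of \<open>s\<close> has larger rank than
    \<open>s\<close> and cannot belong to it.\<close>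
  define p where "p = cn (suc (rk s)) emp emp"
  have C: "Cn p" unfolding p_def using raise(1)[OF one(1), of "suc (rk s)"] s by simp
  then have "p:el s" using s unfolding PP_def by blast
  then have "rk p:el (rk s)" using rk_mem s by blast
  moreover have "rk (suc (rk s)):el (rk p)" unfolding p_def cn_def using rk_pr by simp
  ultimately have "suc (rk s):el (rk s)" using Ord_trans[OF Ord_rk[OF s(1)]] rk_Ord[of "suc (rk s)"] s by simp
  then show False using mem_asym[of "rk s" "suc (rk s)"] by simp
 qed
 moreover have "partial_order_on PP rr" unfolding partial_order_on_def preorder_on_def
 proof (intro conjI)
  show "rr <= PP \<times> PP" "refl_on PP rr" "antisym rr" by (auto simp: rr_def PP_def refl_on_def antisym_def)
  show "trans rr" unfolding trans_def rr_def using lq_trans by blast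
 qed
 ultimately show ?thesis unfolding class_forcing_def by simp
qed

lemma atomic_forcing: "atomic_forcing M E PP rr FF"
proof -
 have "definable3 M E {(a, b, c):M \<times> M \<times> M. F a b c}" by (rule definable3I[OF _ nonempty]) (intro dfn)
 moreover have "{(a, b, c):M \<times> M \<times> M. F a b c} = FF" using F_D by (auto simp: FF_def)
 moreover have "FF = {(p, si, ta):PP \<times> names M E PP \<times> names M E PP. forces_subset M E rr FF p si ta & forces_subset M E rr FF p ta si}"
  unfolding forces_subset_iff names_iff using F_fix unfolding FF_def PP_def by auto
 ultimately show ?thesis unfolding atomic_forcing_def by simp
qed

abbreviation fo where "fo ph p v \<equiv> forces M E PP rr FF ph p v"

lemma fo_mono_dense: "(ALL v. range v <= {x. Nm x} --> (ALL p q. fo ph p v --> lq q p --> fo ph q v) &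
 (ALL p. Cn p --> (ALL q. lq q p --> (EX r. lq r q & fo ph r v)) --> fo ph p v))"
proof (induction ph)
 case (Mem x y) show ?case unfolding forces.simps forces_mem_iff using Fm_mono Fm_dense by (meson Cn_M lqD(1))
next
 case (Eq x y)
 show ?case
 proof (intro allI impI conjI)
  fix v :: "nat => 'a" and p assume v: "range v <= {x. Nm x}" and "Cn p" and d: "ALL q. lq q p --> (EX r. lq r q & fo (Eq x y) r v)"
  have "F p (v x) (v y)"
  proof (rule F_dense[OF \<open>Cn p\<close>])
   fix q assume "lq q p"
   then show "EX r:M. lq r q & F r (v x) (v y)" using d Cn_M[OF lqD(1)] unfolding forces.simps FF_def by blast
  qed (use v in auto)
  then show "fo (Eq x y) p v" by (simp add: FF_def)
 qed (auto simp: FF_def F_mono)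
next
 case (Neg ph)
 show ?case
 proof (intro allI impI)
  fix v :: "nat => 'a" assume v: "range v <= {x. Nm x}"
  have m: "fo ph q v" if "fo ph p v" "lq q p" for p q using Neg v that by blast
  have n: "fo (Neg ph) p v <-> (ALL q. lq q p --> ~ fo ph q v)" for p
   using m below lqD(1) rr_lq by (metis forces.simps(3))
  show "(ALL p q. fo (Neg ph) p v --> lq q p --> fo (Neg ph) q v) &
    (ALL p. Cn p --> (ALL q. lq q p --> (EX r. lq r q & fo (Neg ph) r v)) --> fo (Neg ph) p v)"
   unfolding n using lq_trans m lq_refl lqD(1) by meson
 qed
next
 case (Conj ph ps) 
 show ?case
 proof (intro allI impI conjI)
  fix v :: "nat => 'a" and p assume v: "range v <= {x. Nm x}" and p: "Cn p" "ALL q. lq q p --> (EX r. lq r q & fo (Conj ph ps) r v)"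
  then have "fo ph p v" "fo ps p v" using Conj by (meson forces.simps(4))+
  then show "fo (Conj ph ps) p v" by simp
 qed (use Conj in auto)
next
 case (All x ph)
 have nm: "range (v(x := t)) <= {x. Nm x}" if "range v <= {x. Nm x}" "Nm t" for v :: "nat => 'a" and t using that by auto
 show ?case
 proof (intro allI impI conjI)
  fix v :: "nat => 'a" and p q assume v: "range v <= {x. Nm x}" and "fo (All x ph) p v" "lq q p"
  then show "fo (All x ph) q v" unfolding forces.simps names_iff using All nm[OF v] by (metis mem_Collect_eq)
 next
  fix v :: "nat => 'a" and p assume v: "range v <= {x. Nm x}" and p: "Cn p" "ALL q. lq q p --> (EX r. lq r q & fo (All x ph) r v)"
  then show "fo (All x ph) p v" unfolding forces.simps names_iff using All nm[OF v] by (metis mem_Collect_eq)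
 qed
qed
lemma fo_mono: "fo ph p v ==> lq q p ==> range v <= {x. Nm x} ==> fo ph q v"
 using fo_mono_dense by blast
lemma fo_dense: "Cn p ==> (!!q. lq q p ==> EX r. lq r q & fo ph r v) ==> range v <= {x. Nm x} ==> fo ph p v"
 using fo_mono_dense by blast
lemma fo_Neg: "range v <= {x. Nm x} ==> fo (Neg ph) p v <-> (ALL q. lq q p --> ~ fo ph q v)"
 using fo_mono[of ph _ v] below lqD(1) rr_lq by (metis forces.simps(3))

lemma D_fo: "D A (%v. fo ph (v 0) (%n. v (Suc n)))"
proof (induction ph)
 case (Mem x y) show ?case unfolding forces.simps forces_mem_iff by (intro dfn)
next
 case (Eq x y) show ?case unfolding forces.simps FF_def by (simp, intro dfn)
next
 case (Neg ph)
 have 1: "D A (%v. fo ph (v 0) (%n. v (Suc (Suc n))))" using D_rename[OF Neg, of "%n. if n = 0 then 0 else Suc n"] by simp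
 have "D A (%v. ALL q:M. (Cn q & Cn (v 0) & (q = v 0 | (lq q (v 0) & ~ lq (v 0) q))) --> ~ fo ph q (%n. v (Suc n)))" by (intro dfn 1)
 then show ?case by (rule D_cong[rotated]) (auto simp: rr_def)
next
 case (Conj ph ps) then show ?case by (simp, intro dfn)
next
 case (All x ph)
 have 1: "D A (%v. fo ph (v (Suc 0)) ((%n. v (Suc (Suc n)))(x := v 0)))"
  using D_rename[OF All, of "%n. case n of 0 => Suc 0 | Suc k => if k = x then 0 else Suc (Suc k)"]
  by (simp add: fun_upd_def if_distrib[of "%n. _ n"] cong: if_cong)
 have "D A (%v. ALL t:M. Nm t --> fo ph (v 0) ((%n. v (Suc n))(x := t)))" by (intro dfn 1)
 then show ?case by (rule D_cong[rotated]) (auto simp: names_iff)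
qed

end

text \<open>A pair of an elementary submodel \<open>A\<close> (in the form of a set closed under witnesses) and a filter \<open>G\<close> that is generic for
 the classes definable with parameters from \<open>A\<close>. Generic filters are the case \<open>A = M\<close>; since countable \<open>A\<close> have generic filters,
 what holds in all these extensions is forced.\<close>

locale gx = zfc M E for M :: "'a set" and E +
 fixes A G :: "'a set"
 assumes AM: "A <= M" and Ane: "A ~= {}"
  and skol: "!!Q. D A (%v. Q (v 0)) ==> EX x:M. Q x ==> EX x:A. Q x"
  and GC: "!!p. p:G ==> Cn p" and Gne: "G ~= {}" and Gup: "!!p q. p:G ==> lq p q ==> q:G"
  and Gdir: "!!p q. p:G ==> q:G ==> EX s:G. lq s p & lq s q"
  and gen: "!!Q p. D A (%v. Q (v 0)) ==> p:G ==> (!!s. lq s p ==> EX q:M. lq q s & Q q) ==> EX q:G Int A. Q q"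
begin

lemma Tm_A [dfn]: "a:A ==> Tm A (%v. a)"
 using Tm_const AM by blast
lemma A_in: assumes "Tm A (%v. c)" shows "c:A"
proof -
 obtain a where "a:M" using Ane AM by blast
 then have "c:M" using Tm_in[OF assms, of "%_. a"] by auto
 moreover have "D A (%v. v 0 = c)" by (intro D_eq Tm_var assms)
 ultimately show ?thesis using skol[of "%x. x = c"] by auto
qed
lemma A_M [simp]: "a:A ==> a:M"
 using AM by blast

text \<open>Genericity yields a condition in \<open>A\<close>, and Skolem closure with that
  condition as a parameter yields a witness in \<open>A\<close>. Most density arguments about the
  extension use this form.\<close>

lemma gen2: assumes "D A (%v. Q (v 0) (v 1))" "p:G" "!!s. lq s p ==> EX q:M. lq q s & (EX y:M. Q q y)"
 shows "EX q:G Int A. EX y:A. Q q y"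
proof -
 have Qd: "Tm A s ==> Tm A t ==> D A (%v. Q (s v) (t v))" for s t using D2[OF _ _ assms(1)] .
 have "D A (%v. EX y:M. Q (v 0) y)" by (intro dfn Qd)
 from gen[OF this assms(2,3)] obtain q where q: "q:G" "q:A" "EX y:M. Q q y" by blast
 then have "EX y:A. Q q y" by (intro skol) (auto intro!: dfn Qd)
 then show ?thesis using q by blast
qed

definition N where "N = {x:A. Nm x}"
definition rel where "rel = {(x, y). x:N & y:N & (EX p:G. F p x y)}"
definition CC where "CC = N // rel"
definition EE where "EE = ext_mem M E G"
definition cl where "cl x = rel `` {x}"

lemma N_D [simp]: "x:N ==> Nm x" "x:N ==> x:A"
 by (auto simp: N_def)
lemma equiv_rel: "equiv N rel"
proof (rule equivI)
 show "rel <= N \<times> N" unfolding rel_def by blast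
 show "refl_on N rel" unfolding refl_on_def rel_def using F_refl GC Gne by fastforce
 show "sym rel" unfolding sym_def rel_def using F_sym by blast
 show "trans rel" unfolding trans_def rel_def
 proof safe
  fix x y z p q assume "p:G" "F p x y" "q:G" "F q y z"
  moreover then obtain s where "s:G" "lq s p" "lq s q" using Gdir by blast
  ultimately show "EX p:G. F p x z" using F_mono F_trans by blast
 qed
qed
lemma CC_iff: "CC = cl ` N"
 unfolding CC_def quotient_def cl_def by auto
lemma cl_CC [simp]: "x:N ==> cl x:CC"
 by (simp add: CC_iff)
lemma cl_eq: "x:N ==> y:N ==> cl x = cl y <-> (EX p:G. F p x y)"
 unfolding cl_def using eq_equiv_class_iff[OF equiv_rel] by (simp add: rel_def)
lemma in_cl: "y:cl x <-> x:N & y:N & (EX p:G. F p x y)"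
 by (auto simp: cl_def rel_def)
lemma N_in_A: "Nm c ==> Tm A (%v. c) ==> c:N"
 using A_in unfolding N_def by blast

lemma entry_ex: assumes "y:N" "x:N" "p:G" "Fm p x y"
 shows "EX z:N. EX q:G. pr z q:el y & q:A & cl z = cl x"
proof -
 have xy: "x:A" "y:A" "Nm y" using assms by auto
 have "D A (%v. EX q:M. pr (v 1) q:el y & lq (v 0) q & F (v 0) x (v 1))" by (intro dfn xy)
 from gen2[OF this assms(3)] assms(4) obtain u z where u: "u:G" "u:A" "z:A" "EX q:M. pr z q:el y & lq u q & F u x z"
  unfolding Fm_def memF_def by (metis (no_types, lifting) Cn_M Int_iff lqD(1))
 have "EX q:A. pr z q:el y & lq u q & F u x z" by (rule skol) (use u xy in \<open>auto intro!: dfn\<close>)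
 then obtain q where q: "q:A" "pr z q:el y" "lq u q" "F u x z" by blast
 then have "Nm z" using u Nm_entry[OF xy(3) q(2)] by simp
 then have "z:N" using u unfolding N_def by blast
 moreover have "q:G" using Gup u q by blast
 moreover have "cl z = cl x" using cl_eq assms \<open>z : N\<close> F_sym[OF q(4)] u by blast
 ultimately show ?thesis using q by blast
qed

lemma EE_iff: assumes "x:N" "y:N" shows "EE (cl x) (cl y) <-> (EX p:G. Fm p x y)"
proof
 assume "EE (cl x) (cl y)"
 then obtain s t p where st: "s:cl x" "t:cl y" "p:G" "pr s p:el t" "s:M" unfolding EE_def ext_mem_def has_entry_iff by blast
 then obtain p1 p2 where F: "p1:G" "F p1 x s" "p2:G" "F p2 y t" by (auto simp: in_cl)
 obtain q where q: "q:G" "lq q p1" "lq q p2" using Gdir F by blast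
 obtain q' where q': "q':G" "lq q' q" "lq q' p" using Gdir st q by blast
 have "Fm q' s t" using Fm_entry[OF st(4)] F_D(3)[OF F(4)] q' st by simp
 then have "Fm q' x y" using Fm_cong F_sym F_mono F q q' lq_trans by blast
 then show "EX p:G. Fm p x y" using q' by blast
next
 assume "EX p:G. Fm p x y"
 then obtain z q where z: "z:N" "q:G" "pr z q:el y" "cl z = cl x" using entry_ex assms by blast
 have "z:cl x" "y:cl y" using cl_eq[of x z] cl_eq[of y y] z assms by (auto simp: in_cl)
 moreover have "z:M" "q:M" using z GC by auto
 ultimately show "EE (cl x) (cl y)" unfolding EE_def ext_mem_def has_entry_iff using z by blast
qed
lemma EE_entry: "y:N ==> z:N ==> q:G ==> pr z q:el y ==> EE (cl z) (cl y)"
 using EE_iff Fm_entry[of z q y q] lq_refl GC by auto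
lemma EE_D: "y:N ==> x:N ==> EE (cl x) (cl y) ==> EX z:N. EX q:G. pr z q:el y & q:A & cl z = cl x"
 using EE_iff entry_ex by blast

lemma D_foA2: assumes "range v <= A" "Tm A s" "Tm A t" "Tm A r" "x ~= y" shows "D A (%u. fo ph (s u) (v(x := t u, y := r u)))"
proof (rule D3[OF assms(2-4), where Q = "%p t r. fo ph p (v(x := t, y := r))"])
 let ?r = "%n. if n = 0 then Some 0 else if n = Suc y then Some (2::nat) else if n = Suc x then Some 1 else None"
 have "D A (%u. fo ph (u 0) (%n. case ?r (Suc n) of None => v n | Some m => u m))"
  using D_inst[OF D_fo[of A ph], where a = "%n. v (n - 1)" and ro = ?r] assms(1) by (simp add: image_subset_iff cong: option.case_cong)
 moreover have "(%n. case ?r (Suc n) of None => v n | Some m => u m) = v(x := u 1, y := u 2)" for u :: "nat => 'a" using assms(5) by auto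
 ultimately show "D A (%u. fo ph (u 0) (v(x := u 1, y := u 2)))" by (simp only:)
qed
lemma D_foA1: assumes "range v <= A" "Tm A s" "Tm A t" shows "D A (%u. fo ph (s u) (v(x := t u)))"
proof -
 have "v(x := t u, Suc x := v (Suc x)) = v(x := t u)" for u by auto
 moreover have "v (Suc x):A" using assms(1) by auto
 ultimately show ?thesis using D_foA2[OF assms Tm_A, of "v (Suc x)" x "Suc x" ph] by simp
qed
lemma D_foA: assumes "range v <= A" "Tm A s" shows "D A (%u. fo ph (s u) v)"
 using D_foA1[OF assms Tm_A, of "v 0" ph 0] assms(1) by auto

lemma truth: "range v <= N ==> sat CC EE ph (%n. cl (v n)) <-> (EX p:G. fo ph p v)"
proof (induction ph arbitrary: v)
 case (Mem x y) then show ?case unfolding forces.simps forces_mem_iff by (simp add: EE_iff image_subset_iff)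
next
 case (Eq x y) then show ?case by (simp add: cl_eq image_subset_iff FF_def)
next
 case (Neg ph)
 have v: "range v <= {x. Nm x}" "range v <= A" using Neg.prems N_D by blast+
 obtain p where p: "p:G" using Gne by blast
 have "D A (%u. fo ph (u 0) v | fo (Neg ph) (u 0) v)" by (intro D_or D_foA v dfn)
 moreover have "EX q:M. lq q s & (fo ph q v | fo (Neg ph) q v)" if "lq s p" for s
  using fo_Neg[OF v(1), of ph] that lq_refl lqD(1) by (meson Cn_M)
 ultimately obtain q where q: "q:G" "fo ph q v | fo (Neg ph) q v" using gen[OF _ p, of "%q. fo ph q v | fo (Neg ph) q v"] by blast
 have "~ (fo ph r v & fo (Neg ph) r' v)" if "r:G" "r':G" for r r'
  using Gdir[OF that] fo_Neg[OF v(1), of ph] fo_mono[OF _ _ v(1)] by blast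
 then show ?case using Neg.IH[OF Neg.prems] q by auto
next
 case (Conj ph ps)
 have v: "range v <= {x. Nm x}" using Conj.prems N_D by blast
 have "(EX p:G. fo (Conj ph ps) p v) <-> (EX p:G. fo ph p v) & (EX p:G. fo ps p v)"
  using Gdir fo_mono[OF _ _ v] by (meson forces.simps(4))
 then show ?case using Conj by auto
next
 case (All x ph)
 have v: "range v <= {x. Nm x}" "range v <= A" using All.prems N_D by blast+
 have vt: "range (v(x := t)) <= {x. Nm x}" if "Nm t" for t using v that by auto
 have IH: "sat CC EE ph ((%n. cl (v n))(x := cl t)) <-> (EX p:G. fo ph p (v(x := t)))" if "t:N" for t
 proof -
  have "(%n. cl (v n))(x := cl t) = (%n. cl ((v(x := t)) n))" by (simp add: fun_eq_iff)
  moreover have "range (v(x := t)) <= N" using All.prems that by auto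
  ultimately show ?thesis using All.IH[of "v(x := t)"] by (simp only:)
 qed
 have s: "sat CC EE (All x ph) (%n. cl (v n)) <-> (ALL t:N. EX p:G. fo ph p (v(x := t)))" using IH unfolding CC_iff by simp
 show ?case
 proof
  assume "EX p:G. fo (All x ph) p v"
  then show "sat CC EE (All x ph) (%n. cl (v n))" unfolding s forces.simps names_iff using N_D by blast
 next
  assume a: "sat CC EE (All x ph) (%n. cl (v n))"
  obtain p where p: "p:G" using Gne by blast
  have "D A (%u. fo (All x ph) (u 0) v | (EX t:M. Nm t & fo (Neg ph) (u 0) (v(x := t))))"
   by (intro D_or D_foA v D_ex D_and D_Nm D_foA1 Tm_var)
  moreover have "EX q:M. lq q s & (fo (All x ph) q v | (EX t:M. Nm t & fo (Neg ph) q (v(x := t))))" if s: "lq s p" for s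
  proof (cases "fo (All x ph) s v")
   case True then show ?thesis using lq_refl[OF lqD(1)[OF s]] lqD(1)[OF s] Cn_M by blast
  next
   case False
   then obtain t where t: "Nm t" "~ fo ph s (v(x := t))" unfolding forces.simps names_iff by blast
   then obtain q where "lq q s" "ALL r. lq r q --> ~ fo ph r (v(x := t))" using fo_dense[OF lqD(1)[OF s] _ vt[OF t(1)]] by blast
   then show ?thesis using fo_Neg[OF vt[OF t(1)]] t lqD(1) by (meson Cn_M Nm_M)
  qed
  ultimately obtain q where q: "q:G" "q:A" "fo (All x ph) q v | (EX t:M. Nm t & fo (Neg ph) q (v(x := t)))"
   using gen[OF _ p, of "%q. fo (All x ph) q v | (EX t:M. Nm t & fo (Neg ph) q (v(x := t)))"] by blast
  moreover have False if "EX t:M. Nm t & fo (Neg ph) q (v(x := t))"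
  proof -
   have "EX t:A. Nm t & fo (Neg ph) q (v(x := t))" by (rule skol[OF _ that]) (intro D_and D_Nm D_foA1 v Tm_var dfn q)
   then obtain t where t: "t:N" "fo (Neg ph) q (v(x := t))" unfolding N_def by blast
   then obtain r where "r:G" "fo ph r (v(x := t))" using a unfolding s by blast
   then show False using Gdir[of r q] q t fo_Neg[OF vt, of t ph] fo_mono[OF _ _ vt, of ph r t] N_D by blast
  qed
  ultimately show "EX p:G. fo (All x ph) p v" by blast
 qed
qed

end

section \<open>Elementary hulls and the existence of generic filters\<close>

context zfc
begin

text \<open>Unary predicates given by a formula and a finite list of parameters, with
  \<open>a\<close> filling up the list. Over a countable \<open>A\<close> there are only countably
  many of them.\<close>

definition SQ :: "'a => fm => 'a list => 'a => bool" where
 "SQ a ph xs x = sat M E ph (vmix (%_. x) (%n. if n < length xs then xs ! n else a))"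

lemma SQ_ex: assumes "D A (%v. Q (v 0))" "A <= M" "a:A" shows "EX ph. EX xs:lists A. ALL x:M. Q x = SQ a ph xs x"
proof -
 obtain ph w where w: "w:UNIV \<rightarrow> A" and Q: "!!v. v:UNIV \<rightarrow> M ==> Q (v 0) = sat M E ph (vmix v w)" using assms unfolding D_def by blast
 obtain k where k: "!!n. n:fv ph ==> n < k" using finite_fv[of ph] by (metis finite_nat_set_iff_bounded)
 let ?xs = "map w [0..<k]"
 have "Q x = SQ a ph ?xs x" if "x:M" for x
 proof -
  have "sat M E ph (vmix (%_. x) w) = sat M E ph (vmix (%_. x) (%n. if n < length ?xs then ?xs ! n else a))"
   by (rule sat_cong) (use k in \<open>force simp: vmix_def\<close>)
  then show ?thesis using Q[of "%_. x"] that unfolding SQ_def by auto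
 qed
 moreover have "?xs:lists A" using w by (auto simp: Pi_iff)
 ultimately show ?thesis by blast
qed

text \<open>The downward Loewenheim-Skolem argument, carried out outside the structure, so that
  choice of witnesses is available.\<close>

lemma skolem_hull: assumes "countable X" "X <= M" "X ~= {}"
 shows "EX A. countable A & X <= A & A <= M & (ALL Q. D A (%v. Q (v 0)) --> (EX x:M. Q x) --> (EX x:A. Q x))"
proof -
 obtain a where a: "a:X" using assms by blast
 define w where "w = (%(ph, xs). if EX x:M. SQ a ph xs x then SOME x. x:M & SQ a ph xs x else a)"
 have w: "w (ph, xs):M & SQ a ph xs (w (ph, xs))" if "EX x:M. SQ a ph xs x" for ph xs
  unfolding w_def using that someI_ex[of "%x. x:M & SQ a ph xs x"] by auto
 have wM: "w z:M" for z using w[of "fst z" "snd z"] a assms(2) by (cases "EX x:M. SQ a (fst z) (snd z) x") (auto simp: w_def split: prod.splits)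
 define st where "st Y = Y Un w ` (UNIV \<times> lists Y)" for Y
 define B where "B n = (st ^^ n) X" for n
 have BS: "B (Suc n) = B n Un w ` (UNIV \<times> lists (B n))" for n by (simp add: B_def st_def)
 have mono: "B m <= B n" if "m \<le> n" for m n using that by (rule lift_Suc_mono_le[of B, rotated]) (auto simp: BS)
 have cM: "countable (B n) & B n <= M" for n
 proof (induction n)
  case (Suc n) then show ?case using wM by (auto simp: BS)
 qed (use assms in \<open>auto simp: B_def\<close>)
 let ?A = "UN n. B n"
 have "EX x:?A. Q x" if Q: "D ?A (%v. Q (v 0))" "EX x:M. Q x" for Q
 proof -
  have "a:?A" using a by (intro UN_I[of 0]) (auto simp: B_def)
  then obtain ph xs where xs: "xs:lists ?A" "ALL x:M. Q x = SQ a ph xs x" using SQ_ex[OF Q(1)] cM by (metis UN_least)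
  have "EX n. set ys <= B n" if "set ys <= ?A" for ys using that
  proof (induction ys)
   case (Cons y ys)
   then obtain n m where "set ys <= B n" "y:B m" by auto
   then have "set (y # ys) <= B (max n m)" using mono[of n "max n m"] mono[of m "max n m"] by auto
   then show ?case by blast
  qed auto
  then obtain n where "set xs <= B n" using xs(1) by blast
  then have "w (ph, xs):B (Suc n)" unfolding BS by blast
  moreover have "Q (w (ph, xs))" using w[of ph xs] xs Q(2) by blast
  ultimately show ?thesis by blast
 qed
 moreover have "X <= ?A" by (auto simp: B_def intro!: exI[of _ 0])
 ultimately show ?thesis using cM by (intro exI[of _ ?A]) (auto intro!: countable_UN)
qed

text \<open>The Rasiowa-Sikorski construction for the countably many classes definable over
  \<open>A\<close>. Every step can be taken inside \<open>A\<close> by Skolem closure, and the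
  filter is the upward closure of the steps in \<open>M\<close>.\<close>

lemma gx_ex: assumes A: "countable A" "A <= M" "!!Q. D A (%v. Q (v 0)) ==> EX x:M. Q x ==> EX x:A. Q x" and p: "p:A" "Cn p"
 shows "EX G. gx M E A G & p:G"
proof -
 let ?S = "(UNIV :: fm set) \<times> lists A"
 have S: "countable ?S" "?S ~= {}" using A(1) by auto
 define e where "e = from_nat_into ?S"
 have e: "range e = ?S" unfolding e_def using range_from_nat_into[OF S(2,1)] .
 define qq where "qq n q = SQ p (fst (e n)) (snd (e n)) q" for n q
 define nx where "nx n r = (if EX q:A. lq q r & qq n q then SOME q. q:A & lq q r & qq n q else r)" for n r
 define P where "P = rec_nat p nx"
 have P: "P 0 = p" "P (Suc n) = nx n (P n)" for n by (auto simp: P_def)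
 have nx: "nx n r:A" "lq (nx n r) r" "(EX q:A. lq q r & qq n q) ==> qq n (nx n r)" if "r:A" "Cn r" for n r
  using that someI_ex[of "%q. q:A & lq q r & qq n q"] lq_refl unfolding nx_def by (auto split: if_splits)
 have PA: "P n:A & Cn (P n)" for n
 proof (induction n)
  case (Suc n) then show ?case using nx(1,2)[of "P n" n] lqD(1)[of "nx n (P n)" "P n"] unfolding P by blast
 qed (use p P in simp)
 have dec: "lq (P n) (P m)" if "m \<le> n" for m n
  using that
 proof (induction rule: dec_induct)
  case (step n) then show ?case using nx(2)[of "P n" n] PA[of n] lq_trans unfolding P(2) by blast
 qed (use PA lq_refl in blast)
 define G where "G = {q. EX n. lq (P n) q}"
 have "gx M E A G"
 proof (unfold_locales)
  show "A ~= {}" using p by blast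
  show "Cn q" if "q:G" for q using that lqD(2) unfolding G_def by blast
  show "G ~= {}" using lq_refl PA unfolding G_def by blast
  show "q:G" if "r:G" "lq r q" for r q using that lq_trans unfolding G_def by blast
  show "EX s:G. lq s r & lq s q" if "r:G" "q:G" for r q
  proof -
   obtain n m where nm: "lq (P n) r" "lq (P m) q" using \<open>r : G\<close> \<open>q : G\<close> unfolding G_def by blast
   then have "lq (P (max n m)) r" "lq (P (max n m)) q" using lq_trans[OF dec[of n "max n m"]] lq_trans[OF dec[of m "max n m"]] by simp_all
   then show ?thesis using lq_refl PA unfolding G_def by blast
  qed
  fix Q r assume Q: "D A (%v. Q (v 0))" and r: "r:G" and d: "!!s. lq s r ==> EX q:M. lq q s & Q q"
  obtain m where m: "lq (P m) r" using r unfolding G_def by blast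
  obtain ph xs where xs: "xs:lists A" "ALL x:M. Q x = SQ p ph xs x" using SQ_ex[OF Q A(2) p(1)] by blast
  then have "(ph, xs):range e" unfolding e by simp
  then obtain n where n: "e n = (ph, xs)" by (metis rangeE)
  have qQ: "qq n q = Q q" if "q:M" for q using xs n that unfolding qq_def by simp
  have "lq (P (max n m)) r" using lq_trans[OF dec m] by simp
  then obtain q where "q:M" "lq q (P (max n m))" "Q q" using d by blast
  then have "q:M" "lq q (P n)" "Q q" using lq_trans[OF _ dec[of n "max n m"]] by auto
  moreover have "D A (%v. lq (v 0) (P n) & Q (v 0))" using PA A(2) by (intro dfn Q Tm_const) auto
  ultimately have "EX q:A. lq q (P n) & Q q" using A(3)[of "%q. lq q (P n) & Q q"] by blast
  then have "qq n (P (Suc n))" using nx(3)[of "P n" n] PA qQ A(2) unfolding P by blast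
  then have "Q (P (Suc n))" using qQ PA A(2) by blast
  moreover have "P (Suc n):G" using lq_refl PA unfolding G_def by blast
  ultimately show "EX q:G Int A. Q q" using PA by blast
 qed (use A in auto)
 moreover have "p:G" unfolding G_def using P(1) lq_refl[OF p(2)] by (intro CollectI exI[of _ 0]) simp
 ultimately show ?thesis by blast
qed

lemma generic_gx: assumes "generic M E PP rr G" shows "gx M E M G"
proof (unfold_locales)
 have fi: "filter_in PP rr G" and d: "!!C. definable1 M E C ==> dense_in PP rr C ==> G Int C ~= {}" using assms unfolding generic_def by auto
 show "M ~= {}" by (rule nonempty)
 show C: "Cn p" if "p:G" for p using fi that unfolding filter_in_def PP_def by blast
 show "G ~= {}" using fi unfolding filter_in_def by blast
 show dir: "EX s:G. lq s p & lq s q" if "p:G" "q:G" for p q using fi that rr_lq unfolding filter_in_def by meson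
 have gen: "EX q:G. Q q" if Q: "D M (%v. Q (v 0))" "p:G" "!!s. lq s p ==> EX q:M. lq q s & Q q" "!!q r. Q q ==> lq r q ==> Q r" for Q p
 proof -
  have Qd: "Tm M s ==> D M (%v. Q (s v))" for s using D1[OF _ Q(1)] .
  \<comment> \<open>A class that is dense only below \<open>p\<close> is completed by the conditions
    incompatible with \<open>p\<close>, since generic filters are tested against dense
    classes.\<close>
  let ?C = "{q:M. Cn q & (Q q | (ALL s:M. ~ (lq s q & lq s p)))}"
  have "definable1 M E ?C" using C[OF Q(2)] by (intro definable1I[OF _ nonempty] dfn Qd; simp)
  moreover have "dense_in PP rr ?C" unfolding dense_in_def
  proof (intro conjI ballI)
   fix q assume "q:PP"
   then have q: "Cn q" by (simp add: PP_def)
   have "EX q':M. lq q' q & q':?C"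
   proof (cases "EX s:M. lq s q & lq s p")
    case True
    then obtain s where s: "lq s q" "lq s p" by blast
    then obtain q' where "q':M" "lq q' s" "Q q'" using Q(3) by blast
    then show ?thesis using lq_trans[OF _ s(1)] lqD(1) by blast
   next
    case False then show ?thesis using q lq_refl[OF q] by (intro bexI[of _ q]) auto
   qed
   then obtain q' where q': "lq q' q" "q':?C" by blast
   obtain q'' where q'': "q'':M" "lq q'' q'" "(q'', q):rr" using below[OF lqD(1)[OF q'(1)]] q'(1) by blast
   have "q'':?C" using q'(2) q'' Q(4)[OF _ q''(2)] lqD(1)[OF q''(2)] lq_trans[OF _ q''(2)] by blast
   then show "EX d:?C. (d, q):rr" using q'' by blast
  qed (auto simp: PP_def)
  ultimately obtain q where "q:G" "Q q | (ALL s:M. ~ (lq s q & lq s p))" using d by blast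
  then show ?thesis using dir[OF \<open>q : G\<close> Q(2)] C by auto
 qed
 \<comment> \<open>If \<open>p\<close> and \<open>q\<close> are equivalent but distinct,
   \<open>rr\<close> does not relate them. So \<open>q\<close> is reached from a member of
   \<open>G\<close> strictly below it, which genericity provides.\<close>
 show up: "q:G" if "p:G" "lq p q" for p q
 proof -
  have "EX s:G. Cn s & lq s q & ~ lq q s"
  proof (rule gen[OF _ that(1)])
   show "D M (%v. Cn (v 0) & lq (v 0) q & ~ lq q (v 0))" using lqD(2)[OF that(2)] by (intro dfn; simp)
   show "EX r:M. lq r s & Cn r & lq r q & ~ lq q r" if "lq s p" for s
    using strict[OF lqD(1)[OF that]] lq_trans \<open>lq p q\<close> that lqD(1) by blast
  qed (use lqD(1) lq_trans in blast)
  then obtain s where "s:G" "Cn s" "lq s q" "~ lq q s" by blast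
  then have "(s, q):rr" using lqD(2)[OF that(2)] unfolding rr_def by blast
  then show ?thesis using fi \<open>s : G\<close> unfolding filter_in_def by blast
 qed
 fix Q p assume Q: "D M (%v. Q (v 0))" and p: "p:G" and dn: "!!s. lq s p ==> EX q:M. lq q s & Q q"
 have Qd: "Tm M s ==> D M (%v. Q (s v))" for s using D1[OF _ Q] .
 have "EX q:G. EX r:M. lq q r & Q r"
 proof (rule gen[OF _ p])
  show "EX q:M. lq q s & (EX r:M. lq q r & Q r)" if "lq s p" for s using dn[OF that] lq_refl lqD(1) by blast
  show "EX ra:M. lq r ra & Q ra" if "EX r:M. lq q r & Q r" "lq r q" for q r using that lq_trans by blast
 qed (intro dfn Qd)
 then show "EX q:G Int M. Q q" using up C by (metis Cn_M IntI)
qed auto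

lemma gx_generic: assumes "gx M E M G" shows "generic M E PP rr G"
proof -
 interpret gx M E M G by (rule assms)
 have "EX s:G. (s, p):rr & (s, q):rr" if pq: "p:G" "q:G" for p q
 proof -
  obtain s where s: "s:G" "lq s p" "lq s q" using Gdir pq by blast
  have "EX u:G Int M. lq u s & ~ lq s u"
  proof (rule gen[OF _ s(1)])
   show "D M (%v. lq (v 0) s & ~ lq s (v 0))" using GC s by (intro dfn; simp)
   show "EX q:M. lq q r & lq q s & ~ lq s q" if "lq r s" for r using strict[OF lqD(1)[OF that]] that lq_trans by blast
  qed
  then obtain u where u: "u:G" "lq u s" "~ lq s u" by blast
  then have "(u, p):rr" "(u, q):rr" unfolding rr_def using lq_trans s GC pq by blast+
  then show ?thesis using u by blast
 qed
 then have "filter_in PP rr G" unfolding filter_in_def using GC Gne Gup rr_lq by (auto simp: PP_def)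
 moreover have "G Int C ~= {}" if C: "definable1 M E C" "dense_in PP rr C" for C
 proof -
  obtain p where p: "p:G" using Gne by blast
  have "EX q:M. lq q s & q:C" if "lq s p" for s
   using C(2) lqD(1)[OF that] rr_lq unfolding dense_in_def PP_def by (metis Cn_M lqD(1) mem_Collect_eq)
  then show ?thesis using gen[OF definable1D[OF C(1)] p] by blast
 qed
 ultimately show ?thesis unfolding generic_def by blast
qed

lemma generic_ex: "countable M ==> EX G. generic M E PP rr G"
 using gx_ex[of M "cn emp emp emp"] one(1) gx_generic by fastforce

text \<open>If a condition failed to force an instance, a stronger one would force its negation. A
  countable hull of this condition and the names, with a filter through the condition, would then
  give an extension where the instance is false. Countability is needed for the hull only, not for
  \<open>M\<close>.\<close>

lemma forced_if: assumes T: "!!A G. gx M E A G ==> models (gx.CC M E A G) (gx.EE M E G) T" shows "forced M E PP rr FF T"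
 unfolding forced_def
proof (intro ballI)
 fix ph p and v :: "nat => 'a" assume p: "ph:T" "p:PP" and v: "v:UNIV \<rightarrow> names M E PP"
 have C: "Cn p" and Nv: "range v <= {x. Nm x}" using p v unfolding names_iff by (auto simp: PP_def Pi_iff)
 show "fo ph p v"
 proof (rule fo_dense[OF C _ Nv], rule ccontr)
  fix q assume q: "lq q p" and "~ (EX r. lq r q & fo ph r v)"
  then have n: "fo (Neg ph) q v" using fo_Neg[OF Nv] by blast
  have qC: "Cn q" using lqD(1)[OF q] .
  have "countable (insert q (range v))" by auto
  moreover have "insert q (range v) <= M" using qC Nv by auto
  ultimately obtain A where A: "countable A" "insert q (range v) <= A" "A <= M" "ALL Q. D A (%v. Q (v 0)) --> (EX x:M. Q x) --> (EX x:A. Q x)"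
   using skolem_hull by (metis empty_iff insertCI)
  obtain G where G: "gx M E A G" "q:G" using gx_ex[of A q] A qC by auto
  interpret gx M E A G by (rule G)
  have rv: "range v <= N" using A(2) Nv unfolding N_def by blast
  have "sat CC EE (Neg ph) (%n. cl (v n))" using truth[OF rv] n G(2) by blast
  moreover have "sat CC EE ph (%n. cl (v n))" using T[OF G(1)] p(1) rv unfolding models_def by (auto simp: image_subset_iff)
  ultimately show False by simp
 qed
qed

lemma generic_models: assumes T: "!!A G. gx M E A G ==> models (gx.CC M E A G) (gx.EE M E G) T" and G: "generic M E PP rr G"
 shows "models (ext_carrier M E PP FF G) (ext_mem M E G) T"
proof -
 interpret gx M E M G by (rule generic_gx[OF G])
 have "{(si, ta). EX p:G. (p, si, ta):FF} = rel" unfolding rel_def FF_def N_def using F_D by auto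
 moreover have "names M E PP = N" unfolding names_iff N_def by auto
 ultimately have "ext_carrier M E PP FF G = CC" unfolding ext_carrier_def CC_def by simp
 then show ?thesis using T[OF generic_gx[OF G]] unfolding EE_def by simp
qed

end

section \<open>The axioms of ZFC in the extension\<close>

context zfc
begin

definition Pl where "Pl l = mk {p:M. Cn p & el (ll p) <= el l}"
lemma dfn_Pl [dfn]: "Tm A s ==> Tm A (%v. Pl (s v))"
 by (rule Tm1[where f = Pl]; (assumption | (unfold Pl_def, intro dfn)))
lemma Pl_in [simp]: "Pl l:M"
 by (simp add: Pl_def)
lemma el_Pl [simp]: "Ord l ==> el (Pl l) = {p:M. Cn p & el (ll p) <= el l}"
 unfolding Pl_def by (rule el_mk[OF isset_Pl])

lemma lep_R_rk: assumes "X:M" shows "lep X (R (rk X))"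
proof (rule lep_sub[OF assms])
 have "el X <= el (V (rk X))" using rk_mem[OF assms] assms by (auto simp: el_V)
 also have "\<dots> <= el (V (K (rk X)))" using assms le_K by (intro V_mono) auto
 also have "\<dots> <= el (R (rk X))" using assms by (intro V_sub_R) auto
 finally show "el X <= el (R (rk X))" .
qed

text \<open>The form of pretameness on which the axioms rest: after one strengthening, all
  \<open>Q x\<close> with \<open>x:el X\<close> are controlled by conditions from a single set. The
  stage \<open>rk X\<close> is chosen because \<open>X\<close> embeds in
  \<open>R (rk X)\<close>.\<close>

lemma tame: assumes p: "Cn p" and X: "X:M" and Qd: "D M (%v. Q (v 0) (v 1))" and Qo: "!!x s t. x:el X ==> Q x s ==> lq t s ==> Q x t"
 and Qe: "!!x s. x:el X ==> lq s p ==> EX t:M. lq t s & Q x t"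
 shows "EX q:M. lq q p & (ALL x:el X. ALL w. lq w q -->
  (EX r:el (Pl (suc (rk X))). (EX u:M. Q x u & (ALL w:M. lq w q & lq w r --> lq w u)) & (EX w':M. lq w' w & lq w' r)))"
proof -
 define c where "c = rk X"
 have c: "Ord c" using X by (simp add: c_def)
 obtain p1 where p1: "Cn p1" "lq p1 p" "el (suc c) <= el (ll p1)" using long[OF p c] by blast
 have 2: "EX t:M. lq t s & Q x t" if "x:el X" "lq s p1" for x s using Qe[OF that(1)] lq_trans[OF that(2) p1(2)] by blast
 have lX: "lep X (R c)" using lep_R_rk[OF X] by (simp add: c_def)
 have "EX q:M. pure q p1 (suc c) & (ALL x:el X. meets q p1 c (Q x))" by (rule fusion[OF c p1(1,3) X lX Qd]; (use Qo 2 in blast))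
 then obtain q where q: "q:M" "pure q p1 (suc c)" and Z: "!!x. x:el X ==> meets q p1 c (Q x)" by blast
 show ?thesis
 proof (rule bexI[OF _ q(1)], intro conjI ballI allI impI)
  show "lq q p" using lq_trans[OF pure_lq[OF q(2)] p1(2)] .
  fix x w assume x: "x:el X" and w: "lq w q"
  obtain Zx where Zx: "Zx:M" "lep Zx (R c)" "ALL r:el Zx. Cn r & ll r = suc c & bb r = rs (bb p1) (suc c) & (EX u:M. Q x u & (ALL w. lq w q & lq w r --> lq w u))"
   "ALL w. lq w q --> (EX r:el Zx. EX w':M. lq w' w & lq w' r)" using Z[OF x] unfolding meets_def by blast
  then obtain r where r: "r:el Zx" "EX w':M. lq w' w & lq w' r" using w by blast
  moreover have "r:el (Pl (suc c))" using Zx(3) r(1) c by simp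
  ultimately show "EX r:el (Pl (suc (rk X))). (EX u:M. Q x u & (ALL w:M. lq w q & lq w r --> lq w u)) & (EX w':M. lq w' w & lq w' r)"
   using Zx(3) unfolding c_def by blast
 qed
qed

lemma decide: assumes "Cn s" shows "EX t:M. lq t s & Cn t & (Q t | (ALL u:M. lq u t --> ~ Q u))"
proof (cases "EX t:M. lq t s & Q t")
 case True then show ?thesis using lqD(1) by blast
next
 case False then show ?thesis using lq_refl[OF assms] assms by (intro bexI[of _ s]) auto
qed

text \<open>Names for subsets of (the value of) a name \<open>x\<close> can be taken from the set \<open>PN x\<close>.\<close>

definition dm where "dm x = mk {z:M. EX e:el x. z = ft e}"
definition PN where "PN x = mk {y:M. Nm y & y:el (pw (pd (dm x) (Pl (suc (rk x)))))}"
lemma dfn_dm [dfn]: "Tm A s ==> Tm A (%v. dm (s v))"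
 by (rule Tm1[where f = dm]; (assumption | (unfold dm_def, intro dfn)))
lemma dfn_PN [dfn]: "Tm A s ==> Tm A (%v. PN (s v))"
 by (rule Tm1[where f = PN]; (assumption | (unfold PN_def, intro dfn)))
lemma PN_in [simp]: "PN x:M" "dm x:M"
 by (auto simp: PN_def dm_def)
lemma el_dm: "x:M ==> el (dm x) = ft ` el x"
proof -
 assume x: "x:M"
 have "{z:M. EX e:el x. z = ft e} = ft ` el x" by auto
 then show ?thesis unfolding dm_def using isset_image[OF x, of ft] by (simp add: dfn)
qed
lemma dm_Nm: "Nm x ==> z:el (dm x) <-> (EX q:M. pr z q:el x) & z:M"
proof -
 assume x: "Nm x"
 have "z:M & (EX q:M. pr z q:el x)" if "z:ft ` el x" using that Nm_z[OF x] by fastforce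
 moreover have "z:ft ` el x" if "z:M" "q:M" "pr z q:el x" for q using that by (metis ft_pr image_eqI)
 ultimately show ?thesis using el_dm[of x] x by auto
qed
lemma el_PN: "x:M ==> el (PN x) = {y:M. Nm y & el y <= el (pd (dm x) (Pl (suc (rk x))))}"
proof -
 assume x: "x:M"
 have "isset {y:M. Nm y & y:el (pw (pd (dm x) (Pl (suc (rk x)))))}"
  using x by (intro issetI[of "pw (pd (dm x) (Pl (suc (rk x))))"] dfn; simp)
 then have "el (PN x) = {y:M. Nm y & y:el (pw (pd (dm x) (Pl (suc (rk x)))))}" unfolding PN_def by (rule el_mk)
 then show ?thesis unfolding el_pw[OF op_in2(3)] by blast
qed

text \<open>After \<open>tame\<close>, conditions of bounded length decide \<open>P\<close> for each
  \<open>z\<close> in the domain of \<open>x\<close>. So the part of \<open>x\<close> cut out by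
  \<open>P\<close> has a name in the set \<open>PN x\<close>, which serves separation and power set
  alike.\<close>

lemma sub_name: assumes x: "Nm x" and p: "Cn p" and Pd: "D M (%v. P (v 0) (v 1))" and Pm: "!!s t z. P s z ==> lq t s ==> P t z"
 shows "EX q:M. lq q p & (EX y:M. y:el (PN x) & (ALL z:M. ALL r:M. pr z r:el y --> (ALL w:M. lq w q & lq w r --> P w z)) &
  (ALL z:el (dm x). ALL w:M. lq w q & P w z --> Fm w z y))"
proof -
 have xM: "x:M" using x by simp
 have Pdd: "Tm M s ==> Tm M t ==> D M (%v. P (s v) (t v))" for s t using D2[OF _ _ Pd] .
 let ?Q = "%e s. Cn s & (P s (ft e) | (ALL t:M. lq t s --> ~ P t (ft e)))"
 have Qe: "EX t:M. lq t s & ?Q e t" if "lq s p" for e s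
  using decide[OF lqD(1)[OF that]] .
 have "EX q:M. lq q p & (ALL e:el x. ALL w. lq w q -->
  (EX r:el (Pl (suc (rk x))). (EX u:M. ?Q e u & (ALL w:M. lq w q & lq w r --> lq w u)) & (EX w':M. lq w' w & lq w' r)))"
  by (rule tame[OF p xM]; (use Pm lqD(1) lq_trans Qe in \<open>(intro dfn Pdd) | blast\<close>))
 then obtain q where q: "q:M" "lq q p" "!!e w. e:el x ==> lq w q ==>
  EX r:el (Pl (suc (rk x))). (EX u:M. ?Q e u & (ALL w:M. lq w q & lq w r --> lq w u)) & (EX w':M. lq w' w & lq w' r)" by blast
 define ok where "ok z r <-> (EX u:M. P u z & (ALL w:M. lq w q & lq w r --> lq w u))" for z r
 have okd: "Tm M s ==> Tm M t ==> D M (%v. ok (s v) (t v))" for s t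
  by (rule D2[where Q = ok]; (assumption | (unfold ok_def, intro dfn Pdd; simp add: q)))
 define y where "y = mk {e:M. e:el (pd (dm x) (Pl (suc (rk x)))) & ok (ft e) (sn e)}"
 have y: "el y = {e:M. e:el (pd (dm x) (Pl (suc (rk x)))) & ok (ft e) (sn e)}" unfolding y_def by (intro el_mk isset_sep dfn okd; simp)
 have yM: "y:M" by (simp add: y_def)
 have ol: "Ord (suc (rk x))" using xM by simp
 have dN: "Nm z" if "z:el (dm x)" for z using that dm_Nm[OF x] Nm_entry[OF x] by blast
 have Ny: "Nm y"
 proof (rule NmI[OF yM])
  fix e assume "e:el y"
  then obtain z r where "z:el (dm x)" "r:el (Pl (suc (rk x)))" "e = pr z r" unfolding y by auto
  then show "EX s p. Nm s & Cn p & e = pr s p" using dN ol by auto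
 qed
 have 1: "y:el (PN x)" unfolding el_PN[OF xM] using yM Ny y by blast
 have 2: "P w z" if "z:M" "r:M" "pr z r:el y" "w:M" "lq w q & lq w r" for z r w
 proof -
  have "ok z r" using that unfolding y by simp
  then show ?thesis using Pm that unfolding ok_def by blast
 qed
 have 3: "Fm w z y" if z: "z:el (dm x)" and w: "w:M" "lq w q & P w z" for z w
 proof -
  obtain q' where e: "pr z q':el x" "q':M" using z dm_Nm[OF x] by blast
  have ft: "ft (pr z q') = z" using z e by simp
  show "Fm w z y"
  proof (rule Fm_dense)
   fix v assume v: "lq v w"
   then have vq: "lq v q" using w lq_trans by blast
   obtain r u w' where r: "r:el (Pl (suc (rk x)))" "u:M" "?Q (pr z q') u" "ALL w:M. lq w q & lq w r --> lq w u" "w':M" "lq w' v" "lq w' r" using q(3)[OF e(1) vq] by blast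
   have "lq w' u" using r lq_trans[OF r(6) vq] by blast
   moreover have "P w' z" using Pm w lq_trans[OF r(6) v] by blast
   ultimately have "P u z" using r(3,5) unfolding ft by blast
   then have "ok z r" using r unfolding ok_def by blast
   then have "pr z r:el y" unfolding y using z r(1) by auto
   then have "Fm w' z y" using Fm_entry[OF _ Ny r(7)] z by simp
   then show "EX r:M. lq r v & Fm r z y" using r by blast
  qed
 qed
 show ?thesis using q(1,2) yM 1 2 3 by blast
qed

text \<open>One witness is collected for each pair of an element name and a bounded condition
  deciding that a witness exists. The pairs form a set, so collection in the ground model
  applies.\<close>

lemma coll_name: assumes x: "Nm x" and p: "Cn p" and Pd: "D M (%v. P (v 0) (v 1) (v 2))" and Pm: "!!s t z y. P s z y ==> lq t s ==> P t z y"
 shows "EX q:M. lq q p & (EX B:M. ALL z:el (dm x). ALL w:M. lq w q & (EX y:M. Nm y & P w z y) --> (EX w':M. lq w' w & (EX y:el B. Nm y & P w' z y)))"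
proof -
 have xM: "x:M" using x by simp
 have Pdd: "Tm M s ==> Tm M t ==> Tm M u ==> D M (%v. P (s v) (t v) (u v))" for s t u using D3[OF _ _ _ Pd] .
 let ?P = "%s z. EX y:M. Nm y & P s z y"
 let ?Q = "%z s. Cn s & (?P s z | (ALL t:M. lq t s --> ~  ?P t z))"
 have Qe: "EX t:M. lq t s & ?Q z t" if "lq s p" for z s
  using decide[OF lqD(1)[OF that]] .
 let ?l = "suc (rk (dm x))"
 have "EX q:M. lq q p & (ALL z:el (dm x). ALL w. lq w q -->
  (EX r:el (Pl ?l). (EX u:M. ?Q z u & (ALL w:M. lq w q & lq w r --> lq w u)) & (EX w':M. lq w' w & lq w' r)))"
  by (rule tame[OF p PN_in(2)]; (use Pm lqD(1) lq_trans Qe in \<open>(intro dfn Pdd) | blast\<close>))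
 then obtain q where q: "q:M" "lq q p" "!!z w. z:el (dm x) ==> lq w q ==>
  EX r:el (Pl ?l). (EX u:M. ?Q z u & (ALL w:M. lq w q & lq w r --> lq w u)) & (EX w':M. lq w' w & lq w' r)" by blast
 define ok where "ok z r y <-> (EX u:M. P u z y & (ALL w:M. lq w q & lq w r --> lq w u))" for z r y
 have okd: "Tm M s ==> Tm M t ==> Tm M u ==> D M (%v. ok (s v) (t v) (u v))" for s t u
  by (rule D3[where Q = ok]; (assumption | (unfold ok_def, intro dfn Pdd; simp add: q)))
 \<comment> \<open>Where no witness exists, the second alternative admits a default such as the
   empty name, so that collection applies to all pairs.\<close>
 define C where "C e y <-> Nm y & (ok (ft e) (sn e) y | ~ (EX y:M. Nm y & ok (ft e) (sn e) y))" for e y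
 have e: "Nm emp" by (rule NmI) auto
 have "EX B:M. ALL e:el (pd (dm x) (Pl ?l)). EX y:el B. C e y"
  by (rule collection; (use e in \<open>(unfold C_def, intro dfn okd) | (auto simp: C_def)\<close>))
 then obtain B where B: "B:M" "ALL e:el (pd (dm x) (Pl ?l)). EX y:el B. C e y" by blast
 have "EX w':M. lq w' w & (EX y:el B. Nm y & P w' z y)" if z: "z:el (dm x)" and w: "w:M" "lq w q" "?P w z" for z w
 proof -
  obtain r u w' where r: "r:el (Pl ?l)" "u:M" "?Q z u" "ALL w:M. lq w q & lq w r --> lq w u" "w':M" "lq w' w" "lq w' r" using q(3)[OF z w(2)] by blast
  have w'q: "lq w' q" using lq_trans[OF r(6) w(2)] .
  have "lq w' u" using r w'q by blast
  moreover have "?P w' z" using Pm w(3) r(6) by blast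
  ultimately have "?P u z" using r(3,5) by blast
  then have "EX y:M. Nm y & ok z r y" using r(2,4) unfolding ok_def by blast
  moreover obtain y where y: "y:el B" "C (pr z r) y" using B(2) pd_mem[OF z r(1)] by auto
  ultimately have "Nm y" "ok z r y" using z r(1) unfolding C_def by auto
  then have "P w' z y" using r w'q Pm unfolding ok_def by blast
  then show ?thesis using r y \<open>Nm y\<close> by blast
 qed
 then show ?thesis using q B by blast
qed

definition chk where "chk = rec (%p x g. mk {z:M. EX y:el x. z = pr (app g y) p}) (cn emp emp emp)"
lemma chk_H: "Tm A (%v. (%p x g. mk {z:M. EX y:el x. z = pr (app g y) p}) (v 0) (v 1) (v 2))"
 by (intro dfn)
lemma dfn_chk [dfn]: "Tm A s ==> Tm A (%v. chk (s v))"
 unfolding chk_def by (intro Tm_rec chk_H dfn)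
lemma chk_in [simp]: "chk x:M"
 by (simp add: chk_def)
definition un1 where "un1 = cn emp emp emp"
lemma un1: "Cn un1" "Cn p ==> lq p un1" "un1:M"
 using one by (auto simp: un1_def)
lemma dfn_un1 [dfn]: "Tm A (%v. un1)"
 unfolding un1_def by (intro dfn)
lemma el_chk: "x:M ==> el (chk x) = (%y. pr (chk y) un1) ` el x"
proof -
 assume x: "x:M"
 have "chk x = mk {z:M. EX y:el x. z = pr (app (lam x chk) y) un1}" unfolding chk_def un1_def using rec_eq[OF chk_H, of "cn emp emp emp" x] x by simp
 also have "{z:M. EX y:el x. z = pr (app (lam x chk) y) un1} = (%y. pr (chk y) un1) ` el x"
  using app_lam[OF x dfn_chk[OF Tm_var]] by auto
 finally have "chk x = mk ((%y. pr (chk y) un1) ` el x)" .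
 moreover have "isset ((%y. pr (chk y) un1) ` el x)" using x un1(3) by (intro isset_image dfn)
 ultimately show ?thesis by simp
qed
lemma chk_entry: "x:M ==> z:M ==> q:M ==> pr z q:el (chk x) <-> q = un1 & (EX y:el x. z = chk y)"
 using un1(3) by (auto simp: el_chk)
lemma Nm_chk [simp]: "x:M ==> Nm (chk x)"
proof (rule eps_induct[where R = "%x. Nm (chk x)"])
 show "D M (%v. Nm (chk (v 0)))" by (intro dfn)
 fix x assume "x:M" "!!y. y:el x ==> Nm (chk y)"
 then show "Nm (chk x)" using un1(1) by (intro NmI) (auto simp: el_chk)
qed

end

section \<open>A criterion for ZFC in a structure\<close>

context struct
begin

text \<open>Pairing, union and power set are only asked for up to a superset, which separation
  trims, and replacement is obtained from collection without uniqueness. These are the forms in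
  which names deliver the axioms.\<close>

lemma models_ZFC: assumes ne: "M ~= {}"
 and ex: "!!x y. x:M ==> y:M ==> (!!z. z:M ==> E z x <-> E z y) ==> x = y"
 and fo: "!!x y. x:M ==> y:M ==> E y x ==> EX y:M. E y x & (ALL z:M. E z x --> ~ E z y)"
 and pa: "!!x y. x:M ==> y:M ==> EX z:M. E x z & E y z"
 and un: "!!x. x:M ==> EX u:M. ALL y:M. ALL z:M. E y x & E z y --> E z u"
 and po: "!!x. x:M ==> EX p:M. ALL z:M. (ALL y:M. E y z --> E y x) --> E z p"
 and inf: "EX x:M. (EX e:M. (ALL z:M. ~ E z e) & E e x) & (ALL y:M. E y x --> (EX s:M. (ALL z:M. E z s <-> E z y | z = y) & E s x))"
 and ch: "!!x. x:M ==> (!!y. y:M ==> E y x ==> EX z:M. E z y) ==>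
   (!!y y' z. y:M ==> y':M ==> z:M ==> E y x ==> E y' x ==> E z y ==> E z y' ==> y = y') ==>
   EX c:M. ALL y:M. E y x --> (EX u:M. ALL z:M. E z y & E z c <-> z = u)"
 and sep: "!!ph v x a. v:UNIV \<rightarrow> M ==> a:M ==> EX b:M. ALL z:M. E z b <-> E z a & sat M E ph (v(x := z))"
 and col: "!!ph v x y a. v:UNIV \<rightarrow> M ==> a:M ==> x ~= y ==> (!!s. s:M ==> E s a ==> EX t:M. sat M E ph (v(x := s, y := t))) ==>
   EX b:M. ALL s:M. E s a --> (EX t:M. E t b & sat M E ph (v(x := s, y := t)))"
 shows "models M E ZFC"
 unfolding models_def
proof (intro conjI ballI)
 fix ph and v :: "nat => 'a" assume phi: "ph:ZFC" and v: "v:UNIV \<rightarrow> M"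
 consider "ph = extensionality" | "ph = foundation" | "ph = pairing" | "ph = union" | "ph = power_set" | "ph = infinity" | "ph = choice"
  | "ph:separation" | "ph:replacement" using phi unfolding ZFC_def by blast
 then show "sat M E ph v"
 proof cases
  case 1 then show ?thesis using ex by (simp add: extensionality_def f_defs)
 next
  case 2 then show ?thesis using fo by (simp add: foundation_def f_defs) blast
 next
  case 3
  have "EX z:M. ALL w:M. E w z <-> w = x | w = y" if xy: "x:M" "y:M" for x y
  proof -
   obtain z where z: "z:M" "E x z" "E y z" using pa[OF xy] by blast
   have "(%n. if n = 1 then x else y):UNIV \<rightarrow> M" using xy by auto
   from sep[OF this z(1), where x = 0 and ph = "Disj (Eq 0 1) (Eq 0 2)"] show ?thesis using z by auto
  qed
  then show ?thesis using 3 by (simp add: pairing_def f_defs)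
 next
  case 4
  have "EX u:M. ALL z:M. E z u <-> (EX y:M. E y x & E z y)" if x: "x:M" for x
  proof -
   obtain u where u: "u:M" "ALL y:M. ALL z:M. E y x & E z y --> E z u" using un[OF x] by blast
   have "(%n. x):UNIV \<rightarrow> M" using x by auto
   from sep[OF this u(1), where x = 0 and ph = "Ex 2 (Conj (Mem 2 1) (Mem 0 2))"] obtain b where "b:M" "ALL z:M. E z b <-> E z u & (EX y:M. E y x & E z y)" by auto
   then show ?thesis using u(2) by blast
  qed
  then show ?thesis using 4 by (simp add: union_def f_defs)
 next
  case 5
  have "EX p:M. ALL z:M. E z p <-> (ALL y:M. E y z --> E y x)" if x: "x:M" for x
  proof -
   obtain p where p: "p:M" "ALL z:M. (ALL y:M. E y z --> E y x) --> E z p" using po[OF x] by blast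
   have "(%n. x):UNIV \<rightarrow> M" using x by auto
   from sep[OF this p(1), where x = 0 and ph = "All 2 (Imp (Mem 2 0) (Mem 2 1))"] show ?thesis using p by auto
  qed
  then show ?thesis using 5 by (simp add: power_set_def f_defs f_subset_def)
 next
  case 6 then show ?thesis using inf by (simp add: infinity_def f_defs f_empty_def f_succ_def)
 next
  case 7
  have "(ALL y:M. E y x --> (EX z:M. E z y)) & (ALL y:M. ALL y':M. E y x & E y' x & (EX z:M. E z y & E z y') --> y = y') -->
   (EX c:M. ALL y:M. E y x --> (EX u:M. ALL z:M. E z y & E z c <-> z = u))" if "x:M" for x
   using ch[OF that] by blast
  then show ?thesis using 7 by (simp add: choice_def f_defs)
 next
  case 8
  then obtain x a b ps where p: "ph = Ex b (All x (Iff (Mem x b) (Conj (Mem x a) ps)))" "distinct [x, a, b]" "b ~: fv ps" unfolding separation_def by blast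
  have va: "v a:M" using v by auto
  have "sat M E ps (v(b := c, x := z)) = sat M E ps (v(x := z))" for c z by (rule sat_cong) (use p in auto)
  then show ?thesis using sep[OF v va, where x = x and ph = ps] p by auto
 next
  case 9
  then obtain x y z a b ps where p: "ph = Imp (All x (Imp (Mem x a) (Ex z (All y (Iff ps (Eq y z))))))
    (Ex b (All x (Imp (Mem x a) (Ex y (Conj (Mem y b) ps)))))" "distinct [x, y, z, a, b]" "z ~: fv ps" "b ~: fv ps" unfolding replacement_def by blast
  have va: "v a:M" using v by auto
  have 1: "sat M E ps (v(x := s, z := c, y := t)) = sat M E ps (v(x := s, y := t))" for s t c by (rule sat_cong) (use p in auto)
  have 2: "sat M E ps (v(b := c, x := s, y := t)) = sat M E ps (v(x := s, y := t))" for s t c by (rule sat_cong) (use p in auto)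
  have "x ~= y" using p by auto
  note c = col[OF v va this, where ph = ps]
  have "(ALL s:M. E s (v a) --> (EX c:M. ALL t:M. sat M E ps (v(x := s, y := t)) <-> t = c)) --> (EX b:M. ALL s:M. E s (v a) --> (EX t:M. E t b & sat M E ps (v(x := s, y := t))))"
   using c by blast
  moreover have "a ~= x" "z ~= y" "b ~= x" "b ~= y" using p(2) by auto
  ultimately show ?thesis unfolding p(1) using p(2) by (simp add: 1 2)
 qed
qed (rule ne)

lemma D_M: "D A Q ==> A <= M ==> A ~= {} ==> D M Q"
 unfolding D_def by (auto simp: Pi_iff) blast

end

section \<open>The axioms in the extension\<close>

context gx
begin

lemma D_AM: "D A Q ==> D M Q"
 using D_M AM Ane by blast
lemma CC_E: assumes "X:CC" obtains x where "x:N" "X = cl x"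
 using assms unfolding CC_iff by blast
lemma CC_val: assumes "v:UNIV \<rightarrow> CC" obtains w where "range w <= N" "v = (%n. cl (w n))"
proof -
 have "ALL n. EX x. x:N & v n = cl x" using assms unfolding CC_iff by auto
 then obtain w where "!!n. w n:N & v n = cl (w n)" by metis
 then show thesis using that[of w] by auto
qed
lemma truth1: assumes "range v <= N" "z:N" shows "sat CC EE ph ((%n. cl (v n))(x := cl z)) <-> (EX p:G. fo ph p (v(x := z)))"
proof -
 have "(%n. cl (v n))(x := cl z) = (%n. cl ((v(x := z)) n))" by (simp add: fun_eq_iff)
 moreover have "range (v(x := z)) <= N" using assms by auto
 ultimately show ?thesis using truth by metis
qed
lemma truth2: assumes "range v <= N" "z:N" "y:N" shows "sat CC EE ph ((%n. cl (v n))(x := cl z, x' := cl y)) <-> (EX p:G. fo ph p (v(x := z, x' := y)))"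
proof -
 have "(%n. cl (v n))(x := cl z) = (%n. cl ((v(x := z)) n))" by (simp add: fun_eq_iff)
 moreover have "range (v(x := z)) <= N" using assms by auto
 ultimately show ?thesis using truth1[of "v(x := z)" y ph x'] assms by metis
qed

text \<open>\<open>P\<close> speaks about names and need not respect their equality. Therefore an
  element of the new set is only known to equal some \<open>z'\<close> in the domain of
  \<open>x\<close> with property \<open>P\<close>.\<close>

lemma sep_ext: assumes x: "x:N" and Pd: "D A (%v. P (v 0) (v 1))" and Pm: "!!s t z. P s z ==> lq t s ==> P t z"
 shows "EX y:N. y:el (PN x) & (ALL z:N. EE (cl z) (cl y) --> (EX z':N. cl z' = cl z & z':el (dm x) & (EX p:G Int A. P p z'))) &
  (ALL z:N. z:el (dm x) & (EX p:G. P p z) --> EE (cl z) (cl y))"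
proof -
 have xN: "Nm x" "x:A" "x:M" using x by auto
 have Pdd: "Tm A s ==> Tm A t ==> D A (%v. P (s v) (t v))" for s t using D2[OF _ _ Pd] .
 obtain p where p: "p:G" using Gne by blast
 define C where "C q y <-> y:el (PN x) & (ALL z:M. ALL r:M. pr z r:el y --> (ALL w:M. lq w q & lq w r --> P w z)) &
  (ALL z:el (dm x). ALL w:M. lq w q & P w z --> Fm w z y)" for q y
 have "EX q:G Int A. EX y:A. C q y"
 proof (rule gen2[OF _ p])
  show "D A (%v. C (v 0) (v 1))" unfolding C_def by (intro dfn Pdd xN)
  show "EX q:M. lq q s & (EX y:M. C q y)" if "lq s p" for s
   unfolding C_def by (rule sub_name[OF xN(1) lqD(1)[OF that] D_AM[OF Pd]]; (rule Pm; assumption))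
 qed
 then obtain q y where q: "q:G" "y:A" "y:el (PN x)" and 1: "!!z r w. z:M ==> r:M ==> pr z r:el y ==> w:M ==> lq w q ==> lq w r ==> P w z"
  and 2: "!!z w. z:el (dm x) ==> w:M ==> lq w q ==> P w z ==> Fm w z y" unfolding C_def by blast
 have y: "y:N" "el y <= el (pd (dm x) (Pl (suc (rk x))))" using q el_PN[OF xN(3)] unfolding N_def by auto
 have "EX z':N. cl z' = cl z & z':el (dm x) & (EX p:G Int A. P p z')" if z: "z:N" "EE (cl z) (cl y)" for z
 proof -
  obtain z' r where z': "z':N" "r:G" "pr z' r:el y" "r:A" "cl z' = cl z" using EE_D[OF y(1) z] by blast
  obtain s where s: "s:G" "lq s q" "lq s r" using Gdir[OF q(1) z'(2)] by blast
  have zM: "z':A" "z':M" "r:M" using z' by auto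
  have P: "P w z'" if "lq w s" for w using 1[OF zM(2,3) z'(3)] lq_trans[OF that s(2)] lq_trans[OF that s(3)] lqD(1) Cn_M by blast
  have "EX p:G Int A. P p z'"
  proof (rule gen[OF _ s(1)])
   show "D A (%v. P (v 0) z')" by (intro Pdd dfn zM)
   show "EX q:M. lq q t & P q z'" if "lq t s" for t using P[OF that] lq_refl lqD(1)[OF that] Cn_M by blast
  qed
  moreover have "pr z' r:el (pd (dm x) (Pl (suc (rk x))))" using y z' by blast
  then have "z':el (dm x)" using zM by (auto simp: Pl_in)
  ultimately show ?thesis using z' by blast
 qed
 moreover have "EE (cl z) (cl y)" if z: "z:N" "z:el (dm x)" "p:G" "P p z" for z p
 proof -
  obtain s where s: "s:G" "lq s q" "lq s p" using Gdir[OF q(1) z(3)] by blast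
  then have "Fm s z y" using 2[OF z(2) _ s(2)] Pm[OF z(4)] GC by simp
  then show ?thesis using EE_iff[OF z(1) y(1)] s by blast
 qed
 ultimately show ?thesis using y(1) q(3) by blast
qed

lemma extensionality_ext: assumes x: "x:N" and y: "y:N" and e: "!!z. z:N ==> EE (cl z) (cl x) <-> EE (cl z) (cl y)" shows "cl x = cl y"
proof -
 have xy: "x:A" "y:A" "Nm x" "Nm y" using x y by auto
 obtain p where p: "p:G" using Gne by blast
 \<comment> \<open>A positive witness against inclusion: an entry of \<open>x\<close>, active at
   \<open>q\<close>, that no extension of \<open>q\<close> puts into \<open>y\<close>. Together with
   \<open>F q x y\<close> and the symmetric case this gives a dense class.\<close>
 define H where "H q x y <-> (EX z:M. EX r:M. pr z r:el x & lq q r & (ALL w:M. lq w q --> ~ Fm w z y))" for q x y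
 have Hd: "Tm A s ==> Tm A t ==> Tm A u ==> D A (%v. H (s v) (t v) (u v))" for s t u
  by (rule D3[where Q = H]; (assumption | (unfold H_def, intro dfn)))
 have sub: "EX q:M. lq q s & H q x y" if nS: "~ subF F s x y" for s x y
 proof -
  obtain z r u where u: "z:M" "r:M" "u:M" "pr z r:el x" "lq u s" "lq u r" "~ memF F u z y" by (meson nS subF_def)
  obtain q where q: "lq q u" "ALL r:M. lq r q --> ~ Fm r z y" using Fm_dense[of u z y] u(7) unfolding Fm_def by blast
  then have "H q x y" unfolding H_def using u lq_trans by blast
  then show ?thesis using q lq_trans[OF q(1) u(5)] lqD(1) Cn_M by blast
 qed
 have no: False if H: "q:G" "q:A" "H q x y" and x: "x:N" "y:N" and e: "!!z. z:N ==> EE (cl z) (cl x) ==> EE (cl z) (cl y)" for q x y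
 proof -
  have xA: "x:A" "y:A" "Nm x" "Nm y" using x by auto
  have "EX z:A. EX r:M. pr z r:el x & lq q r & (ALL w:M. lq w q --> ~ Fm w z y)"
   using H(3) unfolding H_def by (rule skol[rotated]) (intro dfn xA H)
  then obtain z r where z: "z:A" "r:M" "pr z r:el x" "lq q r" "ALL w:M. lq w q --> ~ Fm w z y" by blast
  have zN: "z:N" using z(1) Nm_entry[OF xA(3) z(3) A_M[OF z(1)] z(2)] unfolding N_def by blast
  have "EE (cl z) (cl x)" using EE_entry[OF x(1) zN _ z(3)] Gup[OF H(1) z(4)] by blast
  then obtain t where t: "t:G" "Fm t z y" using e[OF zN] EE_iff[OF zN x(2)] by blast
  then obtain w where "w:G" "lq w t" "lq w q" using Gdir H by blast
  then show False using Fm_mono[OF t(2)] z(5) GC by auto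
 qed
 have "EX q:G Int A. F q x y | H q x y | H q y x"
 proof (rule gen[OF _ p])
  show "D A (%v. F (v 0) x y | H (v 0) x y | H (v 0) y x)" by (intro dfn Hd xy)
  fix s assume "lq s p"
  then have s: "Cn s" using lqD(1) by blast
  show "EX q:M. lq q s & (F q x y | H q x y | H q y x)"
  proof (cases "F s x y")
   case True then show ?thesis using lq_refl[OF s] s by auto
  next
   case False
   then have "~ subF F s x y | ~ subF F s y x" using F_fix[of s x y] s xy by blast
   then show ?thesis using sub[of s x y] sub[of s y x] by blast
  qed
 qed
 then obtain q where "q:G" "q:A" "F q x y | H q x y | H q y x" by blast
 then show ?thesis using no[of q x y] no[of q y x] e x y cl_eq by blast
qed

lemma foundation_ext: assumes x: "x:N" and z: "z:N" "EE (cl z) (cl x)"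
 shows "EX y:N. EE (cl y) (cl x) & (ALL z:N. EE (cl z) (cl x) --> ~ EE (cl z) (cl y))"
proof -
 have xA: "x:A" "Nm x" using x by auto
 obtain p where p: "p:G" "Fm p z x" using EE_iff z x by blast
 have "EX q:G Int A. EX y:A. Nm y & Fm q y x & (ALL w:M. ALL z:M. lq w q & Nm z --> ~ (Fm w z x & Fm w z y))"
 proof (rule gen2[OF _ p(1)])
  show "D A (%v. Nm (v 1) & Fm (v 0) (v 1) x & (ALL w:M. ALL z:M. lq w (v 0) & Nm z --> ~ (Fm w z x & Fm w z (v 1))))" by (intro dfn xA)
  fix s assume s: "lq s p"
  have sM: "s:M" "Cn s" using lqD(1)[OF s] by auto
  \<comment> \<open>The rank of a name for an element of \<open>x\<close> is minimized over all
    conditions below \<open>s\<close>. An element of the minimal \<open>y\<close> would be equal,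
    below some condition, to a name occurring in \<open>y\<close>, which has smaller rank.\<close>
  define Q where "Q a <-> (EX y:M. Nm y & rk y = a & (EX w:M. lq w s & Fm w y x))" for a
  have Qd: "D M (%v. Q (v 0))" unfolding Q_def using xA sM by (intro dfn; simp)
  have zM: "z:M" "Nm z" using z by auto
  have "Q (rk z)" unfolding Q_def using zM Fm_mono[OF p(2) s] lq_refl[OF sM(2)] sM by blast
  then obtain a where a: "Ord a" "Q a" "!!b. b:el a ==> ~ Q b" using Ord_min[OF Qd, of "rk z"] zM by auto
  then obtain y w where y: "y:M" "Nm y" "rk y = a" "w:M" "lq w s" "Fm w y x" unfolding Q_def by blast
  have "~ (Fm u t x & Fm u t y)" if u: "u:M" "t:M" "lq u w" "Nm t" for u t
  proof
   assume F: "Fm u t x & Fm u t y"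
   then obtain u' t' r where u': "u':M" "lq u' u" "t':M" "r:M" "pr t' r:el y" "F u' t t'" unfolding Fm_def memF_def using lq_refl[OF lqD(1)[OF u(3)]] u(1) by blast
   have "Fm u' t' x" using Fm_cong[OF _ u'(6) F_refl] F Fm_mono u'(2) xA lqD(1)[OF u'(2)] by blast
   moreover have "Nm t'" using Nm_entry[OF y(2) u'(5)] u' by simp
   moreover have "rk t':el a" using rk_entry[OF y(1) u'(5)] u' y by simp
   ultimately show False using a(3) u' lq_trans[OF lq_trans[OF u'(2) u(3)] y(5)] unfolding Q_def by blast
  qed
  then show "EX q:M. lq q s & (EX y:M. Nm y & Fm q y x & (ALL w:M. ALL z:M. lq w q & Nm z --> ~ (Fm w z x & Fm w z y)))" using y by blast
 qed
 then obtain q y where q: "q:G" "y:A" "Nm y" "Fm q y x" "!!w z. lq w q ==> Nm z ==> ~ (Fm w z x & Fm w z y)" by (metis (no_types, lifting) Cn_M Int_iff Nm_M lqD(1))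
 have y: "y:N" using q unfolding N_def by simp
 have "~ EE (cl z) (cl y)" if z: "z:N" "EE (cl z) (cl x)" for z
 proof
  assume "EE (cl z) (cl y)"
  then obtain p1 p2 where p: "p1:G" "Fm p1 z x" "p2:G" "Fm p2 z y" using EE_iff z x y by blast
  obtain s where s: "s:G" "lq s p1" "lq s p2" using Gdir p by blast
  obtain t where t: "t:G" "lq t s" "lq t q" using Gdir s q by blast
  then show False using q(5)[OF t(3), of z] Fm_mono[OF p(2) lq_trans[OF t(2) s(2)]] Fm_mono[OF p(4) lq_trans[OF t(2) s(3)]] z by simp
 qed
 then show ?thesis using y EE_iff[OF y x] q by blast
qed

lemma uG: "un1:G"
 using Gne Gup un1(2) GC by blast

text \<open>Elements of \<open>B\<close> that are not names are discarded, so any set of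
  \<open>A\<close> that contains the wanted names can be used directly.\<close>

definition sname where "sname B = mk {e:M. EX y:el B. Nm y & e = pr y un1}"
lemma sname: assumes B: "B:A" shows "sname B:N" "y:N ==> y:el B ==> EE (cl y) (cl (sname B))" "y:el (dm (sname B)) <-> y:el B & Nm y"
proof -
 have BM: "B:M" using B by simp
 have el: "el (sname B) = {e:M. EX y:el B. Nm y & e = pr y un1}" unfolding sname_def
 proof (rule el_mk, rule issetI[where x = "pd B (up un1 un1)"])
  show "D M (%v. EX y:el B. Nm y & v 0 = pr y un1)" by (intro dfn BM un1(3))
 qed (use BM un1(3) in auto)
 have Nm: "Nm (sname B)" by (rule NmI) (use un1(1) el in \<open>auto simp: sname_def\<close>)
 show s: "sname B:N" by (rule N_in_A[OF Nm]) (unfold sname_def, intro dfn B)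
 show "EE (cl y) (cl (sname B))" if y: "y:N" "y:el B"
 proof (rule EE_entry[OF s y(1) uG])
  show "pr y un1:el (sname B)" unfolding el using y(2) N_D(1)[OF y(1)] by auto
 qed
 show "y:el (dm (sname B)) <-> y:el B & Nm y" using dm_Nm[OF Nm, of y] un1(3) unfolding el by auto
qed

lemma separation_ext: assumes v: "range v <= N" and a: "a:N"
 shows "EX y:N. ALL z:N. EE (cl z) (cl y) <-> EE (cl z) (cl a) & sat CC EE ph ((%n. cl (v n))(x := cl z))"
proof -
 have aA: "a:A" "Nm a" using a by auto
 have vA: "range v <= A" "range v <= {x. Nm x}" using v by auto
 define P where "P p z <-> Nm z & Fm p z a & fo ph p (v(x := z))" for p z
 have "D A (%v. P (v 0) (v 1))" unfolding P_def by (intro dfn D_foA1 vA aA)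
 moreover have "P t z" if "P s z" "lq t s" for s t z
 proof -
  have "range (v(x := z)) <= {x. Nm x}" using vA(2) that unfolding P_def by auto
  then show ?thesis using that fo_mono[OF _ that(2)] Fm_mono unfolding P_def by blast
 qed
 ultimately obtain y where y: "y:N" "!!z. z:N ==> EE (cl z) (cl y) ==> (EX z':N. cl z' = cl z & z':el (dm a) & (EX p:G Int A. P p z'))"
  "!!z. z:N ==> z:el (dm a) ==> EX p:G. P p z ==> EE (cl z) (cl y)" using sep_ext[OF a, of P] by blast
 have 1: "EE (cl z) (cl a) & sat CC EE ph ((%n. cl (v n))(x := cl z))" if z: "z:N" "EE (cl z) (cl y)" for z
 proof -
  obtain z' p where z': "z':N" "cl z' = cl z" "p:G" "P p z'" using y(2)[OF z] by blast
  then show ?thesis using EE_iff[OF z'(1) a] truth1[OF v z'(1), of ph x] unfolding P_def by auto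
 qed
 have 2: "EE (cl z) (cl y)" if z: "z:N" "EE (cl z) (cl a)" "sat CC EE ph ((%n. cl (v n))(x := cl z))" for z
 proof -
  obtain z' r where z': "z':N" "r:G" "pr z' r:el a" "r:A" "cl z' = cl z" using EE_D[OF a z(1,2)] by blast
  obtain p where p: "p:G" "fo ph p (v(x := z'))" using z z' truth1[OF v z'(1), of ph x] by auto
  obtain s where s: "s:G" "lq s r" "lq s p" using Gdir z' p by blast
  have "range (v(x := z')) <= {x. Nm x}" using vA(2) z' by auto
  then have "P s z'" unfolding P_def using Fm_entry[OF z'(3) aA(2) s(2)] fo_mono[OF p(2) s(3)] z' by simp
  moreover have "z':el (dm a)" using dm_Nm[OF aA(2)] z' by auto
  ultimately show ?thesis using y(3)[OF z'(1)] s z' by auto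
 qed
 show ?thesis using y(1) 1 2 by blast
qed

lemma union_ext: assumes x: "x:N" shows "EX u:N. (ALL y:N. ALL z:N. EE (cl y) (cl x) & EE (cl z) (cl y) --> (EX z':N. z':el (dm u) & cl z' = cl z & EE (cl z) (cl u)))"
proof -
 have xA: "x:A" "Nm x" "x:M" using x by auto
 define B where "B = mk {t:M. EX z:el (dm x). t:el (dm z)}"
 have B: "el B = {t:M. EX z:el (dm x). t:el (dm z)}"
 proof -
  have "{t:M. EX z:el (dm x). t:el (dm z)} = (UN z:el (dm x). el (dm z))" by auto
  then show ?thesis unfolding B_def using isset_UN[of "dm x" dm] by (simp add: dfn)
 qed
 have BA: "B:A" by (rule A_in) (unfold B_def, intro dfn xA)
 have "EX z':N. z':el (dm (sname B)) & cl z' = cl z & EE (cl z) (cl (sname B))" if y: "y:N" "z:N" "EE (cl y) (cl x)" "EE (cl z) (cl y)" for y z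
 proof -
  obtain y' r where y': "y':N" "pr y' r:el x" "r:A" "cl y' = cl y" using EE_D[OF x y(1,3)] by blast
  then obtain z' q where z': "z':N" "pr z' q:el y'" "q:A" "cl z' = cl z" using EE_D[of y' z] y by auto
  have "y':el (dm x)" "z':el (dm y')" using dm_Nm[of x y'] dm_Nm[of y' z'] y' z' xA by auto
  then have "z':el B" using z' unfolding B by auto
  then show ?thesis using sname[OF BA] z' by (metis N_D(1))
 qed
 then show ?thesis using sname(1)[OF BA] by blast
qed

lemma sub_PN: assumes x: "x:N" and z: "z:N" "!!y. y:N ==> EE (cl y) (cl z) ==> EE (cl y) (cl x)"
 shows "EX y:N. y:el (PN x) & cl y = cl z"
proof -
 have xA: "x:A" "Nm x" "x:M" "z:A" using x z by auto
 have "D A (%v. Fm (v 0) (v 1) z)" by (intro dfn xA)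
 from sep_ext[OF x this] Fm_mono obtain y where y: "y:N" "y:el (PN x)" "!!t. t:N ==> EE (cl t) (cl y) ==> (EX z':N. cl z' = cl t & z':el (dm x) & (EX p:G Int A. Fm p z' z))"
  "!!t. t:N ==> t:el (dm x) ==> EX p:G. Fm p t z ==> EE (cl t) (cl y)" by blast
 have "cl y = cl z"
 proof (rule extensionality_ext[OF y(1) z(1)], rule iffI)
  fix t assume t: "t:N" "EE (cl t) (cl y)"
  then show "EE (cl t) (cl z)" using y(3)[OF t] EE_iff z(1) by (metis IntD1)
 next
  fix t assume t: "t:N" "EE (cl t) (cl z)"
  then obtain t' r where t': "t':N" "pr t' r:el x" "r:A" "cl t' = cl t" using EE_D[OF x t(1)] z by blast
  then have "t':el (dm x)" using dm_Nm[of x t'] xA by auto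
  then show "EE (cl t) (cl y)" using y(4)[OF t'(1)] t t' EE_iff[OF t'(1) z(1)] by simp
 qed
 then show ?thesis using y by blast
qed

lemma power_ext: assumes x: "x:N" shows "EX u:N. (ALL z:N. (ALL y:N. EE (cl y) (cl z) --> EE (cl y) (cl x)) --> EE (cl z) (cl u))"
proof -
 have xA: "x:A" using x by auto
 have BA: "PN x:A" by (rule A_in) (intro dfn xA)
 have "EE (cl z) (cl (sname (PN x)))" if z: "z:N" "!!y. y:N ==> EE (cl y) (cl z) ==> EE (cl y) (cl x)" for z
  using sub_PN[OF x z] sname(2)[OF BA] by metis
 then show ?thesis using sname(1)[OF BA] by blast
qed

text \<open>The elements of members of \<open>x\<close> all have names in the ground model set
  \<open>dm u\<close>, which can be well-ordered there. The choice set takes from each member the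
  element whose name comes first; \<open>L\<close> expresses that \<open>g\<close> is this first
  index.\<close>

lemma choice_ext: assumes x: "x:N" and ne: "!!y. y:N ==> EE (cl y) (cl x) ==> EX z:N. EE (cl z) (cl y)"
 and dj: "!!y y' z. y:N ==> y':N ==> z:N ==> EE (cl y) (cl x) ==> EE (cl y') (cl x) ==> EE (cl z) (cl y) ==> EE (cl z) (cl y') ==> cl y = cl y'"
 shows "EX c:N. ALL y:N. EE (cl y) (cl x) --> (EX u:N. ALL z:N. EE (cl z) (cl y) & EE (cl z) (cl c) <-> cl z = cl u)"
proof -
 obtain u where u: "u:N" "!!y z. y:N ==> z:N ==> EE (cl y) (cl x) ==> EE (cl z) (cl y) ==> EX z':N. z':el (dm u) & cl z' = cl z" using union_ext[OF x] by blast
 have uA: "u:A" "u:M" "x:A" "x:M" using u x by auto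
 have "EX a:A. EX f:M. Ord a & inj f a (dm u) & (ALL z:el (dm u). EX y:el a. app f y = z)"
 proof (rule skol)
  show "D A (%v. EX f:M. Ord (v 0) & inj f (v 0) (dm u) & (ALL z:el (dm u). EX y:el (v 0). app f y = z))" by (intro dfn uA)
  show "EX a:M. EX f:M. Ord a & inj f a (dm u) & (ALL z:el (dm u). EX y:el a. app f y = z)" using well_order[of "dm u"] OrdM by fastforce
 qed
 then obtain a where aA: "a:A" "EX f:M. Ord a & inj f a (dm u) & (ALL z:el (dm u). EX y:el a. app f y = z)" by blast
 then have "EX f:A. Ord a & inj f a (dm u) & (ALL z:el (dm u). EX y:el a. app f y = z)" using uA by (intro skol) (intro dfn uA aA)
 then obtain f where f: "f:A" "Ord a" "inj f a (dm u)" "!!z. z:el (dm u) ==> EX y:el a. app f y = z" by blast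
 define L where "L p g y <-> g:el a & Fm p (app f g) y & (ALL b:el g. ALL w:M. lq w p --> ~ Fm w (app f b) y)" for p g y
 have Ld: "Tm A s ==> Tm A t ==> Tm A u ==> D A (%v. L (s v) (t v) (u v))" for s t u
  by (rule D3[where Q = L]; (assumption | (unfold L_def, intro dfn aA f)))
 have Lm: "L q g y" if "L p g y" "lq q p" for p q g y using that Fm_mono lq_trans unfolding L_def by blast
 define P where "P p z <-> (EX y:M. Nm y & Fm p y x & (EX g:M. app f g = z & L p g y))" for p z
 have "D A (%v. P (v 0) (v 1))" unfolding P_def by (intro dfn Ld uA f)
 moreover have "P t z" if "P s z" "lq t s" for s t z using that Fm_mono Lm unfolding P_def by blast
 ultimately obtain c where c: "c:N" "!!z. z:N ==> EE (cl z) (cl c) ==> (EX z':N. cl z' = cl z & z':el (dm u) & (EX p:G Int A. P p z'))"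
  "!!z. z:N ==> z:el (dm u) ==> EX p:G. P p z ==> EE (cl z) (cl c)" using sep_ext[OF u(1), of P] by blast
 have fN: "app f g:N" "app f g:el (dm u)" if "g:A" "g:el a" for g
 proof -
  show d: "app f g:el (dm u)" using f(3) that unfolding inj_def by blast
  have "Nm (app f g)" using d dm_Nm[of u] Nm_entry[of u] N_D(1)[OF u(1)] by blast
  then show "app f g:N" by (rule N_in_A) (intro dfn that f)
 qed
 have "EX t:N. ALL z:N. EE (cl z) (cl y) & EE (cl z) (cl c) <-> cl z = cl t" if y: "y:N" "EE (cl y) (cl x)" for y
 proof -
  have yA: "y:A" "Nm y" "y:M" using y by auto
  obtain z0 where z0: "z0:N" "z0:el (dm u)" "EE (cl z0) (cl y)" using ne[OF y] u(2)[OF y(1) _ y(2)] by metis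
  obtain p1 p2 where "p1:G" "Fm p1 y x" "p2:G" "Fm p2 z0 y" using EE_iff[OF y(1) x] EE_iff[OF z0(1) y(1)] y z0 by blast
  then obtain p where p: "p:G" "Fm p y x" "Fm p z0 y" using Gdir Fm_mono by meson
  obtain g0 where g0: "g0:el a" "app f g0 = z0" using f(4)[OF z0(2)] by blast
  have "EX q:G Int A. EX g:A. Fm q y x & L q g y"
  proof (rule gen2[OF _ p(1)])
   show "D A (%v. Fm (v 0) y x & L (v 0) (v 1) y)" by (intro dfn Ld yA uA)
   fix s assume s: "lq s p"
   have sM: "s:M" "Cn s" using lqD(1)[OF s] by auto
   define Q where "Q g <-> g:el a & (EX w:M. lq w s & Fm w (app f g) y)" for g
   have Qd: "D M (%v. Q (v 0))" unfolding Q_def using aA(1) f sM yA by (intro dfn; simp)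
   have "Q g0" unfolding Q_def using g0 Fm_mono[OF p(3) s] lq_refl[OF sM(2)] sM by blast
   then obtain g where g: "Q g" "!!b. b:el g ==> ~ Q b" using Ord_min[OF Qd Ord_in[OF f(2) g0(1)]] by blast
   then obtain w where w: "g:el a" "w:M" "lq w s" "Fm w (app f g) y" unfolding Q_def by blast
   have "~ Fm t (app f b) y" if "b:el g" "t:M" "lq t w" for b t using g(2)[OF that(1)] Ord_trans[OF f(2) w(1) that(1)] that lq_trans[OF that(3) w(3)] unfolding Q_def by blast
   then have "L w g y" unfolding L_def using w by blast
   moreover have "Fm w y x" using Fm_mono[OF p(2) lq_trans[OF w(3) s]] .
   ultimately have "EX g:M. Fm w y x & L w g y" using elM[OF w(1)] by metis
   then show "EX q:M. lq q s & (EX g:M. Fm q y x & L q g y)" using w(2,3) by metis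
  qed
  then obtain q g where q: "q:G" "q:A" "g:A" "Fm q y x" "L q g y" by blast
  have ga: "g:el a" "Fm q (app f g) y" using q(5) unfolding L_def by auto
  note fg = fN[OF q(3) ga(1)]
  have 1: "EE (cl (app f g)) (cl y)" using EE_iff[OF fg(1) y(1)] q ga by blast
  have 2: "EE (cl (app f g)) (cl c)" using c(3)[OF fg] q yA unfolding P_def by (metis A_M)
  have 3: "cl z = cl (app f g)" if z: "z:N" "EE (cl z) (cl y)" "EE (cl z) (cl c)" for z
  proof -
   obtain z' p' where z': "z':N" "cl z' = cl z" "p':G" "p':A" "P p' z'" using c(2)[OF z(1,3)] by blast
   have "EX y':A. Nm y' & Fm p' y' x & (EX g:M. app f g = z' & L p' g y')" using z'(5) unfolding P_def
    by (rule skol[rotated]) (intro dfn Ld uA f z' N_D)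
   then obtain y' g' where y': "y':A" "Nm y'" "Fm p' y' x" "g':M" "app f g' = z'" "L p' g' y'" by blast
   have yN: "y':N" using y' unfolding N_def by simp
   have "EE (cl y') (cl x)" using EE_iff[OF yN x] y' z' by blast
   moreover have "Fm p' z' y'" using y' unfolding L_def by simp
   then have "EE (cl z) (cl y')" using EE_iff[OF z'(1) yN] z' by metis
   ultimately have "cl y' = cl y" using dj[OF yN y(1) z(1) _ y(2)] z by blast
   then obtain r where r: "r:G" "F r y' y" using cl_eq yN y by blast
   obtain s where s: "s:G" "lq s r" "lq s q" using Gdir r q by blast
   obtain t where t: "t:G" "lq t s" "lq t p'" using Gdir s z' by blast
   have tC: "Cn t" "t:M" using GC t by auto
   have F: "F t y' y" using F_mono[OF r(2)] lq_trans t s by blast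
   have L: "L t g y" "L t g' y'" using Lm q(5) y'(6) t s lq_trans by blast+
   have g': "g':el a" using y' unfolding L_def by simp
   have NN: "Nm (app f g)" "Nm (app f g')" using fg y' z' by auto
   have "Fm t (app f g') y" using Fm_cong[OF _ F_refl[OF tC(1) NN(2)] F] L(2) unfolding L_def by blast
   then have "g' ~: el g" using L(1) lq_refl[OF tC(1)] tC unfolding L_def by blast
   moreover have "Fm t (app f g) y'" using Fm_cong[OF _ F_refl[OF tC(1) NN(1)] F_sym[OF F]] L(1) unfolding L_def by blast
   then have "g ~: el g'" using L(2) lq_refl[OF tC(1)] tC unfolding L_def by blast
   ultimately have "g = g'" using Ord_linear Ord_in[OF f(2)] ga g' by blast
   then show ?thesis using y' z' by simp
  qed
  have "EE (cl z) (cl y) & EE (cl z) (cl c) <-> cl z = cl (app f g)" if "z:N" for z using 1 2 3[OF that] by metis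
  then show ?thesis using fg(1) by blast
 qed
 then show ?thesis using c(1) by blast
qed

lemma collection_ext: assumes v: "range v <= N" and a: "a:N" and xy: "x ~= y"
 and h: "!!s. s:N ==> EE (cl s) (cl a) ==> EX t:N. sat CC EE ph ((%n. cl (v n))(x := cl s, y := cl t))"
 shows "EX b:N. ALL s:N. EE (cl s) (cl a) --> (EX t:N. EE (cl t) (cl b) & sat CC EE ph ((%n. cl (v n))(x := cl s, y := cl t)))"
proof -
 have aA: "a:A" "Nm a" using a by auto
 have vA: "range v <= A" "range v <= {x. Nm x}" using v by auto
 define P where "P p s t <-> Nm s & Nm t & fo ph p (v(x := s, y := t))" for p s t
 have Pd: "Tm A r ==> Tm A s ==> Tm A t ==> D A (%v. P (r v) (s v) (t v))" for r s t
  unfolding P_def by (intro dfn D_foA2 vA xy)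
 have Pm: "P q s t" if "P p s t" "lq q p" for p q s t
 proof -
  have "range (v(x := s, y := t)) <= {x. Nm x}" using vA(2) that unfolding P_def by auto
  then show ?thesis using that fo_mono[OF _ that(2)] unfolding P_def by blast
 qed
 have Pd3: "D M (%v. P (v 0) (v 1) (v 2))" by (rule D_AM, intro Pd dfn)
 obtain p where p: "p:G" using Gne by blast
 define C where "C q B <-> (ALL z:el (dm a). ALL w:M. lq w q & (EX y:M. Nm y & P w z y) --> (EX w':M. lq w' w & (EX y:el B. Nm y & P w' z y)))" for q B
 have "EX q:G Int A. EX B:A. C q B"
 proof (rule gen2[OF _ p])
  show "D A (%v. C (v 0) (v 1))" unfolding C_def by (intro dfn Pd aA)
  show "EX q:M. lq q s & (EX B:M. C q B)" if "lq s p" for s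
   unfolding C_def by (rule coll_name[OF aA(2) lqD(1)[OF that] Pd3]; (rule Pm; assumption))
 qed
 then obtain q B where q: "q:G" "B:A" and B: "!!z w. z:el (dm a) ==> w:M ==> lq w q ==> (EX y:M. Nm y & P w z y) ==> (EX w':M. lq w' w & (EX y:el B. Nm y & P w' z y))"
  unfolding C_def by blast
 have "EX t:N. EE (cl t) (cl (sname B)) & sat CC EE ph ((%n. cl (v n))(x := cl s, y := cl t))" if s: "s:N" "EE (cl s) (cl a)" for s
 proof -
  obtain z r where z: "z:N" "pr z r:el a" "r:A" "cl z = cl s" using EE_D[OF a s] by blast
  have zd: "z:el (dm a)" "z:A" using dm_Nm[of a z] z aA by auto
  obtain t where t: "t:N" "sat CC EE ph ((%n. cl (v n))(x := cl z, y := cl t))" using h[OF s] z by auto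
  obtain p where p: "p:G" "fo ph p (v(x := z, y := t))" using truth2[OF v z(1) t(1), of ph x y] t by blast
  obtain w where w: "w:G" "lq w p" "lq w q" using Gdir p q by blast
  have P: "P p z t" unfolding P_def using p z t by simp
  have "EX u:G Int A. EX t:A. t:el B & P u z t"
  proof (rule gen2[OF _ w(1)])
   show "D A (%v. v 1:el B & P (v 0) z (v 1))" by (intro dfn Pd q zd)
   fix s assume s: "lq s w"
   have "P s z t" "Nm t" "lq s q" "s:M" using Pm[OF P] lq_trans[OF s] w t lqD(1)[OF s] by auto
   then show "EX q:M. lq q s & (EX y:M. y:el B & P q z y)" using B[OF zd(1)] by (metis Nm_M)
  qed
  then obtain u t' where u: "u:G" "t':A" "t':el B" "P u z t'" by blast
  then have t': "t':N" unfolding N_def P_def by simp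
  then show ?thesis using sname(2)[OF q(2) t' u(3)] truth2[OF v z(1) t', of ph x y] u z unfolding P_def by metis
 qed
 then show ?thesis using sname(1)[OF q(2)] by blast
qed

definition j where "j x = cl (chk x)"
lemma chk_N [simp]: "x:A ==> chk x:N"
 by (rule N_in_A[OF Nm_chk[OF A_M]], assumption, rule dfn_chk, rule Tm_A)
lemma j_CC [simp]: "x:A ==> j x:CC"
 unfolding j_def by simp
lemma j_mem: assumes x: "x:A" shows "EE Z (j x) & Z:CC <-> (EX y:el x Int A. Z = j y)"
proof
 assume a: "EE Z (j x) & Z:CC"
 then obtain z where z: "z:N" "Z = cl z" using CC_E by blast
 then obtain z' q where z': "z':N" "q:A" "pr z' q:el (chk x)" "cl z' = Z" using EE_D[OF chk_N[OF x] z(1)] a unfolding j_def by metis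
 have zA: "z':A" "z':M" "q:M" "x:M" using z' x by auto
 have "EX y:M. y:el x & z' = chk y" using z' chk_entry[OF zA(4) zA(2,3)] by auto
 then have "EX y:A. y:el x & z' = chk y" by (rule skol[rotated]) (intro dfn zA x)
 then show "EX y:el x Int A. Z = j y" using z' unfolding j_def by blast
next
 assume "EX y:el x Int A. Z = j y"
 then obtain y where y: "y:el x" "y:A" "Z = j y" by blast
 have "pr (chk y) un1:el (chk x)" using y x by (simp add: el_chk)
 then show "EE Z (j x) & Z:CC" using EE_entry[OF chk_N[OF x] chk_N[OF y(2)] uG] y unfolding j_def by simp
qed

theorem ZFC_ext: "models CC EE ZFC"
proof (rule struct.models_ZFC)
 have CN: "(ALL z:CC. Q z) <-> (ALL z:N. Q (cl z))" "(EX z:CC. Q z) <-> (EX z:N. Q (cl z))" for Q unfolding CC_iff by auto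
 show "CC ~= {}" using chk_N[OF A_in[OF dfn1(1)]] unfolding CC_iff by blast
 show "x = y" if "x:CC" "y:CC" "!!z. z:CC ==> EE z x = EE z y" for x y
  using that extensionality_ext by (metis CC_E cl_CC)
 show "EX y:CC. EE y x & (ALL z:CC. EE z x --> ~ EE z y)" if "x:CC" "y:CC" "EE y x" for x y
  using that foundation_ext unfolding CN by (metis CC_E)
 show "EX z:CC. EE x z & EE y z" if xy: "x:CC" "y:CC" for x y
 proof -
  obtain s t where s: "s:N" "t:N" "x = cl s" "y = cl t" using xy CC_E by metis
  have B: "up s t:A" by (rule A_in) (intro dfn s N_D)
  have "s:el (up s t)" "t:el (up s t)" using s by auto
  then show ?thesis using sname[OF B] s by (metis cl_CC)
 qed
 show "EX u:CC. ALL y:CC. ALL z:CC. EE y x & EE z y --> EE z u" if xC: "x:CC" for x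
 proof -
  obtain s where s: "s:N" "x = cl s" using xC CC_E by metis
  show ?thesis using union_ext[OF s(1)] unfolding CN s(2) by blast
 qed
 show "EX p:CC. ALL z:CC. (ALL y:CC. EE y z --> EE y x) --> EE z p" if "x:CC" for x
  using that power_ext unfolding CN by (metis CC_E)
 have A: "om:A" "emp:A" using A_in[OF dfn_om] A_in[OF dfn1(1)] by auto
 have A': "suc n:A" if "n:A" for n by (rule A_in) (intro dfn that)
 have "EE (j emp) (j om)" "ALL z:CC. ~ EE z (j emp)" using j_mem[OF A(1), of "j emp"] j_mem[OF A(2)] A Lim_emp[OF Lim_om] by auto
 moreover have "EX s:CC. (ALL z:CC. EE z s <-> EE z y | z = y) & EE s (j om)" if y: "y:CC" "EE y (j om)" for y
 proof -
  obtain n where n: "n:el om" "n:A" "y = j n" using j_mem[OF A(1)] y by blast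
  have s: "suc n:el om" using Lim_om n unfolding Lim_def by blast
  have "EE (j (suc n)) (j om)" using j_mem[OF A(1)] s A'[OF n(2)] by blast
  moreover have "EE z (j (suc n)) <-> EE z y | z = y" if z: "z:CC" for z
   using j_mem[OF A'[OF n(2)], of z] j_mem[OF n(2), of z] z n by auto
  ultimately show ?thesis using A'[OF n(2)] by (intro bexI[of _ "j (suc n)"]) auto
 qed
 ultimately show "EX x:CC. (EX e:CC. (ALL z:CC. ~ EE z e) & EE e x) & (ALL y:CC. EE y x --> (EX s:CC. (ALL z:CC. EE z s <-> EE z y | z = y) & EE s x))"
  using A by (intro bexI[of _ "j om"]) auto
 show "EX c:CC. ALL y:CC. EE y x --> (EX u:CC. ALL z:CC. EE z y & EE z c <-> z = u)"
  if x: "x:CC" and 1: "!!y. y:CC ==> EE y x ==> EX z:CC. EE z y"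
  and 2: "!!y y' z. y:CC ==> y':CC ==> z:CC ==> EE y x ==> EE y' x ==> EE z y ==> EE z y' ==> y = y'" for x
 proof -
  obtain s where s: "s:N" "x = cl s" using x CC_E by metis
  show ?thesis unfolding CN s(2)
  proof (rule choice_ext[OF s(1)])
   show "EX z:N. EE (cl z) (cl y)" if "y:N" "EE (cl y) (cl s)" for y using 1[of "cl y"] that s unfolding CN by simp
   show "cl y = cl y'" if "y:N" "y':N" "z:N" "EE (cl y) (cl s)" "EE (cl y') (cl s)" "EE (cl z) (cl y)" "EE (cl z) (cl y')" for y y' z
    using 2[of "cl y" "cl y'" "cl z"] that s by simp
  qed
 qed
 show "EX b:CC. ALL z:CC. EE z b <-> EE z a & sat CC EE ph (v(x := z))" if v: "v:UNIV \<rightarrow> CC" and a: "a:CC" for ph v x a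
 proof -
  obtain w where w: "range w <= N" "v = (%n. cl (w n))" using CC_val[OF v] .
  obtain s where s: "s:N" "a = cl s" using a CC_E by metis
  show ?thesis unfolding CN s(2) w(2) by (rule separation_ext[OF w(1) s(1)])
 qed
 show "EX b:CC. ALL s:CC. EE s a --> (EX t:CC. EE t b & sat CC EE ph (v(x := s, y := t)))"
  if v: "v:UNIV \<rightarrow> CC" and a: "a:CC" and xy: "x ~= y" and h: "!!s. s:CC ==> EE s a ==> EX t:CC. sat CC EE ph (v(x := s, y := t))" for ph v x y a
 proof -
  obtain w where w: "range w <= N" "v = (%n. cl (w n))" using CC_val[OF v] .
  obtain s where s: "s:N" "a = cl s" using a CC_E by metis
  show ?thesis unfolding CN s(2) w(2)
  proof (rule collection_ext[OF w(1) s(1) xy])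
   show "EX t:N. sat CC EE ph ((%n. cl (w n))(x := cl r, y := cl t))" if "r:N" "EE (cl r) (cl s)" for r
    using h[of "cl r"] that s unfolding w(2) CN by simp
  qed
 qed
qed

end

section \<open>Combinatorics of the forcing\<close>

context zfc
begin

lemma lep_rel: assumes X: "X:M" "Y:M" and Qd: "D M (%v. Q (v 0) (v 1))" and ex: "!!x. x:el X ==> EX y:el Y. Q y x"
 and un: "!!x x' y. x:el X ==> x':el X ==> y:el Y ==> Q y x ==> Q y x' ==> x = x'"
 shows "lep X Y"
proof -
 have Q: "Tm M s ==> Tm M t ==> D M (%v. Q (s v) (t v))" for s t using D2[OF _ _ Qd] .
 \<comment> \<open>The union of a singleton extracts its element, which turns the relation into a
   total function.\<close>
 define g where "g = (%y. UU (mk {x:M. x:el X & Q y x}))"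
 have gd: "Tm M (%v. g (v 0))" unfolding g_def by (intro dfn Q X)
 show ?thesis
 proof (rule lep_surj[OF X gd])
  fix x assume x: "x:el X"
  then obtain y where y: "y:el Y" "Q y x" using ex by blast
  have xM: "x:M" using x by simp
  have "{x:M. x:el X & Q y x} = {x}" using un[OF _ x y(1) _ y(2)] x y(2) xM by blast
  then have "g y = UU (up x x)" unfolding g_def using xM by (metis el_up insert_absorb2 mk_el op_in(2))
  moreover have "UU (up x x) = x" using xM by (intro ext) auto
  ultimately show "EX y:el Y. g y = x" using y by auto
 qed
qed

text \<open>The ordinal sum, by recursion on the right summand: the elements of \<open>a\<close> and
  all earlier sums.\<close>

definition ad where "ad = rec (%p x g. mk {z:M. z:el p | (EX y:el x. z = app g y)})"
lemma ad_H: "Tm A (%v. (%p x g. mk {z:M. z:el p | (EX y:el x. z = app g y)}) (v 0) (v 1) (v 2))"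
 by (intro dfn)
lemma dfn_ad [dfn]: "Tm A s ==> Tm A t ==> Tm A (%v. ad (s v) (t v))"
 unfolding ad_def by (intro Tm_rec ad_H)
lemma ad_in [simp]: "ad a x:M"
 by (simp add: ad_def)
lemma el_ad: assumes "a:M" "x:M" shows "el (ad a x) = el a Un ad a ` el x"
proof -
 have T: "Tm M (%v. ad a (v 0))" using assms by (intro dfn)
 have "ad a x = mk {z:M. z:el a | (EX y:el x. z = app (lam x (ad a)) y)}" unfolding ad_def using rec_eq[OF ad_H, of a x] assms by simp
 also have "{z:M. z:el a | (EX y:el x. z = app (lam x (ad a)) y)} = el (un a (mk (ad a ` el x)))"
  using app_lam[OF assms(2) T] isset_image[OF assms(2) T] assms(1) by auto
 finally have "ad a x = un a (mk (ad a ` el x))" by simp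
 then show ?thesis using isset_image[OF assms(2) T] assms(1) by simp
qed
lemma ad_emp [simp]: "a:M ==> ad a emp = a"
 by (rule ext) (auto simp: el_ad)
lemma ad_suc: "a:M ==> b:M ==> ad a (suc b) = suc (ad a b)"
 by (rule ext) (auto simp: el_ad)
lemma ad_mem: "a:M ==> b:M ==> c:el b ==> ad a c:el (ad a b)"
 by (auto simp: el_ad)
lemma ad_ge: "a:M ==> b:M ==> el a <= el (ad a b)"
 by (auto simp: el_ad)
lemma Ord_ad: assumes "Ord a" "Ord b" shows "Ord (ad a b)"
proof (rule Ord_induct[OF assms(2), where R = "%b. Ord (ad a b)"])
 show "D M (%v. Ord (ad a (v 0)))" using assms by (intro dfn; simp)
 fix b assume b: "Ord b" "!!c. c:el b ==> Ord (ad a c)"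
 have e: "el (ad a b) = el a Un ad a ` el b" using assms b by (intro el_ad) auto
 have "el x <= el (ad a b)" if x: "x:el (ad a b)" for x
 proof (cases "x:el a")
  case True then show ?thesis unfolding e using Ord_el_sub[OF assms(1)] by blast
 next
  case False
  then obtain c where c: "c:el b" "x = ad a c" using x e by blast
  have "el x = el a Un ad a ` el c" unfolding c(2) using assms c by (intro el_ad) auto
  then show ?thesis unfolding e using Ord_el_sub[OF b(1) c(1)] by blast
 qed
 then have "tra (ad a b)" unfolding tra_def by blast
 moreover have "Ord x" if "x:el (ad a b)" for x using that b(2) Ord_in[OF assms(1)] unfolding e by blast
 ultimately show "Ord (ad a b)" using OrdI[OF ad_in] by blast
qed
lemma ad_inj: assumes "Ord a" "Ord b" "Ord c" "ad a b = ad a c" shows "b = c"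
 using Ord_linear[OF assms(2,3)] ad_mem[of a b c] ad_mem[of a c b] mem_irrefl[OF ad_in] assms by auto
lemma Lim_ad: assumes "Ord a" "Lim b" shows "Lim (ad a b)"
proof -
 have b: "Ord b" "b:M" using assms(2) unfolding Lim_def by auto
 have e: "el (ad a b) = el a Un ad a ` el b" using assms b by (intro el_ad) auto
 have o: "Ord (ad a b)" using Ord_ad assms b by blast
 have a: "a:el (ad a b)" using ad_mem[of a b emp] Lim_emp[OF assms(2)] assms b by simp
 have "suc x:el (ad a b)" if x: "x:el (ad a b)" for x
 proof (cases "x:el a")
  case True
  then have "suc x = a | suc x:el a" using suc_sub assms(1) Ord_in by blast
  then show ?thesis using a Ord_trans[OF o a] by blast
 next
  case False
  then obtain c where c: "c:el b" "x = ad a c" using x e by blast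
  then have "suc c:el b" using assms(2) unfolding Lim_def by blast
  then show ?thesis using ad_mem[of a b "suc c"] ad_suc[of a c] assms b c by simp
 qed
 then show ?thesis unfolding Lim_def using o a by blast
qed

section \<open>Check names and the ordinals of the extension\<close>

lemma chk_F: "x:M ==> y:M ==> F p (chk x) (chk y) ==> x = y"
proof -
 have Fm: "EX z:el y. EX u:M. F u (chk x) (chk z)" if h: "Fm p (chk x) (chk y)" "Cn p" "x:M" "y:M" for p x y
 proof -
  obtain u t q where u: "u:M" "t:M" "q:M" "pr t q:el (chk y)" "F u (chk x) t" using h lq_refl[OF h(2)] unfolding Fm_def memF_def by (meson Cn_M)
  then show ?thesis using chk_entry[OF h(4) u(2,3)] by blast
 qed
 have sub: "Fm p (chk z) (chk y)" if "F p (chk x) (chk y)" "z:el x" "x:M" for p x y z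
 proof -
  have "subF F p (chk x) (chk y)" "Cn p" using F_post[OF that(1)] F_D(1)[OF that(1)] by auto
  moreover have "pr (chk z) un1:el (chk x)" using that by (simp add: el_chk)
  ultimately show ?thesis using un1 lq_refl unfolding subF_def Fm_def by (meson Cn_M chk_in)
 qed
 assume x: "x:M" "y:M" "F p (chk x) (chk y)"
 have "ALL y:M. ALL p:M. F p (chk x) (chk y) --> x = y"
 proof (rule eps_induct[OF x(1), where R = "%x. ALL y:M. ALL p:M. F p (chk x) (chk y) --> x = y"])
  show "D M (%v. ALL y:M. ALL p:M. F p (chk (v 0)) (chk y) --> v 0 = y)" by (intro dfn)
  fix x assume xM: "x:M" and IH: "!!z. z:el x ==> ALL y:M. ALL p:M. F p (chk z) (chk y) --> z = y"
  show "ALL y:M. ALL p:M. F p (chk x) (chk y) --> x = y"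
  proof (intro ballI impI)
   fix y p assume y: "y:M" "p:M" "F p (chk x) (chk y)"
   have C: "Cn p" using F_D(1)[OF y(3)] .
   have "z:el y" if z: "z:el x" for z
   proof -
    obtain w u where w: "w:el y" "u:M" "F u (chk z) (chk w)" using Fm[OF sub[OF y(3) z xM] C _ y(1)] z by auto
    then have "z = w" using IH[OF z] by (meson elM)
    then show ?thesis using w by simp
   qed
   moreover have "w:el x" if w: "w:el y" for w
   proof -
    obtain z u where z: "z:el x" "u:M" "F u (chk w) (chk z)" using Fm[OF sub[OF F_sym[OF y(3)] w y(1)] C _ xM] w by auto
    then have "z = w" using IH[OF z(1)] F_sym[OF z(3)] w by (meson elM)
    then show ?thesis using z by simp
   qed
   ultimately show "x = y" using ext[OF xM y(1)] by blast
  qed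
 qed
 then show "x = y" using x F_D(1)[OF x(3)] by (meson Cn_M)
qed

text \<open>An element of the value of \<open>t\<close> has a name of smaller rank, so by induction
  the rank of a name bounds the ordinal it can denote. This excludes new ordinals.\<close>

lemma chk_rk: assumes "Nm t" "Ord a" "F p t (chk a)" shows "el a <= el (rk t)"
proof -
 have "ALL a:M. ALL p:M. Ord a & F p t (chk a) --> el a <= el (rk t)"
 proof (rule Nm_induct[OF assms(1), where Q = "%t. ALL a:M. ALL p:M. Ord a & F p t (chk a) --> el a <= el (rk t)"])
  show "D M (%v. ALL a:M. ALL p:M. Ord a & F p (v 0) (chk a) --> el a <= el (rk (v 0)))" by (intro dfn)
  fix t assume t: "Nm t" and IH: "!!s q. pr s q:el t ==> Nm s ==> Cn q ==> ALL a:M. ALL p:M. Ord a & F p s (chk a) --> el a <= el (rk s)"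
  show "ALL a:M. ALL p:M. Ord a & F p t (chk a) --> el a <= el (rk t)"
  proof (intro ballI impI subsetI)
   fix a p b assume a: "a:M" "p:M" "Ord a & F p t (chk a)" and b: "b:el a"
   have "subF F p (chk a) t" "Cn p" using F_post F_D(1) a(3) by blast+
   moreover have "pr (chk b) un1:el (chk a)" using a b by (simp add: el_chk)
   ultimately have "memF F p (chk b) t" using un1 lq_refl a(2) unfolding subF_def by (meson chk_in)
   then obtain u s q where u: "u:M" "s:M" "q:M" "pr s q:el t" "F u (chk b) s" using lq_refl[OF \<open>Cn p\<close>] a(2) unfolding memF_def by meson
   have ob: "Ord b" using a b Ord_in by blast
   have "el b <= el (rk s)" using IH[OF u(4)] Nm_entry[OF t u(4,2,3)] F_sym[OF u(5)] ob u(1) by auto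
   moreover have "rk s:el (rk t)" using rk_entry[OF Nm_M[OF t] u(4,2,3)] by blast
   ultimately show "b:el (rk t)" using Ord_sub[OF ob Ord_rk[OF u(2)]] Ord_trans[OF Ord_rk[OF Nm_M[OF t]]] by blast
  qed
 qed
 then show ?thesis using assms F_D(1)[OF assms(3)] by (meson Cn_M OrdM)
qed

text \<open>For each \<open>x\<close> the value is decided by a predense set of at most
  \<open>R c\<close> lower conditions, and there are at most \<open>R c\<close> many
  \<open>x\<close>. So at most \<open>R c\<close> values are possible altogether; as
  \<open>c\<close> is below \<open>e\<close>, they are bounded by regularity of \<open>K e\<close>
  in the ground model.\<close>

lemma covering: assumes c: "Ord c" and e: "Ord e" "c:el e" and X: "X:M" "lep X (R c)" and p: "Cn p" and h: "Nm h"
 and fn: "!!x y y' w. x:el X ==> y:el (K e) ==> y':el (K e) ==> lq w p ==> Fm w (chk (pr x y)) h ==> Fm w (chk (pr x y')) h ==> y = y'"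
 shows "EX q:M. lq q p & (EX b:M. b:el (K e) & (ALL x:el X. ALL y:el (K e). ALL w:M. lq w q & Fm w (chk (pr x y)) h --> y:el b))"
proof -
 have eM: "e:M" "h:M" "c:M" using e h c by auto
 obtain p1 where p1: "Cn p1" "lq p1 p" "el (suc c) <= el (ll p1)" using long[OF p c] by blast
 define P where "P x y u <-> Fm u (chk (pr x y)) h" for x y u
 have Pd: "Tm M s ==> Tm M t ==> Tm M u ==> D M (%v. P (s v) (t v) (u v))" for s t u unfolding P_def using eM by (intro dfn)
 have Pm: "P x y t" if "P x y s" "lq t s" for x y s t using that Fm_mono unfolding P_def by blast
 define Q where "Q x u <-> Cn u & ((EX y:el (K e). P x y u) | (ALL t:M. lq t u --> ~ (EX y:el (K e). P x y t)))" for x u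
 have Qe: "EX t:M. lq t s & Q x t" if "lq s p1" for x s unfolding Q_def using decide[OF lqD(1)[OF that]] .
 have Qd: "D M (%v. Q (v 0) (v 1))" unfolding Q_def using eM by (intro dfn Pd; simp)
 have Qo: "Q x t" if "Q x s" "lq t s" for x s t using that Pm lqD(1) lq_trans unfolding Q_def by blast
 have "EX q:M. pure q p1 (suc c) & (ALL x:el X. meets q p1 c (Q x))" by (rule fusion[OF c p1(1,3) X Qd]; (use Qo Qe in blast))
 then obtain q where q: "q:M" "pure q p1 (suc c)" and Z: "!!x. x:el X ==> meets q p1 c (Q x)" by blast
 have qp: "lq q p" using lq_trans[OF pure_lq[OF q(2)] p1(2)] .
 define Vl where "Vl = (%x. mk {y:M. y:el (K e) & (EX w:M. lq w q & P x y w)})"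
 have Vld: "Tm M (%v. Vl (v 0))" unfolding Vl_def using eM q by (intro dfn Pd; simp)
 have Vl: "el (Vl x) = {y:M. y:el (K e) & (EX w:M. lq w q & P x y w)}" if "x:M" for x
  unfolding Vl_def using eM q that by (intro el_mk isset_sep dfn Pd; simp)
 have VlM: "Vl x:M" for x unfolding Vl_def by simp
 have "lep (Vl x) (R c)" if x: "x:el X" for x
 proof -
  have xM: "x:M" using x by simp
  obtain Y where Y: "Y:M" "lep Y (R c)" "ALL r:el Y. Cn r & ll r = suc c & bb r = rs (bb p1) (suc c) & (EX u:M. Q x u & (ALL w. lq w q & lq w r --> lq w u))"
   "ALL w. lq w q --> (EX r:el Y. EX w':M. lq w' w & lq w' r)" using Z[OF x] unfolding meets_def by blast
  define S where "S r y <-> (EX w:M. lq w q & lq w r) & (EX u:M. P x y u & (ALL w:M. lq w q & lq w r --> lq w u))" for r y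
  have "lep (Vl x) Y"
  proof (rule lep_rel[OF VlM Y(1), where Q = S])
   show "D M (%v. S (v 0) (v 1))" unfolding S_def using q xM by (intro dfn Pd; simp)
   fix y assume "y:el (Vl x)"
   then obtain w where y: "y:el (K e)" "w:M" "lq w q" "P x y w" unfolding Vl[OF xM] by blast
   then obtain r w' where r: "r:el Y" "w':M" "lq w' w" "lq w' r" using Y(4) by blast
   have w'q: "lq w' q" using lq_trans r y by blast
   obtain u where u: "u:M" "Q x u" "ALL w. lq w q & lq w r --> lq w u" using Y(3) r(1) by blast
   have w'u: "lq w' u" using u w'q r by blast
   have Pw: "P x y w'" using Pm y r by blast
   then obtain y' where y': "y':el (K e)" "P x y' u" using u(2) w'u r(2) y(1) unfolding Q_def by blast
   then have "P x y' w'" using Pm w'u by blast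
   then have "y' = y" using fn[OF x y'(1) y(1) lq_trans[OF w'q qp]] Pw unfolding P_def by blast
   then have "S r y" unfolding S_def using y' u w'q r by blast
   then show "EX r:el Y. S r y" using r by blast
  next
   fix y y' r assume y: "y:el (Vl x)" "y':el (Vl x)" "S r y" "S r y'"
   then obtain w where w: "w:M" "lq w q" "lq w r" unfolding S_def by blast
   then have "P x y w" "P x y' w" using y(3,4) Pm unfolding S_def by blast+
   then show "y = y'" using fn[OF x _ _ lq_trans[OF w(2) qp]] y(1,2) unfolding P_def Vl[OF xM] by blast
  qed
  then show ?thesis using lep_trans[OF VlM _ Y(2)] by blast
 qed
 then have lU: "lep (mk (UN x:el X. el (Vl x))) (R c)" using X R_pairs[OF c] Vld by (intro lep_UN) auto
 have eU: "el (mk (UN x:el X. el (Vl x))) = (UN x:el X. el (Vl x))" using isset_UN[OF X(1) Vld] by simp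
 have sub: "el (suc c) <= el e" using e c Ord_trans by auto
 have "lep (mk (UN x:el X. el (Vl x))) (W e)" using lU lep_W_mono[of _ "suc c" e] W_suc[OF c] sub c e by simp
 moreover have "el (mk (UN x:el X. el (Vl x))) <= el (K e)" unfolding eU using Vl by auto
 ultimately obtain b where b: "b:el (K e)" "(UN x:el X. el (Vl x)) <= el b" using K_bounded[OF e(1)] eU by (metis mk_in)
 have "y:el b" if "x:el X" "y:el (K e)" "w:M" "lq w q & Fm w (chk (pr x y)) h" for x y w
 proof -
  have "y:el (Vl x)" using that Vl[of x] unfolding P_def by auto
  then show ?thesis using b that by blast
 qed
 then show ?thesis using q(1) qp b(1) by (meson elM)
qed

lemma off_mono: assumes "lq w p" "c:el (ll p)" "pr c (rs (ff p) c):el (bb p)" shows "pr c (rs (ff w) c):el (bb w)"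
proof -
 note w = lqD[OF assms(1)]
 have c: "Ord c" "c:M" "el c <= el (ll w)" using Ord_in[OF CnD(1)[OF w(2)] assms(2)] w(3) assms(2) Ord_el_sub[OF CnD(1)[OF w(1)]] by auto
 have "pr c (rs (ff p) c):el (bb w)" using assms(3) unfolding w(4)[symmetric] by simp
 moreover have "PC c (rs (ff w) c)" using PC_rs[OF CnD(3)[OF w(1)] CnD(1)[OF w(1)] c(1,3)] .
 moreover have "le (bb w) (rs (ff w) c) (rs (ff p) c)" using le_rs[OF w(5)] c by simp
 ultimately show ?thesis using valid_open[OF CnD(2)[OF w(1)]] c by simp
qed

lemma PC_elem: assumes "PC l f" "Ord l" "e:el f"
 obtains d x n y where "d:el l" "Ord d" "x:el (K (suc (suc d)))" "n:el (K d)" "y:el (R d)" "e = pr d (pr (pr x n) y)" "ft e = d"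
proof -
 have d: "ft e:el l" "Ord (ft e)" using assms PC_ft Ord_in by blast+
 obtain u where u: "u:el (U (ft e))" "e = pr (ft e) u" using assms unfolding PC_def by blast
 then obtain z y where z: "z:el (pd (K (suc (suc (ft e)))) (K (ft e)))" "y:el (R (ft e))" "u = pr z y" unfolding U_def by auto
 then obtain x n where x: "x:el (K (suc (suc (ft e))))" "n:el (K (ft e))" "z = pr x n" by auto
 show thesis using that[OF d x(1,2) z(2)] u z x by simp
qed

text \<open>The restriction to row 0 at stage \<open>c\<close> matters: other rows there have
  indices up to \<open>K (suc (suc c))\<close> and would leave the level. Without them every entry
  has rank below \<open>K (suc c)\<close>, and regularity bounds these ranks.\<close>

lemma PC_rank: assumes c: "Ord c" and f: "PC (suc c) f" and r0: "!!e. e:el f ==> ft e = c ==> row0 e" shows "f:el (V (K (suc c)))"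
proof -
 have oc: "Ord (suc c)" "c:M" using c by auto
 have fM: "f:M" using PC_M[OF f] .
 have LK: "Lim (K (suc c))" "Ord (K (suc c))" using Lim_K[OF oc(1)] oc by auto
 have "e:el (V (K (suc c)))" if e: "e:el f" for e
 proof (rule PC_elem[OF f oc(1) e])
  fix d x n y assume d: "d:el (suc c)" "Ord d" and x: "x:el (K (suc (suc d)))" and n: "n:el (K d)" and y: "y:el (R d)" and ee: "e = pr d (pr (pr x n) y)" "ft e = d"
  have dM: "d:M" "x:M" "n:M" "y:M" using d x n y by auto
  have Kd: "K d:el (K (suc c))" using K_mono[OF oc(1) d(1)] .
  have dK: "d:el (K (suc c))" using le_K[OF oc(1)] d by blast
  have nK: "n:el (K (suc c))" using Ord_trans[OF LK(2) Kd n] .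
  have yK: "rk y:el (K (suc c))"
  proof -
   have "el y <= el (V (K d))" using y dM unfolding R_def by simp
   then have "rk y = K d | rk y:el (K d)" using V_sub[of "K d" y] dM by simp
   then show ?thesis using Kd Ord_trans[OF LK(2) Kd] by auto
  qed
  have xK: "x:el (K (suc c))"
  proof (cases "d = c")
   case True
   then have "x = emp" using r0[OF e] ee dM unfolding row0_def by simp
   then show ?thesis using Lim_emp[OF LK(1)] by simp
  next
   case False
   then have dc: "d:el c" using d c by simp
   then have "el (suc (suc d)) <= el (suc c)" using suc_sub[OF d(2) c dc] c Ord_trans[OF c dc] d dM by auto
   then have "el (K (suc (suc d))) <= el (K (suc c))" using d oc by (intro K_sub) auto
   then show ?thesis using x by blast
  qed
  have rK: "z:el (V (K (suc c)))" if "z:el (K (suc c))" for z using that rk_Ord[OF Ord_in[OF LK(2) that]] LK by (simp add: el_V)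
  have "y:el (V (K (suc c)))" using yK LK dM by (simp add: el_V)
  then show ?thesis unfolding ee(1) using V_pr[OF LK(1)] rK dK nK xK by meson
 qed
 then have rk: "rk e:el (K (suc c))" if "e:el f" for e using that LK by (auto simp: el_V)
 have T: "Tm M (%v. rk (v 0))" by (intro dfn)
 have i: "el (mk (rk ` el f)) = rk ` el f" using isset_image[OF fM T] by simp
 have "lep f (W (suc c))" using PC_small[OF f oc(1)] .
 then have "lep (mk (rk ` el f)) (W (suc c))" using lep_trans[OF mk_in lep_image[OF fM T]] by blast
 moreover have "el (mk (rk ` el f)) <= el (K (suc c))" unfolding i using rk by blast
 ultimately obtain b where b: "b:el (K (suc c))" "rk ` el f <= el b" using K_bounded[OF oc(1) mk_in, of "rk ` el f"] i by auto
 have ob: "Ord b" using Ord_in LK b by blast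
 have "el (rk f) <= el b" using b(2) by (intro rk_least[OF fM ob]) auto
 then have "rk f = b | rk f:el b" using Ord_sub[OF Ord_rk[OF fM] ob] by blast
 then have "rk f:el (K (suc c))" using b(1) Ord_trans[OF LK(2) b(1)] by blast
 then show ?thesis using fM LK by (simp add: el_V)
qed

text \<open>This is why an off stage has few subsets. Lower conditions deciding membership can be
  stripped of their entries outside row 0 at stage \<open>c\<close>, and what remains lies in
  \<open>V (K (suc c))\<close>. So a name for a subset of \<open>K c\<close> is coded by pairs
  forming a single element of \<open>R (suc c)\<close>.\<close>

lemma code_sub: assumes c: "Ord c" and p: "Cn p" "c:el (ll p)" "pr c (rs (ff p) c):el (bb p)" and s: "Nm s"
 shows "EX q:M. lq q p & (EX B:M. B:el (R (suc c)) &
  (ALL x:el (K c). ALL f:M. pr x f:el B --> (ALL w:M. lq w q & lq w (cn (suc c) (rs (bb p) (suc c)) f) --> Fm w (chk x) s)) &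
  (ALL x:el (K c). ALL w:M. lq w q & Fm w (chk x) s --> (EX w':M. lq w' w & (EX f:M. f:el (V (K (suc c))) & pr x f:el B & lq w' (cn (suc c) (rs (bb p) (suc c)) f)))))"
proof -
 have cM: "c:M" "s:M" "Ord (suc c)" using c s by auto
 have sc: "el (suc c) <= el (ll p)" using p(2) Ord_el_sub[OF CnD(1)[OF p(1)] p(2)] c by auto
 define b where "b = rs (bb p) (suc c)"
 have bM: "b:M" by (simp add: b_def)
 define Q where "Q x u <-> Cn u & (Fm u (chk x) s | (ALL t:M. lq t u --> ~ Fm t (chk x) s))" for x u
 have Qe: "EX t:M. lq t r & Q x t" if "lq r p" for x r unfolding Q_def using decide[OF lqD(1)[OF that]] .
 have Qd: "D M (%v. Q (v 0) (v 1))" unfolding Q_def using cM by (intro dfn; simp)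
 have Qo: "Q x t" if "Q x s" "lq t s" for x s t using that Fm_mono lqD(1) lq_trans unfolding Q_def by blast
 have "EX q:M. pure q p (suc c) & (ALL x:el (K c). meets q p c (Q x))" by (rule fusion[OF c p(1) sc KWR_in(1) lep_K_R[OF c] Qd]; (use Qo Qe in blast))
 then obtain q where q: "q:M" "pure q p (suc c)" and Z: "!!x. x:el (K c) ==> meets q p c (Q x)" by blast
 have qp: "lq q p" using pure_lq[OF q(2)] .
 have off: "pr c (rs (ff w) c):el (bb w)" if "lq w q" for w using off_mono[OF lq_trans[OF that qp] p(2,3)] .
 define ok where "ok x f <-> (EX u:M. Fm u (chk x) s & (ALL w:M. lq w q & lq w (cn (suc c) b f) --> lq w u))" for x f
 have okd: "Tm M t ==> Tm M u ==> D M (%v. ok (t v) (u v))" for t u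
  by (rule D2[where Q = ok]; (assumption | (unfold ok_def, intro dfn; simp add: cM q bM)))
 define B where "B = mk {z:M. z:el (pd (K c) (V (K (suc c)))) & ok (ft z) (sn z)}"
 have B: "el B = {z:M. z:el (pd (K c) (V (K (suc c)))) & ok (ft z) (sn z)}" unfolding B_def by (intro el_mk isset_sep dfn okd; simp)
 have BM: "B:M" by (simp add: B_def)
 have LK: "Lim (K (suc c))" "Ord (K (suc c))" using Lim_K[OF cM(3)] cM by auto
 have KV: "x:el (V (K (suc c)))" if "x:el (K c)" for x
 proof -
  have "x:el (K (suc c))" using Ord_trans[OF LK(2) K_mono[OF cM(3)] that] cM by simp
  then show ?thesis using rk_Ord[OF Ord_in[OF LK(2)], of x] LK by (simp add: el_V)
 qed
 have "el B <= el (V (K (suc c)))"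
 proof
  fix z assume "z:el B"
  then obtain x f where "x:el (K c)" "f:el (V (K (suc c)))" "z = pr x f" unfolding B by auto
  then show "z:el (V (K (suc c)))" using V_pr[OF LK(1) KV] by blast
 qed
 then have BR: "B:el (R (suc c))" unfolding R_def using BM by simp
 have 1: "Fm w (chk x) s" if x: "x:el (K c)" "f:M" "pr x f:el B" "w:M" "lq w q & lq w (cn (suc c) b f)" for x f w
 proof -
  have "ok x f" using x unfolding B by simp
  then show ?thesis using Fm_mono x unfolding ok_def by blast
 qed
 have 2: "EX w':M. lq w' w & (EX f:M. f:el (V (K (suc c))) & pr x f:el B & lq w' (cn (suc c) b f))" if x: "x:el (K c)" and w: "w:M" "lq w q & Fm w (chk x) s" for x w
 proof -
  obtain Y where Y: "Y:M" "lep Y (R c)" "ALL r:el Y. Cn r & ll r = suc c & bb r = rs (bb p) (suc c) & (EX u:M. Q x u & (ALL w. lq w q & lq w r --> lq w u))"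
   "ALL w. lq w q --> (EX r:el Y. EX w':M. lq w' w & lq w' r)" using Z[OF x] unfolding meets_def by blast
  obtain r w' where r0: "r:el Y" "w':M" "lq w' w" "lq w' r" using Y(4) w(2) by blast
  have r: "Cn r" "ll r = suc c" "bb r = b" "EX u:M. Q x u & (ALL w. lq w q & lq w r --> lq w u)" "w':M" "lq w' w" "lq w' r" using bspec[OF Y(3) r0(1)] r0 unfolding b_def by auto
  have w'q: "lq w' q" using lq_trans r w by blast
  obtain u where u: "u:M" "Q x u" "!!w. lq w q ==> lq w r ==> lq w u" using r(4) by blast
  have "Fm w' (chk x) s" using Fm_mono w r by blast
  then have Fu: "Fm u (chk x) s" using u(2) u(3)[OF w'q r(7)] r(5) unfolding Q_def by blast
  \<comment> \<open>Deletes from \<open>r\<close> the entries at stage \<open>c\<close> outside row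
    0. That stage is off below \<open>q\<close>, so there \<open>r\<close> and the stripped
    condition have the same extensions.\<close>
  define f where "f = mk {e:M. e:el (ff r) & (ft e = c --> row0 e)}"
  have f: "el f = {e:M. e:el (ff r) & (ft e = c --> row0 e)}" unfolding f_def using cM by (intro el_mk isset_sep dfn; simp)
  have fM: "f:M" by (simp add: f_def)
  have Pf: "PC (suc c) f" using PC_subset[of "suc c" "ff r" f] CnD(3)[OF r(1)] r(2) fM f cM by auto
  have Cf: "Cn (cn (suc c) b f)" using CnD(2)[OF r(1)] r(2,3) cM Pf by (intro Cn_cn) auto
  have eq: "lq v (cn (suc c) b f) <-> lq v r" if v: "lq v q" for v
  proof -
   have "le (bb v) (ff v) f <-> le (bb v) (ff v) (ff r)" unfolding le_def f using off[OF v] elM[of _ "ff r"] by blast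
   then show ?thesis unfolding lq_def using Cf r cM bM fM by simp
  qed
  have "ok x f" unfolding ok_def using u(1,3) Fu eq by blast
  moreover have fV: "f:el (V (K (suc c)))" using f by (intro PC_rank[OF c Pf]) auto
  ultimately have "pr x f:el B" unfolding B using x fM by auto
  then show ?thesis using r(5,6) fM fV eq[OF w'q] r(7) by blast
 qed
 show ?thesis using q(1) qp BM BR 1 2 unfolding b_def by blast
qed

lemma fresh: assumes f: "PC l f" "Ord l" and c: "c:el l" and z: "z:el (K c)"
 shows "EX n:el (K c). n ~: el z & (ALL e:el f. ft e = c --> sn (ft (sn e)) ~= n)"
proof -
 have oc: "Ord c" "Ord (K c)" "c:M" using f c Ord_in by auto
 have fM: "f:M" using f PC_M by blast
 define g where "g = (%e. sn (ft (sn e)))"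
 have T: "Tm M (%v. g (v 0))" unfolding g_def by (intro dfn)
 have i: "el (mk (g ` el (rs f (suc c)))) = g ` el (rs f (suc c))" using isset_image[OF rs_in T] by simp
 have "g e:el (K c)" if e: "e:el f" "ft e:el (suc c)" for e
 proof (rule PC_elem[OF f e(1)])
  fix d x n y assume d: "d:el l" "Ord d" "n:el (K d)" "e = pr d (pr (pr x n) y)" "ft e = d" "x:el (K (suc (suc d)))" "y:el (R d)"
  have "g e = n" unfolding g_def using d by simp
  moreover have "el d <= el c" using e(2) d oc Ord_el_sub by auto
  then have "el (K d) <= el (K c)" using d oc by (intro K_sub)
  ultimately show ?thesis using d by blast
 qed
 then have "el (mk (g ` el (rs f (suc c)))) <= el (K c)" unfolding i using fM by auto
 moreover have "lep (rs f (suc c)) (W c)" using f c unfolding PC_def by blast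
 then have "lep (mk (g ` el (rs f (suc c)))) (W c)" using lep_trans[OF mk_in lep_image[OF rs_in T]] by blast
 ultimately obtain b where b: "b:el (K c)" "g ` el (rs f (suc c)) <= el b" using K_bounded[OF oc(1) mk_in, of "g ` el (rs f (suc c))"] unfolding i by auto
 have o: "Ord b" "Ord z" using Ord_in[OF oc(2)] b z by auto
 have g: "g e:el b" if "e:el f" "ft e = c" for e using b(2) that fM oc by auto
 show ?thesis
 proof (cases "el b <= el z")
  case True
  then show ?thesis using z g mem_irrefl[of z] unfolding g_def by (metis elM subsetD)
 next
  case False
  then have "b ~: el z" using Ord_el_sub[OF o(2)] by blast
  then show ?thesis using b g mem_irrefl[of b] unfolding g_def by (metis elM)
 qed
qed

lemma add_entry: assumes p: "Cn p" and c: "c:el (ll p)" and x: "x:el (K (suc (suc c)))" and n: "n:el (K c)" and y: "y:el (R c)"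
 and fr: "!!e. e:el (ff p) ==> ft e = c ==> ft (sn e) ~= pr x n"
 shows "EX q:M. lq q p & ll q = ll p & el (ff q) = insert (pr c (pr (pr x n) y)) (el (ff p))"
proof -
 define e where "e = pr c (pr (pr x n) y)"
 have oc: "Ord c" using CnD(1)[OF p] c Ord_in by blast
 have m: "c:M" "x:M" "n:M" "y:M" "e:M" using c x n y by (auto simp: e_def)
 have ft: "ft e = c" "key e = pr c (pr x n)" unfolding e_def key_def using m by auto
 have "pr (pr x n) y:el (U c)" unfolding U_def using x n y by auto
 moreover have "lep (rs (up e e) (suc d)) (W d)" if "d:el (ll p)" for d
 proof -
  have d: "Ord d" using Ord_in[OF CnD(1)[OF p] that] .
  have "emp:el (W d)" using d by (auto simp: el_W lev_def)
  then show ?thesis using m d by (intro lepI[where f = "%_. emp"]) (auto intro!: dfn)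
 qed
 ultimately have "PC (ll p) (up e e)" unfolding PC_def using m c ft by (auto simp: e_def)
 moreover have "e1 = e'" if "e1:el (ff p)" "e':el (up e e)" "key e1 = key e'" for e1 e'
  using that fr[OF that(1)] m ft unfolding key_def by (auto simp: e_def)
 ultimately have P: "PC (ll p) (un (ff p) (up e e))" using CnD[OF p] by (intro PC_un) auto
 have "Cn (cn (ll p) (bb p) (un (ff p) (up e e)))" using CnD[OF p] P by (intro Cn_cn)
 then show ?thesis using p m rs_bb[OF p] by (intro bexI[of _ "cn (ll p) (bb p) (un (ff p) (up e e))"]) (auto simp: lq_def e_def[symmetric] intro!: le_superset)
qed

lemma isset_PC: assumes "Ord l" shows "isset {g:M. PC l g}"
proof (rule issetI[where x = "mk (ff ` el (Pl l))"])
 show "D M (%v. PC l (v 0))" using assms by (intro dfn; simp)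
 fix g assume g: "g:M" "PC l g"
 have "valid emp l" unfolding valid_def by auto
 then have "Cn (cn l emp g)" using assms g by (intro Cn_cn)
 then have "cn l emp g:el (Pl l)" "ff (cn l emp g) = g" using assms g by auto
 then show "g:el (mk (ff ` el (Pl l)))" using isset_image[OF Pl_in, of ff l] by (simp add: dfn) (metis imageI)
qed simp

text \<open>The coding stages start at \<open>suc th\<close>, beyond \<open>p\<close> and all
  conditions in \<open>a\<close>. At stage \<open>ad (suc th) be\<close> the switch consists of the
  lower conditions below some \<open>r\<close> paired with \<open>chk be\<close> in
  \<open>a\<close>, so the generic object turns the stage off exactly when it puts \<open>be\<close>
  into \<open>a\<close>. That \<open>th\<close> is at least \<open>d\<close> is for the sake of
  limits below \<open>d\<close>, where regularity needs it.\<close>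

lemma coding: assumes a: "Nm a" and l0: "Ord l0" "!!z r. z:M ==> r:M ==> pr z r:el a ==> el (ll r) <= el l0" and d: "Ord d" and p: "Cn p"
 shows "EX q:M. lq q p & (EX th:M. Ord th & el d <= el th & el l0 <= el th & ll q = ad (suc th) d &
  (ALL be:el d. ALL g:M. pr (ad (suc th) be) g:el (bb q) <-> PC (ad (suc th) be) g &
   (EX r:M. pr (chk be) r:el a & rs (bb q) (ll r) = bb r & le (bb q) g (ff r))))"
proof -
 have aM: "a:M" "d:M" using a d by auto
 define th where "th = UU (up (ll p) (UU (up l0 d)))"
 have th: "Ord th" "el d <= el th" "el l0 <= el th" "el (ll p) <= el th" unfolding th_def using CnD(1)[OF p] l0(1) d by (auto intro!: Ord_UU)
 define t where "t = suc th"
 have t: "Ord t" "t:M" "el th <= el t" unfolding t_def using th by auto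
 define l where "l = ad t d"
 have l: "Ord l" "l:M" "el t <= el l" unfolding l_def using Ord_ad[OF t(1) d] ad_ge t d by auto
 define b where "b = bb p"
 have vb: "valid b t" "b:M" "valid b (ll p)" using CnD(2)[OF raise(1)[OF p t(1)]] CnD(2)[OF p] th t by (auto simp: b_def)
 define ok where "ok be g <-> (EX r:M. pr (chk be) r:el a & rs b (ll r) = bb r & le b g (ff r))" for be g
 have okd: "Tm M s ==> Tm M u ==> D M (%v. ok (s v) (u v))" for s u
  by (rule D2[where Q = ok]; (assumption | (unfold ok_def, intro dfn; simp add: aM vb)))
 define b1 where "b1 = mk {z:M. EX be:el d. EX g:M. z = pr (ad t be) g & PC (ad t be) g & ok be g}"
 have oa: "Ord (ad t be)" "ad t be:el l" "el t <= el (ad t be)" if "be:el d" for be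
  unfolding l_def using Ord_ad[OF t(1) Ord_in[OF d that]] ad_mem[OF t(2) aM(2) that] ad_ge[OF t(2)] that by auto
 have "isset {z:M. EX be:el d. EX g:M. z = pr (ad t be) g & PC (ad t be) g & ok be g}"
 proof (rule issetI[where x = "pd l (mk {g:M. PC l g})"])
  show "D M (%v. EX be:el d. EX g:M. v 0 = pr (ad t be) g & PC (ad t be) g & ok be g)" using aM t by (intro dfn okd; simp)
  fix z assume "EX be:el d. EX g:M. z = pr (ad t be) g & PC (ad t be) g & ok be g"
  then obtain be g where z: "be:el d" "g:M" "z = pr (ad t be) g" "PC (ad t be) g" by blast
  have "PC l g" using PC_mono[OF z(4) oa(1)[OF z(1)] l(1) Ord_el_sub[OF l(1) oa(2)[OF z(1)]]] .
  then show "z:el (pd l (mk {g:M. PC l g}))" using z oa(2)[OF z(1)] isset_PC[OF l(1)] l by auto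
 qed simp
 then have b1: "el b1 = {z:M. EX be:el d. EX g:M. z = pr (ad t be) g & PC (ad t be) g & ok be g}" "b1:M" unfolding b1_def by auto
 define b' where "b' = un b b1"
 have b': "el b' = el b Un el b1" "b':M" unfolding b'_def using vb b1 by auto
 have b1ft: "ft z ~: el t & ft z:el l" if z1: "z:el b1" for z
 proof -
  obtain be g where z: "be:el d" "g:M" "z = pr (ad t be) g" using z1 unfolding b1 by blast
  then show ?thesis using oa[OF z(1)] mem_irrefl[of "ad t be"] by auto
 qed
 have bft: "ft z:el (ll p)" if "z:el b" for z using valid_ft[OF vb(3) that] .
 have rsb: "rs b' c = rs b c" if "c:M" "el c <= el t" for c using that b' b1ft vb(2) b1(2) by (intro ext) auto
 have leb: "le b' g f <-> le b g f" if "!!e. e:el f ==> ft e:el t" for g f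
 proof -
  have "le (rs b' t) g f = le (rs b t) g f" using rsb[OF t(2)] by simp
  then show ?thesis using le_rs_b[OF that] b' vb t by simp
 qed
 have mem: "pr (ad t be) g:el b' <-> PC (ad t be) g & ok be g" if be: "be:el d" and g: "g:M" for be g
 proof -
  have "pr (ad t be) g ~: el b"
  proof
   assume "pr (ad t be) g:el b"
   then have "ad t be:el (ll p)" using bft g by fastforce
   then have "ad t be:el (ad t be)" using oa(3)[OF be] th(4) t(3) by blast
   then show False using mem_irrefl by simp
  qed
  moreover have "pr (ad t be) g:el b1 <-> PC (ad t be) g & ok be g"
  proof
   assume "pr (ad t be) g:el b1"
   then obtain ga g' where h: "ga:el d" "g':M" "pr (ad t be) g = pr (ad t ga) g'" "PC (ad t ga) g'" "ok ga g'" unfolding b1 by blast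
   then have "ad t be = ad t ga" "g = g'" using g by auto
   then show "PC (ad t be) g & ok be g" using h ad_inj[OF t(1) Ord_in[OF d be] Ord_in[OF d h(1)]] by simp
  next
   assume "PC (ad t be) g & ok be g"
   then show "pr (ad t be) g:el b1" unfolding b1 using be g by blast
  qed
  ultimately show ?thesis unfolding b' by blast
 qed
 have rt: "el (ll r) <= el t" "Cn r" if "pr (chk be) r:el a" "r:M" for be r
  using l0(2)[OF _ that(2) that(1)] th t Nm_entry[OF a that(1) _ that(2)] by auto
 have rft: "ft e:el t" if "pr (chk be) r:el a" "r:M" "e:el (ff r)" for be r e
  using PC_ft[OF CnD(3)[OF rt(2)[OF that(1,2)]] that(3)] rt(1)[OF that(1,2)] by blast
 have "valid b' l" unfolding valid_def
 proof (intro conjI ballI impI)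
  show "b':M" by fact
  fix z assume "z:el b'"
  then consider "z:el b" | "z:el b1" unfolding b' by blast
  then show "EX c:el l. EX g:M. PC c g & z = pr c g"
  proof cases
   case 1 then show ?thesis using vb(1) l(3) unfolding valid_def by blast
  next
   case 2
   then obtain be g where "be:el d" "g:M" "z = pr (ad t be) g" "PC (ad t be) g" unfolding b1 by blast
   then show ?thesis using oa(2) by blast
  qed
 next
  fix c f g assume c: "c:el l" and fg: "f:M" "g:M" and h: "pr c f:el b' & PC c g & le b' g f"
  have cM: "c:M" using c by simp
  consider "pr c f:el b" | "pr c f:el b1" using h unfolding b' by blast
  then show "pr c g:el b'"
  proof cases
   case 1
   have ct: "c:el t" using bft[OF 1] cM fg th t by auto
   obtain c' f' where "PC c' f'" "c':M" "f':M" "pr c f = pr c' f'" using 1 vb(1) unfolding valid_def by (metis elM)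
   then have "PC c f" using cM fg by simp
   then have "ft e:el t" if "e:el f" for e using PC_ft that Ord_trans[OF t(1) ct] by blast
   then have "le b g f" using leb h by blast
   then show ?thesis using valid_open[OF vb(1) 1 cM fg(1)] h unfolding b' by blast
  next
   case 2
   then obtain be where be: "be:el d" "c = ad t be" "PC c f" "ok be f" unfolding b1 using cM fg by auto
   then obtain r where r: "r:M" "pr (chk be) r:el a" "rs b (ll r) = bb r" "le b f (ff r)" unfolding ok_def by blast
   have oc: "Ord c" "el t <= el c" using oa[OF be(1)] be(2) by auto
   have P: "PC t (rs f t)" "PC t (rs g t)" using PC_rs[OF be(3) oc(1) t(1) oc(2)] PC_rs[of c g t] h oc t by auto
   have "le b' (rs g t) (rs f t)" using le_rs[of b' g f t] h fg t by blast
   then have "le b (rs g t) (rs f t)" using leb[of "rs f t"] fg t by auto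
   moreover have "le b (rs f t) (ff r)" using le_rs_g[of "ff r" t f b] rft[OF r(2,1)] fg t r by blast
   ultimately have "le b (rs g t) (ff r)" using le_trans[OF vb(1) t(1) P(2,1)] rft[OF r(2,1)] by blast
   then have "le b g (ff r)" using le_rs_g[of "ff r" t g b] rft[OF r(2,1)] fg t by blast
   then have "ok be g" unfolding ok_def using r by blast
   then show ?thesis using mem[OF be(1) fg(2)] be(2) h by blast
  qed
 qed
 moreover have "PC l (ff p)" using PC_mono[OF CnD(3)[OF p] CnD(1)[OF p] l(1)] th t l by blast
 ultimately have Cq: "Cn (cn l b' (ff p))" using l by (intro Cn_cn)
 have parts: "ll (cn l b' (ff p)) = l" "bb (cn l b' (ff p)) = b'" "ff (cn l b' (ff p)) = ff p" using l b' by auto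
 have "rs b' (ll p) = b" using rsb[of "ll p"] th t rs_bb[OF p] unfolding b_def by auto
 then have "lq (cn l b' (ff p)) p" unfolding lq_def parts using Cq p th t l by (auto simp: b_def)
 moreover have "pr (ad t be) g:el b' <-> PC (ad t be) g & (EX r:M. pr (chk be) r:el a & rs b' (ll r) = bb r & le b' g (ff r))" if "be:el d" "g:M" for be g
 proof -
  have "rs b' (ll r) = rs b (ll r)" "le b' g (ff r) <-> le b g (ff r)" if "pr (chk be) r:el a" "r:M" for r
   using rsb[OF _ rt(1)[OF that]] leb[OF rft[OF that]] by auto
  then show ?thesis unfolding mem[OF that] ok_def by auto
 qed
 ultimately have "EX th:M. Ord th & el d <= el th & el l0 <= el th & ll (cn l b' (ff p)) = ad (suc th) d &
  (ALL be:el d. ALL g:M. pr (ad (suc th) be) g:el (bb (cn l b' (ff p))) <-> PC (ad (suc th) be) g &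
   (EX r:M. pr (chk be) r:el a & rs (bb (cn l b' (ff p))) (ll r) = bb r & le (bb (cn l b' (ff p))) g (ff r)))" "lq (cn l b' (ff p)) p"
  unfolding parts using th OrdM[OF th(1)] unfolding t_def l_def by blast+
 then show ?thesis using parts_in(4) by blast
qed

end

section \<open>The Continuum Coding Axiom inside a model\<close>

context zfc
begin

definition eqp where "eqp a b <-> (EX f:M. inj f a b & (ALL y:el b. EX x:el a. app f x = y))"
lemma D_eqp [dfn]: "Tm A s ==> Tm A t ==> D A (%v. eqp (s v) (t v))"
 by (rule D2[where Q = eqp]; (assumption | (unfold eqp_def, intro dfn)))

lemma eqp_rel: assumes X: "a:M" "b:M" and Qd: "D M (%v. Q (v 0) (v 1))" and e1: "!!x. x:el a ==> EX y:el b. Q x y" and e2: "!!y. y:el b ==> EX x:el a. Q x y"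
 and u1: "!!x y y'. x:el a ==> y:el b ==> y':el b ==> Q x y ==> Q x y' ==> y = y'"
 and u2: "!!x x' y. x:el a ==> x':el a ==> y:el b ==> Q x y ==> Q x' y ==> x = x'"
 shows "eqp a b"
proof -
 have Q: "Tm M s ==> Tm M t ==> D M (%v. Q (s v) (t v))" for s t using D2[OF _ _ Qd] .
 define g where "g = (%x. UU (mk {y:M. y:el b & Q x y}))"
 have gd: "Tm M (%v. g (v 0))" unfolding g_def by (intro dfn Q X)
 have g: "g x = y" if h: "x:el a" "y:el b" "Q x y" for x y
 proof -
  have yM: "y:M" using h by simp
  have "{y:M. y:el b & Q x y} = {y}" using u1[OF h(1) _ h(2) _ h(3)] h yM by blast
  then have "g x = UU (up y y)" unfolding g_def using yM by (metis el_up insert_absorb2 mk_el op_in(2))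
  moreover have "UU (up y y) = y" using yM by (intro ext) auto
  ultimately show ?thesis by simp
 qed
 have al: "app (lam a g) x = g x" if "x:el a" for x using app_lam[OF X(1) gd that] .
 have "inj (lam a g) a b" unfolding inj_def using al g e1 u2 by metis
 moreover have "ALL y:el b. EX x:el a. app (lam a g) x = y" using al g e2 by metis
 ultimately show ?thesis unfolding eqp_def by blast
qed

lemma eqp_lep: "eqp a b ==> lep a b"
 unfolding eqp_def lep_def by blast
lemma eqp_lep': assumes "eqp a b" "a:M" "b:M" shows "lep b a"
proof -
 obtain f where f: "f:M" "ALL y:el b. EX x:el a. app f x = y" using assms(1) unfolding eqp_def by blast
 then show ?thesis using assms by (intro lep_surj[where g = "app f"] dfn) auto
qed

lemma schroeder_bernstein: assumes m: "a:M" "b:M" and "lep a b" "lep b a" shows "eqp a b"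
proof -
 obtain f g where f: "f:M" "inj f a b" and g: "g:M" "inj g b a" using assms unfolding lep_def by blast
 have fi: "app f x:el b" "app f x = app f x' ==> x = x'" if "x:el a" "x':el a" for x x' using f that unfolding inj_def by blast+
 have gi: "app g y:el a" "app g y = app g y' ==> y = y'" if "y:el b" "y':el b" for y y' using g that unfolding inj_def by blast+
 \<comment> \<open>\<open>C\<close> will be the least subset of \<open>a\<close> containing the
   points outside the range of \<open>g\<close> and closed under \<open>f\<close> followed by
   \<open>g\<close>. It is taken as an intersection, which spares an iteration over
   \<open>om\<close>.\<close>
 define cs where "cs X <-> (ALL z:el a. (ALL y:el b. app g y ~= z) --> z:el X) & (ALL z:el X. z:el a --> app g (app f z):el X)" for X
 have csd: "Tm M s ==> D M (%v. cs (s v))" for s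
  by (rule D1[where Q = cs]; (assumption | (unfold cs_def, intro dfn; simp add: m f g)))
 define C where "C = mk {x:M. x:el a & (ALL X:M. cs X --> x:el X)}"
 have C: "el C = {x:M. x:el a & (ALL X:M. cs X --> x:el X)}" unfolding C_def using m by (intro el_mk isset_sep dfn csd; simp)
 have CM: "C:M" by (simp add: C_def)
 have C1: "EX y:el b. app g y = x" if x: "x:el a" "x ~: el C" for x
 proof (rule ccontr)
  assume "~ (EX y:el b. app g y = x)"
  then have "x:el X" if "cs X" for X using that x(1) unfolding cs_def by blast
  then show False using x unfolding C by simp
 qed
 have C2: "app g (app f z):el C" if z: "z:el C" for z
 proof -
  have za: "z:el a" using z unfolding C by simp
  have "app g (app f z):el X" if "X:M" "cs X" for X using z that za unfolding C cs_def by blast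
  moreover have "app g (app f z):el a" using fi(1) gi(1) za by blast
  ultimately show ?thesis unfolding C by simp
 qed
 have C3: "EX z:el C. app g (app f z) = app g y" if y: "y:el b" "app g y:el C" for y
 proof (rule ccontr)
  assume n: "~ (EX z:el C. app g (app f z) = app g y)"
  define X where "X = mk {x:M. x:el C & x ~= app g y}"
  have X: "el X = {x:M. x:el C & x ~= app g y}" "X:M" unfolding X_def using CM by (auto intro!: el_mk isset_sep dfn)
  have "cs X" unfolding cs_def
  proof (intro conjI ballI impI)
   fix z assume z: "z:el a" "ALL y:el b. app g y ~= z"
   then have "z:el C" using C1 by blast
   then show "z:el X" unfolding X using z y by auto
  next
   fix z assume "z:el X" "z:el a"
   then show "app g (app f z):el X" unfolding X using C2 n by auto
  qed
  then show False using y X unfolding C by blast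
 qed
 show ?thesis
 proof (rule eqp_rel[OF m, where Q = "%x y. (x:el C & y = app f x) | (x ~: el C & app g y = x)"])
  show "D M (%v. (v 0:el C & v 1 = app f (v 0)) | (v 0 ~: el C & app g (v 1) = v 0))" using CM f g by (intro dfn)
  show "EX y:el b. (x:el C & y = app f x) | (x ~: el C & app g y = x)" if "x:el a" for x
   by (cases "x:el C") (use C1[OF that] fi(1)[OF that that] in blast)+
  show "EX x:el a. (x:el C & y = app f x) | (x ~: el C & app g y = x)" if y: "y:el b" for y
  proof (cases "app g y:el C")
   case True
   then obtain z where z: "z:el C" "app g (app f z) = app g y" using C3[OF y] by blast
   then have "z:el a" unfolding C by simp
   then show ?thesis using z gi(2)[OF fi(1) y] by blast
  qed (use gi(1)[OF y] y in blast)
 next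
  fix x y y' assume "x:el a" "y:el b" "y':el b" "(x:el C & y = app f x) | (x ~: el C & app g y = x)" "(x:el C & y' = app f x) | (x ~: el C & app g y' = x)"
  then show "y = y'" using gi(2)[of y y'] by metis
 next
  fix x x' y assume h: "x:el a" "x':el a" "y:el b" "(x:el C & y = app f x) | (x ~: el C & app g y = x)" "(x':el C & y = app f x') | (x' ~: el C & app g y = x')"
  then show "x = x'" using fi(2)[OF h(1,2)] C2 by metis
 qed
qed

lemma cantor: assumes k: "k:M" shows "~ lep (pw k) k"
proof
 assume "lep (pw k) k"
 then obtain f where f: "f:M" "inj f (pw k) k" unfolding lep_def by blast
 define d where "d = mk {x:M. x:el k & (EX y:el (pw k). app f y = x & x ~: el y)}"
 have d: "el d = {x:M. x:el k & (EX y:el (pw k). app f y = x & x ~: el y)}" unfolding d_def using k f by (intro el_mk isset_sep dfn; simp)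
 have dM: "d:M" by (simp add: d_def)
 have dp: "d:el (pw k)" using d dM k by auto
 have in1: "app f d:el k" using f(2) dp unfolding inj_def by blast
 have u: "y = d" if "y:el (pw k)" "app f y = app f d" for y using f(2) dp that unfolding inj_def by blast
 show False
 proof (cases "app f d:el d")
  case True
  then obtain y where "y:el (pw k)" "app f y = app f d" "app f d ~: el y" using d by blast
  then show False using u True by blast
 next
  case False
  then have "app f d:{x:M. x:el k & (EX y:el (pw k). app f y = x & x ~: el y)}" using in1 dp by blast
  then show False using d False by blast
 qed
qed

definition Cd where "Cd k <-> Ord k & (ALL x:el k. ~ eqp x k)"
definition csx where "csx l k <-> Cd l & k:el l & (ALL m:M. Cd m & k:el m --> el l <= el m)"

lemma lep_refl: "X:M ==> lep X X"
 by (rule lep_sub) auto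
lemma har_mem: "X:M ==> Ord a ==> a:el (har X) <-> lep a X"
 by (simp add: el_har)
lemma Cd_har: assumes "k:M" shows "Cd (har k)"
 unfolding Cd_def
proof (intro conjI ballI notI)
 show "Ord (har k)" using assms by simp
 fix x assume x: "x:el (har k)" "eqp x (har k)"
 then have "lep (har k) x" "lep x k" using eqp_lep' assms by (auto simp: el_har)
 then show False using not_lep_har[OF assms] lep_trans[OF har_in] by blast
qed
lemma csx_har: assumes k: "Ord k" and l: "l:M" shows "csx l k <-> l = har k"
proof -
 have kM: "k:M" using k by simp
 have 1: "k:el (har k)" using k lep_refl by (simp add: har_mem)
 have 2: "el (har k) <= el m" if m: "Cd m" "k:el m" for m
 proof (rule ccontr)
  assume n: "~ el (har k) <= el m"
  have om: "Ord m" using m unfolding Cd_def by simp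
  then have "m:el (har k)" using n Ord_not_in[of "har k" m] kM by auto
  then have "lep m k" using kM om by (simp add: har_mem)
  moreover have "lep k m" using Ord_el_sub[OF om m(2)] kM by (intro lep_sub)
  ultimately have "eqp k m" using schroeder_bernstein kM om by simp
  then show False using m unfolding Cd_def by blast
 qed
 show ?thesis
 proof
  assume "csx l k"
  then have "el l <= el (har k)" "el (har k) <= el l" using 1 2 Cd_har[OF kM] har_in unfolding csx_def by blast+
  then show "l = har k" using ext[OF l har_in] by blast
 next
  assume "l = har k" then show "csx l k" unfolding csx_def using 1 2 Cd_har[OF kM] by blast
 qed
qed

text \<open>Only the upper bound has content. By Cantor the power set does not embed in
  \<open>k\<close>, so once it is well-ordered it is at least as large as
  \<open>har k\<close>.\<close>

lemma power_har: assumes k: "k:M" shows "eqp (pw k) (har k) <-> lep (pw k) (har k)"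
proof
 assume l: "lep (pw k) (har k)"
 obtain a f where f: "f:M" "Ord a" "inj f a (pw k)" "ALL x:el (pw k). EX y:el a. app f y = x" using well_order[of "pw k"] by auto
 have "lep (har k) (pw k)"
 proof (cases "el (har k) <= el a")
  case True
  then have "lep (har k) a" by (intro lep_sub) auto
  moreover have "lep a (pw k)" using f unfolding lep_def by blast
  ultimately show ?thesis using lep_trans[OF har_in] by blast
 next
  case False
  then have "a:el (har k)" using Ord_not_in[of "har k" a] f(2) k by auto
  then have "lep a k" using k f by (simp add: har_mem)
  moreover have "lep (pw k) a" using f by (intro lep_surj[where g = "app f"] dfn) auto
  ultimately show ?thesis using cantor[OF k] lep_trans[OF op_in(5)] by blast
 qed
 then show "eqp (pw k) (har k)" using schroeder_bernstein l by simp
qed (rule eqp_lep)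

text \<open>The aleph function by a single clause: \<open>om\<close> together with the Hartogs
  numbers of all earlier values. Separate equations at zero, successors and limits are derived from
  it.\<close>

definition AL where "AL = rec (%p x g. mk {z:M. z:el om | (EX y:el x. z:el (har (app g y)))}) emp"
lemma AL_H: "Tm A (%v. (%p x g. mk {z:M. z:el om | (EX y:el x. z:el (har (app g y)))}) (v 0) (v 1) (v 2))"
 by (intro dfn)
lemma dfn_AL [dfn]: "Tm A s ==> Tm A (%v. AL (s v))"
 unfolding AL_def by (intro Tm_rec AL_H dfn)
lemma AL_in [simp]: "AL x:M"
 by (simp add: AL_def)
lemma el_AL: assumes "x:M" shows "el (AL x) = el om Un (UN y:el x. el (har (AL y)))"
proof -
 have T: "Tm M (%v. AL (v 0))" by (intro dfn)
 have T': "Tm M (%v. har (AL (v 0)))" by (intro dfn)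
 have "AL x = mk {z:M. z:el om | (EX y:el x. z:el (har (app (lam x AL) y)))}" unfolding AL_def using rec_eq[OF AL_H, of emp x] assms by simp
 also have "{z:M. z:el om | (EX y:el x. z:el (har (app (lam x AL) y)))} = el (un om (mk (UN y:el x. el (har (AL y)))))"
  using app_lam[OF assms T] isset_UN[OF assms T'] by auto
 finally have "AL x = un om (mk (UN y:el x. el (har (AL y))))" by (simp only: mk_el op_in)
 then show ?thesis using isset_UN[OF assms T'] by simp
qed
lemma Ord_AL [simp]: assumes "x:M" shows "Ord (AL x)"
proof (rule OrdI[OF AL_in])
 show "tra (AL x)" unfolding tra_def el_AL[OF assms] using Ord_el_sub[OF Ord_om] Ord_el_sub[OF Ord_har[OF AL_in]] by blast
 show "Ord y" if "y:el (AL x)" for y using that Ord_in[OF Ord_om] Ord_in[OF Ord_har[OF AL_in]] unfolding el_AL[OF assms] by blast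
qed
lemma AL_emp: "AL emp = om"
 by (rule ext) (auto simp: el_AL)
lemma mem_har: assumes "Ord a" "x:el a" shows "x:el (har a)"
 using assms Ord_in[OF assms] lep_sub[OF _ Ord_el_sub[OF assms]] by (simp add: har_mem)
lemma AL_mem: "Ord b ==> y:el b ==> AL y:el (AL b)"
 using har_mem[of "AL y" "AL y"] lep_refl[of "AL y"] el_AL[of b] by auto
lemma AL_mono: "Ord b ==> y:el b ==> el (AL y) <= el (AL b)"
 using AL_mem Ord_el_sub[OF Ord_AL] OrdM by blast
lemma AL_suc: assumes "Ord y" shows "AL (suc y) = har (AL y)"
proof (rule ext)
 have yM: "y:M" using assms by simp
 have m: "x:el (har (AL y))" if "x:el (AL y)" for x using mem_har[OF Ord_AL[OF yM] that] .
 have "el om <= el (AL y)" "!!z. z:el y ==> el (har (AL z)) <= el (AL y)" using el_AL[OF yM] by auto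
 then show "el (AL (suc y)) = el (har (AL y))" using m yM by (subst el_AL) auto
qed auto
lemma AL_Lim: assumes "Lim x" shows "el (AL x) = (UN y:el x. el (AL y))"
proof
 have x: "Ord x" "x:M" using assms unfolding Lim_def by auto
 show "(UN y:el x. el (AL y)) <= el (AL x)" using AL_mono[OF x(1)] by blast
 have "el (har (AL y)) <= (UN y:el x. el (AL y))" if "y:el x" for y
  using AL_suc[OF Ord_in[OF x(1) that]] Lim_suc[OF assms that] by auto
 moreover have "el om <= (UN y:el x. el (AL y))" using AL_emp Lim_emp[OF assms] by auto
 ultimately show "el (AL x) <= (UN y:el x. el (AL y))" unfolding el_AL[OF x(2)] by blast
qed
lemma le_AL: "Ord b ==> el b <= el (AL b)"
proof (rule Ord_induct[where R = "%b. el b <= el (AL b)"])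
 show "D M (%v. el (v 0) <= el (AL (v 0)))" by (intro dfn)
 fix a assume a: "Ord a" "!!b. b:el a ==> el b <= el (AL b)"
 have "y:el (AL a)" if y: "y:el a" for y
 proof -
  have "lep y (AL y)" using a(2)[OF y] y by (intro lep_sub) auto
  then have "y:el (har (AL y))" using Ord_in[OF a(1) y] by (simp add: har_mem)
  then show ?thesis using y el_AL[of a] a(1) by auto
 qed
 then show "el a <= el (AL a)" by blast
qed

lemma Ord_cases: assumes "Ord x" obtains "x = emp" | y where "Ord y" "y:el x" "x = suc y" | "Lim x"
proof (cases "Lim x | x = emp")
 case False
 then have "el x ~= {}" using ext[of x emp] assms by auto
 then obtain y where y: "y:el x" "suc y ~: el x" using False assms unfolding Lim_def by blast
 then show thesis using that(2)[of y] suc_sub[OF Ord_in[OF assms y(1)] assms y(1)] Ord_in[OF assms y(1)] by auto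
qed (use that in blast)

lemma ad_Lim: assumes "Ord a" "Lim b" shows "el (ad a b) = (UN y:el b. el (ad a y))"
proof -
 have b: "Ord b" "b:M" "a:M" "Ord (ad a b)" using assms Ord_ad unfolding Lim_def by auto
 have 1: "ad a y:(UN y:el b. el (ad a y))" if "y:el b" for y
  using Lim_suc[OF assms(2) that] ad_suc[of a y] that b by (auto intro!: bexI[of _ "suc y"])
 have 2: "el a <= (UN y:el b. el (ad a y))" using Lim_emp[OF assms(2)] b by (auto intro!: bexI[of _ emp])
 have 3: "el (ad a y) <= el (ad a b)" if "y:el b" for y using Ord_el_sub[OF b(4) ad_mem[OF b(3,2) that]] .
 show ?thesis
 proof
  show "el (ad a b) <= (UN y:el b. el (ad a y))" unfolding el_ad[OF b(3,2)] using 1 2 by blast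
  show "(UN y:el b. el (ad a y)) <= el (ad a b)" using 3 by blast
 qed
qed

text \<open>Such a sequence runs through alephs with successor index: at a limit it does not take
  the supremum but the next cardinal. The offset \<open>t\<close> is the index of the largest aleph
  that embeds in \<open>m\<close>, so the sequence starts with the aleph of index
  \<open>suc t\<close>.\<close>

lemma AL_seq: assumes al: "Ord al" and k: "k:M" and m: "Ord m" "el om <= el m" and k0: "emp:el al ==> app k emp = har m"
 and ks: "!!be. be:el al ==> suc be:el al ==> app k (suc be) = har (app k be)"
 and kl: "!!be. Lim be ==> be:el al ==> EX l:M. el l = (UN ga:el be. el (app k ga)) & app k be = har l"
 shows "EX t. Ord t & (ALL be:el al. AL (suc (ad t be)) = app k be)"
proof -
 have mM: "m:M" using m by simp
 define Q where "Q b <-> ~ lep (AL b) m" for b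
 have Qd: "D M (%v. Q (v 0))" unfolding Q_def using mM by (intro dfn)
 have "Q (har m)" unfolding Q_def using not_lep_har[OF mM] lep_sub[OF _ le_AL[of "har m"]] lep_trans[of "har m" "AL (har m)" m] mM by auto
 then obtain b where b: "Ord b" "Q b" "!!c. c:el b ==> ~ Q c" using Ord_min[OF Qd Ord_har[OF mM]] by blast
 obtain t where t: "Ord t" "t:el b" "b = suc t"
 proof (rule Ord_cases[OF b(1)])
  assume "b = emp"
  then have "~ lep om m" using b(2) AL_emp unfolding Q_def by simp
  then show thesis using lep_sub[of om m] m by auto
 next
  assume L: "Lim b"
  \<comment> \<open>A limit \<open>b\<close> is impossible: every \<open>AL c\<close> with
    \<open>c\<close> below \<open>b\<close> would lie below the cardinality \<open>u\<close> of
    \<open>m\<close>, hence so would their union \<open>AL b\<close>.\<close>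
  obtain u where u: "Ord u" "lep m u" "!!c. c:el u ==> ~ lep m c" 
  proof -
   have "D M (%v. lep m (v 0))" using mM by (intro dfn)
   then show thesis using Ord_min[of "%u. lep m u" m] lep_refl[OF mM] m(1) that by metis
  qed
  have um: "lep u m"
  proof -
   have "u = m | u:el m" using Ord_linear[OF u(1) m(1)] u(3) lep_refl[OF mM] by blast
   then show ?thesis using lep_refl[OF mM] lep_sub[of u m] Ord_el_sub[OF m(1)] u(1) by auto
  qed
  have "el (AL c) <= el u" if c: "c:el b" for c
  proof (rule ccontr)
   assume "~ el (AL c) <= el u"
   then have "u:el (AL c)" using Ord_not_in[OF Ord_AL[OF elM[OF c]] u(1)] by blast
   then have "lep u (AL c)" using Ord_el_sub[OF Ord_AL] u(1) c by (intro lep_sub) auto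
   moreover have "lep (har (AL c)) m" using b(3)[OF Lim_suc[OF L c]] AL_suc[OF Ord_in[OF b(1) c]] unfolding Q_def by simp
   ultimately have "lep (har (AL c)) (AL c)" using lep_trans[OF har_in] u(2) by blast
   then show False using not_lep_har by simp
  qed
  then have "el (AL b) <= el u" unfolding AL_Lim[OF L] by blast
  then have "lep (AL b) m" using lep_trans[OF AL_in lep_sub[OF AL_in] um] by blast
  then show thesis using b(2) unfolding Q_def by blast
 qed (use that in blast)
 have tm: "lep (AL t) m" "~ lep (har (AL t)) m" using b(2) b(3)[OF t(2)] t(3) AL_suc[OF t(1)] unfolding Q_def by auto
 have h: "har m = har (AL t)"
 proof (rule ext)
  have "lep x m <-> lep x (AL t)" if x: "Ord x" for x
  proof
   assume l: "lep x m"
   show "lep x (AL t)"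
   proof (rule ccontr)
    assume "~ lep x (AL t)"
    then have "x ~: el (har (AL t))" using x by (simp add: har_mem)
    then have "el (har (AL t)) <= el x" using Ord_not_in[OF Ord_har[OF AL_in] x] by blast
    then show False using tm(2) lep_trans[OF har_in lep_sub[OF har_in] l] by blast
   qed
  next
   assume "lep x (AL t)" then show "lep x m" using lep_trans[of x] tm(1) x by auto
  qed
  then show "el (har m) = el (har (AL t))" using mM by (auto simp: el_har)
 qed auto
 have tM: "t:M" using t by simp
 have "be:el al --> AL (suc (ad t be)) = app k be" if be: "Ord be" for be
 proof (rule Ord_induct[OF be, where R = "%be. be:el al --> AL (suc (ad t be)) = app k be"])
  show "D M (%v. v 0:el al --> AL (suc (ad t (v 0))) = app k (v 0))" using al k tM by (intro dfn; simp)
  fix be assume be: "Ord be" and IH: "!!ga. ga:el be ==> ga:el al --> AL (suc (ad t ga)) = app k ga"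
  show "be:el al --> AL (suc (ad t be)) = app k be"
  proof
   assume ba: "be:el al"
   have IH': "AL (suc (ad t ga)) = app k ga" "ga:el al" if "ga:el be" for ga using IH[OF that] Ord_trans[OF al ba that] by auto
   show "AL (suc (ad t be)) = app k be"
   proof (rule Ord_cases[OF be])
    assume "be = emp" then show ?thesis using k0 ba AL_suc[OF t(1)] h tM by simp
   next
    fix ga assume g: "Ord ga" "ga:el be" "be = suc ga"
    have "AL (suc (ad t be)) = har (AL (suc (ad t ga)))" using AL_suc[OF Ord_suc[OF Ord_ad[OF t(1) g(1)]]] g ad_suc[OF tM] by simp
    then show ?thesis using IH'[OF g(2)] ks[of ga] ba g by simp
   next
    assume L: "Lim be"
    then obtain l where l: "l:M" "el l = (UN ga:el be. el (app k ga))" "app k be = har l" using kl ba by blast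
    have La: "Lim (ad t be)" "Ord (ad t be)" using Lim_ad[OF t(1) L] Ord_ad[OF t(1) be] by auto
    have "el (AL (ad t be)) = (UN ga:el be. el (AL (suc (ad t ga))))"
    proof
     show "el (AL (ad t be)) <= (UN ga:el be. el (AL (suc (ad t ga))))"
     proof
      fix z assume "z:el (AL (ad t be))"
      then obtain y where y: "y:el (ad t be)" "z:el (AL y)" unfolding AL_Lim[OF La(1)] by blast
      then obtain ga where g: "ga:el be" "y:el (ad t ga)" unfolding ad_Lim[OF t(1) L] by blast
      have og: "Ord (ad t ga)" using Ord_ad[OF t(1) Ord_in[OF be g(1)]] .
      have "z:el (AL (ad t ga))" using AL_mono[OF og g(2)] y(2) by blast
      then have "z:el (AL (suc (ad t ga)))" using AL_mono[OF Ord_suc[OF og], of "ad t ga"] by auto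
      then show "z:(UN ga:el be. el (AL (suc (ad t ga))))" using g by blast
     qed
     have "suc (ad t ga):el (ad t be)" if "ga:el be" for ga using Lim_suc[OF La(1) ad_mem[OF tM _ that]] be by simp
     then show "(UN ga:el be. el (AL (suc (ad t ga)))) <= el (AL (ad t be))" using AL_mono[OF La(2)] by blast
    qed
    also have "\<dots> = el l" unfolding l(2) using IH' by simp
    finally have "AL (ad t be) = l" using ext l(1) by simp
    then show ?thesis using AL_suc[OF La(2)] l by simp
   qed
  qed
 qed
 then show ?thesis using t(1) Ord_in[OF al] by blast
qed

text \<open>The formulas express application by membership in the graph, without the default value of \<open>app\<close>.\<close>

definition fnc where "fnc f d <-> (ALL z:el f. EX x:M. EX y:M. z = pr x y) & fun1 f & (ALL x:M. x:el d <-> (EX y:M. pr x y:el f))"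

lemma pr_lam: assumes "X:M" "Tm M (%v. f (v 0))" "x:M" "y:M" shows "pr x y:el (lam X f) <-> x:el X & y = f x"
 unfolding el_lam[OF assms(1,2)] using assms Tm1M[OF assms(2)] by auto
lemma fnc_lam: assumes "X:M" "Tm M (%v. f (v 0))" shows "fnc (lam X f) X"
 unfolding fnc_def using fun1_lam[OF assms] pr_lam[OF assms] Tm1M[OF assms(2)] by (auto simp: el_lam[OF assms])

text \<open>The meaning of \<open>f_rec\<close> in the model, with \<open>S\<close> and
  \<open>T\<close> in place of the start and step formulas.\<close>

definition RC where "RC S T c b <-> (EX f:M. fnc f (suc b) & pr b c:el f & (ALL x:M. ALL u:M. x:el (suc b) & pr x u:el f -->
 (x = emp --> S u) & (ALL y:M. ALL w:M. x = suc y & pr y w:el f --> T u w) &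
 (Lim x --> (ALL z:M. z:el u <-> (EX y:M. EX w:M. y:el x & pr y w:el f & z:el w)))))"

text \<open>Induction along \<open>suc b\<close> shows that any graph as in \<open>RC\<close> agrees
  with \<open>H\<close>; conversely the restriction of \<open>H\<close> to \<open>suc b\<close> is
  such a graph.\<close>

lemma RC_iff: assumes b: "Ord b" and c: "c:M" and H: "Tm M (%v. H (v 0))" and H0: "!!u. u:M ==> S u <-> u = H emp"
 and Hs: "!!u y. u:M ==> Ord y ==> T u (H y) <-> u = H (suc y)" and Hl: "!!x. Lim x ==> el (H x) = (UN y:el x. el (H y))"
 shows "RC S T c b <-> c = H b"
proof
 have Hd: "Tm M s ==> Tm M (%v. H (s v))" for s using Tm1[OF _ H] .
 have HM: "H x:M" if "x:M" for x using Tm1M[OF H that] .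
 have bM: "b:M" "Ord (suc b)" using b by auto
 assume "RC S T c b"
 then obtain f where f: "f:M" "fnc f (suc b)" "pr b c:el f" and r: "ALL x:M. ALL u:M. x:el (suc b) & pr x u:el f -->
  (x = emp --> S u) & (ALL y:M. ALL w:M. x = suc y & pr y w:el f --> T u w) &
  (Lim x --> (ALL z:M. z:el u <-> (EX y:M. EX w:M. y:el x & pr y w:el f & z:el w)))" unfolding RC_def by blast
 have dom: "EX y:M. pr x y:el f" if "x:el (suc b)" for x using f(2) that unfolding fnc_def by (meson elM)
 have "x:el (suc b) --> (ALL u:M. pr x u:el f --> u = H x)" if x: "Ord x" for x
 proof (rule Ord_induct[OF x, where R = "%x. x:el (suc b) --> (ALL u:M. pr x u:el f --> u = H x)"])
  show "D M (%v. v 0:el (suc b) --> (ALL u:M. pr (v 0) u:el f --> u = H (v 0)))" using bM f by (intro dfn Hd; simp)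
  fix x assume x: "Ord x" and IH: "!!y. y:el x ==> y:el (suc b) --> (ALL u:M. pr y u:el f --> u = H y)"
  show "x:el (suc b) --> (ALL u:M. pr x u:el f --> u = H x)"
  proof (intro impI ballI)
   fix u assume xb: "x:el (suc b)" and u: "u:M" "pr x u:el f"
   have xM: "x:M" using x by simp
   have IH': "y:el (suc b)" "!!u. u:M ==> pr y u:el f ==> u = H y" if "y:el x" for y using IH[OF that] Ord_trans[OF bM(2) xb that] by auto
   note ru = mp[OF bspec[OF bspec[OF r xM] u(1)] conjI[OF xb u(2)]]
   show "u = H x"
   proof (rule Ord_cases[OF x])
    assume "x = emp" then show ?thesis using ru H0[OF u(1)] by blast
   next
    fix y assume y: "Ord y" "y:el x" "x = suc y"
    obtain w where w: "w:M" "pr y w:el f" using dom[OF IH'(1)[OF y(2)]] by blast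
    then have "T u w" using ru y(3) OrdM[OF y(1)] by blast
    moreover have "w = H y" using IH'(2)[OF y(2)] w by blast
    ultimately show ?thesis using Hs[OF u(1) y(1)] y(3) by simp
   next
    assume L: "Lim x"
    have "z:el u <-> z:(UN y:el x. el (H y))" if z: "z:M" for z
    proof -
     have "z:el u <-> (EX y:M. EX w:M. y:el x & pr y w:el f & z:el w)" using ru L z by blast
     also have "\<dots> <-> (EX y:el x. z:el (H y))" using IH' dom by (metis elM)
     finally show ?thesis by blast
    qed
    then have "el u = el (H x)" unfolding Hl[OF L] using elM by blast
    then show ?thesis using ext u(1) HM[OF xM] by blast
   qed
  qed
 qed
 then show "c = H b" using b c f(3) by auto
next
 have Hd: "Tm M s ==> Tm M (%v. H (s v))" for s using Tm1[OF _ H] .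
 have HM: "H x:M" if "x:M" for x using Tm1M[OF H that] .
 have bM: "b:M" "Ord (suc b)" "suc b:M" using b by auto
 assume cH: "c = H b"
 note pl = pr_lam[OF bM(3) H]
 show "RC S T c b" unfolding RC_def
 proof (intro bexI[of _ "lam (suc b) H"] conjI ballI impI)
  show "fnc (lam (suc b) H) (suc b)" using fnc_lam[OF bM(3) H] .
  show "pr b c:el (lam (suc b) H)" using pl[OF bM(1) c] cH bM by simp
  fix x u assume x: "x:M" "u:M" "x:el (suc b) & pr x u:el (lam (suc b) H)"
  then have xb: "x:el (suc b)" "u = H x" "Ord x" using pl[OF x(1,2)] Ord_in[OF bM(2)] by auto
  show "S u" if "x = emp" using H0[OF x(2)] xb that by simp
  show "T u w" if h: "y:M" "w:M" "x = suc y & pr y w:el (lam (suc b) H)" for y w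
  proof -
   have "w = H y" "Ord y" using pl[OF h(1,2)] h Ord_in[OF xb(3), of y] by auto
   then show ?thesis using Hs[OF x(2)] xb h by simp
  qed
  fix z assume L: "Lim x" and z: "z:M"
  have "y:el (suc b)" if "y:el x" for y using Ord_trans[OF bM(2) xb(1) that] .
  then have "(EX y:M. EX w:M. y:el x & pr y w:el (lam (suc b) H) & z:el w) <-> (EX y:el x. z:el (H y))" using pl HM by (metis elM)
  then show "z:el u <-> (EX y:M. EX w:M. y:el x & pr y w:el (lam (suc b) H) & z:el w)" using Hl[OF L] xb by auto
 qed simp
qed

end

section \<open>The meaning of the concrete formulas in a model\<close>

context zfc
begin

lemma val_in [simp]: "v:UNIV \<rightarrow> M ==> v i:M"
 by auto
lemma val_upd [simp]: "v:UNIV \<rightarrow> M ==> x:M ==> v(n := x):UNIV \<rightarrow> M"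
 by auto

lemma ball_E: "(ALL y:M. E y x --> Q y) <-> (ALL y:el x. Q y)" and bex_E: "(EX y:M. E y x & Q y) <-> (EX y:el x. Q y)"
 by (auto simp: el_def simp del: elM)

lemma ball_el: "(ALL y:M. y:el x --> Q y) <-> (ALL y:el x. Q y)"
 using elM by blast

lemma sat_conn [simp]: "sat M E ((x \<^bold>\<in> y) n) v <-> E (v x) (v y)" "sat M E ((x \<^bold>= y) n) v <-> v x = v y" "sat M E ((\<^bold>\<not> P) n) v <-> ~ sat M E (P n) v"
 "sat M E ((P \<^bold>\<and> Q) n) v <-> sat M E (P n) v & sat M E (Q n) v" "sat M E ((P \<^bold>\<or> Q) n) v <-> sat M E (P n) v | sat M E (Q n) v"
 "sat M E ((P \<^bold>\<longrightarrow> Q) n) v <-> (sat M E (P n) v --> sat M E (Q n) v)" "sat M E ((P \<^bold>\<longleftrightarrow> Q) n) v <-> (sat M E (P n) v <-> sat M E (Q n) v)"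
 "sat M E (f_all B n) v <-> (ALL x:M. sat M E (B n (Suc n)) (v(n := x)))" "sat M E (f_ex B n) v <-> (EX x:M. sat M E (B n (Suc n)) (v(n := x)))"
 by (auto simp: f_defs)

lemma sat_subset [simp]: "a < n ==> b < n ==> sat M E (f_subset a b n) v <-> el (v a) <= el (v b)"
 by (simp add: f_subset_def) (auto simp: el_def simp del: elM)
lemma sat_empty [simp]: "a < n ==> v:UNIV \<rightarrow> M ==> sat M E (f_empty a n) v <-> v a = emp"
proof -
 assume a: "a < n" "v:UNIV \<rightarrow> M"
 have "(ALL z:M. ~ E z (v a)) <-> el (v a) = {}" by (auto simp: el_def simp del: elM)
 moreover have "el (v a) = {} <-> v a = emp" using ext[of "v a" emp] a by auto
 ultimately show ?thesis using a by (simp add: f_empty_def)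
qed
lemma ext_iff: "x:M ==> y:M ==> x = y <-> (ALL z:M. E z x <-> z:el y)"
proof -
 assume m: "x:M" "y:M"
 have "el x = el y" if "ALL z:M. E z x <-> z:el y" using that E_iff elM by blast
 then show ?thesis using ext[OF m] E_iff by blast
qed
lemma sat_succ [simp]: "a < n ==> b < n ==> v:UNIV \<rightarrow> M ==> sat M E (f_succ a b n) v <-> v a = suc (v b)"
 by (auto simp: f_succ_def ext_iff[of "v a"] E_iff)
lemma sat_trans [simp]: "a < n ==> sat M E (f_trans a n) v <-> tra (v a)"
 by (simp add: f_trans_def tra_def ball_E)
lemma sat_ord [simp]: "a < n ==> v:UNIV \<rightarrow> M ==> sat M E (f_ord a n) v <-> Ord (v a)"
proof -
 assume a: "a < n" "v:UNIV \<rightarrow> M"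
 have "(ALL y:M. ALL z:M. E y (v a) & E z (v a) --> E y z | y = z | E z y) <-> (ALL y:el (v a). ALL z:el (v a). y:el z | y = z | z:el y)"
  by (auto simp: el_def simp del: elM)
 moreover have "sat M E (f_ord a n) v <-> tra (v a) & (ALL y:M. ALL z:M. E y (v a) & E z (v a) --> E y z | y = z | E z y)" using a by (simp add: f_ord_def)
 ultimately show ?thesis unfolding Ord_def using val_in[OF a(2)] by metis
qed
lemma sat_limit [simp]: "a < n ==> v:UNIV \<rightarrow> M ==> sat M E (f_limit a n) v <-> Lim (v a)"
proof -
 assume a: "a < n" "v:UNIV \<rightarrow> M"
 have "(ALL y:M. E y (v a) --> (EX s:M. s = suc y & E s (v a))) <-> (ALL y:el (v a). suc y:el (v a))" by (auto simp: ball_E E_iff)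
 moreover have "v a ~= emp <-> el (v a) ~= {}" using ext[of "v a" emp] a by auto
 ultimately show ?thesis using a by (simp add: f_limit_def Lim_def cong: ball_cong bex_cong)
qed
lemma sat_omega [simp]: "a < n ==> v:UNIV \<rightarrow> M ==> sat M E (f_omega a n) v <-> v a = om"
proof -
 assume a: "a < n" "v:UNIV \<rightarrow> M"
 have "Lim x & (ALL y:el x. ~ Lim y) <-> x = om" for x
 proof
  assume x: "Lim x & (ALL y:el x. ~ Lim y)"
  then have "om = x | om:el x" using Ord_sub[OF Ord_om _ om_least] unfolding Lim_def by blast
  then show "x = om" using x Lim_om by blast
 qed (use Lim_om om_not_Lim in blast)
 then show ?thesis using a by (simp add: f_omega_def ball_E cong: ball_cong)
qed
lemma sat_upair [simp]: "a < n ==> b < n ==> c < n ==> v:UNIV \<rightarrow> M ==> sat M E (f_upair a b c n) v <-> v a = up (v b) (v c)"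
 by (auto simp: f_upair_def ext_iff[of "v a"])
lemma sat_pair [simp]: "a < n ==> b < n ==> c < n ==> v:UNIV \<rightarrow> M ==> sat M E (f_pair a b c n) v <-> v a = pr (v b) (v c)"
 by (simp add: f_pair_def pr_def cong: bex_cong)
lemma sat_app [simp]: "a < n ==> b < n ==> c < n ==> v:UNIV \<rightarrow> M ==> sat M E (f_app a b c n) v <-> pr (v b) (v c):el (v a)"
 by (simp add: f_app_def bex_E cong: bex_cong)
lemma sat_fun [simp]: "a < n ==> b < n ==> v:UNIV \<rightarrow> M ==> sat M E (f_fun a b n) v <-> fnc (v a) (v b)"
 by (simp add: f_fun_def fnc_def fun1_def E_iff cong: ball_cong bex_cong) (auto simp: ball_el)
lemma sat_eqpoll [simp]: "a < n ==> b < n ==> v:UNIV \<rightarrow> M ==> sat M E (f_eqpoll a b n) v <-> eqp (v a) (v b)"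
proof -
 assume a: "a < n" "b < n" "v:UNIV \<rightarrow> M"
 have "eqp x y <-> (EX f:M. fnc f x & (ALL s:M. ALL s':M. ALL t:M. pr s t:el f & pr s' t:el f --> s = s') & (ALL t:M. t:el y <-> (EX s:M. pr s t:el f)))" (is "_ = ?r") if xy: "x:M" "y:M" for x y
 proof
  assume "eqp x y"
  then obtain f where f: "f:M" "inj f x y" "ALL t:el y. EX s:el x. app f s = t" unfolding eqp_def by blast
  have T: "Tm M (%v. app f (v 0))" using f by (intro dfn)
  note pl = pr_lam[OF xy(1) T]
  show ?r
  proof (intro bexI[of _ "lam x (app f)"] conjI ballI impI)
   show "fnc (lam x (app f)) x" using fnc_lam[OF xy(1) T] .
   show "s = s'" if "s:M" "s':M" "t:M" "pr s t:el (lam x (app f)) & pr s' t:el (lam x (app f))" for s s' t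
    using pl[OF that(1,3)] pl[OF that(2,3)] that(4) f(2) unfolding inj_def by blast
   show "t:el y <-> (EX s:M. pr s t:el (lam x (app f)))" if "t:M" for t
    using pl[OF _ that] f(2,3) unfolding inj_def by (metis elM)
  qed simp
 next
  assume ?r
  then obtain f where f: "f:M" "fnc f x" "ALL s:M. ALL s':M. ALL t:M. pr s t:el f & pr s' t:el f --> s = s'" "ALL t:M. t:el y <-> (EX s:M. pr s t:el f)" by blast
  show "eqp x y"
  proof (rule eqp_rel[OF xy, where Q = "%s t. pr s t:el f"])
   show "D M (%v. pr (v 0) (v 1):el f)" using f by (intro dfn)
   show "EX t:el y. pr s t:el f" if "s:el x" for s using f(2,4) that unfolding fnc_def by (meson elM)
   show "EX s:el x. pr s t:el f" if "t:el y" for t using f(2,4) that unfolding fnc_def by (meson elM)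
   show "t = t'" if "s:el x" "t:el y" "t':el y" "pr s t:el f" "pr s t':el f" for s t t' using f(2) that unfolding fnc_def fun1_def by (meson elM)
   show "s = s'" if "s:el x" "s':el x" "t:el y" "pr s t:el f" "pr s' t:el f" for s s' t using f(3) that by (meson elM)
  qed
 qed
 then show ?thesis using a by (simp add: f_eqpoll_def f_bij_def E_iff cong: ball_cong bex_cong)
qed
lemma sat_cardinal [simp]: "a < n ==> v:UNIV \<rightarrow> M ==> sat M E (f_cardinal a n) v <-> Cd (v a)"
 by (simp add: f_cardinal_def Cd_def ball_E cong: ball_cong)
lemma sat_card [simp]: "a < n ==> b < n ==> v:UNIV \<rightarrow> M ==> sat M E (f_card a b n) v <-> Cd (v a) & eqp (v b) (v a)"
 by (simp add: f_card_def)
lemma sat_csucc [simp]: "a < n ==> b < n ==> v:UNIV \<rightarrow> M ==> sat M E (f_csucc a b n) v <-> csx (v a) (v b)"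
 by (simp add: f_csucc_def csx_def E_iff cong: ball_cong)
lemma sat_two_power [simp]: "a < n ==> b < n ==> v:UNIV \<rightarrow> M ==> sat M E (f_two_power a b n) v <-> Cd (v a) & eqp (pw (v b)) (v a)"
proof -
 assume a: "a < n" "b < n" "v:UNIV \<rightarrow> M"
 have "(ALL x:M. E x p <-> el x <= el (v b)) <-> p = pw (v b)" if "p:M" for p using ext_iff[OF that, of "pw (v b)"] a by simp
 then show ?thesis using a by (simp add: f_two_power_def cong: bex_cong)
qed

lemma sat_cong_rules:
 "sat M E (P n) v = X ==> sat M E (Q n) v = Y ==> sat M E ((P \<^bold>\<and> Q) n) v = (X & Y)"
 "sat M E (P n) v = X ==> sat M E (Q n) v = Y ==> sat M E ((P \<^bold>\<longrightarrow> Q) n) v = (X --> Y)"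
 "sat M E (P n) v = X ==> sat M E (Q n) v = Y ==> sat M E ((P \<^bold>\<longleftrightarrow> Q) n) v = (X <-> Y)"
 "(!!x. x:M ==> sat M E (B n (Suc n)) (v(n := x)) = Z x) ==> sat M E (f_all B n) v = (ALL x:M. Z x)"
 "(!!x. x:M ==> sat M E (B n (Suc n)) (v(n := x)) = Z x) ==> sat M E (f_ex B n) v = (EX x:M. Z x)"
 by auto
lemma bex_one: "e:M ==> (EX d:M. d = e & Q d) <-> Q e"
 by auto

declare val_in [simp del]

lemma sat_rec: assumes n: "c < n" "b < n" "v:UNIV \<rightarrow> M"
 and S: "!!m w u. n \<le> m ==> u < m ==> w:UNIV \<rightarrow> M ==> (!!i. i < n ==> w i = v i) ==> sat M E (st u m) w <-> S (w u)"
 and T: "!!m w u z. n \<le> m ==> u < m ==> z < m ==> w:UNIV \<rightarrow> M ==> sat M E (sp u z m) w <-> T (w u) (w z)"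
 shows "sat M E (f_rec st sp c b n) v <-> RC S T (v c) (v b)"
proof -
 have "sat M E (f_rec st sp c b n) v <-> (EX f:M. EX d:M. d = suc (v b) & fnc f d & pr (v b) (v c):el f & (ALL x:M. ALL u:M. x:el d & pr x u:el f -->
  (x = emp --> S u) & (ALL y:M. ALL w:M. x = suc y & pr y w:el f --> T u w) &
  (Lim x --> (ALL z:M. z:el u <-> (EX y:M. EX w:M. y:el x & pr y w:el f & z:el w)))))"
  unfolding f_rec_def by (intro sat_cong_rules; (use n val_in[OF n(3)] in \<open>simp add: S T E_iff\<close>))
 then show ?thesis by (simp only: bex_one[OF op_in(6)] RC_def)
qed

lemma sat_add [simp]: assumes n: "c < n" "a < n" "b < n" "v:UNIV \<rightarrow> M"
 shows "sat M E (f_add c a b n) v <-> RC (%u. u = v a) (%u w. u = suc w) (v c) (v b)"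
 unfolding f_add_def by (rule sat_rec[OF n(1,3,4)]) (use n in auto)
lemma sat_aleph [simp]: assumes n: "c < n" "b < n" "v:UNIV \<rightarrow> M"
 shows "sat M E (f_aleph c b n) v <-> RC (%u. u = om) csx (v c) (v b)"
 unfolding f_aleph_def by (rule sat_rec[OF n]) auto
lemma RC_add: "Ord a ==> Ord b ==> c:M ==> RC (%u. u = a) (%u w. u = suc w) c b <-> c = ad a b"
 by (rule RC_iff) (auto intro!: dfn simp: ad_suc ad_Lim)
lemma RC_aleph: "Ord b ==> c:M ==> RC (%u. u = om) csx c b <-> c = AL b"
 by (rule RC_iff) (auto intro!: dfn simp: AL_emp AL_suc AL_Lim csx_har)

text \<open>The sums, alephs and successor cardinals that the formula quantifies over are unique, so
  its matrix reduces to comparing a power set with a Hartogs number.\<close>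

lemma CCA_I: assumes H: "!!al a. Ord al ==> a:M ==> el a <= el al ==> EX t. Ord t &
  (ALL be:el al. be:el a <-> lep (pw (AL (suc (ad t be)))) (har (AL (suc (ad t be)))))" and v: "v:UNIV \<rightarrow> M"
 shows "sat M E CCA v"
proof -
 define Q where "Q t be <-> (EX s:M. EX s':M. EX k:M. EX l:M. RC (%u. u = t) (%u w. u = suc w) s be & s' = suc s & RC (%u. u = om) csx k s' & (Cd l & eqp (pw k) l) & csx l k)" for t be
 have eq: "Q t be <-> lep (pw (AL (suc (ad t be)))) (har (AL (suc (ad t be))))" if o: "Ord t" "Ord be" for t be
 proof -
  have oa: "Ord (suc (ad t be))" using Ord_ad[OF o] by simp
  have "Q t be <-> (EX k:M. EX l:M. RC (%u. u = om) csx k (suc (ad t be)) & (Cd l & eqp (pw k) l) & csx l k)" unfolding Q_def using RC_add[OF o] ad_in op_in(6) by blast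
  also have "\<dots> <-> (EX l:M. (Cd l & eqp (pw (AL (suc (ad t be)))) l) & csx l (AL (suc (ad t be))))" using RC_aleph[OF oa] AL_in by blast
  also have "\<dots> <-> eqp (pw (AL (suc (ad t be)))) (har (AL (suc (ad t be))))" using Cd_har[OF AL_in, of "suc (ad t be)"] csx_har[OF Ord_AL[OF op_in(6)], of _ "ad t be"] har_in by metis
  finally show ?thesis using power_har[OF AL_in] by blast
 qed
 have "EX t:M. Ord t & (ALL be:M. E be al --> E be a = Q t be)" if h: "Ord al" "a:M" "el a <= el al" for al a
 proof -
  obtain t where t: "Ord t" "!!be. be:el al ==> be:el a <-> lep (pw (AL (suc (ad t be)))) (har (AL (suc (ad t be))))" using H[OF h] by blast
  have "E be a = Q t be" if "be:M" "E be al" for be using eq[OF t(1) Ord_in[OF h(1)]] t(2) that E_iff by blast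
  then show ?thesis using t(1) OrdM by blast
 qed
 then have "ALL al:M. ALL a:M. Ord al & el a <= el al --> (EX t:M. Ord t & (ALL be:M. E be al --> E be a = Q t be))" by blast
 moreover have "sat M E CCA v <-> (ALL al:M. ALL a:M. Ord al & el a <= el al --> (EX t:M. Ord t & (ALL be:M. E be al --> E be a = Q t be)))"
  unfolding CCA_def Q_def by (intro sat_cong_rules; (use v in simp))
 ultimately show ?thesis by blast
qed

end

section \<open>Cardinals in the extension\<close>

text \<open>As the extension is again a model of ZFC, the whole internal set theory developed above
  is available in it under the prefix \<open>ex\<close>.\<close>

sublocale gx < ex: zfc CC EE
 by unfold_locales (rule ZFC_ext)

context gx
begin

lemma el_j: "a:A ==> ex.el (j a) = j ` (el a Int A)"
 using j_mem[of a] unfolding ex.el_def by auto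
lemma j_inj: assumes "x:A" "y:A" shows "j x = j y <-> x = y"
proof
 assume "j x = j y"
 then obtain p where "F p (chk x) (chk y)" using cl_eq[of "chk x" "chk y"] assms unfolding j_def by auto
 then show "x = y" using chk_F assms by simp
qed simp
lemma j_in: "x:A ==> y:A ==> j x:ex.el (j y) <-> x:el y"
 using el_j[of y] j_inj by auto
lemma j_sub: "x:A ==> y:A ==> el x <= el y ==> ex.el (j x) <= ex.el (j y)"
 by (auto simp: el_j)
lemma A_op: "emp:A" "om:A" "x:A ==> y:A ==> up x y:A" "x:A ==> y:A ==> pr x y:A" "x:A ==> suc x:A" "x:A ==> K x:A" "x:A ==> R x:A" "x:A ==> W x:A"
 "x:A ==> y:A ==> ad x y:A" "x:A ==> y:A ==> pd x y:A" "x:A ==> V x:A" "x:A ==> y:A ==> app x y:A"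
 by (rule A_in; (intro dfn; assumption))+
lemma j_up: assumes "x:A" "y:A" shows "j (up x y) = ex.up (j x) (j y)"
 using assms A_op(3)[OF assms] by (intro ex.ext) (auto simp: el_j)
lemma j_pr: "x:A ==> y:A ==> j (pr x y) = ex.pr (j x) (j y)"
 unfolding pr_def ex.pr_def by (simp add: j_up A_op)
lemma j_suc: "x:A ==> j (suc x) = ex.suc (j x)"
 using A_op(5)[of x] by (intro ex.ext) (auto simp: el_j)
lemma j_Ord: assumes "a:A" "Ord a" shows "ex.Ord (j a)"
proof -
 have "ex.tra (j a)" unfolding ex.tra_def using Ord_el_sub[OF assms(2)] assms(1) by (auto simp: el_j)
 moreover have "y:ex.el z | y = z | z:ex.el y" if yz: "y:ex.el (j a)" "z:ex.el (j a)" for y z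
 proof -
  obtain s t where st: "s:el a" "s:A" "y = j s" "t:el a" "t:A" "z = j t" using yz el_j[OF assms(1)] by auto
  then show ?thesis using Ord_linear[OF Ord_in[OF assms(2)] Ord_in[OF assms(2)], of s t] j_in by blast
 qed
 ultimately show ?thesis unfolding ex.Ord_def using assms by simp
qed
text \<open>Every entry of the name \<open>z\<close> has smaller rank than \<open>z\<close>, so
  \<open>j (rk z)\<close> cannot be an element of \<open>Z\<close>. Linearity then puts
  \<open>Z\<close> at or below \<open>j (rk z)\<close>, whose elements are all of the form
  \<open>j a\<close>.\<close>

lemma ex_Ord: assumes "ex.Ord Z" shows "EX a:A. Ord a & Z = j a"
proof -
 obtain z where z: "z:N" "Z = cl z" using assms ex.OrdM CC_E by metis
 have zA: "z:A" "Nm z" "z:M" using z by auto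
 have rA: "rk z:A" by (rule A_in) (intro dfn zA)
 have o: "Ord (rk z)" using zA by simp
 have "j (rk z) ~: ex.el Z"
 proof
  assume "j (rk z):ex.el Z"
  then have "EE (cl (chk (rk z))) (cl z)" unfolding ex.el_def z j_def by simp
  then obtain t q where t: "t:N" "pr t q:el z" "q:A" "cl t = cl (chk (rk z))" using EE_D[OF z(1) chk_N[OF rA]] by blast
  then obtain p where "F p t (chk (rk z))" using cl_eq[OF t(1) chk_N[OF rA]] by blast
  then have "el (rk z) <= el (rk t)" using chk_rk[OF N_D(1)[OF t(1)] o] by blast
  moreover have "rk t:el (rk z)" using rk_entry[OF zA(3) t(2)] t by simp
  ultimately show False using mem_irrefl[of "rk t"] by auto
 qed
 then have "Z = j (rk z) | Z:ex.el (j (rk z))" using ex.Ord_linear[OF assms j_Ord[OF rA o]] by blast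
 then show ?thesis using el_j[OF rA] Ord_in[OF o] rA o by auto
qed
lemma j_Lim: assumes "a:A" "Lim a" shows "ex.Lim (j a)"
proof -
 have "Ord a" using assms unfolding Lim_def by blast
 moreover have "ex.suc y:ex.el (j a)" if "y:ex.el (j a)" for y
 proof -
  obtain s where s: "s:el a" "s:A" "y = j s" using \<open>y : ex.el (j a)\<close> el_j[OF assms(1)] by auto
  then show ?thesis using j_in[OF A_op(5)[OF s(2)] assms(1)] Lim_suc[OF assms(2)] j_suc by simp
 qed
 moreover have "ex.el (j a) ~= {}" using Lim_emp[OF assms(2)] A_op(1) el_j[OF assms(1)] by auto
 ultimately show ?thesis unfolding ex.Lim_def using j_Ord assms by blast
qed
lemma j_app: assumes f: "f:A" "fun1 f" and xy: "x:A" "y:A" "pr x y:el f" shows "ex.app (j f) (j x) = j y"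
proof (rule ex.app_eq)
 show "ex.pr (j x) (j y):ex.el (j f)" using j_pr[OF xy(1,2)] j_in[OF A_op(4)[OF xy(1,2)] f(1)] xy by simp
 show "ex.fun1 (j f)" unfolding ex.fun1_def
 proof (intro ballI impI)
  fix u v w assume uvw: "u:CC" "v:CC" "w:CC" "ex.pr u v:ex.el (j f) & ex.pr u w:ex.el (j f)"
  have "EX s t. s:A & t:A & pr s t:el f & u = j s & v = j t" if h: "u:CC" "v:CC" "ex.pr u v:ex.el (j f)" for u v
  proof -
   obtain z where z: "z:el f" "z:A" "ex.pr u v = j z" using h(3) el_j[OF f(1)] by auto
   have "ex.up (ex.up u u) (ex.up u v) = j z" using z unfolding ex.pr_def by simp
   then have "ex.up u u:ex.el (j z)" "ex.up u v:ex.el (j z)" by (metis ex.el_up ex.op_in(2) insertCI)+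
   then obtain a b where ab: "a:A" "b:A" "ex.up u u = j a" "ex.up u v = j b" using el_j[OF z(2)] by auto
   then have "u:ex.el (j b)" "v:ex.el (j b)" using h by (metis ex.el_up insertCI)+
   then obtain s t where st: "s:A" "t:A" "u = j s" "v = j t" using el_j[OF ab(2)] by auto
   then have "j z = j (pr s t)" using z j_pr by simp
   then have "z = pr s t" using j_inj[OF z(2) A_op(4)[OF st(1,2)]] by simp
   then show ?thesis using st z by blast
  qed
  then obtain s t s' t' where "s:A" "t:A" "pr s t:el f" "u = j s" "v = j t" "s':A" "t':A" "pr s' t':el f" "u = j s'" "w = j t'" using uvw by metis
  then show "v = w" using f(2) j_inj unfolding fun1_def by (metis A_M)
 qed
qed (use xy in auto)
lemma j_lam: assumes X: "X:A" and f: "Tm A (%v. f (v 0))" and x: "x:el X" "x:A" shows "ex.app (j (lam X f)) (j x) = j (f x)" "lam X f:A"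
proof -
 have fM: "Tm M (%v. f (v 0))" using f D_AM unfolding Tm_def by blast
 have fA: "f x:A" by (rule A_in) (rule Tm1[OF Tm_A[OF x(2)] f])
 show l: "lam X f:A" by (rule A_in) (intro Tm_lam Tm_A X Tm1[OF _ f] Tm_var)
 show "ex.app (j (lam X f)) (j x) = j (f x)"
  by (rule j_app[OF l fun1_lam[OF A_M[OF X] fM] x(2) fA]) (use pr_lam[OF A_M[OF X] fM, of x "f x"] x fA in auto)
qed
lemma j_lep: assumes "X:A" "Y:A" "lep X Y" shows "ex.lep (j X) (j Y)"
proof -
 have "EX f:A. inj f X Y" using assms unfolding lep_def by (intro skol) (intro dfn)
 then obtain f where f: "f:A" "inj f X Y" by blast
 have T: "Tm A (%v. app f (v 0))" by (intro dfn f)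
 have ap: "ex.app (j (lam X (app f))) (j x) = j (app f x)" if "x:el X" "x:A" for x using j_lam(1)[OF assms(1) T that] .
 have fA: "app f x:A" if "x:A" for x using A_op(12) f that by blast
 show ?thesis
 proof (cases "el X Int A = {}")
  case True
  then have "ex.el (j X) = {}" using el_j[OF assms(1)] by simp
  then show ?thesis unfolding ex.lep_def ex.inj_def using j_CC[OF assms(1)] by blast
 next
  case False
  then have "lam X (app f):A" using j_lam(2)[OF assms(1) T] by blast
  moreover have "ex.inj (j (lam X (app f))) (j X) (j Y)" unfolding ex.inj_def el_j[OF assms(1)]
  proof (intro conjI ballI impI; elim imageE; clarify)
   fix x assume x: "x:el X" "x:A"
   then have "app f x:el Y" using f(2) unfolding inj_def by blast
   then show "ex.app (j (lam X (app f))) (j x):ex.el (j Y)" using ap[OF x] j_in[OF fA[OF x(2)] assms(2)] by simp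
  next
   fix x y assume x: "x:el X" "x:A" "y:el X" "y:A" "ex.app (j (lam X (app f))) (j x) = ex.app (j (lam X (app f))) (j y)"
   then have "app f x = app f y" using ap j_inj fA by metis
   then show "j x = j y" using f(2) x unfolding inj_def by metis
  qed
  ultimately show ?thesis unfolding ex.lep_def using j_CC by blast
 qed
qed

text \<open>Turns information read off from \<open>G\<close> into a set of the extension; the
  generic surjections and subsets below are obtained in this way.\<close>

lemma gsub: assumes X: "X:A" and Pd: "D A (%v. P (v 0) (v 1))" and Pm: "!!s t z. P s z ==> lq t s ==> P t z"
 shows "EX S:CC. ALL z:A. j z:ex.el S <-> z:el X & (EX p:G. P p z)"
proof -
 have Pdd: "Tm A s ==> Tm A t ==> D A (%v. P (s v) (t v))" for s t using D2[OF _ _ Pd] .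
 define Q where "Q p t <-> (EX z:M. t = chk z & z:el X & P p z)" for p t
 have "D A (%v. Q (v 0) (v 1))" unfolding Q_def by (intro dfn Pdd X)
 moreover have "Q t z" if "Q s z" "lq t s" for s t z using that Pm unfolding Q_def by blast
 ultimately obtain y where y: "y:N" "!!z. z:N ==> EE (cl z) (cl y) ==> (EX z':N. cl z' = cl z & z':el (dm (chk X)) & (EX p:G Int A. Q p z'))"
  "!!z. z:N ==> z:el (dm (chk X)) ==> EX p:G. Q p z ==> EE (cl z) (cl y)" using sep_ext[OF chk_N[OF X], of Q] by blast
 have "j z:ex.el (cl y) <-> z:el X & (EX p:G. P p z)" if z: "z:A" for z
 proof
  assume "j z:ex.el (cl y)"
  then have "EE (cl (chk z)) (cl y)" unfolding ex.el_def j_def by simp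
  then obtain z' p where z': "z':N" "cl z' = cl (chk z)" "p:G" "Q p z'" using y(2)[OF chk_N[OF z]] by blast
  then obtain u where u: "u:M" "z' = chk u" "u:el X" "P p u" unfolding Q_def by blast
  obtain r where "F r (chk u) (chk z)" using cl_eq[OF z'(1) chk_N[OF z]] z' u by blast
  then have "u = z" using chk_F u z by simp
  then show "z:el X & (EX p:G. P p z)" using u z' by blast
 next
  assume h: "z:el X & (EX p:G. P p z)"
  then have "chk z:el (dm (chk X))" using dm_Nm[OF Nm_chk[OF A_M[OF X]]] chk_entry[OF A_M[OF X]] un1(3) by auto
  moreover have "EX p:G. Q p (chk z)" unfolding Q_def using h A_M[OF z] by blast
  ultimately have "EE (cl (chk z)) (cl y)" using y(3)[OF chk_N[OF z]] by blast
  then show "j z:ex.el (cl y)" unfolding ex.el_def j_def using z by simp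
 qed
 then show ?thesis using y(1) cl_CC by blast
qed

lemma in_H: assumes "h:N" "x:A" "y:A" shows "ex.pr (j x) (j y):ex.el (cl h) <-> (EX p:G. Fm p (chk (pr x y)) h)"
proof -
 have "j (pr x y):ex.el (cl h) <-> EE (cl (chk (pr x y))) (cl h)" unfolding ex.el_def j_def using cl_CC[OF chk_N[OF A_op(4)[OF assms(2,3)]]] by blast
 then show ?thesis using EE_iff[OF chk_N[OF A_op(4)[OF assms(2,3)]] assms(1)] j_pr[OF assms(2,3)] by simp
qed

lemma covering_ext: assumes c: "c:A" "e:A" "Ord e" "c:el e" and X: "X:A" "lep X (R c)" and H: "H:CC"
 and fn: "!!x y y'. x:el X ==> x:A ==> y:A ==> y':A ==> y:el (K e) ==> y':el (K e) ==> ex.pr (j x) (j y):ex.el H ==> ex.pr (j x) (j y'):ex.el H ==> y = y'"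
 shows "EX b:el (K e) Int A. ALL x:el X Int A. ALL y:el (K e) Int A. ex.pr (j x) (j y):ex.el H --> y:el b"
proof -
 obtain h where h: "h:N" "H = cl h" using H CC_E by metis
 have hA: "h:A" "Nm h" using h by auto
 note inH = in_H[OF h(1)]
 define P where "P x y q <-> Fm q (chk (pr x y)) h" for x y q
 have Pd: "Tm A s ==> Tm A t ==> Tm A u ==> D A (%v. P (s v) (t v) (u v))" for s t u unfolding P_def by (intro dfn hA)
 have Pm: "P x y q ==> lq r q ==> P x y r" for x y q r unfolding P_def using Fm_mono by blast
 \<comment> \<open>Functionality is only known in this one extension. A condition in
   \<open>G\<close> that excludes every violation below it makes it a forced statement, as
   \<open>covering\<close> requires.\<close>
 define B where "B q <-> (EX x:M. EX y:M. EX y':M. x:el X & y:el (K e) & y':el (K e) & y ~= y' & P x y q & P x y' q)" for q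
 have Bd: "Tm A s ==> D A (%v. B (s v))" for s
  by (rule D1[where Q = B]; (assumption | (unfold B_def, intro dfn Pd X c)))
 obtain p where p: "p:G" using Gne by blast
 have "EX q:G Int A. B q | (ALL u:M. lq u q --> ~ B u)"
 proof (rule gen[OF _ p])
  show "D A (%v. B (v 0) | (ALL u:M. lq u (v 0) --> ~ B u))" by (intro dfn Bd)
  show "EX q:M. lq q s & (B q | (ALL u:M. lq u q --> ~ B u))" if "lq s p" for s using decide[OF lqD(1)[OF that], of B] by blast
 qed
 then obtain q where q: "q:G" "q:A" "B q | (ALL u:M. lq u q --> ~ B u)" by blast
 have "~ B q"
 proof
  assume "B q"
  then have "EX x:A. EX y:M. EX y':M. x:el X & y:el (K e) & y':el (K e) & y ~= y' & P x y q & P x y' q" unfolding B_def by (rule skol[rotated]) (intro dfn Pd X c q)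
  then obtain x where x: "x:A" "EX y:M. EX y':M. x:el X & y:el (K e) & y':el (K e) & y ~= y' & P x y q & P x y' q" by blast
  have "EX y:A. EX y':M. x:el X & y:el (K e) & y':el (K e) & y ~= y' & P x y q & P x y' q" using x(2) by (rule skol[rotated]) (intro dfn Pd X c q x)
  then obtain y where y: "y:A" "EX y':M. x:el X & y:el (K e) & y':el (K e) & y ~= y' & P x y q & P x y' q" by blast
  have "EX y':A. x:el X & y:el (K e) & y':el (K e) & y ~= y' & P x y q & P x y' q" using y(2) by (rule skol[rotated]) (intro dfn Pd X c q x y)
  then obtain y' where y': "y':A" "x:el X" "y:el (K e)" "y':el (K e)" "y ~= y'" "P x y q" "P x y' q" by blast
  then show False using fn[OF y'(2) x(1) y(1) y'(1,3,4)] inH[OF x(1) y(1)] inH[OF x(1) y'(1)] q(1) unfolding P_def h(2) by blast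
 qed
 then have nB: "~ B u" if "lq u q" for u using q(3) that lqD(1) Cn_M by blast
 have "EX r:G Int A. EX b:A. b:el (K e) & (ALL x:el X. ALL y:el (K e). ALL w:M. lq w r & P x y w --> y:el b)"
 proof (rule gen2[OF _ q(1)])
  show "D A (%v. v 1:el (K e) & (ALL x:el X. ALL y:el (K e). ALL w:M. lq w (v 0) & P x y w --> y:el (v 1)))" by (intro dfn Pd X c)
  fix s assume s: "lq s q"
  have oc: "Ord c" "c:M" "X:M" using Ord_in[OF c(3,4)] X by auto
  show "EX r:M. lq r s & (EX b:M. b:el (K e) & (ALL x:el X. ALL y:el (K e). ALL w:M. lq w r & P x y w --> y:el b))" unfolding P_def
  proof (rule covering[OF oc(1) c(3,4) oc(3) X(2) lqD(1)[OF s] hA(2)])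
   fix x y y' w assume xy: "x:el X" "y:el (K e)" "y':el (K e)" "lq w s" "Fm w (chk (pr x y)) h" "Fm w (chk (pr x y')) h"
   then show "y = y'" using nB[OF lq_trans[OF xy(4) s]] unfolding B_def P_def by (meson elM)
  qed
 qed
 then obtain r b where r: "r:G" "b:A" "b:el (K e)" "!!x y w. x:el X ==> y:el (K e) ==> w:M ==> lq w r ==> P x y w ==> y:el b" by blast
 have "y:el b" if xy: "x:el X" "x:A" "y:el (K e)" "y:A" "ex.pr (j x) (j y):ex.el H" for x y
 proof -
  obtain p where p: "p:G" "P x y p" using inH[OF xy(2,4)] xy(5) unfolding h(2) P_def by blast
  obtain w where w: "w:G" "lq w p" "lq w r" using Gdir[OF p(1) r(1)] by blast
  then show ?thesis using r(4)[OF xy(1,3) _ w(3) Pm[OF p(2) w(2)]] GC by simp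
 qed
 then show ?thesis using r by blast
qed

section \<open>Generic entries and the collapse\<close>

definition off where "off c <-> (EX p:G. c:el (ll p) & pr c (rs (ff p) c):el (bb p))"

lemma entry_stays: assumes "w:G" "lq w p" "e:el (ff p)" "row0 e | ~ off (ft e)" shows "e:el (ff w)"
proof -
 note w = lqD[OF assms(2)]
 have "ft e:el (ll w)" using PC_ft[OF CnD(3)[OF w(2)] assms(3)] w(3) by blast
 then show ?thesis using w(5) assms unfolding le_def off_def by blast
qed
lemma entry_unique: assumes "p:G" "p':G" "e:el (ff p)" "e':el (ff p')" "key e = key e'" "row0 e | ~ off (ft e)" shows "e = e'"
proof -
 obtain w where w: "w:G" "lq w p" "lq w p'" using Gdir assms by blast
 have "e:el (ff w)" "e':el (ff w)" using entry_stays[OF w(1)] w assms key_row0[OF assms(5)] by auto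
 then show ?thesis using PC_key[OF CnD(3)[OF GC[OF w(1)]]] assms by blast
qed

text \<open>The freedom to place the column beyond \<open>z\<close> is used at limit stages, where
  it has to lie between \<open>K d\<close> and \<open>K (suc d)\<close>.\<close>

lemma row0_dense: assumes c: "c:A" "Ord c" and y: "y:A" "y:el (R c)" and z: "z:A" "z:el (K c)"
 shows "EX n:A. n:el (K c) & n ~: el z & (EX p:G. pr c (pr (pr emp n) y):el (ff p))"
proof -
 obtain p where p: "p:G" using Gne by blast
 have "EX q:G Int A. EX n:A. n:el (K c) & n ~: el z & pr c (pr (pr emp n) y):el (ff q)"
 proof (rule gen2[OF _ p])
  show "D A (%v. v 1:el (K c) & v 1 ~: el z & pr c (pr (pr emp (v 1)) y):el (ff (v 0)))" by (intro dfn c y z)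
  fix s assume s: "lq s p"
  obtain q where q: "lq q s" "Cn q" "c:el (ll q)" using long[OF lqD(1)[OF s] c(2)] by blast
  obtain n where n: "n:el (K c)" "n ~: el z" "ALL e:el (ff q). ft e = c --> sn (ft (sn e)) ~= n" using fresh[OF CnD(3)[OF q(2)] CnD(1)[OF q(2)] q(3) z(2)] by blast
  have e: "emp:el (K (suc (suc c)))" using Lim_emp[OF Lim_K] c by simp
  have "ft (sn e) ~= pr emp n" if "e:el (ff q)" "ft e = c" for e using n that by auto
  then obtain r where r: "r:M" "lq r q" "el (ff r) = insert (pr c (pr (pr emp n) y)) (el (ff q))" using add_entry[OF q(2,3) e n(1) y(2)] by blast
  then show "EX q:M. lq q s & (EX n:M. n:el (K c) & n ~: el z & pr c (pr (pr emp n) y):el (ff q))" using lq_trans[OF r(2) q(1)] n elM[OF n(1)] by (metis insertI1)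
 qed
 then show ?thesis by blast
qed

lemma row0_mono: assumes "lq q p" "c:M" "n:M" "y:M" "pr c (pr (pr emp n) y):el (ff p)" shows "pr c (pr (pr emp n) y):el (ff q)"
proof -
 have "row0 (pr c (pr (pr emp n) y))" unfolding row0_def using assms by simp
 then show ?thesis using lqD(5)[OF assms(1)] assms(5) unfolding le_def by blast
qed
lemma row0_unique: assumes "p:G" "p':G" "c:M" "n:M" "y:M" "y':M" "pr c (pr (pr emp n) y):el (ff p)" "pr c (pr (pr emp n) y'):el (ff p')" shows "y = y'"
proof -
 have "pr c (pr (pr emp n) y) = pr c (pr (pr emp n) y')" using assms by (intro entry_unique[OF assms(1,2,7,8)]) (auto simp: key_def row0_def)
 then show ?thesis using assms by simp
qed

text \<open>Row 0 of stage \<open>c\<close> is a partial function on \<open>K c\<close> that takes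
  every value in \<open>R c\<close>. The order never ignores row 0, so this holds whether the stage
  is on or off.\<close>

lemma R_lep_K: assumes c: "c:A" "Ord c" shows "ex.lep (j (R c)) (j (K c))"
proof -
 have cM: "c:M" using c by simp
 define P where "P p z <-> (EX n:M. EX y:M. z = pr n y & pr c (pr (pr emp n) y):el (ff p))" for p z
 have Pd: "D A (%v. P (v 0) (v 1))" unfolding P_def by (intro dfn c)
 have Pm: "P t z" if "P s z" "lq t s" for s t z using that row0_mono[OF that(2) cM] unfolding P_def by blast
 have XA: "pd (K c) (R c):A" using A_op(10)[OF A_op(6)[OF c(1)] A_op(7)[OF c(1)]] .
 have "EX S:CC. ALL z:A. j z:ex.el S <-> z:el (pd (K c) (R c)) & (EX p:G. P p z)" by (rule gsub[OF XA Pd]; (rule Pm; assumption))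
 then obtain S where S: "S:CC" "!!z. z:A ==> j z:ex.el S <-> z:el (pd (K c) (R c)) & (EX p:G. P p z)" by blast
 have KA: "K c:A" "R c:A" using A_op c by auto
 have SP: "ex.pr (j n) (j y):ex.el S <-> (EX p:G. pr c (pr (pr emp n) y):el (ff p))" if h: "n:el (K c)" "n:A" "y:el (R c)" "y:A" for n y
 proof -
  have "P p (pr n y) <-> pr c (pr (pr emp n) y):el (ff p)" for p unfolding P_def using h by auto
  then show ?thesis using S(2)[OF A_op(4)[OF h(2,4)]] h j_pr[OF h(2,4)] by auto
 qed
 show ?thesis
 proof (rule ex.lep_rel[OF j_CC[OF KA(2)] j_CC[OF KA(1)], where Q = "%n y. ex.pr n y:ex.el S"])
  show "ex.D CC (%v. ex.pr (v 0) (v 1):ex.el S)" by (intro ex.dfn_pr ex.D_el ex.Tm_var ex.Tm_constM S)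
  fix Y assume "Y:ex.el (j (R c))"
  then obtain y where y: "y:el (R c)" "y:A" "Y = j y" using el_j[OF KA(2)] by auto
  have "emp:el (K c)" using Lim_emp[OF Lim_K[OF c(2)]] .
  then obtain n where "n:A" "n:el (K c)" "EX p:G. pr c (pr (pr emp n) y):el (ff p)" using row0_dense[OF c y(2,1) A_op(1)] by blast
  then show "EX n:ex.el (j (K c)). ex.pr n Y:ex.el S" using SP[of n y] y j_in[of n "K c"] KA by auto
 next
  fix Y Y' n' assume h: "Y:ex.el (j (R c))" "Y':ex.el (j (R c))" "n':ex.el (j (K c))" "ex.pr n' Y:ex.el S" "ex.pr n' Y':ex.el S"
  obtain y y' n where y: "y:el (R c)" "y:A" "Y = j y" "y':el (R c)" "y':A" "Y' = j y'" "n:el (K c)" "n:A" "n' = j n" using h el_j KA by auto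
  obtain p p' where "p:G" "p':G" "pr c (pr (pr emp n) y):el (ff p)" "pr c (pr (pr emp n) y'):el (ff p')" using SP[OF y(7,8,1,2)] SP[OF y(7,8,4,5)] h y by auto
  then have "y = y'" using row0_unique[of p p' c n y y'] y cM by auto
  then show "Y = Y'" using y by simp
 qed
qed

text \<open>Row 0 of stage \<open>c\<close> itself has too many columns, namely \<open>K c\<close>.
  Instead, row 0 of each stage \<open>suc d\<close> is read only between \<open>K d\<close> and
  \<open>K (suc d)\<close>. These intervals are disjoint, so for all \<open>d\<close> below
  \<open>c\<close> together they give one partial function on the supremum that still takes all
  values in \<open>W c\<close>.\<close>

lemma W_lep_sup: assumes c: "c:A" "Lim c" and l: "l:A" "el l = (UN d:el c. el (K d))" shows "ex.lep (j (W c)) (j l)"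
proof -
 have oc: "Ord c" "c:M" using c unfolding Lim_def by auto
 define P where "P p z <-> (EX d:el c. EX n:M. EX y:M. z = pr n y & n:el (K (suc d)) & n ~: el (K d) & pr (suc d) (pr (pr emp n) y):el (ff p))" for p z
 have Pd: "D A (%v. P (v 0) (v 1))" unfolding P_def by (intro dfn c)
 have Pm: "P t z" if "P s z" "lq t s" for s t z using that row0_mono[OF that(2) op_in(6)] unfolding P_def by blast
 have WA: "W c:A" "pd l (W c):A" using A_op c l by auto
 have "EX S:CC. ALL z:A. j z:ex.el S <-> z:el (pd l (W c)) & (EX p:G. P p z)" by (rule gsub[OF WA(2) Pd]; (rule Pm; assumption))
 then obtain S where S: "S:CC" "!!z. z:A ==> j z:ex.el S <-> z:el (pd l (W c)) & (EX p:G. P p z)" by blast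
 have SP: "ex.pr (j n) (j y):ex.el S <-> (EX p:G. EX d:el c. n:el (K (suc d)) & n ~: el (K d) & pr (suc d) (pr (pr emp n) y):el (ff p))" if h: "n:el l" "n:A" "y:el (W c)" "y:A" for n y
 proof -
  have "P p (pr n y) <-> (EX d:el c. n:el (K (suc d)) & n ~: el (K d) & pr (suc d) (pr (pr emp n) y):el (ff p))" for p unfolding P_def using h by auto
  then show ?thesis using S(2)[OF A_op(4)[OF h(2,4)]] h j_pr[OF h(2,4)] pd_mem[OF h(1,3) A_M[OF l(1)] A_M[OF WA(1)]] by auto
 qed
 show ?thesis
 proof (rule ex.lep_rel[OF j_CC[OF WA(1)] j_CC[OF l(1)], where Q = "%n y. ex.pr n y:ex.el S"])
  show "ex.D CC (%v. ex.pr (v 0) (v 1):ex.el S)" by (intro ex.dfn_pr ex.D_el ex.Tm_var ex.Tm_constM S)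
  fix Y assume "Y:ex.el (j (W c))"
  then obtain y where y: "y:el (W c)" "y:A" "Y = j y" using el_j[OF WA(1)] by auto
  have "EX d:M. d:el c & y:el (R d)"
  proof -
   obtain m where m: "lev c m" "el y <= el (V m)" using y el_W[OF oc(2)] by auto
   show ?thesis
   proof (cases "m = om")
    case True
    have "el (V om) <= el (V (K emp))" using om_in_K[OF Ord_emp] Ord_el_sub[OF Ord_K[OF op_in(1)]] by (intro V_mono) auto
    then have "y:el (R emp)" unfolding R_def using m True y by auto
    then show ?thesis using Lim_emp[OF c(2)] by blast
   next
    case False
    then obtain d where "d:el c" "m = K d" using m unfolding lev_def by blast
    then show ?thesis using m y unfolding R_def by (intro bexI[of _ d]) auto
   qed
  qed
  then have "EX d:A. d:el c & y:el (R d)" by (rule skol[rotated]) (intro dfn c y)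
  then obtain d where d: "d:A" "d:el c" "y:el (R d)" by blast
  have od: "Ord d" "d:M" using Ord_in[OF oc(1) d(2)] by auto
  have sd: "suc d:A" "Ord (suc d)" "suc d:el c" using A_op d od Lim_suc[OF c(2)] by auto
  have "el (R d) <= el (R (suc d))" unfolding R_def using V_mono[OF Ord_K Ord_K K_sub[OF od(1) sd(2)]] od by auto
  then have yR: "y:el (R (suc d))" using d by blast
  have "K d:el (K (suc d))" using K_mono[OF sd(2)] od by simp
  then obtain n where n: "n:A" "n:el (K (suc d))" "n ~: el (K d)" "EX p:G. pr (suc d) (pr (pr emp n) y):el (ff p)" using row0_dense[OF sd(1,2) y(2) yR A_op(6)[OF d(1)]] by blast
  have "n:el l" unfolding l using n sd by blast
  then show "EX n:ex.el (j l). ex.pr n Y:ex.el S" using SP[of n y] n y d j_in[OF n(1) l(1)] by blast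
 next
  fix Y Y' n' assume h: "Y:ex.el (j (W c))" "Y':ex.el (j (W c))" "n':ex.el (j l)" "ex.pr n' Y:ex.el S" "ex.pr n' Y':ex.el S"
  obtain y y' n where y: "y:el (W c)" "y:A" "Y = j y" "y':el (W c)" "y':A" "Y' = j y'" "n:el l" "n:A" "n' = j n" using h el_j WA l(1) by auto
  obtain p d where p: "p:G" "d:el c" "n:el (K (suc d))" "n ~: el (K d)" "pr (suc d) (pr (pr emp n) y):el (ff p)" using SP[OF y(7,8,1,2)] h y by auto
  obtain p' d' where p': "p':G" "d':el c" "n:el (K (suc d'))" "n ~: el (K d')" "pr (suc d') (pr (pr emp n) y'):el (ff p')" using SP[OF y(7,8,4,5)] h y by auto
  have o: "Ord d" "Ord d'" using Ord_in[OF oc(1)] p p' by auto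
  have no: False if "u:el w" "Ord u" "Ord w" "n:el (K (suc u))" "n ~: el (K w)" for u w
  proof -
   have "el (suc u) <= el w" using that Ord_el_sub by auto
   then show False using K_sub[of "suc u" w] that by auto
  qed
  have "d = d'" using Ord_linear[OF o] no[of d d'] no[of d' d] o p p' by blast
  then have "y = y'" using row0_unique[OF p(1) p'(1) op_in(6) _ _ _ p(5)] p' y by auto
  then show "Y = Y'" using y by simp
 qed
qed

end

section \<open>Successor cardinals in the extension\<close>

context gx
begin

lemma converse_graph: assumes "f:CC" "Y:CC" shows "EX H:CC. ALL x:CC. ALL y:CC. ex.pr x y:ex.el H <-> y:ex.el Y & x = ex.app f y"
proof -
 have T: "ex.Tm CC (%v. ex.pr (ex.app f (v 0)) (v 0))" using assms by (intro ex.dfn_pr ex.dfn2 ex.Tm_var ex.Tm_constM)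
 define H where "H = ex.mk ((%y. ex.pr (ex.app f y) y) ` ex.el Y)"
 have H: "ex.el H = (%y. ex.pr (ex.app f y) y) ` ex.el Y" unfolding H_def using ex.isset_image[OF assms(2) T] by simp
 have "ex.pr x y:ex.el H <-> y:ex.el Y & x = ex.app f y" if "x:CC" "y:CC" for x y unfolding H using that by auto
 then show ?thesis unfolding H_def by blast
qed

text \<open>The converse of the injection is a partial function from \<open>X\<close> to
  \<open>K e\<close>, so \<open>covering_ext\<close> bounds its values.\<close>

lemma inj_bound: assumes f: "f:CC" "ex.inj f (j (K e)) Z" and c: "c:A" "e:A" "Ord e" "c:el e" and X: "X:A" "lep X (R c)"
 shows "EX b:el (K e) Int A. ALL y:el (K e) Int A. ex.app f (j y):ex.el (j X) --> y:el b"
proof -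
 have KA: "K e:A" using A_op(6) c by simp
 obtain H where H: "H:CC" "!!x y. x:CC ==> y:CC ==> ex.pr x y:ex.el H <-> y:ex.el (j (K e)) & x = ex.app f y" using converse_graph[OF f(1) j_CC[OF KA]] by auto
 have "EX b:el (K e) Int A. ALL x:el X Int A. ALL y:el (K e) Int A. ex.pr (j x) (j y):ex.el H --> y:el b"
 proof (rule covering_ext[OF c X H(1)])
  fix x y y' assume h: "x:el X" "x:A" "y:A" "y':A" "y:el (K e)" "y':el (K e)" "ex.pr (j x) (j y):ex.el H" "ex.pr (j x) (j y'):ex.el H"
  then have "j y:ex.el (j (K e))" "j y':ex.el (j (K e))" "ex.app f (j y) = ex.app f (j y')" using H(2)[of "j x" "j y"] H(2)[of "j x" "j y'"] by auto
  then have "j y = j y'" using f(2) unfolding ex.inj_def by blast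
  then show "y = y'" using j_inj h by blast
 qed
 then obtain b where b: "b:el (K e) Int A" "!!x y. x:el X ==> x:A ==> y:el (K e) ==> y:A ==> ex.pr (j x) (j y):ex.el H ==> y:el b" by blast
 have "y:el b" if y: "y:el (K e)" "y:A" "ex.app f (j y):ex.el (j X)" for y
 proof -
  obtain x where x: "x:el X" "x:A" "ex.app f (j y) = j x" using y(3) el_j[OF X(1)] by auto
  then have "ex.pr (j x) (j y):ex.el H" using H(2)[of "j x" "j y"] y j_in[OF y(2) KA] by simp
  then show ?thesis using b(2)[OF x(1,2) y(1,2)] by blast
 qed
 then show ?thesis using b(1) by blast
qed

lemma K_suc_regular: assumes c: "c:A" "Ord c" shows "~ ex.lep (j (K (suc c))) (j (K c))"
proof
 assume "ex.lep (j (K (suc c))) (j (K c))"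
 then obtain f where f: "f:CC" "ex.inj f (j (K (suc c))) (j (K c))" unfolding ex.lep_def by blast
 have A1: "suc c:A" "K (suc c):A" "K c:A" using A_op c by auto
 obtain b where b: "b:el (K (suc c))" "b:A" "!!y. y:el (K (suc c)) ==> y:A ==> ex.app f (j y):ex.el (j (K c)) ==> y:el b"
  using inj_bound[OF f c(1) A1(1) _ _ A1(3) lep_K_R[OF c(2)]] c by auto
 have "ex.app f (j b):ex.el (j (K c))" using f(2) j_in[OF b(2) A1(2)] b(1) unfolding ex.inj_def by blast
 then show False using b(3)[OF b(1,2)] mem_irrefl[of b] b by simp
qed

lemma har_eq: assumes k: "k:A" "X:A" "Ord k" and 1: "!!a. a:el k ==> a:A ==> ex.lep (j a) (j X)" and 2: "~ ex.lep (j k) (j X)"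
 shows "ex.har (j X) = j k"
proof (rule ex.ext)
 have "Z:ex.el (ex.har (j X)) <-> Z:ex.el (j k)" for Z
 proof
  assume "Z:ex.el (ex.har (j X))"
  then have Z: "ex.Ord Z" "ex.lep Z (j X)" using k by (auto simp: ex.el_har)
  then obtain a where a: "a:A" "Ord a" "Z = j a" using ex_Ord by blast
  have "a:el k"
  proof (rule ccontr)
   assume "a ~: el k"
   then have "ex.el (j k) <= ex.el (j a)" using Ord_not_in[OF k(3) a(2)] j_sub[OF k(1) a(1)] by blast
   then have "ex.lep (j k) (j a)" using k by (intro ex.lep_sub) auto
   then show False using ex.lep_trans[of "j k" "j a" "j X"] Z a k 2 by auto
  qed
  then show "Z:ex.el (j k)" using a j_in k by blast
 next
  assume "Z:ex.el (j k)"
  then obtain a where a: "a:el k" "a:A" "Z = j a" using el_j[OF k(1)] by auto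
  then show "Z:ex.el (ex.har (j X))" using 1 j_Ord[OF a(2) Ord_in[OF k(3)]] k by (simp add: ex.el_har)
 qed
 then show "ex.el (ex.har (j X)) = ex.el (j k)" by blast
qed (use k in auto)

lemma har_K: assumes c: "c:A" "Ord c" shows "ex.har (j (K c)) = j (K (suc c))"
proof (rule har_eq)
 show "K (suc c):A" "K c:A" using A_op c by auto
 show "Ord (K (suc c))" using c by simp
 show "~ ex.lep (j (K (suc c))) (j (K c))" using K_suc_regular[OF c] .
 fix a assume a: "a:el (K (suc c))" "a:A"
 have "lep a (R c)" using K_lep_W[OF Ord_suc[OF c(2)] a(1)] W_suc[OF c(2)] by simp
 then have "ex.lep (j a) (j (R c))" using j_lep[OF a(2) A_op(7)[OF c(1)]] by blast
 then show "ex.lep (j a) (j (K c))" using ex.lep_trans[OF j_CC[OF a(2)] _ R_lep_K[OF c]] by blast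
qed

text \<open>Under an injection into the supremum, the preimage of each \<open>K (ad t g)\<close> is
  bounded by \<open>inj_bound\<close>. The least bounds form a function on \<open>be\<close>; since
  \<open>be\<close> is at most \<open>t\<close>, it embeds in \<open>R t\<close>, and covering
  bounds this function too. Then all of \<open>K (ad t be)\<close> would lie below one of its
  elements.\<close>

lemma K_lim_regular: assumes t: "t:A" "Ord t" and b: "be:A" "Lim be" "el be <= el t" and l: "l:A" "el l = (UN d:el (ad t be). el (K d))"
 shows "~ ex.lep (j (K (ad t be))) (j l)"
proof
 define c where "c = ad t be"
 have ob: "Ord be" using b unfolding Lim_def by blast
 have c: "c:A" "Ord c" "t:el c" unfolding c_def using A_op t b Ord_ad[OF t(2) ob] ad_mem[of t be emp] Lim_emp[OF b(2)] by auto
 have KA: "K c:A" using A_op(6) c by simp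
 assume "ex.lep (j (K (ad t be))) (j l)"
 then obtain f where f: "f:CC" "ex.inj f (j (K c)) (j l)" unfolding ex.lep_def c_def by blast
 have T: "Tm A (%v. K (ad t (v 0)))" by (intro dfn t)
 \<comment> \<open>The sequence of the \<open>K (ad t g)\<close> as a set of the ground model, so
   that the extension can define the least bounds from it.\<close>
 define kk where "kk = lam be (%g. K (ad t g))"
 have kk: "ex.app (j kk) (j g) = j (K (ad t g))" if "g:el be" "g:A" for g unfolding kk_def using j_lam(1)[OF b(1) T that] .
 have kA: "j kk:CC" unfolding kk_def using j_lam(2)[OF b(1) T Lim_emp[OF b(2)] A_op(1)] by simp
 define Bd where "Bd g u <-> (ALL y:ex.el (j (K c)). ex.app f y:ex.el (ex.app (j kk) g) --> y:ex.el u)" for g u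
 have Bdd: "ex.Tm CC s ==> ex.Tm CC r ==> ex.D CC (%v. Bd (s v) (r v))" for s r
  by (rule ex.D2[where Q = Bd]; (assumption | (unfold Bd_def, intro ex.D_ball ex.D_imp ex.D_el ex.dfn2 ex.Tm_var ex.Tm_constM; simp add: KA kA f)))
 define L where "L g u <-> Bd g u & (ALL w:ex.el u. ~ Bd g w)" for g u
 have Ld: "ex.Tm CC s ==> ex.Tm CC r ==> ex.D CC (%v. L (s v) (r v))" for s r
  by (rule ex.D2[where Q = L]; (assumption | (unfold L_def, intro ex.D_ball ex.D_and ex.D_not Bdd ex.Tm_var)))
 define H where "H = ex.mk {z:CC. z:ex.el (ex.pd (j be) (j (K c))) & L (ex.ft z) (ex.sn z)}"
 have H: "ex.el H = {z:CC. z:ex.el (ex.pd (j be) (j (K c))) & L (ex.ft z) (ex.sn z)}" unfolding H_def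
  by (intro ex.el_mk ex.isset_sep Ld ex.dfn2 ex.Tm_var ex.op_in2)
 have HC: "H:CC" unfolding H_def by simp
 have Hp: "ex.pr g u:ex.el H <-> g:ex.el (j be) & u:ex.el (j (K c)) & L g u" if "g:CC" "u:CC" for g u unfolding H using that b KA by auto
 have oK: "ex.Ord (j (K c))" using j_Ord[OF KA] c by simp
 have lt: "lep be (R t)"
 proof -
  have "el be <= el (K t)" using b(3) le_K[OF t(2)] by blast
  then show ?thesis using lep_trans[OF _ lep_sub lep_K_R[OF t(2)]] b(1) by simp
 qed
 have "EX u:el (K c) Int A. ALL g:el be Int A. ALL w:el (K c) Int A. ex.pr (j g) (j w):ex.el H --> w:el u"
 proof (rule covering_ext[OF t(1) c b(1) lt HC])
  fix g w w' assume h: "g:A" "w:A" "w':A" "ex.pr (j g) (j w):ex.el H" "ex.pr (j g) (j w'):ex.el H"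
  then have "L (j g) (j w)" "L (j g) (j w')" "j w:ex.el (j (K c))" "j w':ex.el (j (K c))" using Hp[of "j g" "j w"] Hp[of "j g" "j w'"] by auto
  then have "j w = j w'" using ex.Ord_linear[OF ex.Ord_in[OF oK] ex.Ord_in[OF oK], of "j w" "j w'"] unfolding L_def by blast
  then show "w = w'" using j_inj h by blast
 qed
 then obtain u where u: "u:el (K c)" "u:A" "!!g w. g:el be ==> g:A ==> w:el (K c) ==> w:A ==> ex.pr (j g) (j w):ex.el H ==> w:el u" by blast
 have "y:el u" if y: "y:el (K c)" "y:A" for y
 proof -
  have "ex.app f (j y):ex.el (j l)" using f(2) j_in[OF y(2) KA] y unfolding ex.inj_def by blast
  then obtain x where x: "x:el l" "x:A" "ex.app f (j y) = j x" using el_j[OF l(1)] by auto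
  then obtain d where d: "d:el c" "x:el (K d)" unfolding l c_def by blast
  then obtain g0 where g0: "g0:el be" "d:el (ad t g0)" unfolding c_def ad_Lim[OF t(2) b(2)] by blast
  have og0: "Ord (ad t g0)" using Ord_ad[OF t(2) Ord_in[OF ob g0(1)]] .
  have "x:el (K (ad t g0))" using K_sub[OF Ord_in[OF og0 g0(2)] og0 Ord_el_sub[OF og0 g0(2)]] d by blast
  then have "EX g:M. g:el be & x:el (K (ad t g))" using g0(1) by (meson elM)
  then have "EX g:A. g:el be & x:el (K (ad t g))" by (rule skol[rotated]) (intro dfn b x t)
  then obtain g where g: "g:A" "g:el be" "x:el (K (ad t g))" by blast
  have ag: "ad t g:A" "ad t g:el c" "Ord (ad t g)" "K (ad t g):A" unfolding c_def using A_op t g b ad_mem[of t be g] Ord_ad[OF t(2) Ord_in[OF ob g(2)]] by auto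
  obtain w0 where w0: "w0:el (K c)" "w0:A" "!!y. y:el (K c) ==> y:A ==> ex.app f (j y):ex.el (j (K (ad t g))) ==> y:el w0"
   using inj_bound[OF f ag(1) c(1,2) ag(2,4) lep_K_R[OF ag(3)]] by blast
  have w0K: "j w0:ex.el (j (K c))" using j_in[OF w0(2) KA] w0 by blast
  have "Bd (j g) (j w0)" unfolding Bd_def kk[OF g(2,1)] el_j[OF KA] using w0 j_in by auto
  moreover have "ex.D CC (%v. Bd (j g) (v 0))" using g by (intro Bdd ex.Tm_var ex.Tm_constM) auto
  ultimately obtain m where m: "ex.Ord m" "Bd (j g) m" "!!w. w:ex.el m ==> ~ Bd (j g) w" "m = j w0 | m:ex.el (j w0)"
   using ex.Ord_min[of "%u. Bd (j g) u" "j w0"] ex.Ord_in[OF oK w0K] by blast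
  have mK: "m:ex.el (j (K c))" using m(4) w0K ex.Ord_trans[OF oK w0K] by blast
  then obtain w where w: "w:el (K c)" "w:A" "m = j w" using el_j[OF KA] by auto
  have "j g:ex.el (j be)" using j_in g b by blast
  then have "ex.pr (j g) (j w):ex.el H" using Hp[of "j g" "j w"] g w m mK unfolding L_def by auto
  then have wu: "w:el u" using u(3)[OF g(2,1) w(1,2)] by blast
  have "j y:ex.el (j w)" using m(2) w(3) x j_in[OF x(2) ag(4)] g(3) j_in[OF y(2) KA] y(1) unfolding Bd_def kk[OF g(2,1)] by auto
  then have "y:el w" using j_in y w by blast
  then show ?thesis using Ord_trans[OF Ord_in[OF _ u(1)] wu] c by simp
 qed
 then show False using u mem_irrefl[of u] by auto
qed

lemma har_lim: assumes t: "t:A" "Ord t" and b: "be:A" "Lim be" "el be <= el t" and l: "l:A" "el l = (UN d:el (ad t be). el (K d))"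
 shows "ex.har (j l) = j (K (ad t be))"
proof (rule har_eq)
 have c: "ad t be:A" "Lim (ad t be)" "Ord (ad t be)" using A_op t b Lim_ad[OF t(2) b(2)] unfolding Lim_def by auto
 show "K (ad t be):A" "l:A" using A_op c l by auto
 show "Ord (K (ad t be))" by simp
 show "~ ex.lep (j (K (ad t be))) (j l)" using K_lim_regular[OF t b l] .
 fix a assume a: "a:el (K (ad t be))" "a:A"
 have "ex.lep (j a) (j (W (ad t be)))" using j_lep[OF a(2) A_op(8)[OF c(1)] K_lep_W[OF c(3) a(1)]] .
 then show "ex.lep (j a) (j l)" using ex.lep_trans[OF j_CC[OF a(2)] _ W_lep_sup[OF c(1,2) l]] by blast
qed

text \<open>Each subset of \<open>K c\<close> is decoded from a code in \<open>R (suc c)\<close> as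
  in \<open>code_sub\<close>, by one decoding function for all subsets; the collapse at stage
  \<open>suc c\<close> then replaces \<open>R (suc c)\<close> by \<open>K (suc c)\<close>.\<close>

lemma off_power: assumes c: "c:A" "Ord c" and "off c" shows "ex.lep (ex.pw (j (K c))) (j (K (suc c)))"
proof -
 define Z0 where "Z0 p <-> c:el (ll p) & pr c (rs (ff p) c):el (bb p)" for p
 have Od: "D A (%v. Z0 (v 0))" unfolding Z0_def by (intro dfn c)
 obtain p' where p': "p':G" "Z0 p'" using assms(3) unfolding off_def Z0_def by blast
 have Om: "Z0 q" if "lq q p" "Z0 p" for p q using off_mono[OF that(1)] lqD(3)[OF that(1)] that(2) unfolding Z0_def by blast
 have "EX q:G Int A. Z0 q"
 proof (rule gen[OF Od p'(1)])
  show "EX q:M. lq q s & Z0 q" if "lq s p'" for s using Om[OF that p'(2)] lq_refl[OF lqD(1)[OF that]] lqD(1)[OF that] Cn_M by blast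
 qed
 then obtain p where p: "p:G" "p:A" "Z0 p" by blast
 define b where "b = rs (bb p) (suc c)"
 have bA: "b:A" unfolding b_def by (rule A_in) (intro dfn p c)
 have A1: "suc c:A" "K c:A" "K (suc c):A" "R (suc c):A" "V (K (suc c)):A" using A_op c by auto
 have Pd: "D A (%v. lq (v 0) (cn (suc c) b (v 1)))" by (intro dfn c bA)
 have "EX S:CC. ALL z:A. j z:ex.el S <-> z:el (V (K (suc c))) & (EX p:G. lq p (cn (suc c) b z))" by (rule gsub[OF A1(5) Pd]; (use lq_trans in blast))
 then obtain S where S: "S:CC" "!!z. z:A ==> j z:ex.el S <-> z:el (V (K (suc c))) & (EX p:G. lq p (cn (suc c) b z))" by blast
 \<comment> \<open>The decoding: a point is accepted if the code pairs it with a lower condition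
   that \<open>S\<close> records as satisfied by \<open>G\<close>.\<close>
 define g where "g = (%Y. ex.mk {x:CC. x:ex.el (j (K c)) & (EX f:ex.el (j (V (K (suc c)))). f:ex.el S & ex.pr x f:ex.el Y)})"
 have gd: "ex.Tm CC (%v. g (v 0))" unfolding g_def by (intro ex.Tm_mk ex.D_and ex.D_bex ex.D_el ex.dfn_pr ex.Tm_var ex.Tm_constM; simp add: A1 S)
 have g: "ex.el (g Y) = {x:CC. x:ex.el (j (K c)) & (EX f:ex.el (j (V (K (suc c)))). f:ex.el S & ex.pr x f:ex.el Y)}" if "Y:CC" for Y
  unfolding g_def by (intro ex.el_mk ex.isset_sep ex.D_and ex.D_bex ex.D_el ex.dfn_pr ex.Tm_var ex.Tm_constM; simp add: A1 S that)
 have "ex.lep (ex.pw (j (K c))) (j (R (suc c)))"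
 proof (rule ex.lep_surj[OF ex.op_in(5) j_CC[OF A1(4)] gd])
  fix Z assume "Z:ex.el (ex.pw (j (K c)))"
  then have Z: "Z:CC" "ex.el Z <= ex.el (j (K c))" using A1 by auto
  then obtain s where s: "s:N" "Z = cl s" using CC_E by metis
  have sA: "s:A" "Nm s" using s by auto
  have inZ: "j x:ex.el Z <-> (EX p:G. Fm p (chk x) s)" if "x:A" for x
  proof -
   have "j x:ex.el Z <-> EE (cl (chk x)) (cl s)" unfolding ex.el_def j_def s using cl_CC[OF chk_N[OF that]] by blast
   then show ?thesis using EE_iff[OF chk_N[OF that] s(1)] by simp
  qed
  define C where "C q B <-> B:el (R (suc c)) &
   (ALL x:el (K c). ALL f:M. pr x f:el B --> (ALL w:M. lq w q & lq w (cn (suc c) b f) --> Fm w (chk x) s)) &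
   (ALL x:el (K c). ALL w:M. lq w q & Fm w (chk x) s --> (EX w':M. lq w' w & (EX f:M. f:el (V (K (suc c))) & pr x f:el B & lq w' (cn (suc c) b f))))" for q B
  have "EX q:G Int A. EX B:A. C q B"
  proof (rule gen2[OF _ p(1)])
   show "D A (%v. C (v 0) (v 1))" unfolding C_def by (intro dfn c bA sA)
   fix r assume r: "lq r p"
   have "Z0 r" using Om[OF r p(3)] .
   moreover have "rs (bb r) (suc c) = b"
   proof -
    have "el (suc c) <= el (ll p)" using p(3) Ord_el_sub[OF CnD(1)[OF GC[OF p(1)]]] c unfolding Z0_def by auto
    then show ?thesis unfolding b_def lqD(4)[OF r, symmetric] using rs_rs[of "bb r" "ll p" "suc c"] by simp
   qed
   ultimately show "EX q:M. lq q r & (EX B:M. C q B)" using code_sub[OF c(2) lqD(1)[OF r] _ _ sA(2)] unfolding Z0_def C_def by blast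
  qed
  then obtain q B where q: "q:G" "B:A" "B:el (R (suc c))"
   and B1: "!!x f w. x:el (K c) ==> f:M ==> pr x f:el B ==> w:M ==> lq w q ==> lq w (cn (suc c) b f) ==> Fm w (chk x) s"
   and B2: "!!x w. x:el (K c) ==> w:M ==> lq w q ==> Fm w (chk x) s ==> EX w':M. lq w' w & (EX f:M. f:el (V (K (suc c))) & pr x f:el B & lq w' (cn (suc c) b f))" unfolding C_def by blast
  have "j x:ex.el (g (j B)) <-> j x:ex.el Z" if x: "x:el (K c)" "x:A" for x
  proof
   assume "j x:ex.el (g (j B))"
   then obtain F' where "F':ex.el (j (V (K (suc c))))" "F':ex.el S" "ex.pr (j x) F':ex.el (j B)" unfolding g[OF j_CC[OF q(2)]] by blast
   then obtain f where f: "f:A" "j f:ex.el S" "ex.pr (j x) (j f):ex.el (j B)" using el_j[OF A1(5)] by auto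
   then obtain r where r: "r:G" "lq r (cn (suc c) b f)" using S(2) by blast
   have xf: "pr x f:el B" using f(3) j_pr[OF x(2) f(1)] j_in[OF A_op(4)[OF x(2) f(1)] q(2)] by simp
   obtain w where w: "w:G" "lq w r" "lq w q" using Gdir[OF r(1) q(1)] by blast
   have "Fm w (chk x) s" using B1[OF x(1) A_M[OF f(1)] xf _ w(3) lq_trans[OF w(2) r(2)]] GC[OF w(1)] by simp
   then show "j x:ex.el Z" using inZ[OF x(2)] w by blast
  next
   assume "j x:ex.el Z"
   then obtain r where r: "r:G" "Fm r (chk x) s" using inZ[OF x(2)] by blast
   obtain w where w: "w:G" "lq w r" "lq w q" using Gdir[OF r(1) q(1)] by blast
   have "EX w':G Int A. EX f:A. f:el (V (K (suc c))) & pr x f:el B & lq w' (cn (suc c) b f)"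
   proof (rule gen2[OF _ w(1)])
    show "D A (%v. v 1:el (V (K (suc c))) & pr x (v 1):el B & lq (v 0) (cn (suc c) b (v 1)))" by (intro dfn c bA x q)
    fix u assume u: "lq u w"
    show "EX w':M. lq w' u & (EX f:M. f:el (V (K (suc c))) & pr x f:el B & lq w' (cn (suc c) b f))"
     using B2[OF x(1) _ lq_trans[OF u w(3)] Fm_mono[OF r(2) lq_trans[OF u w(2)]]] lqD(1)[OF u] by simp
   qed
   then obtain w' f where f: "w':G" "f:A" "f:el (V (K (suc c)))" "pr x f:el B" "lq w' (cn (suc c) b f)" by blast
   have "j f:ex.el S" "j f:ex.el (j (V (K (suc c))))" "ex.pr (j x) (j f):ex.el (j B)"
    using S(2)[OF f(2)] f j_in[OF f(2) A1(5)] j_pr[OF x(2) f(2)] j_in[OF A_op(4)[OF x(2) f(2)] q(2)] by auto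
   then show "j x:ex.el (g (j B))" unfolding g[OF j_CC[OF q(2)]] using j_in[OF x(2) A1(2)] x j_CC[OF x(2)] by blast
  qed
  moreover have "ex.el (g (j B)) <= ex.el (j (K c))" unfolding g[OF j_CC[OF q(2)]] by blast
  ultimately have "ex.el (g (j B)) = ex.el Z" using Z(2) unfolding el_j[OF A1(2)] by (intro subset_antisym subsetI) auto
  then have "g (j B) = Z" using ex.ext[OF _ Z(1)] unfolding g_def by blast
  then show "EX Y:ex.el (j (R (suc c))). g Y = Z" using j_in[OF q(2) A1(4)] q(3) by blast
 qed
 then show ?thesis using ex.lep_trans[OF ex.op_in(5) _ R_lep_K[OF A1(1)]] c by simp
qed

lemma on_power: assumes c: "c:A" "Ord c" and on: "~ off c" shows "ex.lep (j (K (suc (suc c)))) (ex.pw (j (K c)))"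
proof -
 have cM: "c:M" using c by simp
 have A1: "K (suc (suc c)):A" "K c:A" "pd (K (suc (suc c))) (K c):A" using A_op c by auto
 \<comment> \<open>An entry outside row 0 can be lost when a condition is strengthened, so
   \<open>P\<close> only asks for it in some weaker \<open>q\<close>. For members of
   \<open>G\<close> this changes nothing, as \<open>G\<close> is upward closed.\<close>
 define P where "P p z <-> (EX q:M. lq p q & pr c (pr z emp):el (ff q))" for p z
 have Pd: "D A (%v. P (v 0) (v 1))" unfolding P_def by (intro dfn c)
 have Pm: "P t z" if "P s z" "lq t s" for s t z using that lq_trans unfolding P_def by blast
 have PG: "(EX p:G. P p z) <-> (EX p:G. pr c (pr z emp):el (ff p))" for z unfolding P_def using Gup GC lq_refl Cn_M by meson
 have "EX S:CC. ALL z:A. j z:ex.el S <-> z:el (pd (K (suc (suc c))) (K c)) & (EX p:G. P p z)" by (rule gsub[OF A1(3) Pd]; (rule Pm; assumption))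
 then obtain S where S: "S:CC" "!!z. z:A ==> j z:ex.el S <-> z:el (pd (K (suc (suc c))) (K c)) & (EX p:G. pr c (pr z emp):el (ff p))" unfolding PG by blast
 \<comment> \<open>A row is read as the set of columns where its value is \<open>emp\<close>. Two
   rows are told apart by a column with values \<open>emp\<close> and
   \<open>suc emp\<close>.\<close>
 define g where "g = (%X. ex.mk {n:CC. n:ex.el (j (K c)) & ex.pr X n:ex.el S})"
 have gd: "ex.Tm CC (%v. g (v 0))" unfolding g_def by (intro ex.Tm_mk ex.D_and ex.D_el ex.dfn_pr ex.Tm_var ex.Tm_constM; simp add: A1 S)
 have g: "ex.el (g X) = {n:CC. n:ex.el (j (K c)) & ex.pr X n:ex.el S}" if "X:CC" for X
  unfolding g_def by (intro ex.el_mk ex.isset_sep ex.D_el ex.dfn_pr ex.Tm_var ex.Tm_constM; simp add: A1 S that)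
 have gj: "j n:ex.el (g (j x)) <-> (EX p:G. pr c (pr (pr x n) emp):el (ff p))" if h: "x:el (K (suc (suc c)))" "x:A" "n:el (K c)" "n:A" for x n
  unfolding g[OF j_CC[OF h(2)]] using h j_in[OF h(4) A1(2)] S(2)[OF A_op(4)[OF h(2,4)]] j_pr[OF h(2,4)] pd_mem[OF h(1,3) KWR_in(1) KWR_in(1)] by auto
 have eR: "emp:el (R c)" "suc emp:el (R c)"
 proof -
  have "emp:el (V (K c))" using rk_Ord[OF Ord_emp] Lim_emp[OF Lim_K[OF c(2)]] cM by (simp add: el_V)
  then show "emp:el (R c)" "suc emp:el (R c)" unfolding R_def by auto
 qed
 show ?thesis
 proof (rule ex.lepI[OF j_CC[OF A1(1)] gd])
  show "g X:ex.el (ex.pw (j (K c)))" if "X:ex.el (j (K (suc (suc c))))" for X using g[of X] that A1 unfolding g_def by auto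
  fix X X' assume X: "X:ex.el (j (K (suc (suc c))))" "X':ex.el (j (K (suc (suc c))))" "g X = g X'"
  obtain x x' where x: "x:el (K (suc (suc c)))" "x:A" "X = j x" "x':el (K (suc (suc c)))" "x':A" "X' = j x'" using X el_j[OF A1(1)] by auto
  show "X = X'"
  proof (rule ccontr)
   assume "X ~= X'"
   then have ne: "x ~= x'" using x by blast
   obtain p where p: "p:G" using Gne by blast
   have "EX q:G Int A. EX n:A. n:el (K c) & pr c (pr (pr x n) emp):el (ff q) & pr c (pr (pr x' n) (suc emp)):el (ff q)"
   proof (rule gen2[OF _ p])
    show "D A (%v. v 1:el (K c) & pr c (pr (pr x (v 1)) emp):el (ff (v 0)) & pr c (pr (pr x' (v 1)) (suc emp)):el (ff (v 0)))" by (intro dfn c x)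
    fix s assume s: "lq s p"
    obtain q where q: "lq q s" "Cn q" "c:el (ll q)" using long[OF lqD(1)[OF s] c(2)] by blast
    obtain n where n: "n:el (K c)" "ALL e:el (ff q). ft e = c --> sn (ft (sn e)) ~= n" using fresh[OF CnD(3)[OF q(2)] CnD(1)[OF q(2)] q(3) Lim_emp[OF Lim_K[OF c(2)]]] by blast
    have m: "n:M" "x:M" "x':M" using n x by auto
    have fr: "ft (sn e) ~= pr y n" if "e:el (ff q)" "ft e = c" "y:M" for e y using n(2) that m by auto
    obtain r where r: "r:M" "lq r q" "ll r = ll q" "el (ff r) = insert (pr c (pr (pr x n) emp)) (el (ff q))" using add_entry[OF q(2,3) x(1) n(1) eR(1)] fr m by blast
    have "ft (sn e) ~= pr x' n" if e: "e:el (ff r)" "ft e = c" for e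
     using e r(4) fr[of e x'] m ne cM by (metis ft_pr insert_iff op_in(1,7) sn_pr)
    then obtain u where u: "u:M" "lq u r" "el (ff u) = insert (pr c (pr (pr x' n) (suc emp))) (el (ff r))" using add_entry[OF lqD(1)[OF r(2)] _ x(4) n(1) eR(2)] q(3) r(3) by auto
    have "pr c (pr (pr x n) emp):el (ff u)" "pr c (pr (pr x' n) (suc emp)):el (ff u)" "lq u s" using u r lq_trans[OF lq_trans[OF u(2) r(2)] q(1)] by auto
    then show "EX q:M. lq q s & (EX n:M. n:el (K c) & pr c (pr (pr x n) emp):el (ff q) & pr c (pr (pr x' n) (suc emp)):el (ff q))" using u(1) n(1) m(1) by blast
   qed
   then obtain q n where q: "q:G" "n:A" "n:el (K c)" "pr c (pr (pr x n) emp):el (ff q)" "pr c (pr (pr x' n) (suc emp)):el (ff q)" by blast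
   then have "j n:ex.el (g X)" using gj[OF x(1,2) q(3,2)] x(3) by blast
   then obtain r where r: "r:G" "pr c (pr (pr x' n) emp):el (ff r)" using gj[OF x(4,5) q(3,2)] x(6) X(3) by auto
   have m: "n:M" "x':M" using q x by auto
   have "pr c (pr (pr x' n) emp) = pr c (pr (pr x' n) (suc emp))" using on cM m by (intro entry_unique[OF r(1) q(1) r(2) q(5)]) (auto simp: key_def)
   then have "emp = suc emp" using cM m by simp
   then show False using suc_emp by simp
  qed
 qed
qed

text \<open>\<open>sub_PN\<close> replaces the name of \<open>a\<close> by one in
  \<open>PN (chk al)\<close>. The conditions in such a name have bounded length, which is what
  allows \<open>coding\<close> to work beyond all of them.\<close>

lemma coding_ext: assumes al: "al:A" "Ord al" and a: "a:CC" "ex.el a <= ex.el (j al)"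
 shows "EX th:A. Ord th & el al <= el th & (ALL be:el al Int A. off (ad (suc th) be) <-> j be:ex.el a)"
proof -
 have aM: "al:M" using al by simp
 obtain z where z: "z:N" "a = cl z" using a CC_E by metis
 have "EE (cl t) (cl (chk al))" if "t:N" "EE (cl t) (cl z)" for t using a(2) that unfolding z ex.el_def j_def by (simp add: Collect_mono_iff)
 then obtain y where y: "y:N" "y:el (PN (chk al))" "cl y = a" using sub_PN[OF chk_N[OF al(1)] z(1)] z by blast
 have yA: "y:A" "Nm y" using y by auto
 define l0 where "l0 = suc (rk (chk al))"
 have l0: "l0:A" "Ord l0"
 proof -
  show "l0:A" unfolding l0_def by (rule A_in) (intro dfn al)
  show "Ord l0" unfolding l0_def by simp
 qed
 have ysub: "el y <= el (pd (dm (chk al)) (Pl l0))" using y(2) unfolding el_PN[OF chk_in] l0_def by blast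
 have ent: "el (ll r) <= el l0" "t:el (dm (chk al))" if "t:M" "r:M" "pr t r:el y" for t r
 proof -
  have "pr t r:el (pd (dm (chk al)) (Pl l0))" using ysub that by blast
  then have "t:el (dm (chk al)) & r:el (Pl l0)" using that by (auto simp del: el_Pl)
  then show "el (ll r) <= el l0" "t:el (dm (chk al))" using l0 by auto
 qed
 have ina: "j be:ex.el a <-> (EX r:G. pr (chk be) r:el y)" if b: "be:A" for be
 proof
  assume "j be:ex.el a"
  then have "EE (cl (chk be)) (cl y)" unfolding y(3) ex.el_def j_def by simp
  then obtain t r where t: "t:N" "r:G" "pr t r:el y" "cl t = cl (chk be)" using EE_D[OF y(1) chk_N[OF b]] by blast
  have "t:el (dm (chk al))" using ent(2)[OF _ _ t(3)] N_D(2)[OF t(1)] GC[OF t(2)] by simp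
  then obtain g where g: "g:M" "t = chk g" using dm_Nm[OF Nm_chk[OF aM]] chk_entry[OF aM] by (metis elM)
  obtain p where "F p (chk g) (chk be)" using cl_eq[OF t(1) chk_N[OF b]] t g by blast
  then have "g = be" using chk_F g b by simp
  then show "EX r:G. pr (chk be) r:el y" using t g by blast
 next
  assume "EX r:G. pr (chk be) r:el y"
  then have "EE (j be) a" using EE_entry[OF y(1) chk_N[OF b]] y(3) unfolding j_def by blast
  then show "j be:ex.el a" unfolding ex.el_def using b by simp
 qed
 obtain p where p: "p:G" using Gne by blast
 define C where "C q th <-> Ord th & el al <= el th & el l0 <= el th & ll q = ad (suc th) al &
  (ALL be:el al. ALL g:M. pr (ad (suc th) be) g:el (bb q) <-> PC (ad (suc th) be) g &
   (EX r:M. pr (chk be) r:el y & rs (bb q) (ll r) = bb r & le (bb q) g (ff r)))" for q th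
 have "EX q:G Int A. EX th:A. C q th"
 proof (rule gen2[OF _ p])
  show "D A (%v. C (v 0) (v 1))" unfolding C_def by (intro dfn al l0 yA)
  show "EX q:M. lq q s & (EX th:M. C q th)" if "lq s p" for s
   unfolding C_def by (rule coding[OF yA(2) l0(2) _ al(2) lqD(1)[OF that]]) (rule ent(1))
 qed
 then obtain q th where q: "q:G" "th:A" "Ord th" "el al <= el th" "el l0 <= el th" "ll q = ad (suc th) al"
  and cd: "!!be g. be:el al ==> g:M ==> pr (ad (suc th) be) g:el (bb q) <-> PC (ad (suc th) be) g &
   (EX r:M. pr (chk be) r:el y & rs (bb q) (ll r) = bb r & le (bb q) g (ff r))" unfolding C_def by blast
 have "off (ad (suc th) be) <-> j be:ex.el a" if b: "be:el al" "be:A" for be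
 proof -
  define c where "c = ad (suc th) be"
  have c: "Ord c" "c:M" "c:el (ll q)" "el th <= el c" unfolding c_def q(6)
   using Ord_ad[OF Ord_suc[OF q(3)] Ord_in[OF al(2) b(1)]] ad_mem[OF _ aM b(1)] ad_ge[of "suc th" be] q(3) b by auto
  \<comment> \<open>For members of \<open>G\<close> below \<open>q\<close>, being below
    \<open>r\<close> depends only on entries below stage \<open>c\<close>, and this is exactly what
    the switch at \<open>c\<close> tests.\<close>
  have key: "lq w r <-> rs (bb q) (ll r) = bb r & le (bb q) (rs (ff w) c) (ff r)" if w: "w:G" "lq w q" and r: "r:M" "pr (chk be) r:el y" for w r
  proof -
   note wq = lqD[OF w(2)]
   have r': "Cn r" "el (ll r) <= el th" using Nm_entry[OF yA(2) r(2)] ent(1)[OF _ r] r(1) q(5) by auto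
   have rq: "el (ll r) <= el (ll q)" using r'(2) c(3,4) Ord_el_sub[OF CnD(1)[OF wq(2)]] by blast
   have 1: "rs (bb w) (ll r) = rs (bb q) (ll r)" using rs_rs[of "bb w" "ll q" "ll r"] rq wq(4) by simp
   have fr: "ft e:el c" "ft e:el (ll q)" if "e:el (ff r)" for e using PC_ft[OF CnD(3)[OF r'(1)] that] r'(2) c(4) rq by blast+
   have 2: "le (bb q) (rs (ff w) c) (ff r) <-> le (bb w) (ff w) (ff r)"
    using le_rs_g[of "ff r" c "ff w" "bb q"] le_rs_b[of "ff r" "ll q" "bb w" "ff w"] fr c(1) wq(4) by simp
   show ?thesis unfolding lq_def 1 2 using wq(1,3) r'(1) rq by auto
  qed
  show ?thesis unfolding c_def[symmetric]
  proof
   assume "off c"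
   then obtain p' where p': "p':G" "c:el (ll p')" "pr c (rs (ff p') c):el (bb p')" unfolding off_def by blast
   obtain w where w: "w:G" "lq w p'" "lq w q" using Gdir[OF p'(1) q(1)] by blast
   have "pr c (rs (ff w) c):el (bb w)" using off_mono[OF w(2) p'(2,3)] .
   then have "pr c (rs (ff w) c):el (bb q)" unfolding lqD(4)[OF w(3), symmetric] using c by simp
   then obtain r where r: "r:M" "pr (chk be) r:el y" "rs (bb q) (ll r) = bb r" "le (bb q) (rs (ff w) c) (ff r)" using cd[OF b(1) rs_in] unfolding c_def by blast
   then have "lq w r" using key[OF w(1,3) r(1,2)] by blast
   then show "j be:ex.el a" using ina[OF b(2)] Gup[OF w(1)] r(2) by blast
  next
   assume "j be:ex.el a"
   then obtain r where r: "r:G" "pr (chk be) r:el y" using ina[OF b(2)] by blast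
   obtain w where w: "w:G" "lq w r" "lq w q" using Gdir[OF r(1) q(1)] by blast
   have rM: "r:M" using GC r by simp
   have cw: "c:el (ll w)" using lqD(3)[OF w(3)] c by blast
   have "PC c (rs (ff w) c)" using PC_rs[OF CnD(3,1)[OF GC[OF w(1)]] c(1) Ord_el_sub[OF CnD(1)[OF GC[OF w(1)]] cw]] .
   then have "pr c (rs (ff w) c):el (bb q)" using cd[OF b(1) rs_in] key[OF w(1,3) rM r(2)] w(2) rM r(2) unfolding c_def by blast
   then have "pr c (rs (ff w) c):el (bb w)" unfolding lqD(4)[OF w(3), symmetric] by simp
   then show "off c" unfolding off_def using w cw by blast
  qed
 qed
 then show ?thesis using q by blast
qed

lemma j_emp: "j emp = ex.emp"
 using A_op(1) by (intro ex.ext) (auto simp: el_j)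
lemma Lim_j: assumes b: "be:A" "Ord be" "ex.Lim (j be)" shows "Lim be"
proof (rule Ord_cases[OF b(2)])
 assume "be = emp" then show ?thesis using b(3) j_emp unfolding ex.Lim_def by simp
next
 fix y assume y: "Ord y" "y:el be" "be = suc y"
 have "EX y:M. Ord y & be = suc y" using y OrdM by blast
 then have "EX y:A. Ord y & be = suc y" by (rule skol[rotated]) (intro dfn b)
 then obtain s where s: "s:A" "Ord s" "be = suc s" by blast
 have "j s:ex.el (j be)" using j_in[OF s(1) b(1)] s by simp
 then have "j be:ex.el (j be)" using b(3) j_suc[OF s(1)] s(3) unfolding ex.Lim_def by auto
 then show ?thesis using ex.mem_irrefl j_CC[OF b(1)] by blast
qed

theorem CCA_ext: assumes "v:UNIV \<rightarrow> CC" shows "sat CC EE CCA v"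
proof (rule ex.CCA_I[OF _ assms])
 fix al' a assume al': "ex.Ord al'" and a: "a:CC" "ex.el a <= ex.el al'"
 obtain al where al: "al:A" "Ord al" "al' = j al" using ex_Ord[OF al'] by blast
 obtain th where th: "th:A" "Ord th" "el al <= el th" and cd: "!!be. be:el al ==> be:A ==> off (ad (suc th) be) <-> j be:ex.el a"
  using coding_ext[OF al(1,2) a(1)] a(2) al(3) by blast
 \<comment> \<open>With a successor \<open>t\<close> the sequence starts at \<open>K t\<close>, the
   cardinal after \<open>K th\<close>, so \<open>AL_seq\<close> applies with \<open>K th\<close> as
   its starting set. As \<open>th\<close> is at least \<open>al\<close>, limits below
   \<open>al\<close> satisfy the bound in \<open>har_lim\<close>.\<close>
 define t where "t = suc th"
 have t: "t:A" "Ord t" "t:M" unfolding t_def using A_op th by auto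
 have T: "Tm A (%v. K (ad t (v 0)))" by (intro dfn t)
 define k where "k = j (lam al (%b. K (ad t b)))"
 have k: "ex.app k (j b) = j (K (ad t b))" if "b:el al" "b:A" for b unfolding k_def using j_lam(1)[OF al(1) T that] .
 have "lam al (%b. K (ad t b)):A" by (rule A_in) (intro dfn al t)
 then have kC: "k:CC" unfolding k_def by simp
 have ab: "ad t b:A" "Ord (ad t b)" if "b:el al" "b:A" for b using A_op(9)[OF t(1) that(2)] Ord_ad[OF t(2) Ord_in[OF al(2) that(1)]] by auto
 have KA: "K th:A" using A_op(6) th by simp
 have "EX u. ex.Ord u & (ALL be:ex.el (j al). ex.AL (ex.suc (ex.ad u be)) = ex.app k be)"
 proof (rule ex.AL_seq[OF j_Ord[OF al(1,2)] kC])
  show "ex.Ord (j (K th))" using j_Ord[OF KA] th by simp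
  show "ex.el ex.om <= ex.el (j (K th))" using ex.om_least[OF j_Lim[OF KA Lim_K[OF th(2)]]] .
  show "ex.app k ex.emp = ex.har (j (K th))" if "ex.emp:ex.el (j al)"
  proof -
   have "emp:el al" using that j_in[OF A_op(1) al(1)] j_emp by simp
   then have "ex.app k ex.emp = j (K (ad t emp))" using k[OF _ A_op(1)] j_emp by simp
   then show ?thesis using har_K[OF th(1,2)] t unfolding t_def by simp
  qed
  show "ex.app k (ex.suc be') = ex.har (ex.app k be')" if h: "be':ex.el (j al)" "ex.suc be':ex.el (j al)" for be'
  proof -
   obtain b where b: "b:el al" "b:A" "be' = j b" using h el_j[OF al(1)] by auto
   have s: "suc b:el al" "suc b:A" using h(2) j_suc[OF b(2)] j_in[OF A_op(5)[OF b(2)] al(1)] b A_op(5) by auto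
   have "ex.app k (ex.suc be') = j (K (suc (ad t b)))" using k[OF s] j_suc[OF b(2)] b(3) ad_suc[OF t(3) A_M[OF b(2)]] by simp
   then show ?thesis using har_K[OF ab[OF b(1,2)]] k[OF b(1,2)] b(3) by simp
  qed
  show "EX l:CC. ex.el l = (UN ga:ex.el be'. ex.el (ex.app k ga)) & ex.app k be' = ex.har l" if h: "ex.Lim be'" "be':ex.el (j al)" for be'
  proof -
   obtain b where b: "b:el al" "b:A" "be' = j b" using h el_j[OF al(1)] by auto
   have ob: "Ord b" "Lim b" using Ord_in[OF al(2) b(1)] Lim_j[OF b(2)] h b by auto
   have bt: "el b <= el t" unfolding t_def using Ord_el_sub[OF al(2) b(1)] th by auto
   define l where "l = mk {z:M. EX d:el (ad t b). z:el (K d)}"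
   have lA: "l:A" unfolding l_def by (rule A_in) (intro dfn t b)
   have l: "el l = (UN d:el (ad t b). el (K d))"
   proof -
    have "{z:M. EX d:el (ad t b). z:el (K d)} = (UN d:el (ad t b). el (K d))" by auto
    then show ?thesis unfolding l_def using isset_UN[of "ad t b" K] by (simp add: dfn)
   qed
   have sub: "g:el al" if "g:el b" for g using Ord_trans[OF al(2) b(1) that] .
   have zl: "z:el l <-> (EX g:el b Int A. z:el (K (ad t g)))" if z: "z:A" for z
   proof
    assume "z:el l"
    then obtain d where d: "d:el (ad t b)" "z:el (K d)" unfolding l by blast
    then obtain g0 where g0: "g0:el b" "d:el (ad t g0)" unfolding ad_Lim[OF t(2) ob(2)] by blast
    have o: "Ord (ad t g0)" using Ord_ad[OF t(2) Ord_in[OF ob(1) g0(1)]] .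
    have "z:el (K (ad t g0))" using K_sub[OF Ord_in[OF o g0(2)] o Ord_el_sub[OF o g0(2)]] d by blast
    then have "EX g:M. g:el b & z:el (K (ad t g))" using g0 by (meson elM)
    then have "EX g:A. g:el b & z:el (K (ad t g))" by (rule skol[rotated]) (intro dfn b z t)
    then show "EX g:el b Int A. z:el (K (ad t g))" by blast
   next
    assume "EX g:el b Int A. z:el (K (ad t g))"
    then show "z:el l" unfolding l using ad_mem[OF t(3) A_M[OF b(2)]] by blast
   qed
   have KgA: "K (ad t g):A" if "g:A" for g using A_op(6,9) t that by blast
   have "ex.el (j l) = (UN ga:ex.el (j b). ex.el (ex.app k ga))"
   proof -
    have "(UN ga:ex.el (j b). ex.el (ex.app k ga)) = (UN g:el b Int A. ex.el (j (K (ad t g))))" unfolding el_j[OF b(2)] using k sub by auto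
    also have "\<dots> = (UN g:el b Int A. j ` (el (K (ad t g)) Int A))" using el_j[OF KgA] by auto
    also have "\<dots> = j ` (el l Int A)" 
    proof -
     have "el l Int A = (UN g:el b Int A. el (K (ad t g)) Int A)" using zl by auto
     then show ?thesis by (simp only: image_UN)
    qed
    finally show ?thesis using el_j[OF lA] by simp
   qed
   moreover have "ex.app k (j b) = ex.har (j l)" using k[OF b(1,2)] har_lim[OF t(1,2) b(2) ob(2) bt lA l] by simp
   ultimately show ?thesis using b(3) lA by (intro bexI[of _ "j l"]) auto
  qed
 qed
 then obtain u where u: "ex.Ord u" "!!be. be:ex.el (j al) ==> ex.AL (ex.suc (ex.ad u be)) = ex.app k be" by blast
 have "be':ex.el a <-> ex.lep (ex.pw (ex.AL (ex.suc (ex.ad u be')))) (ex.har (ex.AL (ex.suc (ex.ad u be'))))" if h: "be':ex.el al'" for be'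
 proof -
  obtain b where b: "b:el al" "b:A" "be' = j b" using h el_j[OF al(1)] al(3) by auto
  define c where "c = ad t b"
  have c: "c:A" "Ord c" unfolding c_def using ab[OF b(1,2)] by auto
  have s: "suc c:A" "Ord (suc c)" using A_op c by auto
  have AL: "ex.AL (ex.suc (ex.ad u be')) = j (K c)" using u(2)[of be'] h al(3) k[OF b(1,2)] b(3) unfolding c_def by simp
  \<comment> \<open>At an on stage the power set is at least \<open>K (suc (suc c))\<close>, which
    is two cardinals above \<open>K c\<close>.\<close>
  have "~ ex.lep (ex.pw (j (K c))) (j (K (suc c)))" if "~ off c"
   using K_suc_regular[OF s] ex.lep_trans[OF j_CC[OF A_op(6)[OF A_op(5)[OF s(1)]]] on_power[OF c that]] by blast
  then show ?thesis unfolding AL har_K[OF c] using off_power[OF c] cd[OF b(1,2)] b(3) unfolding c_def t_def by blast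
 qed
 then show "EX t. ex.Ord t & (ALL be:ex.el al'. be:ex.el a <-> ex.lep (ex.pw (ex.AL (ex.suc (ex.ad t be)))) (ex.har (ex.AL (ex.suc (ex.ad t be)))))"
  using u(1) by blast
qed

end

theorem theoremT:
  fixes M :: "'a set" and E :: "'a \<Rightarrow> 'a \<Rightarrow> bool"
  assumes "models M E ZFC"
  shows "\<exists>P r F.
    class_forcing M E P r \<and>
    atomic_forcing M E P r F \<and>
    forced M E P r F (ZFC \<union> {CCA}) \<and>
    (\<forall>G. generic M E P r G \<longrightarrow>
       models (ext_carrier M E P F G) (ext_mem M E G) (ZFC \<union> {CCA})) \<and>
    (countable M \<longrightarrow> (\<exists>G. generic M E P r G))"
proof -
  interpret zfc M E by unfold_locales (rule assms)
  have T: "models (gx.CC M E A G) (gx.EE M E G) (ZFC \<union> {CCA})" if "gx M E A G" for A G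
  proof -
    interpret gx M E A G by (rule that)
    show ?thesis using ZFC_ext CCA_ext unfolding models_def by auto
  qed
  show ?thesis using class_forcing atomic_forcing forced_if[OF T] generic_models[OF T] generic_ex by blast
qed

end
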